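(* Let $K$ be a field, $\mathscr X$ a poset, $C$ a right semiperfect $K$-coalgebra and $\mathscr R:\mathscr X\longrightarrow\mathscr Ent_C$ an entwined $C$-representation. (1) The forgetful functor $\mathscr F:Mod^C-\mathscr R\longrightarrow Mod-\mathscr R$ has a right adjoint $\mathscr G:Mod-\mathscr R\longrightarrow Mod^C-\mathscr R$ (given by $\mathscr G(\mathscr N)_x=\mathscr G_x(\mathscr N_x)$). (2) A natural transformation $\upsilon\in Nat(\mathscr G\mathscr F,1_{Mod^C-\mathscr R})$ corresponds (via $\upsilon(\mathscr M)_x=\upsilon_x(\mathscr M_x)$) to a collection of natural transformations $\{\upsilon_x\in Nat(\mathscr G_x\mathscr F_x,1_{\mathbf M^C_{\mathscr R_x}(\psi_x)})\}_{x\in\mathscr X}$ such that for any $\alpha:x\longrightarrow y$ in $\mathscr X$ and any object $\mathscr M\in Mod^C-\mathscr R$ we have $$\mathscr M_\alpha\circ\upsilon_x(\mathscr M_x)=\alpha_\ast\upsilon_y(\mathscr M_y)\circ\mathscr G_x\mathscr F_x(\mathscr M_\alpha).$$ (3) The space $Nat(\mathscr G\mathscr F,1_{Mod^C-\mathscr R})$ is isomorphic to $V_1$.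
   Context: Conventions. $\otimes=\otimes_K$; coalgebras are coassociative counital $K$-coalgebras; $\Delta_C(c)=c_1\otimes c_2$ and comodule coactions are written $m\mapsto m_0\otimes m_1$ (summation suppressed). For a small $K$-linear category $\mathcal R$, $\mathbf M_{\mathcal R}$ is the category of right $\mathcal R$-modules ($K$-linear functors $\mathcal R^{op}\to Vect_K$); for $m\in\mathcal M(r)$, $f\in\mathcal R(s,r)$ write $mf:=\mathcal M(f)(m)\in\mathcal M(s)$. $C$ is right semiperfect if the category of right $C$-comodules has enough projectives. A poset is viewed as a category with a single morphism $x\to y$ when $x\le y$. Entwining structure. $(\mathcal R,C,\psi)$ consists of a small $K$-linear category $\mathcal R$, a $K$-coalgebra $C$ and $K$-linear maps $\psi_{rs}:C\otimes\mathcal R(r,s)\to\mathcal R(r,s)\otimes C$, written $\psi(c\otimes f)=f_\psi\otimes c^\psi$, such that for $f\in\mathcal R(r,s)$, $g\in\mathcal R(s,t)$, $c\in C$: $(gf)_\psi\otimes c^\psi=g_\psi f_\psi\otimes {c^\psi}^\psi$ ($\psi$ is first applied to $c\otimes g$, then to $c^\psi\otimes f$); $\varepsilon_C(c^\psi)f_\psi=\varepsilon_C(c)f$; $f_\psi\otimes\Delta_C(c^\psi)={f_\psi}_\psi\otimes {c_1}^\psi\otimes {c_2}^\psi$ ($\psi$ is first applied to $c_2\otimes f$, then to $c_1\otimes f_\psi$); $\psi(c\otimes id_r)=id_r\otimes c$. Entwined modules. $\mathbf M_{\mathcal R}^C(\psi)$ has as objects right $\mathcal R$-modules $\mathcal M$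 with a right $C$-comodule structure on each $\mathcal M(s)$ such that $(mf)_0\otimes(mf)_1=m_0f_\psi\otimes {m_1}^\psi$ for $f\in\mathcal R(s,r)$, $m\in\mathcal M(r)$; morphisms are morphisms of right $\mathcal R$-modules that are $C$-colinear at each object. Representations. $\mathscr Ent_C$ is the category of entwining structures $(\mathcal R,C,\psi)$ with $C$ fixed; a morphism $\alpha:(\mathcal R,C,\psi)\to(\mathcal S,C,\psi')$ is a $K$-linear functor $\alpha:\mathcal R\to\mathcal S$ with $\alpha(f_\psi)\otimes c^\psi=\alpha(f)_{\psi'}\otimes c^{\psi'}$. It induces restriction functors $\alpha_\ast:\mathbf M_{\mathcal S}^C(\psi')\to\mathbf M_{\mathcal R}^C(\psi)$ and $\alpha_\ast:\mathbf M_{\mathcal S}\to\mathbf M_{\mathcal R}$, $(\alpha_\ast\mathcal N)(r)=\mathcal N(\alpha(r))$ (same coaction, $\mathcal R$ acting through $\alpha$). An entwined $C$-representation of $\mathscr X$ is a functor $\mathscr R:\mathscr X\to\mathscr Ent_C$, $x\mapsto(\mathscr R_x,C,\psi_x)$; for $\alpha:x\to y$ in $\mathscr X$ write $\alpha$ also for $\mathscr R_\alpha$ and $\alpha_\ast$ for $\mathscr R_{\alpha\ast}$. Modules over $\mathscr R$. An object $\mathscr M$ of $Mod^C-\mathscr R$ consists of $\mathscr M_x\in\mathbf M^C_{\mathscr R_x}(\psi_x)$ for each $x\in\mathscr X$ and morphisms $\mathscr M_\alpha:\mathscr M_x\to\alpha_\ast\mathscr M_y$ in $\mathbf M^C_{\mathscr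 R_x}(\psi_x)$ for each $\alpha:x\to y$, with $\mathscr M_{id_x}=id$ and $\mathscr M_{\beta\alpha}=\alpha_\ast(\mathscr M_\beta)\circ\mathscr M_\alpha$. A morphism $\eta:\mathscr M\to\mathscr N$ consists of morphisms $\eta_x:\mathscr M_x\to\mathscr N_x$ with $\mathscr N_\alpha\circ\eta_x=\alpha_\ast(\eta_y)\circ\mathscr M_\alpha$. $Mod-\mathscr R$ is defined in the same way with $\mathbf M_{\mathscr R_x}$ in place of $\mathbf M^C_{\mathscr R_x}(\psi_x)$ (no comodule structures). Functors. $\mathscr F_x:\mathbf M^C_{\mathscr R_x}(\psi_x)\to\mathbf M_{\mathscr R_x}$ forgets the $C$-coactions. Its right adjoint $\mathscr G_x$ is $\mathscr G_x(\mathcal N)(r)=\mathcal N(r)\otimes C$ with action $(n\otimes c)f=nf_{\psi_x}\otimes c^{\psi_x}$ and coaction $id\otimes\Delta_C$. Both commute with $\alpha_\ast$; $\mathscr F$ and $\mathscr G$ are defined pointwise: $\mathscr F(\mathscr M)_x=\mathscr F_x(\mathscr M_x)$, $\mathscr F(\mathscr M)_\alpha=\mathscr F_x(\mathscr M_\alpha)$, and similarly for $\mathscr G$. The space $V_1$. $V_1$ is the $K$-vector space of collections $\theta=\{\theta_x(r):C\otimes C\to\mathscr R_x(r,r)\}_{x\in\mathscr X,\,r\in\mathscr R_x}$ of $K$-linear maps such that: (i) $\theta_x(r)(c\otimes d_1)\otimes d_2=(\theta_x(r)(c_2\otimes d))_{\psi_x}\otimes {c_1}^{\psi_x}$ for all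 $c,d\in C$; (ii) $\theta_x(r)(c\otimes d)\circ f={f_{\psi_x}}_{\psi_x}\circ\theta_x(s)(c^{\psi_x}\otimes d^{\psi_x})$ for all $f:s\to r$ in $\mathscr R_x$ and $c,d\in C$ ($\psi_x$ is first applied to $d\otimes f$, then to $c\otimes f_{\psi_x}$); (iii) $\alpha(\theta_x(r)(c\otimes d))=\theta_y(\alpha(r))(c\otimes d)$ for all $\alpha:x\to y$ in $\mathscr X$, $r\in\mathscr R_x$, $c,d\in C$. *)

theory Defs
  imports "HOL-Library.FuncSet" "HOL-Library.Infinite_Typeclass" "HOL-Algebra.Module"
begin

text \<open>
  Universe convention: the underlying set of every vector space is a subset of one fixed
  type \<open>'u\<close> of class \<open>infinite\<close>. Since \<open>'u\<close> is infinite, this universe is closed under tensor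
  products; since \<open>'u\<close> is a type variable, it can be taken as large as desired.

  Maps are extensional functions (\<open>undefined\<close> outside their domain), so that equality of
  morphisms is equality of HOL functions.
\<close>

section \<open>Categories\<close>

text \<open>Hom-sets need not be disjoint; composition therefore takes the three objects
  as arguments: \<open>Cmp \<C> A B D g f\<close> is the composite of \<open>f : A \<rightarrow> B\<close> and \<open>g : B \<rightarrow> D\<close>.\<close>

record ('o, 'a) cat =
  Ob :: "'o set"
  Mor :: "'o \<Rightarrow> 'o \<Rightarrow> 'a set"
  Cmp :: "'o \<Rightarrow> 'o \<Rightarrow> 'o \<Rightarrow> 'a \<Rightarrow> 'a \<Rightarrow> 'a"
  Idt :: "'o \<Rightarrow> 'a"

locale category =
  fixes \<C> :: "('o, 'a, 'm) cat_scheme"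
  assumes Idt_closed: "A \<in> Ob \<C> \<Longrightarrow> Idt \<C> A \<in> Mor \<C> A A"
    and Cmp_closed: "\<lbrakk>A \<in> Ob \<C>; B \<in> Ob \<C>; D \<in> Ob \<C>; f \<in> Mor \<C> A B; g \<in> Mor \<C> B D\<rbrakk>
      \<Longrightarrow> Cmp \<C> A B D g f \<in> Mor \<C> A D"
    and Cmp_Idt_left: "\<lbrakk>A \<in> Ob \<C>; B \<in> Ob \<C>; f \<in> Mor \<C> A B\<rbrakk> \<Longrightarrow> Cmp \<C> A B B (Idt \<C> B) f = f"
    and Cmp_Idt_right: "\<lbrakk>A \<in> Ob \<C>; B \<in> Ob \<C>; f \<in> Mor \<C> A B\<rbrakk> \<Longrightarrow> Cmp \<C> A A B f (Idt \<C> A) = f"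
    and Cmp_assoc: "\<lbrakk>A \<in> Ob \<C>; B \<in> Ob \<C>; D \<in> Ob \<C>; E \<in> Ob \<C>;
        f \<in> Mor \<C> A B; g \<in> Mor \<C> B D; h \<in> Mor \<C> D E\<rbrakk>
      \<Longrightarrow> Cmp \<C> A D E h (Cmp \<C> A B D g f) = Cmp \<C> A B E (Cmp \<C> B D E h g) f"

record ('o, 'a, 'p, 'b) fctr =
  fobj :: "'o \<Rightarrow> 'p"
  farr :: "'o \<Rightarrow> 'o \<Rightarrow> 'a \<Rightarrow> 'b"

locale cat_functor = dom: category \<C> + cod: category \<D>
  for \<C> :: "('o, 'a, 'm) cat_scheme" and \<D> :: "('p, 'b, 'n) cat_scheme" +
  fixes F :: "('o, 'a, 'p, 'b) fctr"
  assumes fobj_closed: "fobj F \<in> Ob \<C> \<rightarrow>\<^sub>E Ob \<D>"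
    and farr_closed: "farr F \<in>
      (\<Pi>\<^sub>E A\<in>Ob \<C>. \<Pi>\<^sub>E B\<in>Ob \<C>. Mor \<C> A B \<rightarrow>\<^sub>E Mor \<D> (fobj F A) (fobj F B))"
    and farr_Idt: "A \<in> Ob \<C> \<Longrightarrow> farr F A A (Idt \<C> A) = Idt \<D> (fobj F A)"
    and farr_Cmp: "\<lbrakk>A \<in> Ob \<C>; B \<in> Ob \<C>; D \<in> Ob \<C>; f \<in> Mor \<C> A B; g \<in> Mor \<C> B D\<rbrakk>
      \<Longrightarrow> farr F A D (Cmp \<C> A B D g f)
        = Cmp \<D> (fobj F A) (fobj F B) (fobj F D) (farr F B D g) (farr F A B f)"

definition fun_id :: "('o, 'a, 'm) cat_scheme \<Rightarrow> ('o, 'a, 'o, 'a) fctr" where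
  "fun_id \<C> = \<lparr>fobj = (\<lambda>A\<in>Ob \<C>. A), farr = (\<lambda>A\<in>Ob \<C>. \<lambda>B\<in>Ob \<C>. \<lambda>f\<in>Mor \<C> A B. f)\<rparr>"

text \<open>\<open>fun_comp \<C> G F\<close> is the composite of \<open>F\<close>, with domain \<open>\<C>\<close>, followed by \<open>G\<close>.\<close>

definition fun_comp ::
  "('o, 'a, 'm) cat_scheme \<Rightarrow> ('p, 'b, 'q, 'c) fctr \<Rightarrow> ('o, 'a, 'p, 'b) fctr \<Rightarrow> ('o, 'a, 'q, 'c) fctr"
where
  "fun_comp \<C> G F =
    \<lparr>fobj = (\<lambda>A\<in>Ob \<C>. fobj G (fobj F A)),
     farr = (\<lambda>A\<in>Ob \<C>. \<lambda>B\<in>Ob \<C>. \<lambda>f\<in>Mor \<C> A B. farr G (fobj F A) (fobj F B) (farr F A B f))\<rparr>"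

definition NatTrans ::
  "('o, 'a, 'm) cat_scheme \<Rightarrow> ('p, 'b, 'n) cat_scheme \<Rightarrow> ('o, 'a, 'p, 'b) fctr
    \<Rightarrow> ('o, 'a, 'p, 'b) fctr \<Rightarrow> ('o \<Rightarrow> 'b) set"
where
  "NatTrans \<C> \<D> F G =
    {\<upsilon> \<in> (\<Pi>\<^sub>E A\<in>Ob \<C>. Mor \<D> (fobj F A) (fobj G A)).
      \<forall>A\<in>Ob \<C>. \<forall>B\<in>Ob \<C>. \<forall>f\<in>Mor \<C> A B.
        Cmp \<D> (fobj F A) (fobj G A) (fobj G B) (farr G A B f) (\<upsilon> A)
          = Cmp \<D> (fobj F A) (fobj F B) (fobj G B) (\<upsilon> B) (farr F A B f)}"

definition right_adjoint ::
  "('o, 'a, 'm) cat_scheme \<Rightarrow> ('p, 'b, 'n) cat_scheme \<Rightarrow> ('o, 'a, 'p, 'b) fctr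
    \<Rightarrow> ('p, 'b, 'o, 'a) fctr \<Rightarrow> bool"
where
  "right_adjoint \<C> \<D> F G \<longleftrightarrow>
    cat_functor \<C> \<D> F \<and> cat_functor \<D> \<C> G \<and>
    (\<exists>\<phi>. (\<forall>A\<in>Ob \<C>. \<forall>B\<in>Ob \<D>. bij_betw (\<phi> A B) (Mor \<D> (fobj F A) B) (Mor \<C> A (fobj G B))) \<and>
      (\<forall>A\<in>Ob \<C>. \<forall>A'\<in>Ob \<C>. \<forall>B\<in>Ob \<D>. \<forall>B'\<in>Ob \<D>.
        \<forall>h\<in>Mor \<C> A' A. \<forall>k\<in>Mor \<D> B B'. \<forall>f\<in>Mor \<D> (fobj F A) B.
          \<phi> A' B' (Cmp \<D> (fobj F A') B B' k (Cmp \<D> (fobj F A') (fobj F A) B f (farr F A' A h)))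
            = Cmp \<C> A' (fobj G B) (fobj G B') (farr G B B' k)
                (Cmp \<C> A' A (fobj G B) (\<phi> A B f) h)))"

definition epi :: "('o, 'a, 'm) cat_scheme \<Rightarrow> 'o \<Rightarrow> 'o \<Rightarrow> 'a \<Rightarrow> bool" where
  "epi \<C> A B e \<longleftrightarrow> e \<in> Mor \<C> A B \<and>
    (\<forall>D\<in>Ob \<C>. \<forall>g\<in>Mor \<C> B D. \<forall>h\<in>Mor \<C> B D. Cmp \<C> A B D g e = Cmp \<C> A B D h e \<longrightarrow> g = h)"

definition projective :: "('o, 'a, 'm) cat_scheme \<Rightarrow> 'o \<Rightarrow> bool" where
  "projective \<C> P \<longleftrightarrow> P \<in> Ob \<C> \<and>
    (\<forall>A\<in>Ob \<C>. \<forall>B\<in>Ob \<C>. \<forall>e f. epi \<C> A B e \<longrightarrow> f \<in> Mor \<C> P B \<longrightarrow>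
      (\<exists>g\<in>Mor \<C> P A. Cmp \<C> P A B e g = f))"

definition enough_projectives :: "('o, 'a, 'm) cat_scheme \<Rightarrow> bool" where
  "enough_projectives \<C> \<longleftrightarrow> (\<forall>A\<in>Ob \<C>. \<exists>P e. projective \<C> P \<and> epi \<C> P A e)"

definition poset_cat :: "'x set \<Rightarrow> 'x rel \<Rightarrow> ('x, unit) cat" where
  "poset_cat X leq =
    \<lparr>Ob = X, Mor = (\<lambda>x y. {u. (x, y) \<in> leq}), Cmp = (\<lambda>_ _ _ _ _. ()), Idt = (\<lambda>_. ())\<rparr>"


section \<open>Linear maps and tensor products\<close>

definition Lin ::
  "('k, 'r) ring_scheme \<Rightarrow> ('k, 'a, 'm) module_scheme \<Rightarrow> ('k, 'b, 'n) module_scheme \<Rightarrow> ('a \<Rightarrow> 'b) set"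
where
  "Lin K V W = {f \<in> carrier V \<rightarrow>\<^sub>E carrier W.
    (\<forall>v\<in>carrier V. \<forall>v'\<in>carrier V. f (v \<oplus>\<^bsub>V\<^esub> v') = f v \<oplus>\<^bsub>W\<^esub> f v') \<and>
    (\<forall>k\<in>carrier K. \<forall>v\<in>carrier V. f (k \<odot>\<^bsub>V\<^esub> v) = k \<odot>\<^bsub>W\<^esub> f v)}"

definition mod_iso ::
  "('k, 'r) ring_scheme \<Rightarrow> ('k, 'a, 'm) module_scheme \<Rightarrow> ('k, 'b, 'n) module_scheme \<Rightarrow> bool"
where
  "mod_iso K V W \<longleftrightarrow> module K V \<and> module K W \<and>
    (\<exists>f\<in>Lin K V W. bij_betw f (carrier V) (carrier W))"

text \<open>
  A list \<open>[(v\<^sub>1, w\<^sub>1), \<dots>, (v\<^sub>n, w\<^sub>n)]\<close> stands for the formal sum of the \<open>v\<^sub>i \<otimes> w\<^sub>i\<close>, and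
  \<open>tens_eq\<close> is the least congruence that makes addition commutative and \<open>\<otimes>\<close> bilinear. An
  element of \<open>V \<otimes> W\<close> is a congruence class. In order to stay inside \<open>'u\<close>, a class is recorded
  as the code, under a fixed injection of lists into \<open>'u\<close>, of a chosen member of it. The record
  fields \<open>mult\<close> and \<open>one\<close>, which modules inherit from rings, carry no meaning.
\<close>

inductive tens_eq ::
  "('k, 'r) ring_scheme \<Rightarrow> ('k, 'a, 'm) module_scheme \<Rightarrow> ('k, 'b, 'n) module_scheme
    \<Rightarrow> ('a \<times> 'b) list \<Rightarrow> ('a \<times> 'b) list \<Rightarrow> bool"
  for K and V and W
where
  tens_refl: "xs \<in> lists (carrier V \<times> carrier W) \<Longrightarrow> tens_eq K V W xs xs"
| tens_sym: "tens_eq K V W xs ys \<Longrightarrow> tens_eq K V W ys xs"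
| tens_trans: "\<lbrakk>tens_eq K V W xs ys; tens_eq K V W ys zs\<rbrakk> \<Longrightarrow> tens_eq K V W xs zs"
| tens_append: "\<lbrakk>tens_eq K V W xs ys; zs \<in> lists (carrier V \<times> carrier W)\<rbrakk>
    \<Longrightarrow> tens_eq K V W (zs @ xs) (zs @ ys)"
| tens_commute: "\<lbrakk>xs \<in> lists (carrier V \<times> carrier W); ys \<in> lists (carrier V \<times> carrier W)\<rbrakk>
    \<Longrightarrow> tens_eq K V W (xs @ ys) (ys @ xs)"
| tens_zero: "w \<in> carrier W \<Longrightarrow> tens_eq K V W [(\<zero>\<^bsub>V\<^esub>, w)] []"
| tens_add_left: "\<lbrakk>v \<in> carrier V; v' \<in> carrier V; w \<in> carrier W\<rbrakk>
    \<Longrightarrow> tens_eq K V W [(v \<oplus>\<^bsub>V\<^esub> v', w)] [(v, w), (v', w)]"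
| tens_add_right: "\<lbrakk>v \<in> carrier V; w \<in> carrier W; w' \<in> carrier W\<rbrakk>
    \<Longrightarrow> tens_eq K V W [(v, w \<oplus>\<^bsub>W\<^esub> w')] [(v, w), (v, w')]"
| tens_smult: "\<lbrakk>k \<in> carrier K; v \<in> carrier V; w \<in> carrier W\<rbrakk>
    \<Longrightarrow> tens_eq K V W [(k \<odot>\<^bsub>V\<^esub> v, w)] [(v, k \<odot>\<^bsub>W\<^esub> w)]"

definition list_code :: "('u::infinite \<times> 'u) list \<Rightarrow> 'u" where
  "list_code = (SOME e. inj e)"

definition tclass ::
  "('k, 'r) ring_scheme \<Rightarrow> ('k, 'u::infinite, 'm) module_scheme \<Rightarrow> ('k, 'u, 'n) module_scheme
    \<Rightarrow> ('u \<times> 'u) list \<Rightarrow> 'u"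
where
  "tclass K V W xs = list_code (SOME ys. tens_eq K V W xs ys)"

definition trep :: "'u::infinite \<Rightarrow> ('u \<times> 'u) list" where
  "trep = inv_into UNIV list_code"

definition tens ::
  "('k, 'r) ring_scheme \<Rightarrow> ('k, 'u::infinite, 'm) module_scheme \<Rightarrow> ('k, 'u, 'n) module_scheme
    \<Rightarrow> ('k, 'u) module"
where
  "tens K V W =
    \<lparr>carrier = tclass K V W ` lists (carrier V \<times> carrier W),
     mult = undefined, one = undefined,
     zero = tclass K V W [],
     add = (\<lambda>z z'. tclass K V W (trep z @ trep z')),
     smult = (\<lambda>k z. tclass K V W (map (\<lambda>(v, w). (k \<odot>\<^bsub>V\<^esub> v, w)) (trep z)))\<rparr>"

definition tpure ::
  "('k, 'r) ring_scheme \<Rightarrow> ('k, 'u::infinite, 'm) module_scheme \<Rightarrow> ('k, 'u, 'n) module_scheme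
    \<Rightarrow> 'u \<Rightarrow> 'u \<Rightarrow> 'u"
where
  "tpure K V W v w = tclass K V W [(v, w)]"

text \<open>
  \<open>tsum U z b\<close> is the value at \<open>z = \<Sum>\<^sub>i v\<^sub>i \<otimes> w\<^sub>i\<close> of the linear map into \<open>U\<close> induced by the
  bilinear map \<open>b\<close>, i.e. \<open>\<Sum>\<^sub>i b v\<^sub>i w\<^sub>i\<close>. It renders the summation that is suppressed in the
  Sweedler notation: for instance \<open>tsum U (\<Delta> c) (\<lambda>c\<^sub>1 c\<^sub>2. b c\<^sub>1 c\<^sub>2)\<close> is \<open>b c\<^sub>1 c\<^sub>2\<close>.
\<close>

definition tsum ::
  "('k, 'a, 'm) module_scheme \<Rightarrow> 'u::infinite \<Rightarrow> ('u \<Rightarrow> 'u \<Rightarrow> 'a) \<Rightarrow> 'a"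
where
  "tsum U z b = foldr (\<lambda>(v, w) u. b v w \<oplus>\<^bsub>U\<^esub> u) (trep z) \<zero>\<^bsub>U\<^esub>"


section \<open>Coalgebras and comodules\<close>

record ('k, 'u) coalgebra = "('k, 'u) module" +
  comul :: "'u \<Rightarrow> 'u"
  counit :: "'u \<Rightarrow> 'k"

locale coalgebra = field K + module K C
  for K :: "('k, 'r) ring_scheme" (structure) and C :: "('k, 'u::infinite, 'm) coalgebra_scheme" +
  assumes comul_Lin: "comul C \<in> Lin K C (tens K C C)"
    and counit_closed: "counit C \<in> carrier C \<rightarrow>\<^sub>E carrier K"
    and counit_add: "\<lbrakk>c \<in> carrier C; d \<in> carrier C\<rbrakk>
      \<Longrightarrow> counit C (c \<oplus>\<^bsub>C\<^esub> d) = counit C c \<oplus>\<^bsub>K\<^esub> counit C d"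
    and counit_smult: "\<lbrakk>k \<in> carrier K; c \<in> carrier C\<rbrakk>
      \<Longrightarrow> counit C (k \<odot>\<^bsub>C\<^esub> c) = k \<otimes>\<^bsub>K\<^esub> counit C c"
    and coassoc: "c \<in> carrier C \<Longrightarrow>
      tsum (tens K C (tens K C C)) (comul C c) (\<lambda>a d.
        tsum (tens K C (tens K C C)) (comul C a) (\<lambda>a' b.
          tpure K C (tens K C C) a' (tpure K C C b d)))
      = tsum (tens K C (tens K C C)) (comul C c) (\<lambda>a d. tpure K C (tens K C C) a (comul C d))"
    and counit_left: "c \<in> carrier C \<Longrightarrow> tsum C (comul C c) (\<lambda>a b. counit C a \<odot>\<^bsub>C\<^esub> b) = c"
    and counit_right: "c \<in> carrier C \<Longrightarrow> tsum C (comul C c) (\<lambda>a b. counit C b \<odot>\<^bsub>C\<^esub> a) = c"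

locale comodule = module K V
  for K :: "('k, 'r) ring_scheme" (structure)
    and C :: "('k, 'u::infinite, 'm) coalgebra_scheme"
    and V :: "('k, 'u, 'n) module_scheme"
    and \<rho> :: "'u \<Rightarrow> 'u" +
  assumes coact_Lin: "\<rho> \<in> Lin K V (tens K V C)"
    and coact_coassoc: "v \<in> carrier V \<Longrightarrow>
      tsum (tens K V (tens K C C)) (\<rho> v) (\<lambda>a d.
        tsum (tens K V (tens K C C)) (\<rho> a) (\<lambda>a' b.
          tpure K V (tens K C C) a' (tpure K C C b d)))
      = tsum (tens K V (tens K C C)) (\<rho> v) (\<lambda>a d. tpure K V (tens K C C) a (comul C d))"
    and coact_counit: "v \<in> carrier V \<Longrightarrow> tsum V (\<rho> v) (\<lambda>a c. counit C c \<odot>\<^bsub>V\<^esub> a) = v"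

definition colinear ::
  "('k, 'r) ring_scheme \<Rightarrow> ('k, 'u::infinite, 'm) coalgebra_scheme
    \<Rightarrow> ('k, 'u, 'n) module_scheme \<Rightarrow> ('u \<Rightarrow> 'u) \<Rightarrow> ('k, 'u, 'n') module_scheme \<Rightarrow> ('u \<Rightarrow> 'u)
    \<Rightarrow> ('u \<Rightarrow> 'u) \<Rightarrow> bool"
where
  "colinear K C V \<rho> W \<sigma> f \<longleftrightarrow>
    (\<forall>v\<in>carrier V. tsum (tens K W C) (\<rho> v) (\<lambda>a c. tpure K W C (f a) c) = \<sigma> (f v))"

definition Comod ::
  "('k, 'r) ring_scheme \<Rightarrow> ('k, 'u::infinite, 'm) coalgebra_scheme
    \<Rightarrow> (('k, 'u) module \<times> ('u \<Rightarrow> 'u), 'u \<Rightarrow> 'u) cat"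
where
  "Comod K C =
    \<lparr>Ob = {(V, \<rho>). comodule K C V \<rho>},
     Mor = (\<lambda>(V, \<rho>) (W, \<sigma>). {f \<in> Lin K V W. colinear K C V \<rho> W \<sigma> f}),
     Cmp = (\<lambda>(V, _) _ _ g f. compose (carrier V) g f),
     Idt = (\<lambda>(V, _). \<lambda>v\<in>carrier V. v)\<rparr>"

definition right_semiperfect ::
  "('k, 'r) ring_scheme \<Rightarrow> ('k, 'u::infinite, 'm) coalgebra_scheme \<Rightarrow> bool"
where
  "right_semiperfect K C \<longleftrightarrow> enough_projectives (Comod K C)"


section \<open>Entwining structures\<close>

record ('k, 'o, 'u) lincat = "('o, 'u) cat" +
  homs :: "'o \<Rightarrow> 'o \<Rightarrow> ('k, 'u) module"

locale linear_category = category \<R>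
  for K :: "('k, 'r) ring_scheme" and \<R> :: "('k, 'o, 'u, 'm) lincat_scheme" +
  assumes homs_module: "\<lbrakk>r \<in> Ob \<R>; s \<in> Ob \<R>\<rbrakk> \<Longrightarrow> module K (homs \<R> r s)"
    and homs_carrier: "\<lbrakk>r \<in> Ob \<R>; s \<in> Ob \<R>\<rbrakk> \<Longrightarrow> carrier (homs \<R> r s) = Mor \<R> r s"
    and Cmp_add_left: "\<lbrakk>r \<in> Ob \<R>; s \<in> Ob \<R>; t \<in> Ob \<R>; f \<in> Mor \<R> r s; g \<in> Mor \<R> s t; g' \<in> Mor \<R> s t\<rbrakk>
      \<Longrightarrow> Cmp \<R> r s t (g \<oplus>\<^bsub>homs \<R> s t\<^esub> g') f
        = Cmp \<R> r s t g f \<oplus>\<^bsub>homs \<R> r t\<^esub> Cmp \<R> r s t g' f"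
    and Cmp_add_right: "\<lbrakk>r \<in> Ob \<R>; s \<in> Ob \<R>; t \<in> Ob \<R>; f \<in> Mor \<R> r s; f' \<in> Mor \<R> r s; g \<in> Mor \<R> s t\<rbrakk>
      \<Longrightarrow> Cmp \<R> r s t g (f \<oplus>\<^bsub>homs \<R> r s\<^esub> f')
        = Cmp \<R> r s t g f \<oplus>\<^bsub>homs \<R> r t\<^esub> Cmp \<R> r s t g f'"
    and Cmp_smult_left: "\<lbrakk>r \<in> Ob \<R>; s \<in> Ob \<R>; t \<in> Ob \<R>; f \<in> Mor \<R> r s; g \<in> Mor \<R> s t; k \<in> carrier K\<rbrakk>
      \<Longrightarrow> Cmp \<R> r s t (k \<odot>\<^bsub>homs \<R> s t\<^esub> g) f = k \<odot>\<^bsub>homs \<R> r t\<^esub> Cmp \<R> r s t g f"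
    and Cmp_smult_right: "\<lbrakk>r \<in> Ob \<R>; s \<in> Ob \<R>; t \<in> Ob \<R>; f \<in> Mor \<R> r s; g \<in> Mor \<R> s t; k \<in> carrier K\<rbrakk>
      \<Longrightarrow> Cmp \<R> r s t g (k \<odot>\<^bsub>homs \<R> r s\<^esub> f) = k \<odot>\<^bsub>homs \<R> r t\<^esub> Cmp \<R> r s t g f"

locale linear_functor = cat_functor \<R> \<S> \<alpha>
  for K :: "('k, 'r) ring_scheme" and \<R> :: "('k, 'o, 'u, 'm) lincat_scheme"
    and \<S> :: "('k, 'p, 'v, 'n) lincat_scheme" and \<alpha> :: "('o, 'u, 'p, 'v) fctr" +
  assumes farr_Lin: "\<lbrakk>r \<in> Ob \<R>; s \<in> Ob \<R>\<rbrakk>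
    \<Longrightarrow> farr \<alpha> r s \<in> Lin K (homs \<R> r s) (homs \<S> (fobj \<alpha> r) (fobj \<alpha> s))"

record ('k, 'o, 'u) entw = "('k, 'o, 'u) lincat" +
  psi :: "'o \<Rightarrow> 'o \<Rightarrow> 'u \<Rightarrow> 'u"

abbreviation entw_app ::
  "('k, 'r) ring_scheme \<Rightarrow> ('k, 'u::infinite, 'c) coalgebra_scheme \<Rightarrow> ('k, 'o, 'u, 'm) entw_scheme
    \<Rightarrow> 'o \<Rightarrow> 'o \<Rightarrow> 'u \<Rightarrow> 'u \<Rightarrow> 'u"
where
  "entw_app K C E r s c f \<equiv> psi E r s (tpure K C (homs E r s) c f)"

locale entwining = linear_category K E
  for K :: "('k, 'r) ring_scheme" and C :: "('k, 'u::infinite, 'c) coalgebra_scheme"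
    and E :: "('k, 'o, 'u, 'm) entw_scheme" +
  assumes psi_Lin: "\<lbrakk>r \<in> Ob E; s \<in> Ob E\<rbrakk>
      \<Longrightarrow> psi E r s \<in> Lin K (tens K C (homs E r s)) (tens K (homs E r s) C)"
    and psi_Cmp: "\<lbrakk>r \<in> Ob E; s \<in> Ob E; t \<in> Ob E; f \<in> Mor E r s; g \<in> Mor E s t; c \<in> carrier C\<rbrakk>
      \<Longrightarrow> entw_app K C E r t c (Cmp E r s t g f)
        = tsum (tens K (homs E r t) C) (entw_app K C E s t c g) (\<lambda>g' c'.
            tsum (tens K (homs E r t) C) (entw_app K C E r s c' f) (\<lambda>f' c''.
              tpure K (homs E r t) C (Cmp E r s t g' f') c''))"
    and psi_counit: "\<lbrakk>r \<in> Ob E; s \<in> Ob E; f \<in> Mor E r s; c \<in> carrier C\<rbrakk>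
      \<Longrightarrow> tsum (homs E r s) (entw_app K C E r s c f) (\<lambda>f' c'. counit C c' \<odot>\<^bsub>homs E r s\<^esub> f')
        = counit C c \<odot>\<^bsub>homs E r s\<^esub> f"
    and psi_comul: "\<lbrakk>r \<in> Ob E; s \<in> Ob E; f \<in> Mor E r s; c \<in> carrier C\<rbrakk>
      \<Longrightarrow> tsum (tens K (homs E r s) (tens K C C)) (entw_app K C E r s c f) (\<lambda>f' c'.
            tpure K (homs E r s) (tens K C C) f' (comul C c'))
        = tsum (tens K (homs E r s) (tens K C C)) (comul C c) (\<lambda>c1 c2.
            tsum (tens K (homs E r s) (tens K C C)) (entw_app K C E r s c2 f) (\<lambda>f' c2'.
              tsum (tens K (homs E r s) (tens K C C)) (entw_app K C E r s c1 f') (\<lambda>f'' c1'.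
                tpure K (homs E r s) (tens K C C) f'' (tpure K C C c1' c2'))))"
    and psi_Idt: "\<lbrakk>r \<in> Ob E; c \<in> carrier C\<rbrakk>
      \<Longrightarrow> entw_app K C E r r c (Idt E r) = tpure K (homs E r r) C (Idt E r) c"

definition entw_mor ::
  "('k, 'r) ring_scheme \<Rightarrow> ('k, 'u::infinite, 'c) coalgebra_scheme
    \<Rightarrow> ('k, 'o, 'u) entw \<Rightarrow> ('k, 'o, 'u) entw \<Rightarrow> ('o, 'u, 'o, 'u) fctr set"
where
  "entw_mor K C E E' = {\<alpha>. linear_functor K E E' \<alpha> \<and>
    (\<forall>r\<in>Ob E. \<forall>s\<in>Ob E. \<forall>f\<in>Mor E r s. \<forall>c\<in>carrier C.
      tsum (tens K (homs E' (fobj \<alpha> r) (fobj \<alpha> s)) C) (entw_app K C E r s c f) (\<lambda>f' c'.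
        tpure K (homs E' (fobj \<alpha> r) (fobj \<alpha> s)) C (farr \<alpha> r s f') c')
      = entw_app K C E' (fobj \<alpha> r) (fobj \<alpha> s) c (farr \<alpha> r s f))}"

definition Ent ::
  "('k, 'r) ring_scheme \<Rightarrow> ('k, 'u::infinite, 'c) coalgebra_scheme
    \<Rightarrow> (('k, 'o, 'u) entw, ('o, 'u, 'o, 'u) fctr) cat"
where
  "Ent K C =
    \<lparr>Ob = {E. entwining K C E},
     Mor = entw_mor K C,
     Cmp = (\<lambda>E _ _ \<beta> \<alpha>. fun_comp E \<beta> \<alpha>),
     Idt = fun_id\<rparr>"


section \<open>Modules and entwined modules\<close>

text \<open>For \<open>f \<in> \<R>(s,r)\<close> and \<open>m \<in> M(r)\<close>, the element \<open>mf \<in> M(s)\<close> is \<open>act M s r f m\<close>.\<close>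

record ('k, 'o, 'u) rmod =
  space :: "'o \<Rightarrow> ('k, 'u) module"
  act :: "'o \<Rightarrow> 'o \<Rightarrow> 'u \<Rightarrow> 'u \<Rightarrow> 'u"

record ('k, 'o, 'u) emod = "('k, 'o, 'u) rmod" +
  coact :: "'o \<Rightarrow> 'u \<Rightarrow> 'u"

locale right_module =
  fixes K :: "('k, 'r) ring_scheme" and \<R> :: "('k, 'o, 'u, 'm) lincat_scheme"
    and M :: "('k, 'o, 'u, 'n) rmod_scheme"
  assumes space_module: "r \<in> Ob \<R> \<Longrightarrow> module K (space M r)"
    and act_Lin: "\<lbrakk>s \<in> Ob \<R>; r \<in> Ob \<R>; f \<in> Mor \<R> s r\<rbrakk> \<Longrightarrow> act M s r f \<in> Lin K (space M r) (space M s)"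
    and act_add: "\<lbrakk>s \<in> Ob \<R>; r \<in> Ob \<R>; f \<in> Mor \<R> s r; g \<in> Mor \<R> s r; m \<in> carrier (space M r)\<rbrakk>
      \<Longrightarrow> act M s r (f \<oplus>\<^bsub>homs \<R> s r\<^esub> g) m = act M s r f m \<oplus>\<^bsub>space M s\<^esub> act M s r g m"
    and act_smult: "\<lbrakk>s \<in> Ob \<R>; r \<in> Ob \<R>; f \<in> Mor \<R> s r; k \<in> carrier K; m \<in> carrier (space M r)\<rbrakk>
      \<Longrightarrow> act M s r (k \<odot>\<^bsub>homs \<R> s r\<^esub> f) m = k \<odot>\<^bsub>space M s\<^esub> act M s r f m"
    and act_Idt: "\<lbrakk>r \<in> Ob \<R>; m \<in> carrier (space M r)\<rbrakk> \<Longrightarrow> act M r r (Idt \<R> r) m = m"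
    and act_Cmp: "\<lbrakk>t \<in> Ob \<R>; s \<in> Ob \<R>; r \<in> Ob \<R>; f \<in> Mor \<R> t s; g \<in> Mor \<R> s r; m \<in> carrier (space M r)\<rbrakk>
      \<Longrightarrow> act M t r (Cmp \<R> t s r g f) m = act M t s f (act M s r g m)"

definition rmod_hom ::
  "('k, 'r) ring_scheme \<Rightarrow> ('k, 'o, 'u, 'm) lincat_scheme
    \<Rightarrow> ('k, 'o, 'u, 'n) rmod_scheme \<Rightarrow> ('k, 'o, 'u, 'n) rmod_scheme \<Rightarrow> ('o \<Rightarrow> 'u \<Rightarrow> 'u) set"
where
  "rmod_hom K \<R> M N = {\<eta> \<in> (\<Pi>\<^sub>E r\<in>Ob \<R>. Lin K (space M r) (space N r)).
    \<forall>s\<in>Ob \<R>. \<forall>r\<in>Ob \<R>. \<forall>f\<in>Mor \<R> s r. \<forall>m\<in>carrier (space M r).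
      \<eta> s (act M s r f m) = act N s r f (\<eta> r m)}"

definition RMod ::
  "('k, 'r) ring_scheme \<Rightarrow> ('k, 'o, 'u, 'm) lincat_scheme
    \<Rightarrow> (('k, 'o, 'u) rmod, 'o \<Rightarrow> 'u \<Rightarrow> 'u) cat"
where
  "RMod K \<R> =
    \<lparr>Ob = {M. right_module K \<R> M},
     Mor = rmod_hom K \<R>,
     Cmp = (\<lambda>M _ _ \<theta> \<eta>. \<lambda>r\<in>Ob \<R>. compose (carrier (space M r)) (\<theta> r) (\<eta> r)),
     Idt = (\<lambda>M. \<lambda>r\<in>Ob \<R>. \<lambda>m\<in>carrier (space M r). m)\<rparr>"

locale entwined_module = right_module K E M
  for K :: "('k, 'r) ring_scheme" and C :: "('k, 'u::infinite, 'c) coalgebra_scheme"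
    and E :: "('k, 'o, 'u, 'm) entw_scheme" and M :: "('k, 'o, 'u, 'n) emod_scheme" +
  assumes space_comodule: "r \<in> Ob E \<Longrightarrow> comodule K C (space M r) (coact M r)"
    and coact_act: "\<lbrakk>s \<in> Ob E; r \<in> Ob E; f \<in> Mor E s r; m \<in> carrier (space M r)\<rbrakk>
      \<Longrightarrow> coact M s (act M s r f m)
        = tsum (tens K (space M s) C) (coact M r m) (\<lambda>m0 m1.
            tsum (tens K (space M s) C) (entw_app K C E s r m1 f) (\<lambda>f' c.
              tpure K (space M s) C (act M s r f' m0) c))"

definition EMod ::
  "('k, 'r) ring_scheme \<Rightarrow> ('k, 'u::infinite, 'c) coalgebra_scheme \<Rightarrow> ('k, 'o, 'u, 'm) entw_scheme
    \<Rightarrow> (('k, 'o, 'u) emod, 'o \<Rightarrow> 'u \<Rightarrow> 'u) cat"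
where
  "EMod K C E =
    \<lparr>Ob = {M. entwined_module K C E M},
     Mor = (\<lambda>M N. {\<eta> \<in> rmod_hom K E M N.
       \<forall>r\<in>Ob E. colinear K C (space M r) (coact M r) (space N r) (coact N r) (\<eta> r)}),
     Cmp = (\<lambda>M _ _ \<theta> \<eta>. \<lambda>r\<in>Ob E. compose (carrier (space M r)) (\<theta> r) (\<eta> r)),
     Idt = (\<lambda>M. \<lambda>r\<in>Ob E. \<lambda>m\<in>carrier (space M r). m)\<rparr>"

text \<open>Restriction along \<open>\<alpha> : E \<rightarrow> E'\<close>, as functors from modules over \<open>E'\<close> to modules over \<open>E\<close>.\<close>

definition rres ::
  "('k, 'r) ring_scheme \<Rightarrow> ('k, 'o, 'u) entw \<Rightarrow> ('k, 'o, 'u) entw \<Rightarrow> ('o, 'u, 'o, 'u) fctr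
    \<Rightarrow> (('k, 'o, 'u) rmod, 'o \<Rightarrow> 'u \<Rightarrow> 'u, ('k, 'o, 'u) rmod, 'o \<Rightarrow> 'u \<Rightarrow> 'u) fctr"
where
  "rres K E E' \<alpha> =
    \<lparr>fobj = (\<lambda>N\<in>Ob (RMod K E').
       \<lparr>space = (\<lambda>r. space N (fobj \<alpha> r)),
        act = (\<lambda>s r f. act N (fobj \<alpha> s) (fobj \<alpha> r) (farr \<alpha> s r f))\<rparr>),
     farr = (\<lambda>N\<in>Ob (RMod K E'). \<lambda>N'\<in>Ob (RMod K E'). \<lambda>\<eta>\<in>Mor (RMod K E') N N'.
       \<lambda>r\<in>Ob E. \<eta> (fobj \<alpha> r))\<rparr>"

definition eres ::
  "('k, 'r) ring_scheme \<Rightarrow> ('k, 'u::infinite, 'c) coalgebra_scheme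
    \<Rightarrow> ('k, 'o, 'u) entw \<Rightarrow> ('k, 'o, 'u) entw \<Rightarrow> ('o, 'u, 'o, 'u) fctr
    \<Rightarrow> (('k, 'o, 'u) emod, 'o \<Rightarrow> 'u \<Rightarrow> 'u, ('k, 'o, 'u) emod, 'o \<Rightarrow> 'u \<Rightarrow> 'u) fctr"
where
  "eres K C E E' \<alpha> =
    \<lparr>fobj = (\<lambda>N\<in>Ob (EMod K C E').
       \<lparr>space = (\<lambda>r. space N (fobj \<alpha> r)),
        act = (\<lambda>s r f. act N (fobj \<alpha> s) (fobj \<alpha> r) (farr \<alpha> s r f)),
        coact = (\<lambda>r. coact N (fobj \<alpha> r))\<rparr>),
     farr = (\<lambda>N\<in>Ob (EMod K C E'). \<lambda>N'\<in>Ob (EMod K C E'). \<lambda>\<eta>\<in>Mor (EMod K C E') N N'.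
       \<lambda>r\<in>Ob E. \<eta> (fobj \<alpha> r))\<rparr>"

definition forget ::
  "('k, 'r) ring_scheme \<Rightarrow> ('k, 'u::infinite, 'c) coalgebra_scheme \<Rightarrow> ('k, 'o, 'u) entw
    \<Rightarrow> (('k, 'o, 'u) emod, 'o \<Rightarrow> 'u \<Rightarrow> 'u, ('k, 'o, 'u) rmod, 'o \<Rightarrow> 'u \<Rightarrow> 'u) fctr"
where
  "forget K C E =
    \<lparr>fobj = (\<lambda>M\<in>Ob (EMod K C E). rmod.truncate M),
     farr = (\<lambda>M\<in>Ob (EMod K C E). \<lambda>N\<in>Ob (EMod K C E). \<lambda>\<eta>\<in>Mor (EMod K C E) M N. \<eta>)\<rparr>"

definition cofree ::
  "('k, 'r) ring_scheme \<Rightarrow> ('k, 'u::infinite, 'c) coalgebra_scheme \<Rightarrow> ('k, 'o, 'u) entw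
    \<Rightarrow> (('k, 'o, 'u) rmod, 'o \<Rightarrow> 'u \<Rightarrow> 'u, ('k, 'o, 'u) emod, 'o \<Rightarrow> 'u \<Rightarrow> 'u) fctr"
where
  "cofree K C E =
    \<lparr>fobj = (\<lambda>N\<in>Ob (RMod K E).
       \<lparr>space = (\<lambda>r. tens K (space N r) C),
        act = (\<lambda>s r f. \<lambda>z\<in>carrier (tens K (space N r) C).
          tsum (tens K (space N s) C) z (\<lambda>n c.
            tsum (tens K (space N s) C) (entw_app K C E s r c f) (\<lambda>f' c'.
              tpure K (space N s) C (act N s r f' n) c'))),
        coact = (\<lambda>r. \<lambda>z\<in>carrier (tens K (space N r) C).
          tsum (tens K (tens K (space N r) C) C) z (\<lambda>n c.
            tsum (tens K (tens K (space N r) C) C) (comul C c) (\<lambda>c1 c2.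
              tpure K (tens K (space N r) C) C (tpure K (space N r) C n c1) c2)))\<rparr>),
     farr = (\<lambda>N\<in>Ob (RMod K E). \<lambda>N'\<in>Ob (RMod K E). \<lambda>\<eta>\<in>Mor (RMod K E) N N'.
       \<lambda>r\<in>Ob E. \<lambda>z\<in>carrier (tens K (space N r) C).
         tsum (tens K (space N' r) C) z (\<lambda>n c. tpure K (space N' r) C (\<eta> r n) c))\<rparr>"


section \<open>Modules over a representation\<close>

text \<open>
  Modules with values in a family of categories \<open>cat x\<close> (\<open>x \<in> X\<close>) with restriction functors
  \<open>res x y : cat y \<rightarrow> cat x\<close> for \<open>(x, y) \<in> leq\<close>; the module \<open>M\<close> has components \<open>mobj M x\<close> and
  transition morphisms \<open>mtr M x y : M\<^sub>x \<rightarrow> \<alpha>\<^sub>* M\<^sub>y\<close> for \<open>\<alpha> : x \<rightarrow> y\<close>.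
\<close>

record ('x, 'm, 'a) repmod =
  mobj :: "'x \<Rightarrow> 'm"
  mtr :: "'x \<Rightarrow> 'x \<Rightarrow> 'a"

definition RepMod ::
  "'x set \<Rightarrow> 'x rel \<Rightarrow> ('x \<Rightarrow> ('m, 'a) cat) \<Rightarrow> ('x \<Rightarrow> 'x \<Rightarrow> ('m, 'a, 'm, 'a) fctr)
    \<Rightarrow> (('x, 'm, 'a) repmod, 'x \<Rightarrow> 'a) cat"
where
  "RepMod X leq cat res =
    \<lparr>Ob = {M. (\<forall>x\<in>X. mobj M x \<in> Ob (cat x)) \<and>
       (\<forall>(x, y)\<in>leq. mtr M x y \<in> Mor (cat x) (mobj M x) (fobj (res x y) (mobj M y))) \<and>
       (\<forall>x\<in>X. mtr M x x = Idt (cat x) (mobj M x)) \<and>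
       (\<forall>x y z. (x, y) \<in> leq \<and> (y, z) \<in> leq \<longrightarrow>
         mtr M x z =
           Cmp (cat x) (mobj M x) (fobj (res x y) (mobj M y))
             (fobj (res x y) (fobj (res y z) (mobj M z)))
             (farr (res x y) (mobj M y) (fobj (res y z) (mobj M z)) (mtr M y z)) (mtr M x y))},
     Mor = (\<lambda>M N. {\<eta> \<in> (\<Pi>\<^sub>E x\<in>X. Mor (cat x) (mobj M x) (mobj N x)).
       \<forall>(x, y)\<in>leq.
         Cmp (cat x) (mobj M x) (mobj N x) (fobj (res x y) (mobj N y)) (mtr N x y) (\<eta> x)
         = Cmp (cat x) (mobj M x) (fobj (res x y) (mobj M y)) (fobj (res x y) (mobj N y))
             (farr (res x y) (mobj M y) (mobj N y) (\<eta> y)) (mtr M x y)}),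
     Cmp = (\<lambda>M N P \<theta> \<eta>. \<lambda>x\<in>X. Cmp (cat x) (mobj M x) (mobj N x) (mobj P x) (\<theta> x) (\<eta> x)),
     Idt = (\<lambda>M. \<lambda>x\<in>X. Idt (cat x) (mobj M x))\<rparr>"

text \<open>
  The functor induced pointwise by functors \<open>\<Phi> x\<close> that commute with the restriction functors.
\<close>

definition pointwise ::
  "'x set \<Rightarrow> (('x, 'm, 'a) repmod, 'x \<Rightarrow> 'a) cat \<Rightarrow> ('x \<Rightarrow> 'x \<Rightarrow> ('m, 'a, 'm, 'a) fctr)
    \<Rightarrow> ('x \<Rightarrow> ('m, 'a, 'n, 'b) fctr)
    \<Rightarrow> (('x, 'm, 'a) repmod, 'x \<Rightarrow> 'a, ('x, 'n, 'b) repmod, 'x \<Rightarrow> 'b) fctr"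
where
  "pointwise X \<M> res \<Phi> =
    \<lparr>fobj = (\<lambda>M\<in>Ob \<M>.
       \<lparr>mobj = (\<lambda>x. fobj (\<Phi> x) (mobj M x)),
        mtr = (\<lambda>x y. farr (\<Phi> x) (mobj M x) (fobj (res x y) (mobj M y)) (mtr M x y))\<rparr>),
     farr = (\<lambda>M\<in>Ob \<M>. \<lambda>N\<in>Ob \<M>. \<lambda>\<eta>\<in>Mor \<M> M N.
       \<lambda>x\<in>X. farr (\<Phi> x) (mobj M x) (mobj N x) (\<eta> x))\<rparr>"

type_synonym ('k, 'o, 'u, 'x) entw_rep =
  "('x, unit, ('k, 'o, 'u) entw, ('o, 'u, 'o, 'u) fctr) fctr"

abbreviation RRes ::
  "('k, 'r) ring_scheme \<Rightarrow> ('k, 'o, 'u, 'x) entw_rep \<Rightarrow> 'x \<Rightarrow> 'x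
    \<Rightarrow> (('k, 'o, 'u) rmod, 'o \<Rightarrow> 'u \<Rightarrow> 'u, ('k, 'o, 'u) rmod, 'o \<Rightarrow> 'u \<Rightarrow> 'u) fctr"
where
  "RRes K \<R> x y \<equiv> rres K (fobj \<R> x) (fobj \<R> y) (farr \<R> x y ())"

abbreviation ERes ::
  "('k, 'r) ring_scheme \<Rightarrow> ('k, 'u::infinite, 'c) coalgebra_scheme \<Rightarrow> ('k, 'o, 'u, 'x) entw_rep
    \<Rightarrow> 'x \<Rightarrow> 'x
    \<Rightarrow> (('k, 'o, 'u) emod, 'o \<Rightarrow> 'u \<Rightarrow> 'u, ('k, 'o, 'u) emod, 'o \<Rightarrow> 'u \<Rightarrow> 'u) fctr"
where
  "ERes K C \<R> x y \<equiv> eres K C (fobj \<R> x) (fobj \<R> y) (farr \<R> x y ())"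

definition ModR ::
  "('k, 'r) ring_scheme \<Rightarrow> 'x set \<Rightarrow> 'x rel \<Rightarrow> ('k, 'o, 'u, 'x) entw_rep
    \<Rightarrow> (('x, ('k, 'o, 'u) rmod, 'o \<Rightarrow> 'u \<Rightarrow> 'u) repmod, 'x \<Rightarrow> 'o \<Rightarrow> 'u \<Rightarrow> 'u) cat"
where
  "ModR K X leq \<R> = RepMod X leq (\<lambda>x. RMod K (fobj \<R> x)) (RRes K \<R>)"

definition ModCR ::
  "('k, 'r) ring_scheme \<Rightarrow> ('k, 'u::infinite, 'c) coalgebra_scheme \<Rightarrow> 'x set \<Rightarrow> 'x rel
    \<Rightarrow> ('k, 'o, 'u, 'x) entw_rep
    \<Rightarrow> (('x, ('k, 'o, 'u) emod, 'o \<Rightarrow> 'u \<Rightarrow> 'u) repmod, 'x \<Rightarrow> 'o \<Rightarrow> 'u \<Rightarrow> 'u) cat"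
where
  "ModCR K C X leq \<R> = RepMod X leq (\<lambda>x. EMod K C (fobj \<R> x)) (ERes K C \<R>)"

definition Forget ::
  "('k, 'r) ring_scheme \<Rightarrow> ('k, 'u::infinite, 'c) coalgebra_scheme \<Rightarrow> 'x set \<Rightarrow> 'x rel
    \<Rightarrow> ('k, 'o, 'u, 'x) entw_rep
    \<Rightarrow> (('x, ('k, 'o, 'u) emod, 'o \<Rightarrow> 'u \<Rightarrow> 'u) repmod, 'x \<Rightarrow> 'o \<Rightarrow> 'u \<Rightarrow> 'u,
        ('x, ('k, 'o, 'u) rmod, 'o \<Rightarrow> 'u \<Rightarrow> 'u) repmod, 'x \<Rightarrow> 'o \<Rightarrow> 'u \<Rightarrow> 'u) fctr"
where
  "Forget K C X leq \<R> =
    pointwise X (ModCR K C X leq \<R>) (ERes K C \<R>) (\<lambda>x. forget K C (fobj \<R> x))"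

definition Cofree ::
  "('k, 'r) ring_scheme \<Rightarrow> ('k, 'u::infinite, 'c) coalgebra_scheme \<Rightarrow> 'x set \<Rightarrow> 'x rel
    \<Rightarrow> ('k, 'o, 'u, 'x) entw_rep
    \<Rightarrow> (('x, ('k, 'o, 'u) rmod, 'o \<Rightarrow> 'u \<Rightarrow> 'u) repmod, 'x \<Rightarrow> 'o \<Rightarrow> 'u \<Rightarrow> 'u,
        ('x, ('k, 'o, 'u) emod, 'o \<Rightarrow> 'u \<Rightarrow> 'u) repmod, 'x \<Rightarrow> 'o \<Rightarrow> 'u \<Rightarrow> 'u) fctr"
where
  "Cofree K C X leq \<R> =
    pointwise X (ModR K X leq \<R>) (RRes K \<R>) (\<lambda>x. cofree K C (fobj \<R> x))"


section \<open>The spaces of natural transformations\<close>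

definition Nat_GF ::
  "('k, 'r) ring_scheme \<Rightarrow> ('k, 'u::infinite, 'c) coalgebra_scheme \<Rightarrow> 'x set \<Rightarrow> 'x rel
    \<Rightarrow> ('k, 'o, 'u, 'x) entw_rep
    \<Rightarrow> (('x, ('k, 'o, 'u) emod, 'o \<Rightarrow> 'u \<Rightarrow> 'u) repmod \<Rightarrow> 'x \<Rightarrow> 'o \<Rightarrow> 'u \<Rightarrow> 'u) set"
where
  "Nat_GF K C X leq \<R> = NatTrans (ModCR K C X leq \<R>) (ModCR K C X leq \<R>)
    (fun_comp (ModCR K C X leq \<R>) (Cofree K C X leq \<R>) (Forget K C X leq \<R>))
    (fun_id (ModCR K C X leq \<R>))"

abbreviation cofree_forget ::
  "('k, 'r) ring_scheme \<Rightarrow> ('k, 'u::infinite, 'c) coalgebra_scheme \<Rightarrow> ('k, 'o, 'u) entw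
    \<Rightarrow> (('k, 'o, 'u) emod, 'o \<Rightarrow> 'u \<Rightarrow> 'u, ('k, 'o, 'u) emod, 'o \<Rightarrow> 'u \<Rightarrow> 'u) fctr"
where
  "cofree_forget K C E \<equiv> fun_comp (EMod K C E) (cofree K C E) (forget K C E)"

definition Nat_GF_at ::
  "('k, 'r) ring_scheme \<Rightarrow> ('k, 'u::infinite, 'c) coalgebra_scheme \<Rightarrow> ('k, 'o, 'u) entw
    \<Rightarrow> (('k, 'o, 'u) emod \<Rightarrow> 'o \<Rightarrow> 'u \<Rightarrow> 'u) set"
where
  "Nat_GF_at K C E =
    NatTrans (EMod K C E) (EMod K C E) (cofree_forget K C E) (fun_id (EMod K C E))"

definition compatible_families ::
  "('k, 'r) ring_scheme \<Rightarrow> ('k, 'u::infinite, 'c) coalgebra_scheme \<Rightarrow> 'x set \<Rightarrow> 'x rel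
    \<Rightarrow> ('k, 'o, 'u, 'x) entw_rep
    \<Rightarrow> ('x \<Rightarrow> ('k, 'o, 'u) emod \<Rightarrow> 'o \<Rightarrow> 'u \<Rightarrow> 'u) set"
where
  "compatible_families K C X leq \<R> =
    {\<upsilon> \<in> (\<Pi>\<^sub>E x\<in>X. Nat_GF_at K C (fobj \<R> x)).
      \<forall>(x, y)\<in>leq. \<forall>M\<in>Ob (ModCR K C X leq \<R>).
        (let GF = (\<lambda>z. cofree_forget K C (fobj \<R> z));
             Mx = mobj M x; My = mobj M y; res = ERes K C \<R> x y
         in Cmp (EMod K C (fobj \<R> x)) (fobj (GF x) Mx) Mx (fobj res My)
              (mtr M x y) (\<upsilon> x Mx)
            = Cmp (EMod K C (fobj \<R> x)) (fobj (GF x) Mx) (fobj (GF x) (fobj res My)) (fobj res My)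
                (farr res (fobj (GF y) My) My (\<upsilon> y My))
                (farr (GF x) Mx (fobj res My) (mtr M x y)))}"

definition Nat_space ::
  "('k, 'r) ring_scheme \<Rightarrow> ('k, 'u::infinite, 'c) coalgebra_scheme \<Rightarrow> 'x set \<Rightarrow> 'x rel
    \<Rightarrow> ('k, 'o, 'u, 'x) entw_rep
    \<Rightarrow> ('k, ('x, ('k, 'o, 'u) emod, 'o \<Rightarrow> 'u \<Rightarrow> 'u) repmod \<Rightarrow> 'x \<Rightarrow> 'o \<Rightarrow> 'u \<Rightarrow> 'u) module"
where
  "Nat_space K C X leq \<R> =
    (let on_dom = (\<lambda>h. \<lambda>M\<in>Ob (ModCR K C X leq \<R>). \<lambda>x\<in>X. \<lambda>r\<in>Ob (fobj \<R> x).
           \<lambda>z\<in>carrier (tens K (space (mobj M x) r) C). h M x r z)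
     in \<lparr>carrier = Nat_GF K C X leq \<R>,
         mult = undefined, one = undefined,
         zero = on_dom (\<lambda>M x r z. \<zero>\<^bsub>space (mobj M x) r\<^esub>),
         add = (\<lambda>\<upsilon> \<upsilon>'. on_dom (\<lambda>M x r z. \<upsilon> M x r z \<oplus>\<^bsub>space (mobj M x) r\<^esub> \<upsilon>' M x r z)),
         smult = (\<lambda>k \<upsilon>. on_dom (\<lambda>M x r z. k \<odot>\<^bsub>space (mobj M x) r\<^esub> \<upsilon> M x r z))\<rparr>)"

definition V1_set ::
  "('k, 'r) ring_scheme \<Rightarrow> ('k, 'u::infinite, 'c) coalgebra_scheme \<Rightarrow> 'x set \<Rightarrow> 'x rel
    \<Rightarrow> ('k, 'o, 'u, 'x) entw_rep \<Rightarrow> ('x \<Rightarrow> 'o \<Rightarrow> 'u \<Rightarrow> 'u) set"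
where
  "V1_set K C X leq \<R> =
    {\<theta> \<in> (\<Pi>\<^sub>E x\<in>X. \<Pi>\<^sub>E r\<in>Ob (fobj \<R> x). Lin K (tens K C C) (homs (fobj \<R> x) r r)).
      (\<forall>x\<in>X. \<forall>r\<in>Ob (fobj \<R> x). \<forall>c\<in>carrier C. \<forall>d\<in>carrier C.
        (let E = fobj \<R> x; T = tens K (homs E r r) C in
          tsum T (comul C d) (\<lambda>d1 d2. tpure K (homs E r r) C (\<theta> x r (tpure K C C c d1)) d2)
          = tsum T (comul C c) (\<lambda>c1 c2. entw_app K C E r r c1 (\<theta> x r (tpure K C C c2 d))))) \<and>
      (\<forall>x\<in>X. \<forall>s\<in>Ob (fobj \<R> x). \<forall>r\<in>Ob (fobj \<R> x). \<forall>f\<in>Mor (fobj \<R> x) s r.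
        \<forall>c\<in>carrier C. \<forall>d\<in>carrier C.
        (let E = fobj \<R> x in
          Cmp E s r r (\<theta> x r (tpure K C C c d)) f
          = tsum (homs E s r) (entw_app K C E s r d f) (\<lambda>f' d'.
              tsum (homs E s r) (entw_app K C E s r c f') (\<lambda>f'' c'.
                Cmp E s s r f'' (\<theta> x s (tpure K C C c' d')))))) \<and>
      (\<forall>(x, y)\<in>leq. \<forall>r\<in>Ob (fobj \<R> x). \<forall>c\<in>carrier C. \<forall>d\<in>carrier C.
        farr (farr \<R> x y ()) r r (\<theta> x r (tpure K C C c d))
        = \<theta> y (fobj (farr \<R> x y ()) r) (tpure K C C c d))}"

definition V1_space ::
  "('k, 'r) ring_scheme \<Rightarrow> ('k, 'u::infinite, 'c) coalgebra_scheme \<Rightarrow> 'x set \<Rightarrow> 'x rel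
    \<Rightarrow> ('k, 'o, 'u, 'x) entw_rep \<Rightarrow> ('k, 'x \<Rightarrow> 'o \<Rightarrow> 'u \<Rightarrow> 'u) module"
where
  "V1_space K C X leq \<R> =
    (let on_dom = (\<lambda>h. \<lambda>x\<in>X. \<lambda>r\<in>Ob (fobj \<R> x). \<lambda>z\<in>carrier (tens K C C). h x r z)
     in \<lparr>carrier = V1_set K C X leq \<R>,
         mult = undefined, one = undefined,
         zero = on_dom (\<lambda>x r z. \<zero>\<^bsub>homs (fobj \<R> x) r r\<^esub>),
         add = (\<lambda>\<theta> \<theta>'. on_dom (\<lambda>x r z. \<theta> x r z \<oplus>\<^bsub>homs (fobj \<R> x) r r\<^esub> \<theta>' x r z)),
         smult = (\<lambda>k \<theta>. on_dom (\<lambda>x r z. k \<odot>\<^bsub>homs (fobj \<R> x) r r\<^esub> \<theta> x r z))\<rparr>)"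

end

theory Submission
  imports Defs
begin

text \<open>
Everything comes down to one entwining structure \<open>E\<close> at a time. For an object \<open>r\<close> let
\<open>h\<^sub>r = E(-, r)\<close> be the representable right module. A natural transformation
\<open>\<upsilon> : G F \<rightarrow> 1\<close> on entwined modules is determined by the maps
\<open>\<theta>\<^sub>r(c \<otimes> d) = (id \<otimes> \<epsilon>) \<upsilon>(h\<^sub>r \<otimes> C)(id\<^sub>r \<otimes> c \<otimes> d)\<close>. Indeed, the coaction
\<open>M \<rightarrow> M \<otimes> C\<close> is a morphism of entwined modules, and naturality at it, followed by
\<open>id \<otimes> \<epsilon>\<close>, expresses \<open>\<upsilon>(M)(m \<otimes> c)\<close> through \<open>\<upsilon>(M \<otimes> C)(m\<^sub>0 \<otimes> m\<^sub>1 \<otimes> c)\<close>; and an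
element \<open>n\<close> of \<open>M(r)\<close> is the image of \<open>id\<^sub>r\<close> under the morphism \<open>h\<^sub>r \<rightarrow> M\<close>, \<open>f \<mapsto> n f\<close>, so
naturality at \<open>h\<^sub>r \<otimes> C \<rightarrow> M \<otimes> C\<close> reduces the value at \<open>n \<otimes> c \<otimes> d\<close> to the one at
\<open>id\<^sub>r \<otimes> c \<otimes> d\<close>. The outcome, lemma \<open>nat_eq_pure\<close>, is
\<open>\<upsilon>(M)(m \<otimes> c) = m\<^sub>0 \<theta>\<^sub>r(m\<^sub>1 \<otimes> c)\<close>. For a map of this shape condition (i) on \<open>\<theta>\<close> gives colinearity
and condition (ii) gives linearity over \<open>E\<close> (\<open>nat_of_colinear\<close>, \<open>nat_of_act\<close>), and conversely
both conditions are read off from \<open>\<upsilon>(h\<^sub>r \<otimes> C)\<close> (\<open>V_of_V_at\<close>).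

Over a representation of a poset, an entwined module \<open>M\<close> over \<open>\<R>\<^sub>x\<close> extends to an object
\<open>coe x M\<close> of \<open>Mod\<^sup>C-\<R>\<close>: the restriction of \<open>M\<close> at \<open>y \<le> x\<close>, and zero elsewhere. This is the
value of a right adjoint of the evaluation at \<open>x\<close>, and restriction of scalars is the only
construction that it involves. The unit \<open>M \<rightarrow> coe x M\<^sub>x\<close> has the identity as its component at \<open>x\<close>,
so naturality of \<open>\<upsilon>\<close> at the unit shows that \<open>\<upsilon>(M)\<^sub>x = \<upsilon>(coe x M\<^sub>x)\<^sub>x\<close> depends on \<open>M\<^sub>x\<close> only
(\<open>hat_component\<close>). Hence natural transformations are compatible families (\<open>assemble_bij\<close>), and
a compatible family is a family of \<open>\<theta>\<close>'s; its compatibility is condition (iii), as one sees by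
testing it on \<open>coe y (h\<^sub>s \<otimes> C)\<close> with \<open>s = \<alpha>(r)\<close> (\<open>V1_of_compatible\<close>).

The adjunction is given over each \<open>x\<close> by \<open>f \<mapsto> (m \<mapsto> f(m\<^sub>0) \<otimes> m\<^sub>1)\<close>, with inverse
\<open>g \<mapsto> (id \<otimes> \<epsilon>) g\<close> (\<open>adjunct_bij\<close>).

Two points of technique. A computation with Sweedler notation is a chain of equalities between
nested sums \<open>tsum\<close>; each axiom about tensors is first turned into an identity between sums of an
arbitrary multilinear map (for instance \<open>comodule_coassoc\<close> and \<open>psi_comul_sum\<close>), and two linear
maps on a tensor product are equal when they agree on pure tensors (\<open>pure_ext\<close>). Modules carry
arbitrary values at arguments outside the category, so the cofree functor commutes with
restriction only where these values do not matter; the relation \<open>em_agree\<close> expresses this, and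
sets of morphisms respect it.
\<close>

section \<open>Linear and bilinear maps\<close>

text \<open>
\<open>Lin\<close> consists of extensional functions, which makes equality of morphisms equality of functions
but is awkward for maps written as terms. The predicate \<open>lin\<close> drops extensionality, and includes
that both sides are modules, so that a linearity fact carries these facts along.
\<close>

definition lin ::
  "('k, 'r) ring_scheme \<Rightarrow> ('k, 'a, 'm) module_scheme \<Rightarrow> ('k, 'b, 'n) module_scheme
    \<Rightarrow> ('a \<Rightarrow> 'b) \<Rightarrow> bool"
where
  "lin K V W f \<longleftrightarrow> module K V \<and> module K W \<and> (\<forall>v\<in>carrier V. f v \<in> carrier W) \<and>
    (\<forall>v\<in>carrier V. \<forall>v'\<in>carrier V. f (v \<oplus>\<^bsub>V\<^esub> v') = f v \<oplus>\<^bsub>W\<^esub> f v') \<and>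
    (\<forall>k\<in>carrier K. \<forall>v\<in>carrier V. f (k \<odot>\<^bsub>V\<^esub> v) = k \<odot>\<^bsub>W\<^esub> f v)"

definition bilin ::
  "('k, 'r) ring_scheme \<Rightarrow> ('k, 'a, 'm) module_scheme \<Rightarrow> ('k, 'b, 'n) module_scheme
    \<Rightarrow> ('k, 'c, 'p) module_scheme \<Rightarrow> ('a \<Rightarrow> 'b \<Rightarrow> 'c) \<Rightarrow> bool"
where
  "bilin K V W U b \<longleftrightarrow> module K V \<and> module K W \<and> module K U \<and>
    (\<forall>v\<in>carrier V. lin K W U (b v)) \<and> (\<forall>w\<in>carrier W. lin K V U (\<lambda>v. b v w))"

lemma linD:
  assumes "lin K V W f"
  shows "module K V" "module K W" "v \<in> carrier V \<Longrightarrow> f v \<in> carrier W"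
    "\<lbrakk>v \<in> carrier V; v' \<in> carrier V\<rbrakk> \<Longrightarrow> f (v \<oplus>\<^bsub>V\<^esub> v') = f v \<oplus>\<^bsub>W\<^esub> f v'"
    "\<lbrakk>k \<in> carrier K; v \<in> carrier V\<rbrakk> \<Longrightarrow> f (k \<odot>\<^bsub>V\<^esub> v) = k \<odot>\<^bsub>W\<^esub> f v"
  using assms by (auto simp: lin_def)

lemma linI:
  assumes "module K V" "module K W" "\<And>v. v \<in> carrier V \<Longrightarrow> f v \<in> carrier W"
    "\<And>v v'. \<lbrakk>v \<in> carrier V; v' \<in> carrier V\<rbrakk> \<Longrightarrow> f (v \<oplus>\<^bsub>V\<^esub> v') = f v \<oplus>\<^bsub>W\<^esub> f v'"
    "\<And>k v. \<lbrakk>k \<in> carrier K; v \<in> carrier V\<rbrakk> \<Longrightarrow> f (k \<odot>\<^bsub>V\<^esub> v) = k \<odot>\<^bsub>W\<^esub> f v"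
  shows "lin K V W f"
  using assms by (auto simp: lin_def)

lemma bilinI:
  assumes "module K V" "module K W" "module K U"
    "\<And>v. v \<in> carrier V \<Longrightarrow> lin K W U (\<lambda>w. b v w)"
    "\<And>w. w \<in> carrier W \<Longrightarrow> lin K V U (\<lambda>v. b v w)"
  shows "bilin K V W U b"
  using assms by (auto simp: bilin_def)

lemma bilinD:
  assumes "bilin K V W U b"
  shows "module K V" "module K W" "module K U"
    "v \<in> carrier V \<Longrightarrow> lin K W U (\<lambda>w. b v w)" "w \<in> carrier W \<Longrightarrow> lin K V U (\<lambda>v. b v w)"
    "\<lbrakk>v \<in> carrier V; w \<in> carrier W\<rbrakk> \<Longrightarrow> b v w \<in> carrier U"
  using assms by (auto simp: bilin_def dest: linD)

lemma Lin_lin: "\<lbrakk>f \<in> Lin K V W; module K V; module K W\<rbrakk> \<Longrightarrow> lin K V W f"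
  by (auto simp: Lin_def lin_def)

lemma LinI: "\<lbrakk>lin K V W f; f \<in> extensional (carrier V)\<rbrakk> \<Longrightarrow> f \<in> Lin K V W"
  by (auto simp: Lin_def lin_def PiE_def)

lemma Lin_restrict_iff: "restrict f (carrier V) \<in> Lin K V W \<longleftrightarrow> lin K V W f"
  if "module K V" "module K W"
proof -
  interpret module K V by (rule that)
  show ?thesis
    using that by (auto simp: Lin_def lin_def)
qed

lemma Lin_extensional: "f \<in> Lin K V W \<Longrightarrow> f \<in> extensional (carrier V)"
  by (auto simp: Lin_def PiE_def)

lemma lin_id: "module K V \<Longrightarrow> lin K V V (\<lambda>v. v)"
  by (auto simp: lin_def)

lemma lin_comp: "\<lbrakk>lin K V W g; lin K U V f\<rbrakk> \<Longrightarrow> lin K U W (\<lambda>u. g (f u))"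
  by (auto simp: lin_def)

lemma lin_cong: "(\<And>v. v \<in> carrier V \<Longrightarrow> f v = g v) \<Longrightarrow> lin K V W f = lin K V W g"
proof (cases "module K V")
  case True
  assume *: "\<And>v. v \<in> carrier V \<Longrightarrow> f v = g v"
  interpret module K V by (rule True)
  show ?thesis unfolding lin_def using * by auto
qed (auto simp: lin_def)

lemma lin_zero: "lin K V W f \<Longrightarrow> f \<zero>\<^bsub>V\<^esub> = \<zero>\<^bsub>W\<^esub>"
proof -
  assume f: "lin K V W f"
  interpret V: module K V by (rule linD(1)[OF f])
  interpret W: module K W by (rule linD(2)[OF f])
  have "f (\<zero>\<^bsub>V\<^esub> \<oplus>\<^bsub>V\<^esub> \<zero>\<^bsub>V\<^esub>) = f \<zero>\<^bsub>V\<^esub> \<oplus>\<^bsub>W\<^esub> f \<zero>\<^bsub>V\<^esub>" by (rule linD(4)[OF f]) auto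
  then show ?thesis using linD(3)[OF f V.zero_closed] by simp
qed

lemma lin_const_zero: "\<lbrakk>module K V; module K W\<rbrakk> \<Longrightarrow> lin K V W (\<lambda>v. \<zero>\<^bsub>W\<^esub>)"
proof -
  assume "module K V" "module K W"
  interpret W: module K W by fact
  show ?thesis using \<open>module K V\<close> \<open>module K W\<close> by (auto simp: lin_def)
qed

lemma lin_add: "\<lbrakk>lin K V W f; lin K V W g\<rbrakk> \<Longrightarrow> lin K V W (\<lambda>v. f v \<oplus>\<^bsub>W\<^esub> g v)"
proof -
  assume f: "lin K V W f" and g: "lin K V W g"
  interpret W: module K W by (rule linD(2)[OF f])
  show ?thesis
    by (rule linI) (use linD[OF f] linD[OF g] in \<open>auto simp: W.smult_r_distr W.a_ac\<close>)
qed

lemma lin_smult: "\<lbrakk>lin K V W f; k \<in> carrier K\<rbrakk> \<Longrightarrow> lin K V W (\<lambda>v. k \<odot>\<^bsub>W\<^esub> f v)"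
proof -
  assume f: "lin K V W f" and k: "k \<in> carrier K"
  interpret W: module K W by (rule linD(2)[OF f])
  show ?thesis
    by (rule linI) (use linD[OF f] k in \<open>auto simp: W.smult_r_distr W.smult_assoc1[symmetric] W.m_comm\<close>)
qed

lemma smult_closed_mod: "\<lbrakk>module K V; k \<in> carrier K; v \<in> carrier V\<rbrakk> \<Longrightarrow> k \<odot>\<^bsub>V\<^esub> v \<in> carrier V"
  by (rule module.smult_closed)

section \<open>Tensor products\<close>

text \<open>
Membership in \<open>lists\<close> is kept folded: the relation \<open>tens_eq\<close> is stated with it.
\<close>

declare in_lists_conv_set [simp del] in_listsD [rule del] in_listsI [rule del] tens_eq.tens_trans [trans]

lemma inj_list_code: "inj (list_code :: ('u::infinite \<times> 'u) list \<Rightarrow> 'u)"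
proof -
  obtain p :: "'u \<times> 'u \<Rightarrow> 'u" where p: "inj p"
    using card_of_Times_same_infinite[OF infinite_UNIV[where 'a = 'u]]
    by (auto simp: card_of_ordIso[symmetric] bij_betw_def)
  obtain a :: 'u and h :: "'u \<Rightarrow> 'u" where h: "bij_betw h UNIV (UNIV - {a})"
    using infinite_imp_bij_betw[OF infinite_UNIV] by blast
  have ih: "inj h" and ha: "h x \<noteq> a" for x
    using h by (auto simp: bij_betw_def)
  \<comment> \<open>encode the empty list by the spare point \<open>a\<close>, a nonempty one by pairing head and tail\<close>
  define e where "e = rec_list a (\<lambda>x _ u. h (p (p x, u)))"
  have e: "e [] = a" "e (x # xs) = h (p (p x, e xs))" for x xs by (auto simp: e_def)
  have "e xs = e ys \<Longrightarrow> xs = ys" for xs ys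
  proof (induction xs arbitrary: ys)
    case Nil then show ?case by (cases ys) (use ha in \<open>auto simp: e dest: sym\<close>)
  next
    case (Cons x xs)
    then show ?case
      by (cases ys) (use ha in \<open>auto simp: e dest!: injD[OF ih] injD[OF p]\<close>)
  qed
  then have "inj e" by (auto simp: inj_def)
  then show ?thesis unfolding list_code_def by (rule someI[where P = inj])
qed

text \<open>
\<open>tsum U z b\<close> is the sum of \<open>b\<close> over the chosen representative of \<open>z\<close>; \<open>lsum\<close> sums over any list, so
that independence of the representative can be stated.
\<close>

definition lsum :: "('k, 'a, 'm) module_scheme \<Rightarrow> ('v \<Rightarrow> 'w \<Rightarrow> 'a) \<Rightarrow> ('v \<times> 'w) list \<Rightarrow> 'a" where
  "lsum U b xs = foldr (\<lambda>(v, w) u. b v w \<oplus>\<^bsub>U\<^esub> u) xs \<zero>\<^bsub>U\<^esub>"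

lemma lsum_simps [simp]:
  "lsum U b [] = \<zero>\<^bsub>U\<^esub>" "lsum U b ((v, w) # xs) = b v w \<oplus>\<^bsub>U\<^esub> lsum U b xs"
  by (auto simp: lsum_def)

lemma tsum_lsum: "tsum U z b = lsum U b (trep z)"
  by (simp add: tsum_def lsum_def)

lemma lsum_closed:
  assumes "module K U" "\<And>v w. \<lbrakk>v \<in> A; w \<in> B\<rbrakk> \<Longrightarrow> b v w \<in> carrier U" "xs \<in> lists (A \<times> B)"
  shows "lsum U b xs \<in> carrier U"
proof -
  interpret module K U by fact
  show ?thesis using assms(3) by (induction xs) (use assms(2) in auto)
qed

lemma lsum_append:
  assumes "module K U" "\<And>v w. \<lbrakk>v \<in> A; w \<in> B\<rbrakk> \<Longrightarrow> b v w \<in> carrier U"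
    "xs \<in> lists (A \<times> B)" "ys \<in> lists (A \<times> B)"
  shows "lsum U b (xs @ ys) = lsum U b xs \<oplus>\<^bsub>U\<^esub> lsum U b ys"
proof -
  interpret module K U by fact
  have "lsum U b ys \<in> carrier U" by (rule lsum_closed[where b = b, OF assms(1,2,4)])
  with assms(3) show ?thesis
    by (induction xs) (use assms(2) lsum_closed[where b = b and A = A and B = B, OF assms(1,2)] in \<open>auto simp: a_assoc\<close>)
qed

lemma lsum_cong:
  assumes "\<And>v w. \<lbrakk>v \<in> A; w \<in> B\<rbrakk> \<Longrightarrow> b v w = b' v w" "xs \<in> lists (A \<times> B)"
  shows "lsum U b xs = lsum U b' xs"
  using assms(2) by (induction xs) (use assms(1) in auto)

lemma lsum_lin:
  assumes f: "lin K U U' f" and b: "\<And>v w. \<lbrakk>v \<in> A; w \<in> B\<rbrakk> \<Longrightarrow> b v w \<in> carrier U" "xs \<in> lists (A \<times> B)"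
  shows "f (lsum U b xs) = lsum U' (\<lambda>v w. f (b v w)) xs"
  using b(2)
proof (induction xs)
  case Nil then show ?case using lin_zero[OF f] by simp
next
  case (Cons p xs)
  then show ?case
    using lsum_closed[OF linD(1)[OF f], of A B b xs] b(1) by (cases p) (auto simp: linD(4)[OF f])
qed

context
  fixes K :: "('k, 'r) ring_scheme" and V :: "('k, 'u::infinite, 'm) module_scheme"
    and W :: "('k, 'u, 'n) module_scheme"
  assumes V: "module K V" and W: "module K W"
begin

interpretation V: module K V by (rule V)
interpretation W: module K W by (rule W)

private abbreviation (input) "FL \<equiv> lists (carrier V \<times> carrier W)"

lemma tens_eq_lists: "tens_eq K V W xs ys \<Longrightarrow> xs \<in> FL \<and> ys \<in> FL"
  by (induction rule: tens_eq.induct) auto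

lemma tens_eq_append:
  assumes "tens_eq K V W xs xs'" "tens_eq K V W ys ys'"
  shows "tens_eq K V W (xs @ ys) (xs' @ ys')"
proof -
  note l = tens_eq_lists[OF assms(1)] tens_eq_lists[OF assms(2)]
  have "tens_eq K V W (xs @ ys) (xs @ ys')" using assms(2) l by (auto intro: tens_append)
  also have "tens_eq K V W (xs @ ys') (ys' @ xs)" using l by (auto intro: tens_commute)
  also have "tens_eq K V W (ys' @ xs) (ys' @ xs')" using assms(1) l by (auto intro: tens_append)
  also have "tens_eq K V W (ys' @ xs') (xs' @ ys')" using l by (auto intro: tens_commute)
  finally show ?thesis .
qed

text \<open>
This is the universal property of the tensor product: each generating relation of \<open>tens_eq\<close> is
respected by the sum of a bilinear map.
\<close>

lemma lsum_tens_eq: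
  assumes b: "bilin K V W U b"
  shows "tens_eq K V W xs ys \<Longrightarrow> lsum U b xs = lsum U b ys"
proof (induction rule: tens_eq.induct)
  interpret U: module K U by (rule bilinD(3)[OF b])
  note c = bilinD(6)[OF b]
  note ap = lsum_append[where b = b and A = "carrier V" and B = "carrier W", OF bilinD(3)[OF b], OF c]
    and cl = lsum_closed[where b = b and A = "carrier V" and B = "carrier W", OF bilinD(3)[OF b], OF c]
  {
    case (tens_append xs ys zs)
    then show ?case using tens_eq_lists ap by auto
  next
    case (tens_commute xs ys)
    then show ?case using ap cl U.a_comm by auto
  next
    case (tens_zero w)
    then show ?case using lin_zero[OF bilinD(5)[OF b]] by auto
  next
    case (tens_add_left v v' w)
    then show ?case using linD(4)[OF bilinD(5)[OF b]] c by (auto simp: U.a_assoc)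
  next
    case (tens_add_right v w w')
    then show ?case using linD(4)[OF bilinD(4)[OF b]] c by (auto simp: U.a_assoc)
  next
    case (tens_smult k v w)
    then show ?case using linD(5)[OF bilinD(4)[OF b]] linD(5)[OF bilinD(5)[OF b]] by auto
  }
qed auto

lemma tens_eq_smult:
  assumes k: "k \<in> carrier K"
  shows "tens_eq K V W xs ys \<Longrightarrow>
    tens_eq K V W (map (\<lambda>(v, w). (k \<odot>\<^bsub>V\<^esub> v, w)) xs) (map (\<lambda>(v, w). (k \<odot>\<^bsub>V\<^esub> v, w)) ys)"
proof (induction rule: tens_eq.induct)
  have l: "xs \<in> FL \<Longrightarrow> map (\<lambda>(v, w). (k \<odot>\<^bsub>V\<^esub> v, w)) xs \<in> FL" for xs
    using k by (induction xs) auto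
  {
    case (tens_refl xs) then show ?case using l by (auto intro: tens_eq.tens_refl)
  next
    case (tens_sym xs ys) then show ?case by (blast intro: tens_eq.tens_sym)
  next
    case (tens_trans xs ys zs) then show ?case by (blast intro: tens_eq.tens_trans)
  next
    case (tens_append xs ys zs)
    then show ?case using l by (auto intro: tens_eq.tens_append)
  next
    case (tens_commute xs ys)
    then show ?case using l by (auto intro: tens_eq.tens_commute)
  next
    case (tens_zero w) then show ?case using k by (auto intro: tens_eq.tens_zero)
  next
    case (tens_add_left v v' w)
    then show ?case using k by (auto intro: tens_eq.tens_add_left simp: V.smult_r_distr)
  next
    case (tens_add_right v w w')
    then show ?case using k by (auto intro: tens_eq.tens_add_right)
  next
    case (tens_smult k' v w)
    have "k \<odot>\<^bsub>V\<^esub> (k' \<odot>\<^bsub>V\<^esub> v) = k' \<odot>\<^bsub>V\<^esub> (k \<odot>\<^bsub>V\<^esub> v)"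
      using tens_smult k by (simp add: V.smult_assoc1[symmetric] V.m_comm)
    then show ?case using tens_smult k by (auto intro: tens_eq.tens_smult)
  }
qed

private abbreviation (input) "T \<equiv> tens K V W"
private abbreviation (input) "cls \<equiv> tclass K V W"

lemma tclass_eqI: "tens_eq K V W xs ys \<Longrightarrow> cls xs = cls ys"
proof -
  assume "tens_eq K V W xs ys"
  then have "tens_eq K V W xs = tens_eq K V W ys"
    by (intro ext iffI) (blast intro: tens_sym tens_trans)+
  then show ?thesis by (simp add: tclass_def)
qed

lemma trep_tclass: "xs \<in> FL \<Longrightarrow> tens_eq K V W xs (trep (cls xs))"
  unfolding tclass_def trep_def inv_into_f_f[OF inj_list_code UNIV_I]
  by (rule someI[of _ xs]) (rule tens_refl)

lemma tens_carrierE: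
  assumes "z \<in> carrier T" obtains xs where "xs \<in> FL" "z = cls xs"
  using assms by (auto simp: tens_def)

lemma tclass_closed: "xs \<in> FL \<Longrightarrow> cls xs \<in> carrier T"
  by (auto simp: tens_def)

lemma trep_lists: "z \<in> carrier T \<Longrightarrow> trep z \<in> FL"
  by (erule tens_carrierE) (use trep_tclass tens_eq_lists in blast)

lemma tens_zero_cls: "\<zero>\<^bsub>T\<^esub> = cls []"
  by (simp add: tens_def)

lemma tens_add_cls: "\<lbrakk>xs \<in> FL; ys \<in> FL\<rbrakk> \<Longrightarrow> cls xs \<oplus>\<^bsub>T\<^esub> cls ys = cls (xs @ ys)"
  by (simp add: tens_def) (metis tclass_eqI tens_eq_append tens_sym trep_tclass)

lemma tens_smult_cls:
  "\<lbrakk>k \<in> carrier K; xs \<in> FL\<rbrakk> \<Longrightarrow> k \<odot>\<^bsub>T\<^esub> cls xs = cls (map (\<lambda>(v, w). (k \<odot>\<^bsub>V\<^esub> v, w)) xs)"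
  by (simp add: tens_def) (metis tclass_eqI tens_eq_smult tens_sym trep_tclass)

lemma smult_list_closed: "\<lbrakk>k \<in> carrier K; xs \<in> FL\<rbrakk> \<Longrightarrow> map (\<lambda>(v, w). (k \<odot>\<^bsub>V\<^esub> v, w)) xs \<in> FL"
  by (induction xs) auto

lemma tens_eq_smult_distr:
  assumes "a \<in> carrier K" "b \<in> carrier K" "xs \<in> FL"
  shows "tens_eq K V W (map (\<lambda>(v, w). ((a \<oplus>\<^bsub>K\<^esub> b) \<odot>\<^bsub>V\<^esub> v, w)) xs)
    (map (\<lambda>(v, w). (a \<odot>\<^bsub>V\<^esub> v, w)) xs @ map (\<lambda>(v, w). (b \<odot>\<^bsub>V\<^esub> v, w)) xs)"
  using assms(3)
proof (induction xs)
  case Nil then show ?case by (auto intro: tens_refl)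
next
  case (Cons p xs)
  obtain v w where p: "p = (v, w)" "v \<in> carrier V" "w \<in> carrier W" using Cons by auto
  let ?A = "map (\<lambda>(v, w). (a \<odot>\<^bsub>V\<^esub> v, w)) xs" and ?B = "map (\<lambda>(v, w). (b \<odot>\<^bsub>V\<^esub> v, w)) xs"
  have l: "?A \<in> FL" "?B \<in> FL" using Cons assms smult_list_closed by auto
  have "tens_eq K V W [((a \<oplus>\<^bsub>K\<^esub> b) \<odot>\<^bsub>V\<^esub> v, w)] [(a \<odot>\<^bsub>V\<^esub> v, w), (b \<odot>\<^bsub>V\<^esub> v, w)]"
    using p assms by (auto simp: V.smult_l_distr intro: tens_add_left)
  from tens_eq_append[OF this Cons.IH]
  have "tens_eq K V W (map (\<lambda>(v, w). ((a \<oplus>\<^bsub>K\<^esub> b) \<odot>\<^bsub>V\<^esub> v, w)) (p # xs))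
    ([(a \<odot>\<^bsub>V\<^esub> v, w)] @ (([(b \<odot>\<^bsub>V\<^esub> v, w)] @ ?A) @ ?B))"
    using p Cons by simp
  also have "tens_eq K V W \<dots> ([(a \<odot>\<^bsub>V\<^esub> v, w)] @ ((?A @ [(b \<odot>\<^bsub>V\<^esub> v, w)]) @ ?B))"
    using p assms l by (intro tens_eq_append tens_commute tens_refl) auto
  finally show ?case using p by simp
qed

text \<open>
The module laws hold already for lists of pairs, up to \<open>tens_eq\<close>. The negative of a class is its
multiple by \<open>-1\<close>, because \<open>((-1) + 1) v = 0\<close> in every entry.
\<close>

lemma module_tens: "module K T"
proof (rule moduleI)
  note [simp] = tens_add_cls tens_smult_cls tens_zero_cls
  note [simp] = smult_list_closed tclass_closed
  show "cring K" by (rule V.R.is_cring)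
  show "abelian_group T"
  proof (rule abelian_groupI)
    fix x y assume "x \<in> carrier T" "y \<in> carrier T"
    then show "x \<oplus>\<^bsub>T\<^esub> y \<in> carrier T" "x \<oplus>\<^bsub>T\<^esub> y = y \<oplus>\<^bsub>T\<^esub> x"
      by (auto elim!: tens_carrierE intro!: tclass_eqI[OF tens_commute])
  next
    show "\<zero>\<^bsub>T\<^esub> \<in> carrier T" by auto
  next
    fix x y z assume "x \<in> carrier T" "y \<in> carrier T" "z \<in> carrier T"
    then show "x \<oplus>\<^bsub>T\<^esub> y \<oplus>\<^bsub>T\<^esub> z = x \<oplus>\<^bsub>T\<^esub> (y \<oplus>\<^bsub>T\<^esub> z)" by (auto elim!: tens_carrierE)
  next
    fix x assume "x \<in> carrier T"
    then obtain xs where x: "xs \<in> FL" "x = cls xs" by (rule tens_carrierE)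
    then show "\<zero>\<^bsub>T\<^esub> \<oplus>\<^bsub>T\<^esub> x = x" by simp
    have "tens_eq K V W (map (\<lambda>(v, w). (\<zero>\<^bsub>K\<^esub> \<odot>\<^bsub>V\<^esub> v, w)) xs) []" using x(1)
    proof (induction xs)
      case (Cons p xs)
      then obtain v w where p: "p = (v, w)" "v \<in> carrier V" "w \<in> carrier W" by auto
      have "tens_eq K V W ([(\<zero>\<^bsub>K\<^esub> \<odot>\<^bsub>V\<^esub> v, w)] @ map (\<lambda>(v, w). (\<zero>\<^bsub>K\<^esub> \<odot>\<^bsub>V\<^esub> v, w)) xs) ([] @ [])"
        using Cons p by (intro tens_eq_append) (auto intro: tens_zero)
      then show ?case using p by simp
    qed (auto intro: tens_refl)
    moreover have "tens_eq K V W (map (\<lambda>(v, w). ((\<ominus>\<^bsub>K\<^esub> \<one>\<^bsub>K\<^esub> \<oplus>\<^bsub>K\<^esub> \<one>\<^bsub>K\<^esub>) \<odot>\<^bsub>V\<^esub> v, w)) xs)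
      (map (\<lambda>(v, w). ((\<ominus>\<^bsub>K\<^esub> \<one>\<^bsub>K\<^esub>) \<odot>\<^bsub>V\<^esub> v, w)) xs @ map (\<lambda>(v, w). (\<one>\<^bsub>K\<^esub> \<odot>\<^bsub>V\<^esub> v, w)) xs)"
      using x by (intro tens_eq_smult_distr) auto
    moreover have "map (\<lambda>(v, w). (\<one>\<^bsub>K\<^esub> \<odot>\<^bsub>V\<^esub> v, w)) xs = xs"
      using x(1) by (induction xs) auto
    ultimately have "tens_eq K V W (map (\<lambda>(v, w). ((\<ominus>\<^bsub>K\<^esub> \<one>\<^bsub>K\<^esub>) \<odot>\<^bsub>V\<^esub> v, w)) xs @ xs) []"
      using V.R.l_neg[OF V.R.one_closed] by (auto intro: tens_sym tens_trans)
    then have "cls (map (\<lambda>(v, w). ((\<ominus>\<^bsub>K\<^esub> \<one>\<^bsub>K\<^esub>) \<odot>\<^bsub>V\<^esub> v, w)) xs) \<oplus>\<^bsub>T\<^esub> x = \<zero>\<^bsub>T\<^esub>"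
      using x by (simp add: tclass_eqI)
    then show "\<exists>y\<in>carrier T. y \<oplus>\<^bsub>T\<^esub> x = \<zero>\<^bsub>T\<^esub>" using x by (metis smult_list_closed tclass_closed V.R.a_inv_closed V.R.one_closed)
  qed
next
  fix a x assume a: "a \<in> carrier K" and "x \<in> carrier T"
  then obtain xs where x: "xs \<in> FL" "x = cls xs" by (auto elim!: tens_carrierE)
  show "a \<odot>\<^bsub>T\<^esub> x \<in> carrier T"
    using a x by (simp add: tens_smult_cls smult_list_closed tclass_closed)
  {
    fix b assume b: "b \<in> carrier K"
    show "(a \<oplus>\<^bsub>K\<^esub> b) \<odot>\<^bsub>T\<^esub> x = a \<odot>\<^bsub>T\<^esub> x \<oplus>\<^bsub>T\<^esub> b \<odot>\<^bsub>T\<^esub> x"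
      using a b x
      by (auto simp: tens_smult_cls tens_add_cls smult_list_closed intro!: tclass_eqI tens_eq_smult_distr)
    have "map (\<lambda>(v, w). ((a \<otimes>\<^bsub>K\<^esub> b) \<odot>\<^bsub>V\<^esub> v, w)) xs
      = map (\<lambda>(v, w). (a \<odot>\<^bsub>V\<^esub> v, w)) (map (\<lambda>(v, w). (b \<odot>\<^bsub>V\<^esub> v, w)) xs)"
      using x(1) a b by (induction xs) (auto simp: V.smult_assoc1)
    from arg_cong[OF this, of cls] show "(a \<otimes>\<^bsub>K\<^esub> b) \<odot>\<^bsub>T\<^esub> x = a \<odot>\<^bsub>T\<^esub> (b \<odot>\<^bsub>T\<^esub> x)"
      using a b x by (simp add: tens_smult_cls smult_list_closed del: map_map)
  }
  {
    fix y assume "y \<in> carrier T"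
    then obtain ys where y: "ys \<in> FL" "y = cls ys" by (auto elim!: tens_carrierE)
    show "a \<odot>\<^bsub>T\<^esub> (x \<oplus>\<^bsub>T\<^esub> y) = a \<odot>\<^bsub>T\<^esub> x \<oplus>\<^bsub>T\<^esub> a \<odot>\<^bsub>T\<^esub> y"
      using a x y by (simp add: tens_smult_cls tens_add_cls smult_list_closed)
  }
next
  fix x assume "x \<in> carrier T"
  then obtain xs where x: "xs \<in> FL" "x = cls xs" by (auto elim!: tens_carrierE)
  have "map (\<lambda>(v, w). (\<one>\<^bsub>K\<^esub> \<odot>\<^bsub>V\<^esub> v, w)) xs = xs" using x(1) by (induction xs) auto
  then show "\<one>\<^bsub>K\<^esub> \<odot>\<^bsub>T\<^esub> x = x" using x by (simp add: tens_smult_cls)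
qed

lemma tsum_tclass: "\<lbrakk>bilin K V W U b; xs \<in> FL\<rbrakk> \<Longrightarrow> tsum U (cls xs) b = lsum U b xs"
  unfolding tsum_lsum by (rule lsum_tens_eq[symmetric], assumption, rule trep_tclass)

lemma tpure_closed: "\<lbrakk>v \<in> carrier V; w \<in> carrier W\<rbrakk> \<Longrightarrow> tpure K V W v w \<in> carrier T"
  by (auto simp: tpure_def intro: tclass_closed)

lemma bilin_tpure: "bilin K V W T (tpure K V W)"
proof (intro bilinI linI V W module_tens)
  fix k v w assume k: "k \<in> carrier K" and vw: "v \<in> carrier V" "w \<in> carrier W"
  show "tpure K V W (k \<odot>\<^bsub>V\<^esub> v) w = k \<odot>\<^bsub>T\<^esub> tpure K V W v w"
    using k vw by (simp add: tpure_def tens_smult_cls)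
  also have "\<dots> = tpure K V W v (k \<odot>\<^bsub>W\<^esub> w)"
    using k vw by (auto simp: tpure_def tens_smult_cls intro!: tclass_eqI tens_eq.tens_smult)
  finally show "tpure K V W v (k \<odot>\<^bsub>W\<^esub> w) = k \<odot>\<^bsub>T\<^esub> tpure K V W v w"
    using k vw by (simp add: tpure_def tens_smult_cls)
qed (auto simp: tpure_def tens_add_cls tclass_closed
      intro!: tclass_eqI tens_eq.tens_add_left tens_eq.tens_add_right)

lemma tsum_tpure: "\<lbrakk>bilin K V W U b; v \<in> carrier V; w \<in> carrier W\<rbrakk> \<Longrightarrow> tsum U (tpure K V W v w) b = b v w"
proof -
  assume b: "bilin K V W U b" and vw: "v \<in> carrier V" "w \<in> carrier W"
  interpret U: module K U by (rule bilinD(3)[OF b])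
  show ?thesis unfolding tpure_def using tsum_tclass[OF b, of "[(v,w)]"] bilinD(6)[OF b] vw by auto
qed

lemma lin_tsum: "bilin K V W U b \<Longrightarrow> lin K T U (\<lambda>z. tsum U z b)"
proof -
  assume b: "bilin K V W U b"
  note c = bilinD(6)[OF b]
  note ap = lsum_append[where b = b and A = "carrier V" and B = "carrier W", OF bilinD(3)[OF b], OF c]
    and cl = lsum_closed[where b = b and A = "carrier V" and B = "carrier W", OF bilinD(3)[OF b], OF c]
  interpret U: module K U by (rule bilinD(3)[OF b])
  have s: "lsum U b (map (\<lambda>(v, w). (k \<odot>\<^bsub>V\<^esub> v, w)) xs) = k \<odot>\<^bsub>U\<^esub> lsum U b xs"
    if "k \<in> carrier K" "xs \<in> FL" for k xs
    using that(2)
  proof (induction xs)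
    case (Cons p xs)
    then show ?case
      using c cl[of xs] that(1) linD(5)[OF bilinD(5)[OF b]] by (cases p) (auto simp: U.smult_r_distr)
  qed (use that in auto)
  show ?thesis
    by (rule linI, rule module_tens, rule bilinD(3)[OF b])
      (auto elim!: tens_carrierE simp: tens_add_cls tens_smult_cls tsum_tclass[OF b] s ap cl
        smult_list_closed)
qed

lemma tsum_closed:
  "\<lbrakk>z \<in> carrier T; module K U; \<And>v w. \<lbrakk>v \<in> carrier V; w \<in> carrier W\<rbrakk> \<Longrightarrow> b v w \<in> carrier U\<rbrakk>
    \<Longrightarrow> tsum U z b \<in> carrier U"
  unfolding tsum_lsum by (rule lsum_closed[OF _ _ trep_lists])

lemma tsum_cong:
  "\<lbrakk>z \<in> carrier T; \<And>v w. \<lbrakk>v \<in> carrier V; w \<in> carrier W\<rbrakk> \<Longrightarrow> b v w = b' v w\<rbrakk>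
    \<Longrightarrow> tsum U z b = tsum U z b'"
  unfolding tsum_lsum by (rule lsum_cong[OF _ trep_lists])

lemma tsum_lin:
  "\<lbrakk>lin K U U' f; z \<in> carrier T; \<And>v w. \<lbrakk>v \<in> carrier V; w \<in> carrier W\<rbrakk> \<Longrightarrow> b v w \<in> carrier U\<rbrakk>
    \<Longrightarrow> f (tsum U z b) = tsum U' z (\<lambda>v w. f (b v w))"
  unfolding tsum_lsum by (rule lsum_lin[OF _ _ trep_lists])

text \<open>
The zero tensor needs no case of its own, since it is the pure tensor of two zeros.
\<close>

lemma tens_induct:
  assumes z: "z \<in> carrier T" and p: "\<And>v w. \<lbrakk>v \<in> carrier V; w \<in> carrier W\<rbrakk> \<Longrightarrow> P (tpure K V W v w)"
    and a: "\<And>z z'. \<lbrakk>z \<in> carrier T; z' \<in> carrier T; P z; P z'\<rbrakk> \<Longrightarrow> P (z \<oplus>\<^bsub>T\<^esub> z')"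
  shows "P z"
proof -
  have "P (cls xs)" if "xs \<in> FL" for xs using that
  proof (induction xs)
    case Nil
    have "tpure K V W \<zero>\<^bsub>V\<^esub> \<zero>\<^bsub>W\<^esub> = cls []"
      by (auto simp: tpure_def intro: tclass_eqI tens_zero)
    then show ?case using p[OF V.zero_closed W.zero_closed] by simp
  next
    case (Cons q xs)
    then show ?case
      using a[OF tpure_closed tclass_closed, of "fst q" "snd q" xs] p
      by (cases q) (auto simp: tens_add_cls tpure_def)
  qed
  then show ?thesis using z by (auto elim!: tens_carrierE)
qed

lemma tens_ext:
  assumes "lin K T U f" "lin K T U g" "z \<in> carrier T"
    "\<And>v w. \<lbrakk>v \<in> carrier V; w \<in> carrier W\<rbrakk> \<Longrightarrow> f (tpure K V W v w) = g (tpure K V W v w)"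
  shows "f z = g z"
  using assms(3) by (rule tens_induct) (use assms linD in metis)+

lemma tsum_pure_self: "z \<in> carrier T \<Longrightarrow> tsum T z (tpure K V W) = z"
  by (rule tens_ext[OF lin_tsum[OF bilin_tpure] lin_id[OF module_tens]])
    (auto intro: tsum_tpure[OF bilin_tpure])

end

section \<open>Multilinear maps and Sweedler sums\<close>

text \<open>
Coassociativity and the law relating \<open>\<psi>\<close> to \<open>\<Delta>\<close> are equations in a threefold tensor product. In
Sweedler form they are statements about trilinear maps.
\<close>

definition trilin where
  "trilin K A B D U t \<longleftrightarrow> module K A \<and> module K B \<and> module K D \<and> module K U \<and>
    (\<forall>b\<in>carrier B. \<forall>d\<in>carrier D. lin K A U (\<lambda>a. t a b d)) \<and>
    (\<forall>a\<in>carrier A. \<forall>d\<in>carrier D. lin K B U (\<lambda>b. t a b d)) \<and>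
    (\<forall>a\<in>carrier A. \<forall>b\<in>carrier B. lin K D U (\<lambda>d. t a b d))"

lemma trilinI:
  assumes "module K A" "module K B" "module K D" "module K U"
    "\<And>b d. \<lbrakk>b \<in> carrier B; d \<in> carrier D\<rbrakk> \<Longrightarrow> lin K A U (\<lambda>a. t a b d)"
    "\<And>a d. \<lbrakk>a \<in> carrier A; d \<in> carrier D\<rbrakk> \<Longrightarrow> lin K B U (\<lambda>b. t a b d)"
    "\<And>a b. \<lbrakk>a \<in> carrier A; b \<in> carrier B\<rbrakk> \<Longrightarrow> lin K D U (\<lambda>d. t a b d)"
  shows "trilin K A B D U t"
  using assms by (auto simp: trilin_def)

lemma trilinD:
  assumes "trilin K A B D U t"
  shows "module K A" "module K B" "module K D" "module K U"
    "\<lbrakk>b \<in> carrier B; d \<in> carrier D\<rbrakk> \<Longrightarrow> lin K A U (\<lambda>a. t a b d)"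
    "\<lbrakk>a \<in> carrier A; d \<in> carrier D\<rbrakk> \<Longrightarrow> lin K B U (\<lambda>b. t a b d)"
    "\<lbrakk>a \<in> carrier A; b \<in> carrier B\<rbrakk> \<Longrightarrow> lin K D U (\<lambda>d. t a b d)"
    "\<lbrakk>a \<in> carrier A; b \<in> carrier B; d \<in> carrier D\<rbrakk> \<Longrightarrow> t a b d \<in> carrier U"
  using assms by (auto simp: trilin_def dest: linD)

text \<open>
The following rules repeat the facts about \<open>tsum\<close> with the membership of \<open>z\<close> in front. Solving
this premise first determines the two factors of the tensor product, so that the remaining
premises contain no unknown modules.
\<close>

lemma sum_cong:
  assumes "z \<in> carrier (tens K V W)" "module K V" "module K W"
    "\<And>v w. \<lbrakk>v \<in> carrier V; w \<in> carrier W\<rbrakk> \<Longrightarrow> b v w = b' v w"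
  shows "tsum U z b = tsum U z b'"
  using assms by (intro tsum_cong[of K V W])

lemma sum_closed:
  assumes "z \<in> carrier (tens K V W)" "module K V" "module K W" "module K U"
    "\<And>v w. \<lbrakk>v \<in> carrier V; w \<in> carrier W\<rbrakk> \<Longrightarrow> b v w \<in> carrier U"
  shows "tsum U z b \<in> carrier U"
  using assms by (intro tsum_closed[of K V W])

lemma lin_sum:
  assumes "z \<in> carrier (tens K V W)" "module K V" "module K W" "lin K U U' f"
    "\<And>v w. \<lbrakk>v \<in> carrier V; w \<in> carrier W\<rbrakk> \<Longrightarrow> b v w \<in> carrier U"
  shows "f (tsum U z b) = tsum U' z (\<lambda>v w. f (b v w))"
  using assms by (intro tsum_lin[of K V W])

lemma sum_sum:
  assumes "z \<in> carrier (tens K V W)" "module K V" "module K W" "bilin K A B U b'"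
    "\<And>v w. \<lbrakk>v \<in> carrier V; w \<in> carrier W\<rbrakk> \<Longrightarrow> b v w \<in> carrier (tens K A B)"
  shows "tsum U (tsum (tens K A B) z b) b' = tsum U z (\<lambda>v w. tsum U (b v w) b')"
proof -
  have "lin K (tens K A B) U (\<lambda>z. tsum U z b')"
    by (rule lin_tsum[OF _ _ assms(4)]) (use bilinD[OF assms(4)] in auto)
  from lin_sum[OF assms(1-3) this assms(5)] show ?thesis .
qed

lemma sum_tpure:
  assumes "bilin K V W U b" "v \<in> carrier V" "w \<in> carrier W"
  shows "tsum U (tpure K V W v w) b = b v w"
  using tsum_tpure[OF bilinD(1,2)[OF assms(1)] assms] .

text \<open>
Every step of a Sweedler computation has side conditions: some term belongs to a module, or depends
linearly on a variable. The rules \<open>ml\<close> (for multilinearity) are syntax directed: the head symbol of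
the term selects the rule, and of the two rules for \<open>tsum\<close> one applies when the variable occurs in
the tensor and the other when it occurs in the summand. The method \<open>(rule ml h | assumption)+\<close>,
where \<open>h\<close> collects the typing facts of the context, therefore solves these conditions.
\<close>

named_theorems ml

lemmas [ml] = lin_id bilinI trilinI module_tens sum_closed smult_closed_mod

lemma pure_closed [ml]:
  "\<lbrakk>module K V; module K W; v \<in> carrier V; w \<in> carrier W\<rbrakk> \<Longrightarrow> tpure K V W v w \<in> carrier (tens K V W)"
  by (rule tpure_closed)

lemma lin_tpure1 [ml]:
  "\<lbrakk>lin K U V f; module K W; w \<in> carrier W\<rbrakk> \<Longrightarrow> lin K U (tens K V W) (\<lambda>u. tpure K V W (f u) w)"
  by (rule lin_comp[OF bilinD(5)[OF bilin_tpure]]) (auto dest: linD)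

lemma lin_tpure2 [ml]:
  "\<lbrakk>lin K U W f; module K V; v \<in> carrier V\<rbrakk> \<Longrightarrow> lin K U (tens K V W) (\<lambda>u. tpure K V W v (f u))"
  by (rule lin_comp[OF bilinD(4)[OF bilin_tpure]]) (auto dest: linD)

lemma lin_tsum1 [ml]:
  "\<lbrakk>lin K U (tens K V W) f; bilin K V W U' b\<rbrakk> \<Longrightarrow> lin K U U' (\<lambda>u. tsum U' (f u) b)"
  by (rule lin_comp[OF lin_tsum]) (auto dest: bilinD)

lemma lin_tsum2 [ml]:
  assumes z: "z \<in> carrier (tens K V W)" and V: "module K V" and W: "module K W"
    and U: "module K U" and U': "module K U'"
    and b: "\<And>v w. \<lbrakk>v \<in> carrier V; w \<in> carrier W\<rbrakk> \<Longrightarrow> lin K U U' (\<lambda>u. b u v w)"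
  shows "lin K U U' (\<lambda>u. tsum U' z (b u))"
proof -
  have l: "trep z \<in> lists (carrier V \<times> carrier W)" by (rule trep_lists[OF V W z])
  have "lin K U U' (\<lambda>u. lsum U' (b u) xs)" if "xs \<in> lists (carrier V \<times> carrier W)" for xs
    using that
  proof (induction xs)
    case Nil then show ?case by (simp add: lin_const_zero[OF U U'])
  next
    case (Cons p xs)
    then obtain v w where [simp]: "p = (v, w)" and vw: "v \<in> carrier V" "w \<in> carrier W" by auto
    show ?case using lin_add[OF b[OF vw] Cons.IH] by simp
  qed
  from this[OF l] show ?thesis by (simp add: tsum_lsum)
qed

lemmas [ml] = lin_smult

lemma lin_into_sum: "\<lbrakk>z \<in> carrier (tens K V W); module K V; module K W\<rbrakk>
  \<Longrightarrow> tsum (tens K V W) z (\<lambda>v w. tpure K V W v w) = z"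
  using tsum_pure_self[of K V W z] by simp

lemma pure_ext:
  assumes "z \<in> carrier (tens K V W)" "lin K (tens K V W) U f" "lin K (tens K V W) U g"
    "module K V" "module K W"
    "\<And>v w. \<lbrakk>v \<in> carrier V; w \<in> carrier W\<rbrakk> \<Longrightarrow> f (tpure K V W v w) = g (tpure K V W v w)"
  shows "f z = g z"
  by (rule tens_ext[OF assms(4,5,2,3,1)]) (rule assms(6))

lemma sum_sum_pure:
  assumes "z \<in> carrier (tens K V W)" "module K V" "module K W" "bilin K A B U b"
    "\<And>v w. \<lbrakk>v \<in> carrier V; w \<in> carrier W\<rbrakk> \<Longrightarrow> p v w \<in> carrier A"
    "\<And>v w. \<lbrakk>v \<in> carrier V; w \<in> carrier W\<rbrakk> \<Longrightarrow> q v w \<in> carrier B"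
  shows "tsum U (tsum (tens K A B) z (\<lambda>v w. tpure K A B (p v w) (q v w))) b
    = tsum U z (\<lambda>v w. b (p v w) (q v w))"
proof -
  note h = assms(1-3,5,6) bilinD(1,2)[OF assms(4)]
  have "tsum U (tsum (tens K A B) z (\<lambda>v w. tpure K A B (p v w) (q v w))) b
    = tsum U z (\<lambda>v w. tsum U (tpure K A B (p v w) (q v w)) b)"
    by (rule sum_sum) (rule assms(4) | rule ml h | assumption)+
  also have "\<dots> = tsum U z (\<lambda>v w. b (p v w) (q v w))"
    by (rule sum_cong, (rule h | assumption)+, rule sum_tpure) (rule assms(4) h | assumption)+
  finally show ?thesis .
qed

lemma lin_restrict: "lin K V W f \<Longrightarrow> lin K V W (restrict f (carrier V))"
  by (subst lin_cong) auto

text \<open>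
Both sums run over finite lists, so this is commutativity of addition in \<open>U\<close>.
\<close>

lemma sum_swap:
  assumes z: "z \<in> carrier (tens K A B)" and A: "module K A" and B: "module K B"
    and y: "y \<in> carrier (tens K V W)" and V: "module K V" and W: "module K W" and U: "module K U"
    and t: "\<And>a b v w. \<lbrakk>a \<in> carrier A; b \<in> carrier B; v \<in> carrier V; w \<in> carrier W\<rbrakk> \<Longrightarrow> t a b v w \<in> carrier U"
  shows "tsum U z (\<lambda>a b. tsum U y (\<lambda>v w. t a b v w)) = tsum U y (\<lambda>v w. tsum U z (\<lambda>a b. t a b v w))"
proof -
  interpret U: module K U by (rule U)
  have ly: "trep y \<in> lists (carrier V \<times> carrier W)" by (rule trep_lists[OF V W y])
  have "lsum U (\<lambda>a b. lsum U (t a b) ys) zs = lsum U (\<lambda>v w. lsum U (\<lambda>a b. t a b v w) zs) ys"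
    if zs: "zs \<in> lists (carrier A \<times> carrier B)" and ys: "ys \<in> lists (carrier V \<times> carrier W)" for zs ys
    using zs
  proof (induction zs)
    case Nil
    have "lsum U (\<lambda>v w. \<zero>\<^bsub>U\<^esub>) ys = \<zero>\<^bsub>U\<^esub>" using ys by (induction ys) auto
    then show ?case by simp
  next
    case (Cons p zs)
    then obtain a b where p[simp]: "p = (a, b)" and ab: "a \<in> carrier A" "b \<in> carrier B" by auto
    have c: "lsum U (\<lambda>a b. t a b v w) zs \<in> carrier U" if "v \<in> carrier V" "w \<in> carrier W" for v w
      by (rule lsum_closed[OF U _ Cons.hyps(2)]) (use t that in auto)
    have "lsum U (\<lambda>v w. t a b v w \<oplus>\<^bsub>U\<^esub> lsum U (\<lambda>a b. t a b v w) zs) ys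
      = lsum U (t a b) ys \<oplus>\<^bsub>U\<^esub> lsum U (\<lambda>v w. lsum U (\<lambda>a b. t a b v w) zs) ys"
      using ys
    proof (induction ys)
      case (Cons q ys)
      then obtain v w where q[simp]: "q = (v, w)" and vw: "v \<in> carrier V" "w \<in> carrier W" by auto
      have "lsum U (t a b) ys \<in> carrier U" "lsum U (\<lambda>v w. lsum U (\<lambda>a b. t a b v w) zs) ys \<in> carrier U"
        by (rule lsum_closed[OF U _ Cons.hyps(2)]; use t ab c in auto)+
      then show ?case using Cons t[OF ab vw] c[OF vw] by (simp add: U.a_ac)
    qed auto
    then show ?case using Cons.IH Cons.hyps by simp
  qed
  from this[OF trep_lists[OF A B z] ly] show ?thesis by (simp add: tsum_lsum)
qed

section \<open>Coalgebras and comodules\<close>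

context coalgebra begin

text \<open>
The map \<open>id \<otimes> \<epsilon> : V \<otimes> C \<rightarrow> V\<close>.
\<close>

abbreviation "contract V z \<equiv> tsum V z (\<lambda>n c. counit C c \<odot>\<^bsub>V\<^esub> n)"

lemma mod_C [ml]: "module K C" by (rule module_axioms)

lemma lin_comul: "lin K C (tens K C C) (comul C)"
  by (rule Lin_lin[OF comul_Lin]) (rule ml)+

lemma lin_comul' [ml]: "lin K U C f \<Longrightarrow> lin K U (tens K C C) (\<lambda>u. comul C (f u))"
  by (rule lin_comp[OF lin_comul])

lemma comul_closed [ml]: "c \<in> carrier C \<Longrightarrow> comul C c \<in> carrier (tens K C C)"
  by (rule linD(3)[OF lin_comul])

lemma counit_cl [ml]: "c \<in> carrier C \<Longrightarrow> counit C c \<in> carrier K"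
  using counit_closed by auto

lemma lin_counit [ml]:
  assumes "lin K U C f" "module K W" "w \<in> carrier W"
  shows "lin K U W (\<lambda>u. counit C (f u) \<odot>\<^bsub>W\<^esub> w)"
proof -
  interpret W: module K W by fact
  note d = linD[OF assms(1)]
  show ?thesis
    by (rule linI)
      (use d assms counit_cl in \<open>auto simp: counit_add counit_smult W.smult_l_distr W.smult_assoc1\<close>)
qed

lemma comodule_mod: "comodule K C V \<rho> \<Longrightarrow> module K V"
  by (simp add: comodule_def)

lemma comodule_lin: "comodule K C V \<rho> \<Longrightarrow> lin K V (tens K V C) \<rho>"
  by (rule Lin_lin) (auto intro: comodule.coact_Lin ml comodule_mod)

text \<open>
With this, the Sweedler identities of comodules specialise to those of \<open>C\<close>.
\<close>

lemma comodule_comul: "comodule K C C (comul C)"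
  by unfold_locales (use comul_Lin coassoc counit_right in auto)

text \<open>
Coassociativity is an equation in \<open>V \<otimes> (C \<otimes> C)\<close>. Applying to both sides the linear map \<open>L\<close> that \<open>t\<close>
induces on this module gives the usual rule \<open>t(a\<^sub>0, a\<^sub>1, c) = t(a, c\<^sub>1, c\<^sub>2)\<close>. The remaining Sweedler
identities of this section and of the next one are obtained in the same way.
\<close>

lemma comodule_coassoc:
  assumes \<rho>: "comodule K C V \<rho>" and t: "trilin K V C C U t" and v: "v \<in> carrier V"
  shows "tsum U (\<rho> v) (\<lambda>a d. tsum U (\<rho> a) (\<lambda>a' b. t a' b d))
    = tsum U (\<rho> v) (\<lambda>a d. tsum U (comul C d) (\<lambda>b e. t a b e))"
proof -
  note h = comodule_mod[OF \<rho>] lin_comp[OF comodule_lin[OF \<rho>]] linD(3)[OF comodule_lin[OF \<rho>]]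
    trilinD(4-8)[OF t] v
  let ?T = "tens K V (tens K C C)"
  define L where "L = (\<lambda>z. tsum U z (\<lambda>a y. tsum U y (\<lambda>b d. t a b d)))"
  have L: "lin K ?T U L"
    unfolding L_def by (rule ml h | assumption)+
  have Lp: "L (tpure K V (tens K C C) a y) = tsum U y (\<lambda>b d. t a b d)"
    if "a \<in> carrier V" "y \<in> carrier (tens K C C)" for a y
    unfolding L_def by (subst sum_tpure) (rule ml h that refl | assumption)+
  have Lpp: "L (tpure K V (tens K C C) a (tpure K C C b d)) = t a b d"
    if "a \<in> carrier V" "b \<in> carrier C" "d \<in> carrier C" for a b d
    by (subst Lp, (rule ml h that | assumption)+, subst sum_tpure) (rule ml h that refl | assumption)+
  have "L (tsum ?T (\<rho> v) (\<lambda>a d. tsum ?T (\<rho> a) (\<lambda>a' b. tpure K V (tens K C C) a' (tpure K C C b d))))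
    = tsum U (\<rho> v) (\<lambda>a d. tsum U (\<rho> a) (\<lambda>a' b. t a' b d))" (is "?l = ?r")
  proof -
    have "?l = tsum U (\<rho> v) (\<lambda>a d. L (tsum ?T (\<rho> a) (\<lambda>a' b. tpure K V (tens K C C) a' (tpure K C C b d))))"
      by (rule lin_sum) (rule ml h L | assumption)+
    also have "\<dots> = tsum U (\<rho> v) (\<lambda>a d. tsum U (\<rho> a) (\<lambda>a' b. L (tpure K V (tens K C C) a' (tpure K C C b d))))"
      by (rule sum_cong, (rule ml h | assumption)+, rule lin_sum) (rule ml h L | assumption)+
    also have "\<dots> = ?r"
      by (rule sum_cong, (rule ml h | assumption)+, rule sum_cong, (rule ml h | assumption)+, rule Lpp)
    finally show ?thesis .
  qed
  moreover have "L (tsum ?T (\<rho> v) (\<lambda>a d. tpure K V (tens K C C) a (comul C d)))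
    = tsum U (\<rho> v) (\<lambda>a d. tsum U (comul C d) (\<lambda>b e. t a b e))" (is "?l = ?r")
  proof -
    have "?l = tsum U (\<rho> v) (\<lambda>a d. L (tpure K V (tens K C C) a (comul C d)))"
      by (rule lin_sum) (rule ml h L | assumption)+
    also have "\<dots> = ?r"
      by (rule sum_cong, (rule ml h | assumption)+, rule Lp) (rule ml h | assumption)+
    finally show ?thesis .
  qed
  ultimately show ?thesis using comodule.coact_coassoc[OF \<rho> v] by simp
qed

lemmas comul_coassoc = comodule_coassoc[OF comodule_comul]

lemma comodule_counit:
  assumes \<rho>: "comodule K C V \<rho>" and L: "lin K V U L" and v: "v \<in> carrier V"
  shows "tsum U (\<rho> v) (\<lambda>a c. counit C c \<odot>\<^bsub>U\<^esub> L a) = L v"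
proof -
  note h = comodule_mod[OF \<rho>] lin_comp[OF comodule_lin[OF \<rho>]] linD(3)[OF comodule_lin[OF \<rho>]] v
    linD(2,3)[OF L]
  have "L v = L (contract V (\<rho> v))"
    using comodule.coact_counit[OF \<rho> v] by simp
  also have "\<dots> = tsum U (\<rho> v) (\<lambda>a c. L (counit C c \<odot>\<^bsub>V\<^esub> a))"
    by (rule lin_sum) (rule ml h L | assumption)+
  also have "\<dots> = tsum U (\<rho> v) (\<lambda>a c. counit C c \<odot>\<^bsub>U\<^esub> L a)"
    by (rule sum_cong, (rule ml h | assumption)+, rule linD(5)[OF L]) (rule ml h | assumption)+
  finally show ?thesis by simp
qed

lemmas comul_counit_right = comodule_counit[OF comodule_comul]

lemma comul_counit_left:
  assumes L: "lin K C U L" and c: "c \<in> carrier C"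
  shows "tsum U (comul C c) (\<lambda>a b. counit C a \<odot>\<^bsub>U\<^esub> L b) = L c"
proof -
  note h = c linD(2,3)[OF L]
  have "L c = L (tsum C (comul C c) (\<lambda>a b. counit C a \<odot>\<^bsub>C\<^esub> b))"
    using counit_left[OF c] by simp
  also have "\<dots> = tsum U (comul C c) (\<lambda>a b. L (counit C a \<odot>\<^bsub>C\<^esub> b))"
    by (rule lin_sum) (rule ml h L | assumption)+
  also have "\<dots> = tsum U (comul C c) (\<lambda>a b. counit C a \<odot>\<^bsub>U\<^esub> L b)"
    by (rule sum_cong, (rule ml h | assumption)+, rule linD(5)[OF L]) (rule ml h | assumption)+
  finally show ?thesis by simp
qed

lemma colinear_sum:
  assumes "colinear K C V \<rho> W \<sigma> f" and \<rho>: "comodule K C V \<rho>" and W: "module K W"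
    and f: "lin K V W f" and b: "bilin K W C U b" and v: "v \<in> carrier V"
  shows "tsum U (\<sigma> (f v)) b = tsum U (\<rho> v) (\<lambda>a c. b (f a) c)"
proof -
  note h = comodule_mod[OF \<rho>] lin_comp[OF comodule_lin[OF \<rho>]] linD(3)[OF comodule_lin[OF \<rho>]] v
    linD(2,3)[OF f] b
  have "tsum U (\<sigma> (f v)) b = tsum U (tsum (tens K W C) (\<rho> v) (\<lambda>a c. tpure K W C (f a) c)) b"
    using assms(1) v by (simp add: colinear_def)
  also have "\<dots> = tsum U (\<rho> v) (\<lambda>a c. tsum U (tpure K W C (f a) c) b)"
    by (rule sum_sum) (rule ml h | assumption)+
  also have "\<dots> = tsum U (\<rho> v) (\<lambda>a c. b (f a) c)"
    by (rule sum_cong, (rule ml h | assumption)+, rule sum_tpure) (rule ml h | assumption)+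
  finally show ?thesis .
qed

end

section \<open>Entwining structures\<close>

text \<open>
An entwining structure together with the coalgebra axioms, which \<open>entwining\<close> does not include.
\<close>

locale entw_struct = coalgebra K C + entwining K C E
  for K :: "('k, 'r) ring_scheme" and C :: "('k, 'u::infinite) coalgebra"
    and E :: "('k, 'o, 'u) entw"
begin

lemma mod_homs [ml]: "\<lbrakk>r \<in> Ob E; s \<in> Ob E\<rbrakk> \<Longrightarrow> module K (homs E r s)"
  by (rule homs_module)

lemma lin_Cmp1 [ml]:
  assumes "lin K U (homs E s t) f" "r \<in> Ob E" "s \<in> Ob E" "t \<in> Ob E" "g \<in> carrier (homs E r s)"
  shows "lin K U (homs E r t) (\<lambda>u. Cmp E r s t (f u) g)"
  by (rule lin_comp[OF _ assms(1)], rule linI)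
    (use assms in \<open>auto simp: homs_carrier Cmp_closed Cmp_add_left Cmp_smult_left homs_module\<close>)

lemma lin_Cmp2 [ml]:
  assumes "lin K U (homs E r s) f" "r \<in> Ob E" "s \<in> Ob E" "t \<in> Ob E" "g \<in> carrier (homs E s t)"
  shows "lin K U (homs E r t) (\<lambda>u. Cmp E r s t g (f u))"
  by (rule lin_comp[OF _ assms(1)], rule linI)
    (use assms in \<open>auto simp: homs_carrier Cmp_closed Cmp_add_right Cmp_smult_right homs_module\<close>)

lemma Cmp_cl [ml]:
  "\<lbrakk>f \<in> carrier (homs E r s); g \<in> carrier (homs E s t); r \<in> Ob E; s \<in> Ob E; t \<in> Ob E\<rbrakk>
    \<Longrightarrow> Cmp E r s t g f \<in> carrier (homs E r t)"
  by (simp add: homs_carrier Cmp_closed)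

lemma Idt_cl [ml]: "r \<in> Ob E \<Longrightarrow> Idt E r \<in> carrier (homs E r r)"
  by (simp add: homs_carrier Idt_closed)

lemma lin_psi: "\<lbrakk>r \<in> Ob E; s \<in> Ob E\<rbrakk> \<Longrightarrow> lin K (tens K C (homs E r s)) (tens K (homs E r s) C) (psi E r s)"
  by (rule Lin_lin[OF psi_Lin]) (rule ml | assumption)+

lemma lin_psi' [ml]:
  "\<lbrakk>lin K U (tens K C (homs E r s)) f; r \<in> Ob E; s \<in> Ob E\<rbrakk>
    \<Longrightarrow> lin K U (tens K (homs E r s) C) (\<lambda>u. psi E r s (f u))"
  by (rule lin_comp[OF lin_psi])

lemma psi_cl [ml]:
  "\<lbrakk>z \<in> carrier (tens K C (homs E r s)); r \<in> Ob E; s \<in> Ob E\<rbrakk>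
    \<Longrightarrow> psi E r s z \<in> carrier (tens K (homs E r s) C)"
  by (rule linD(3)[OF lin_psi])

lemma psi_Cmp_sum:
  assumes r: "r \<in> Ob E" "s \<in> Ob E" "t \<in> Ob E" and f: "f \<in> carrier (homs E r s)"
    and g: "g \<in> carrier (homs E s t)" and c: "c \<in> carrier C" and b: "bilin K (homs E r t) C U b"
  shows "tsum U (entw_app K C E r t c (Cmp E r s t g f)) b
    = tsum U (entw_app K C E s t c g) (\<lambda>g' c'. tsum U (entw_app K C E r s c' f) (\<lambda>f' c''.
        b (Cmp E r s t g' f') c''))"
proof -
  note h = r f g c b
  let ?T = "tens K (homs E r t) C"
  have "tsum U (entw_app K C E r t c (Cmp E r s t g f)) b
    = tsum U (tsum ?T (entw_app K C E s t c g) (\<lambda>g' c'. tsum ?T (entw_app K C E r s c' f) (\<lambda>f' c''.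
        tpure K (homs E r t) C (Cmp E r s t g' f') c''))) b"
    using psi_Cmp[of r s t f g c] r f g c by (simp add: homs_carrier)
  also have "\<dots> = tsum U (entw_app K C E s t c g) (\<lambda>g' c'. tsum U (tsum ?T (entw_app K C E r s c' f) (\<lambda>f' c''.
        tpure K (homs E r t) C (Cmp E r s t g' f') c'')) b)"
    by (rule sum_sum) (rule ml h | assumption)+
  also have "\<dots> = tsum U (entw_app K C E s t c g) (\<lambda>g' c'. tsum U (entw_app K C E r s c' f) (\<lambda>f' c''.
        b (Cmp E r s t g' f') c''))"
    by (rule sum_cong, (rule ml h | assumption)+, rule sum_sum_pure) (rule ml h | assumption)+
  finally show ?thesis .
qed

lemma psi_counit_sum:
  assumes r: "r \<in> Ob E" "s \<in> Ob E" and f: "f \<in> carrier (homs E r s)"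
    and c: "c \<in> carrier C" and L: "lin K (homs E r s) U L"
  shows "tsum U (entw_app K C E r s c f) (\<lambda>f' c'. counit C c' \<odot>\<^bsub>U\<^esub> L f') = counit C c \<odot>\<^bsub>U\<^esub> L f"
proof -
  note h = r f c L linD(2,3)[OF L]
  have "counit C c \<odot>\<^bsub>U\<^esub> L f = L (counit C c \<odot>\<^bsub>homs E r s\<^esub> f)"
    by (rule linD(5)[OF L, symmetric]) (rule ml h)+
  also have "\<dots> = L (contract (homs E r s) (entw_app K C E r s c f))"
    using psi_counit[of r s f c] r f c by (simp add: homs_carrier)
  also have "\<dots> = tsum U (entw_app K C E r s c f) (\<lambda>f' c'. L (counit C c' \<odot>\<^bsub>homs E r s\<^esub> f'))"
    by (rule lin_sum) (rule ml h | assumption)+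
  also have "\<dots> = tsum U (entw_app K C E r s c f) (\<lambda>f' c'. counit C c' \<odot>\<^bsub>U\<^esub> L f')"
    by (rule sum_cong, (rule ml h | assumption)+, rule linD(5)[OF L]) (rule ml h | assumption)+
  finally show ?thesis by simp
qed

lemma psi_Idt_sum:
  assumes "r \<in> Ob E" "c \<in> carrier C" "bilin K (homs E r r) C U b"
  shows "tsum U (entw_app K C E r r c (Idt E r)) b = b (Idt E r) c"
  by (simp add: psi_Idt assms, rule sum_tpure) (rule ml assms)+

lemma psi_comul_sum:
  assumes r: "r \<in> Ob E" "s \<in> Ob E" and f: "f \<in> carrier (homs E r s)"
    and c: "c \<in> carrier C" and t: "trilin K (homs E r s) C C U t"
  shows "tsum U (entw_app K C E r s c f) (\<lambda>f' c'. tsum U (comul C c') (\<lambda>x y. t f' x y))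
    = tsum U (comul C c) (\<lambda>c1 c2. tsum U (entw_app K C E r s c2 f) (\<lambda>f' y.
        tsum U (entw_app K C E r s c1 f') (\<lambda>f'' x. t f'' x y)))"
proof -
  note h = r f c trilinD(4-8)[OF t]
  let ?H = "homs E r s" let ?T = "tens K ?H (tens K C C)"
  define L where "L = (\<lambda>z. tsum U z (\<lambda>a y. tsum U y (\<lambda>b d. t a b d)))"
  have L: "lin K ?T U L"
    unfolding L_def by (rule ml h | assumption)+
  have Lp: "L (tpure K ?H (tens K C C) a y) = tsum U y (\<lambda>b d. t a b d)"
    if "a \<in> carrier ?H" "y \<in> carrier (tens K C C)" for a y
    unfolding L_def by (subst sum_tpure) (rule ml h that refl | assumption)+
  have Lpp: "L (tpure K ?H (tens K C C) a (tpure K C C b d)) = t a b d"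
    if "a \<in> carrier ?H" "b \<in> carrier C" "d \<in> carrier C" for a b d
    by (subst Lp, (rule ml h that | assumption)+, subst sum_tpure) (rule ml h that refl | assumption)+
  have "L (tsum ?T (entw_app K C E r s c f) (\<lambda>f' c'. tpure K ?H (tens K C C) f' (comul C c')))
    = tsum U (entw_app K C E r s c f) (\<lambda>f' c'. tsum U (comul C c') (\<lambda>x y. t f' x y))" (is "?l = ?r")
  proof -
    have "?l = tsum U (entw_app K C E r s c f) (\<lambda>f' c'. L (tpure K ?H (tens K C C) f' (comul C c')))"
      by (rule lin_sum) (rule ml h L | assumption)+
    also have "\<dots> = ?r"
      by (rule sum_cong, (rule ml h | assumption)+, rule Lp) (rule ml h | assumption)+
    finally show ?thesis .
  qed
  moreover have "L (tsum ?T (comul C c) (\<lambda>c1 c2. tsum ?T (entw_app K C E r s c2 f) (\<lambda>f' c2'.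
      tsum ?T (entw_app K C E r s c1 f') (\<lambda>f'' c1'. tpure K ?H (tens K C C) f'' (tpure K C C c1' c2')))))
    = tsum U (comul C c) (\<lambda>c1 c2. tsum U (entw_app K C E r s c2 f) (\<lambda>f' y.
        tsum U (entw_app K C E r s c1 f') (\<lambda>f'' x. t f'' x y)))" (is "?l = ?r")
  proof -
    have "?l = tsum U (comul C c) (\<lambda>c1 c2. L (tsum ?T (entw_app K C E r s c2 f) (\<lambda>f' c2'.
      tsum ?T (entw_app K C E r s c1 f') (\<lambda>f'' c1'. tpure K ?H (tens K C C) f'' (tpure K C C c1' c2')))))"
      by (rule lin_sum) (rule ml h L | assumption)+
    also have "\<dots> = tsum U (comul C c) (\<lambda>c1 c2. tsum U (entw_app K C E r s c2 f) (\<lambda>f' c2'. L (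
      tsum ?T (entw_app K C E r s c1 f') (\<lambda>f'' c1'. tpure K ?H (tens K C C) f'' (tpure K C C c1' c2')))))"
      by (rule sum_cong, (rule ml h | assumption)+, rule lin_sum) (rule ml h L | assumption)+
    also have "\<dots> = tsum U (comul C c) (\<lambda>c1 c2. tsum U (entw_app K C E r s c2 f) (\<lambda>f' c2'.
      tsum U (entw_app K C E r s c1 f') (\<lambda>f'' c1'. L (tpure K ?H (tens K C C) f'' (tpure K C C c1' c2')))))"
      by (rule sum_cong, (rule ml h | assumption)+, rule sum_cong, (rule ml h | assumption)+, rule lin_sum)
        (rule ml h L | assumption)+
    also have "\<dots> = ?r"
      by (rule sum_cong, (rule ml h | assumption)+, rule sum_cong, (rule ml h | assumption)+,
          rule sum_cong, (rule ml h | assumption)+, rule Lpp)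
    finally show ?thesis .
  qed
  ultimately show ?thesis using psi_comul[of r s f c] r f c by (simp add: homs_carrier)
qed

section \<open>Modules and entwined modules\<close>

lemma rm_mod [ml]: "\<lbrakk>right_module K E N; r \<in> Ob E\<rbrakk> \<Longrightarrow> module K (space N r)"
  by (rule right_module.space_module)

lemma em_rm [ml]: "entwined_module K C E M \<Longrightarrow> right_module K E M"
  by (rule entwined_module.axioms(1))

lemma lin_act [ml]:
  assumes "lin K U (space N r) f" "right_module K E N" "s \<in> Ob E" "r \<in> Ob E" "g \<in> carrier (homs E s r)"
  shows "lin K U (space N s) (\<lambda>u. act N s r g (f u))"
  by (rule lin_comp[OF Lin_lin[OF right_module.act_Lin] assms(1)])
    (use assms in \<open>auto simp: homs_carrier intro: ml\<close>)

lemma lin_act2 [ml]: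
  assumes "lin K U (homs E s r) f" "right_module K E N" "s \<in> Ob E" "r \<in> Ob E" "m \<in> carrier (space N r)"
  shows "lin K U (space N s) (\<lambda>u. act N s r (f u) m)"
proof -
  have c: "act N s r g m \<in> carrier (space N s)" if "g \<in> carrier (homs E s r)" for g
    using right_module.act_Lin[OF assms(2-4), of g] that assms by (auto simp: homs_carrier Lin_def)
  show ?thesis
    by (rule lin_comp[OF _ assms(1)], rule linI)
      (use assms c in \<open>auto simp: homs_carrier right_module.act_add right_module.act_smult intro: ml\<close>)
qed

lemma act_cl [ml]:
  "\<lbrakk>right_module K E N; f \<in> carrier (homs E s r); m \<in> carrier (space N r); s \<in> Ob E; r \<in> Ob E\<rbrakk>
    \<Longrightarrow> act N s r f m \<in> carrier (space N s)"
  by (rule linD(3)[OF lin_act[OF lin_id]]) (rule ml | assumption)+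

lemma em_comodule: "\<lbrakk>entwined_module K C E M; r \<in> Ob E\<rbrakk> \<Longrightarrow> comodule K C (space M r) (coact M r)"
  by (rule entwined_module.space_comodule)

lemma lin_coact [ml]:
  "\<lbrakk>lin K U (space M r) f; entwined_module K C E M; r \<in> Ob E\<rbrakk>
    \<Longrightarrow> lin K U (tens K (space M r) C) (\<lambda>u. coact M r (f u))"
  by (rule lin_comp[OF comodule_lin[OF em_comodule]])

lemma coact_cl [ml]:
  "\<lbrakk>entwined_module K C E M; r \<in> Ob E; m \<in> carrier (space M r)\<rbrakk>
    \<Longrightarrow> coact M r m \<in> carrier (tens K (space M r) C)"
  by (rule linD(3)[OF comodule_lin[OF em_comodule]])

lemma coact_act_sum:
  assumes M: "entwined_module K C E M" and r: "s \<in> Ob E" "r \<in> Ob E"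
    and f: "f \<in> carrier (homs E s r)" and m: "m \<in> carrier (space M r)" and b: "bilin K (space M s) C U b"
  shows "tsum U (coact M s (act M s r f m)) b
    = tsum U (coact M r m) (\<lambda>m0 m1. tsum U (entw_app K C E s r m1 f) (\<lambda>f' c. b (act M s r f' m0) c))"
proof -
  note h = assms
  let ?T = "tens K (space M s) C"
  have "tsum U (coact M s (act M s r f m)) b
    = tsum U (tsum ?T (coact M r m) (\<lambda>m0 m1. tsum ?T (entw_app K C E s r m1 f) (\<lambda>f' c.
        tpure K (space M s) C (act M s r f' m0) c))) b"
    using entwined_module.coact_act[OF M r] f m r by (simp add: homs_carrier)
  also have "\<dots> = tsum U (coact M r m) (\<lambda>m0 m1. tsum U (tsum ?T (entw_app K C E s r m1 f) (\<lambda>f' c.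
        tpure K (space M s) C (act M s r f' m0) c)) b)"
    by (rule sum_sum) (rule ml h | assumption)+
  also have "\<dots> = tsum U (coact M r m) (\<lambda>m0 m1. tsum U (entw_app K C E s r m1 f) (\<lambda>f' c.
        b (act M s r f' m0) c))"
    by (rule sum_cong, (rule ml h | assumption)+, rule sum_sum_pure) (rule ml h | assumption)+
  finally show ?thesis .
qed

lemma hom_lin: "\<lbrakk>\<eta> \<in> rmod_hom K E M N; right_module K E M; right_module K E N; r \<in> Ob E\<rbrakk>
    \<Longrightarrow> lin K (space M r) (space N r) (\<eta> r)"
  by (rule Lin_lin) (auto simp: rmod_hom_def intro: ml)

lemma hom_act: "\<lbrakk>\<eta> \<in> rmod_hom K E M N; s \<in> Ob E; r \<in> Ob E; f \<in> carrier (homs E s r);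
    m \<in> carrier (space M r)\<rbrakk> \<Longrightarrow> \<eta> s (act M s r f m) = act N s r f (\<eta> r m)"
  by (auto simp: rmod_hom_def homs_carrier)

section \<open>The cofree entwined module\<close>

abbreviation "cof \<equiv> fobj (cofree K C E)"

context
  fixes N :: "('k, 'o, 'u) rmod"
  assumes N: "right_module K E N"
begin

lemma cof_space: "space (cof N) r = tens K (space N r) C"
  and cof_act: "act (cof N) s r f = (\<lambda>z\<in>carrier (tens K (space N r) C).
          tsum (tens K (space N s) C) z (\<lambda>n c.
            tsum (tens K (space N s) C) (entw_app K C E s r c f) (\<lambda>f' c'.
              tpure K (space N s) C (act N s r f' n) c')))"
  and cof_coact: "coact (cof N) r = (\<lambda>z\<in>carrier (tens K (space N r) C).
          tsum (tens K (tens K (space N r) C) C) z (\<lambda>n c.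
            tsum (tens K (tens K (space N r) C) C) (comul C c) (\<lambda>c1 c2.
              tpure K (tens K (space N r) C) C (tpure K (space N r) C n c1) c2)))"
  using N by (auto simp: cofree_def RMod_def)

lemma cof_act_pure:
  assumes "s \<in> Ob E" "r \<in> Ob E" "f \<in> carrier (homs E s r)" "n \<in> carrier (space N r)" "c \<in> carrier C"
  shows "act (cof N) s r f (tpure K (space N r) C n c)
    = tsum (tens K (space N s) C) (entw_app K C E s r c f) (\<lambda>f' c'.
              tpure K (space N s) C (act N s r f' n) c')"
proof -
  note h = assms N
  have "tpure K (space N r) C n c \<in> carrier (tens K (space N r) C)" by (rule ml h)+
  then show ?thesis
    by (simp add: cof_act, subst sum_tpure) (rule ml h refl | assumption)+
qed

lemma lin_cof_act:
  assumes "s \<in> Ob E" "r \<in> Ob E" "f \<in> carrier (homs E s r)"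
  shows "lin K (tens K (space N r) C) (tens K (space N s) C) (act (cof N) s r f)"
  unfolding cof_act by (subst Lin_restrict_iff[symmetric], (rule ml N assms)+, simp, subst Lin_restrict_iff)
    (rule ml N assms | assumption)+

lemma cof_act_sum:
  assumes "s \<in> Ob E" "r \<in> Ob E" "f \<in> carrier (homs E s r)" "n \<in> carrier (space N r)" "c \<in> carrier C"
    "bilin K (space N s) C U b"
  shows "tsum U (act (cof N) s r f (tpure K (space N r) C n c)) b
    = tsum U (entw_app K C E s r c f) (\<lambda>f' c'. b (act N s r f' n) c')"
  by (subst cof_act_pure, (rule assms)+, rule sum_sum_pure) (rule ml N assms | assumption)+

lemma cof_coact_pure:
  assumes "r \<in> Ob E" "n \<in> carrier (space N r)" "c \<in> carrier C"
  shows "coact (cof N) r (tpure K (space N r) C n c)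
    = tsum (tens K (tens K (space N r) C) C) (comul C c) (\<lambda>c1 c2.
              tpure K (tens K (space N r) C) C (tpure K (space N r) C n c1) c2)"
proof -
  note h = assms N
  have "tpure K (space N r) C n c \<in> carrier (tens K (space N r) C)" by (rule ml h)+
  then show ?thesis
    by (simp add: cof_coact, subst sum_tpure) (rule ml h refl | assumption)+
qed

lemma lin_cof_coact:
  assumes "r \<in> Ob E"
  shows "lin K (tens K (space N r) C) (tens K (tens K (space N r) C) C) (coact (cof N) r)"
  unfolding cof_coact by (subst Lin_restrict_iff[symmetric], (rule ml N assms)+, simp, subst Lin_restrict_iff)
    (rule ml N assms | assumption)+

lemma cof_coact_sum:
  assumes "r \<in> Ob E" "n \<in> carrier (space N r)" "c \<in> carrier C" "bilin K (tens K (space N r) C) C U b"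
  shows "tsum U (coact (cof N) r (tpure K (space N r) C n c)) b
    = tsum U (comul C c) (\<lambda>c1 c2. b (tpure K (space N r) C n c1) c2)"
  by (subst cof_coact_pure, (rule assms)+, rule sum_sum_pure) (rule ml N assms | assumption)+

end

text \<open>
The coaction \<open>id \<otimes> \<Delta>\<close> inherits its laws from the comultiplication; the action law and the
entwining law of \<open>N \<otimes> C\<close> below are the laws of \<open>\<psi>\<close> for composites and for the comultiplication.
\<close>

lemma cof_comodule:
  assumes N: "right_module K E N" and r: "r \<in> Ob E"
  shows "comodule K C (tens K (space N r) C) (coact (cof N) r)"
proof -
  let ?V = "space N r" let ?W = "tens K ?V C" let ?\<rho> = "coact (cof N) r" let ?C2 = "tens K C C"
  note l = lin_comp[OF lin_cof_coact[OF N r]] linD(3)[OF lin_cof_coact[OF N r]]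
  note h = N r l
  have W: "module K ?W" by (rule ml h)+
  show ?thesis
  proof (intro comodule.intro comodule_axioms.intro W)
    show "?\<rho> \<in> Lin K ?W (tens K ?W C)"
      by (rule LinI[OF lin_cof_coact[OF N r]]) (simp add: cof_coact[OF N])
  next
    fix z assume z: "z \<in> carrier ?W"
    let ?T = "tens K ?W ?C2"
    show "tsum ?T (?\<rho> z) (\<lambda>a d. tsum ?T (?\<rho> a) (\<lambda>a' b. tpure K ?W ?C2 a' (tpure K C C b d)))
      = tsum ?T (?\<rho> z) (\<lambda>a d. tpure K ?W ?C2 a (comul C d))"
    proof (rule pure_ext[OF z, where U = ?T])
      fix v c assume v: "v \<in> carrier ?V" and c: "c \<in> carrier C"
      note h = h v c
      let ?t = "\<lambda>x y w. tpure K ?W ?C2 (tpure K ?V C v x) (tpure K C C y w)"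
      have "tsum ?T (?\<rho> (tpure K ?V C v c)) (\<lambda>a d. tsum ?T (?\<rho> a) (\<lambda>a' b. tpure K ?W ?C2 a' (tpure K C C b d)))
        = tsum ?T (comul C c) (\<lambda>c1 c2. tsum ?T (?\<rho> (tpure K ?V C v c1)) (\<lambda>a' b. tpure K ?W ?C2 a' (tpure K C C b c2)))"
        by (rule cof_coact_sum[OF N r v c]) (rule ml h | assumption)+
      also have "\<dots> = tsum ?T (comul C c) (\<lambda>c1 c2. tsum ?T (comul C c1) (\<lambda>x y. ?t x y c2))"
        by (rule sum_cong, (rule ml h | assumption)+, rule cof_coact_sum[OF N r v]) (rule ml h | assumption)+
      also have "\<dots> = tsum ?T (comul C c) (\<lambda>x c2. tsum ?T (comul C c2) (\<lambda>y w. ?t x y w))"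
        by (rule comul_coassoc) (rule ml h | assumption)+
      also have "\<dots> = tsum ?T (comul C c) (\<lambda>x c2. tpure K ?W ?C2 (tpure K ?V C v x) (tsum ?C2 (comul C c2) (\<lambda>y w. tpure K C C y w)))"
        by (rule sum_cong, (rule ml h | assumption)+, rule lin_sum[symmetric, where f = "\<lambda>u. tpure K ?W ?C2 _ u"])
          (rule ml h | assumption)+
      also have "\<dots> = tsum ?T (comul C c) (\<lambda>x c2. tpure K ?W ?C2 (tpure K ?V C v x) (comul C c2))"
        by (rule sum_cong, (rule ml h | assumption)+, subst lin_into_sum) (rule ml h refl | assumption)+
      also have "\<dots> = tsum ?T (?\<rho> (tpure K ?V C v c)) (\<lambda>a d. tpure K ?W ?C2 a (comul C d))"
        by (rule cof_coact_sum[OF N r v c, symmetric]) (rule ml h | assumption)+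
      finally show "tsum ?T (?\<rho> (tpure K ?V C v c)) (\<lambda>a d. tsum ?T (?\<rho> a) (\<lambda>a' b. tpure K ?W ?C2 a' (tpure K C C b d)))
        = tsum ?T (?\<rho> (tpure K ?V C v c)) (\<lambda>a d. tpure K ?W ?C2 a (comul C d))" .
    qed (rule ml h | assumption)+
  next
    fix z assume z: "z \<in> carrier ?W"
    show "contract ?W (?\<rho> z) = z"
    proof (rule pure_ext[OF z, where U = ?W])
      fix v c assume v: "v \<in> carrier ?V" and c: "c \<in> carrier C"
      note h = h v c
      have "contract ?W (?\<rho> (tpure K ?V C v c))
        = tsum ?W (comul C c) (\<lambda>c1 c2. counit C c2 \<odot>\<^bsub>?W\<^esub> tpure K ?V C v c1)"
        by (rule cof_coact_sum[OF N r v c]) (rule ml h | assumption)+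
      also have "\<dots> = tpure K ?V C v c"
        by (rule comul_counit_right) (rule ml h | assumption)+
      finally show "contract ?W (?\<rho> (tpure K ?V C v c)) = tpure K ?V C v c" .
    qed (rule ml h | assumption)+
  qed
qed

lemma cof_rm:
  assumes N: "right_module K E N"
  shows "right_module K E (cof N)"
proof (rule right_module.intro)
  note sp = cof_space[OF N]
  fix r assume r: "r \<in> Ob E"
  show "module K (space (cof N) r)" unfolding sp by (rule ml N r)+
  {
    fix z assume z: "z \<in> carrier (space (cof N) r)"
    then have z': "z \<in> carrier (tens K (space N r) C)" by (simp add: sp)
    note l = lin_cof_act[OF N r r Idt_cl[OF r]]
    show "act (cof N) r r (Idt E r) z = z"
    proof (rule pure_ext[OF z' l])
      fix v c assume v: "v \<in> carrier (space N r)" and c: "c \<in> carrier C"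
      note h = N r v c
      have "act (cof N) r r (Idt E r) (tpure K (space N r) C v c)
        = tpure K (space N r) C (act N r r (Idt E r) v) c"
        by (subst cof_act_pure[OF N], (rule ml h)+, rule psi_Idt_sum) (rule ml h | assumption)+
      then show "act (cof N) r r (Idt E r) (tpure K (space N r) C v c) = tpure K (space N r) C v c"
        using right_module.act_Idt[OF N r v] by simp
    qed (rule ml N r)+
  }
  fix s assume s: "s \<in> Ob E"
  {
    fix f assume "f \<in> Mor E s r"
    then have f: "f \<in> carrier (homs E s r)" using r s by (simp add: homs_carrier)
    show "act (cof N) s r f \<in> Lin K (space (cof N) r) (space (cof N) s)"
      unfolding sp by (rule LinI[OF lin_cof_act[OF N s r f]]) (simp add: cof_act[OF N])
  }
  note h = N r s
  have l: "lin K (homs E s r) (tens K (space N s) C) (\<lambda>f. act (cof N) s r f z)"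
    if z: "z \<in> carrier (tens K (space N r) C)" for z
    using z unfolding cof_act[OF N] restrict_def by simp (rule ml h z | assumption)+
  {
    fix f g z assume "f \<in> Mor E s r" "g \<in> Mor E s r" "z \<in> carrier (space (cof N) r)"
    then show "act (cof N) s r (f \<oplus>\<^bsub>homs E s r\<^esub> g) z
      = act (cof N) s r f z \<oplus>\<^bsub>space (cof N) s\<^esub> act (cof N) s r g z"
      unfolding sp using linD(4)[OF l] r s by (simp add: homs_carrier)
  }
  {
    fix f k z assume "f \<in> Mor E s r" "k \<in> carrier K" "z \<in> carrier (space (cof N) r)"
    then show "act (cof N) s r (k \<odot>\<^bsub>homs E s r\<^esub> f) z
      = k \<odot>\<^bsub>space (cof N) s\<^esub> act (cof N) s r f z"
      unfolding sp using linD(5)[OF l] r s by (simp add: homs_carrier)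
  }
  fix t f g z assume t: "t \<in> Ob E" and "f \<in> Mor E t s" "g \<in> Mor E s r" "z \<in> carrier (space (cof N) r)"
  then have f: "f \<in> carrier (homs E t s)" and g: "g \<in> carrier (homs E s r)"
    and z: "z \<in> carrier (tens K (space N r) C)" using r s by (simp_all add: sp homs_carrier)
  let ?G = "tens K (space N t) C"
  note gf = Cmp_cl[OF f g t s r]
  note h = h t f g gf
  show "act (cof N) t r (Cmp E t s r g f) z = act (cof N) t s f (act (cof N) s r g z)"
  proof (rule pure_ext[OF z lin_cof_act[OF N t r gf] lin_comp[OF lin_cof_act[OF N t s f] lin_cof_act[OF N s r g]]])
    fix v c assume v: "v \<in> carrier (space N r)" and c: "c \<in> carrier C"
    note h = h v c
    have "act (cof N) t r (Cmp E t s r g f) (tpure K (space N r) C v c)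
      = tsum ?G (entw_app K C E t r c (Cmp E t s r g f)) (\<lambda>f' c'. tpure K (space N t) C (act N t r f' v) c')"
      by (rule cof_act_pure[OF N]) (rule ml h)+
    also have "\<dots> = tsum ?G (entw_app K C E s r c g) (\<lambda>g' c'. tsum ?G (entw_app K C E t s c' f) (\<lambda>f' c''.
        tpure K (space N t) C (act N t r (Cmp E t s r g' f') v) c''))"
      by (rule psi_Cmp_sum) (rule ml h | assumption)+
    also have "\<dots> = tsum ?G (entw_app K C E s r c g) (\<lambda>g' c'. tsum ?G (entw_app K C E t s c' f) (\<lambda>f' c''.
        tpure K (space N t) C (act N t s f' (act N s r g' v)) c''))"
      by (rule sum_cong, (rule ml h | assumption)+, rule sum_cong, (rule ml h | assumption)+)
        (use h in \<open>simp add: right_module.act_Cmp[OF N] homs_carrier\<close>)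
    also have "\<dots> = tsum ?G (entw_app K C E s r c g) (\<lambda>g' c'. act (cof N) t s f (tpure K (space N s) C (act N s r g' v) c'))"
      by (rule sum_cong, (rule ml h | assumption)+, rule cof_act_pure[OF N, symmetric]) (rule ml h | assumption)+
    also have "\<dots> = act (cof N) t s f (tsum (tens K (space N s) C) (entw_app K C E s r c g) (\<lambda>g' c'. tpure K (space N s) C (act N s r g' v) c'))"
      by (rule lin_sum[OF _ _ _ lin_cof_act[OF N t s f], symmetric]) (rule ml h | assumption)+
    also have "\<dots> = act (cof N) t s f (act (cof N) s r g (tpure K (space N r) C v c))"
      by (subst cof_act_pure[OF N s r g]) (rule ml h refl)+
    finally show "act (cof N) t r (Cmp E t s r g f) (tpure K (space N r) C v c)
      = act (cof N) t s f (act (cof N) s r g (tpure K (space N r) C v c))" .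
  qed (rule ml h)+
qed

lemma cof_em:
  assumes N: "right_module K E N"
  shows "entwined_module K C E (cof N)"
proof (intro entwined_module.intro entwined_module_axioms.intro cof_rm[OF N])
  note sp = cof_space[OF N]
  fix r assume r: "r \<in> Ob E"
  show "comodule K C (space (cof N) r) (coact (cof N) r)"
    unfolding sp by (rule cof_comodule[OF N r])
  fix s f z assume s: "s \<in> Ob E" and "f \<in> Mor E s r" and "z \<in> carrier (space (cof N) r)"
  then have f: "f \<in> carrier (homs E s r)" and z: "z \<in> carrier (tens K (space N r) C)"
    using r by (simp_all add: sp homs_carrier)
  let ?G = "tens K (space N s) C" let ?T = "tens K ?G C"
  have ca: "act (cof N) s r f x \<in> carrier ?G" if "f \<in> carrier (homs E s r)" "x \<in> carrier (tens K (space N r) C)" for f x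
    by (rule linD(3)[OF lin_cof_act[OF N s r that(1)] that(2)])
  have lf: "lin K (homs E s r) ?G (\<lambda>f. act (cof N) s r f x)" if x: "x \<in> carrier (tens K (space N r) C)" for x
    using x unfolding cof_act[OF N] restrict_def by simp (rule ml N r s x | assumption)+
  note h = N r s f lin_comp[OF lin_cof_act[OF N s r]] ca lin_comp[OF lf]
    lin_comp[OF lin_cof_coact[OF N]] linD(3)[OF lin_cof_coact[OF N]]
  show "coact (cof N) s (act (cof N) s r f z)
    = tsum (tens K (space (cof N) s) C) (coact (cof N) r z) (\<lambda>m0 m1.
        tsum (tens K (space (cof N) s) C) (entw_app K C E s r m1 f) (\<lambda>f' c.
          tpure K (space (cof N) s) C (act (cof N) s r f' m0) c))"
    unfolding sp
  proof (rule pure_ext[OF z, where U = ?T])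
    fix v c assume v: "v \<in> carrier (space N r)" and c: "c \<in> carrier C"
    note h = h v c
    have "coact (cof N) s (act (cof N) s r f (tpure K (space N r) C v c))
      = coact (cof N) s (tsum ?G (entw_app K C E s r c f) (\<lambda>f' c'. tpure K (space N s) C (act N s r f' v) c'))"
      by (subst cof_act_pure[OF N s r f]) (rule ml h refl)+
    also have "\<dots> = tsum ?T (entw_app K C E s r c f) (\<lambda>f' c'. coact (cof N) s (tpure K (space N s) C (act N s r f' v) c'))"
      by (rule lin_sum[OF _ _ _ lin_cof_coact[OF N s]]) (rule ml h | assumption)+
    also have "\<dots> = tsum ?T (entw_app K C E s r c f) (\<lambda>f' c'. tsum ?T (comul C c') (\<lambda>x y.
        tpure K ?G C (tpure K (space N s) C (act N s r f' v) x) y))"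
      by (rule sum_cong, (rule ml h | assumption)+, rule cof_coact_pure[OF N s]) (rule ml h | assumption)+
    also have "\<dots> = tsum ?T (comul C c) (\<lambda>c1 c2. tsum ?T (entw_app K C E s r c2 f) (\<lambda>f' y.
        tsum ?T (entw_app K C E s r c1 f') (\<lambda>f'' x. tpure K ?G C (tpure K (space N s) C (act N s r f'' v) x) y)))"
      by (rule psi_comul_sum) (rule ml h | assumption)+
    also have "\<dots> = tsum ?T (comul C c) (\<lambda>c1 c2. tsum ?T (entw_app K C E s r c2 f) (\<lambda>f' y.
        tpure K ?G C (tsum ?G (entw_app K C E s r c1 f') (\<lambda>f'' x. tpure K (space N s) C (act N s r f'' v) x)) y))"
      by (rule sum_cong, (rule ml h | assumption)+, rule sum_cong, (rule ml h | assumption)+,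
          rule lin_sum[symmetric, where f = "\<lambda>u. tpure K ?G C u _"]) (rule ml h | assumption)+
    also have "\<dots> = tsum ?T (comul C c) (\<lambda>c1 c2. tsum ?T (entw_app K C E s r c2 f) (\<lambda>f' y.
        tpure K ?G C (act (cof N) s r f' (tpure K (space N r) C v c1)) y))"
      by (rule sum_cong, (rule ml h | assumption)+, rule sum_cong, (rule ml h | assumption)+,
          subst cof_act_pure[OF N]) (rule ml h refl | assumption)+
    also have "\<dots> = tsum ?T (coact (cof N) r (tpure K (space N r) C v c)) (\<lambda>m0 m1.
        tsum ?T (entw_app K C E s r m1 f) (\<lambda>f' c. tpure K ?G C (act (cof N) s r f' m0) c))"
      by (rule cof_coact_sum[OF N r v c, symmetric]) (rule ml h | assumption)+
    finally show "coact (cof N) s (act (cof N) s r f (tpure K (space N r) C v c))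
      = tsum ?T (coact (cof N) r (tpure K (space N r) C v c)) (\<lambda>m0 m1.
        tsum ?T (entw_app K C E s r m1 f) (\<lambda>f' c. tpure K ?G C (act (cof N) s r f' m0) c))" .
  qed (rule ml h | assumption)+
qed

end

section \<open>Categories of modules and entwined modules\<close>

text \<open>
Composites in the module categories have this form, so naturality squares become equations
between elements.
\<close>

lemma restrict_compose_eq_iff:
  "(\<lambda>r\<in>I. compose (A r) (f r) (g r)) = (\<lambda>r\<in>I. compose (A r) (f' r) (g' r))
    \<longleftrightarrow> (\<forall>r\<in>I. \<forall>a\<in>A r. f r (g r a) = f' r (g' r a))"
proof
  assume e: "(\<lambda>r\<in>I. compose (A r) (f r) (g r)) = (\<lambda>r\<in>I. compose (A r) (f' r) (g' r))"
  show "\<forall>r\<in>I. \<forall>a\<in>A r. f r (g r a) = f' r (g' r a)"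
  proof (intro ballI)
    fix r a assume "r \<in> I" "a \<in> A r"
    then show "f r (g r a) = f' r (g' r a)"
      using fun_cong[OF fun_cong[OF e, of r], of a] by (simp add: compose_def)
  qed
qed (auto simp: compose_def restrict_def fun_eq_iff)

lemma RMod_simps:
  "Ob (RMod K E) = {M. right_module K E M}" "Mor (RMod K E) = rmod_hom K E"
  "Cmp (RMod K E) M N P \<theta> \<eta> = (\<lambda>r\<in>Ob E. compose (carrier (space M r)) (\<theta> r) (\<eta> r))"
  "Idt (RMod K E) M = (\<lambda>r\<in>Ob E. \<lambda>m\<in>carrier (space M r). m)"
  by (simp_all add: RMod_def)

lemma EMod_simps:
  "Ob (EMod K C E) = {M. entwined_module K C E M}"
  "Mor (EMod K C E) M N = {\<eta> \<in> rmod_hom K E M N.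
       \<forall>r\<in>Ob E. colinear K C (space M r) (coact M r) (space N r) (coact N r) (\<eta> r)}"
  "Cmp (EMod K C E) M N P \<theta> \<eta> = (\<lambda>r\<in>Ob E. compose (carrier (space M r)) (\<theta> r) (\<eta> r))"
  "Idt (EMod K C E) M = (\<lambda>r\<in>Ob E. \<lambda>m\<in>carrier (space M r). m)"
  by (simp_all add: EMod_def)

lemma truncate_simps [simp]: "space (rmod.truncate M) = space M" "act (rmod.truncate M) = act M"
  by (simp_all add: rmod.truncate_def)

lemma right_module_truncate [simp]: "right_module K E (rmod.truncate M) = right_module K E M"
  by (simp add: right_module_def)

lemma rmod_hom_truncate [simp]: "rmod_hom K E (rmod.truncate M) (rmod.truncate N) = rmod_hom K E M N"
  by (simp add: rmod_hom_def)

text \<open>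
The representable right module \<open>h\<^sub>r = E(-, r)\<close>.
\<close>

definition hmod :: "('k, 'o, 'u) entw \<Rightarrow> 'o \<Rightarrow> ('k, 'o, 'u) rmod" where
  "hmod E r = \<lparr>space = (\<lambda>s. homs E s r), act = (\<lambda>t s f. \<lambda>g\<in>carrier (homs E s r). Cmp E t s r g f)\<rparr>"

lemma hmod_simps [simp]: "space (hmod E r) s = homs E s r"
  "g \<in> carrier (homs E s r) \<Longrightarrow> act (hmod E r) t s f g = Cmp E t s r g f"
  by (simp_all add: hmod_def)

text \<open>
The part of the space \<open>V\<^sub>1\<close> that concerns a single entwining structure: families of maps
\<open>\<theta>\<^sub>r : C \<otimes> C \<rightarrow> E(r, r)\<close> with conditions (i) and (ii).
\<close>

definition V_at ::
  "('k, 'r) ring_scheme \<Rightarrow> ('k, 'u::infinite) coalgebra \<Rightarrow> ('k, 'o, 'u) entw \<Rightarrow> ('o \<Rightarrow> 'u \<Rightarrow> 'u) set"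
where
  "V_at K C E =
    {\<theta> \<in> (\<Pi>\<^sub>E r\<in>Ob E. Lin K (tens K C C) (homs E r r)).
      (\<forall>r\<in>Ob E. \<forall>c\<in>carrier C. \<forall>d\<in>carrier C.
        tsum (tens K (homs E r r) C) (comul C d) (\<lambda>d1 d2. tpure K (homs E r r) C (\<theta> r (tpure K C C c d1)) d2)
        = tsum (tens K (homs E r r) C) (comul C c) (\<lambda>c1 c2. entw_app K C E r r c1 (\<theta> r (tpure K C C c2 d)))) \<and>
      (\<forall>s\<in>Ob E. \<forall>r\<in>Ob E. \<forall>f\<in>Mor E s r. \<forall>c\<in>carrier C. \<forall>d\<in>carrier C.
        Cmp E s r r (\<theta> r (tpure K C C c d)) f
        = tsum (homs E s r) (entw_app K C E s r d f) (\<lambda>f' d'.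
            tsum (homs E s r) (entw_app K C E s r c f') (\<lambda>f'' c'.
              Cmp E s s r f'' (\<theta> s (tpure K C C c' d')))))}"

text \<open>
The formula \<open>m \<otimes> c \<mapsto> m\<^sub>0 \<theta>\<^sub>r(m\<^sub>1 \<otimes> c)\<close>.
\<close>

definition nat_of ::
  "('k, 'r) ring_scheme \<Rightarrow> ('k, 'u::infinite) coalgebra \<Rightarrow> ('k, 'o, 'u) entw \<Rightarrow> ('o \<Rightarrow> 'u \<Rightarrow> 'u)
    \<Rightarrow> ('k, 'o, 'u) emod \<Rightarrow> 'o \<Rightarrow> 'u \<Rightarrow> 'u"
where
  "nat_of K C E \<theta> M = (\<lambda>r\<in>Ob E. \<lambda>z\<in>carrier (tens K (space M r) C).
     tsum (space M r) z (\<lambda>m c. tsum (space M r) (coact M r m) (\<lambda>a d. act M r r (\<theta> r (tpure K C C d c)) a)))"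

context entw_struct begin

lemma emod_hom_sum:
  assumes \<eta>: "\<eta> \<in> Mor (EMod K C E) M N" and M: "entwined_module K C E M" and N: "entwined_module K C E N"
    and r: "r \<in> Ob E" and b: "bilin K (space N r) C U b" and m: "m \<in> carrier (space M r)"
  shows "tsum U (coact N r (\<eta> r m)) b = tsum U (coact M r m) (\<lambda>a c. b (\<eta> r a) c)"
  by (rule colinear_sum[OF _ em_comodule[OF M r] _ _ b m])
    (use assms in \<open>auto simp: EMod_simps intro: ml hom_lin\<close>)

lemma emod_hom_lin:
  assumes "\<eta> \<in> Mor (EMod K C E) M N" "entwined_module K C E M" "entwined_module K C E N" "r \<in> Ob E"
  shows "lin K (space M r) (space N r) (\<eta> r)"
  by (rule hom_lin) (use assms in \<open>auto simp: EMod_simps intro: ml\<close>)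

lemma emod_hom_act:
  assumes "\<eta> \<in> Mor (EMod K C E) M N" "s \<in> Ob E" "r \<in> Ob E" "f \<in> carrier (homs E s r)"
    "m \<in> carrier (space M r)"
  shows "\<eta> s (act M s r f m) = act N s r f (\<eta> r m)"
  by (rule hom_act) (use assms in \<open>auto simp: EMod_simps\<close>)

lemma hmod_rm: assumes r: "r \<in> Ob E" shows "right_module K E (hmod E r)"
proof (rule right_module.intro)
  fix s t f assume s: "s \<in> Ob E" and t: "t \<in> Ob E" and "f \<in> Mor E t s"
  then have f: "f \<in> carrier (homs E t s)" by (simp add: homs_carrier)
  have l: "lin K (homs E s r) (homs E t r) (\<lambda>g. Cmp E t s r g f)" by (rule ml r s t f)+
  show "act (hmod E r) t s f \<in> Lin K (space (hmod E r) s) (space (hmod E r) t)"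
    using l r s t by (simp add: hmod_def Lin_restrict_iff homs_module)
qed (auto simp: homs_carrier r homs_module Cmp_closed hmod_def Cmp_add_right Cmp_smult_right
      Cmp_Idt_right Cmp_assoc)

abbreviation "cofm \<equiv> farr (cofree K C E)"

context
  fixes N N' :: "('k, 'o, 'u) rmod" and \<eta>
  assumes N: "right_module K E N" and N': "right_module K E N'" and \<eta>: "\<eta> \<in> rmod_hom K E N N'"
begin

lemma cofm_eq: "cofm N N' \<eta> = (\<lambda>r\<in>Ob E. \<lambda>z\<in>carrier (tens K (space N r) C).
         tsum (tens K (space N' r) C) z (\<lambda>n c. tpure K (space N' r) C (\<eta> r n) c))"
  using N N' \<eta> by (simp add: cofree_def RMod_simps)

lemma lin_cofm: "r \<in> Ob E \<Longrightarrow> lin K (tens K (space N r) C) (tens K (space N' r) C) (cofm N N' \<eta> r)"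
proof -
  assume r: "r \<in> Ob E"
  note h = N N' r lin_comp[OF hom_lin[OF \<eta> N N' r]] linD(3)[OF hom_lin[OF \<eta> N N' r]]
  show ?thesis
    unfolding cofm_eq using r
    by simp (rule lin_restrict, (rule ml h | assumption)+)
qed

lemma cofm_pure: "\<lbrakk>r \<in> Ob E; n \<in> carrier (space N r); c \<in> carrier C\<rbrakk>
  \<Longrightarrow> cofm N N' \<eta> r (tpure K (space N r) C n c) = tpure K (space N' r) C (\<eta> r n) c"
proof -
  assume r: "r \<in> Ob E" and n: "n \<in> carrier (space N r)" and c: "c \<in> carrier C"
  note h = N N' r n c lin_comp[OF hom_lin[OF \<eta> N N' r]] linD(3)[OF hom_lin[OF \<eta> N N' r]]
  have "tpure K (space N r) C n c \<in> carrier (tens K (space N r) C)" by (rule ml h)+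
  then show ?thesis unfolding cofm_eq using r
    by (simp, subst sum_tpure) (rule ml h refl | assumption)+
qed

lemma cofm_hom: "cofm N N' \<eta> \<in> Mor (EMod K C E) (cof N) (cof N')"
proof -
  note sp = cof_space[OF N] cof_space[OF N']
  note l = lin_cofm
  have "cofm N N' \<eta> \<in> rmod_hom K E (cof N) (cof N')"
    unfolding rmod_hom_def sp
  proof (intro CollectI conjI ballI)
    show "cofm N N' \<eta> \<in> (\<Pi>\<^sub>E r\<in>Ob E. Lin K (tens K (space N r) C) (tens K (space N' r) C))"
      by (rule PiE_I, rule LinI[OF l]) (auto simp: cofm_eq)
    fix s r f z assume s: "s \<in> Ob E" and r: "r \<in> Ob E" and "f \<in> Mor E s r"
      and z: "z \<in> carrier (tens K (space N r) C)"
    then have f: "f \<in> carrier (homs E s r)" by (simp add: homs_carrier)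
    show "cofm N N' \<eta> s (act (cof N) s r f z) = act (cof N') s r f (cofm N N' \<eta> r z)"
    proof (rule pure_ext[OF z lin_comp[OF l[OF s] lin_cof_act[OF N s r f]] lin_comp[OF lin_cof_act[OF N' s r f] l[OF r]]])
      fix n c assume n: "n \<in> carrier (space N r)" and c: "c \<in> carrier C"
      let ?T = "tens K (space N' s) C"
      note h = N N' r s f n c lin_comp[OF hom_lin[OF \<eta> N N']] linD(3)[OF hom_lin[OF \<eta> N N']]
      have "cofm N N' \<eta> s (act (cof N) s r f (tpure K (space N r) C n c))
        = cofm N N' \<eta> s (tsum (tens K (space N s) C) (entw_app K C E s r c f) (\<lambda>f' c'.
            tpure K (space N s) C (act N s r f' n) c'))"
        by (subst cof_act_pure[OF N s r f n c]) (rule refl)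
      also have "\<dots> = tsum ?T (entw_app K C E s r c f) (\<lambda>f' c'. cofm N N' \<eta> s
            (tpure K (space N s) C (act N s r f' n) c'))"
        by (rule lin_sum[OF _ _ _ l[OF s]]) (rule ml h | assumption)+
      also have "\<dots> = tsum ?T (entw_app K C E s r c f) (\<lambda>f' c'. 
            tpure K (space N' s) C (\<eta> s (act N s r f' n)) c')"
        by (rule sum_cong, (rule ml h | assumption)+, rule cofm_pure) (rule ml h | assumption)+
      also have "\<dots> = tsum ?T (entw_app K C E s r c f) (\<lambda>f' c'. 
            tpure K (space N' s) C (act N' s r f' (\<eta> r n)) c')"
        by (rule sum_cong, (rule ml h | assumption)+, subst hom_act[OF \<eta>]) (rule ml h refl | assumption)+
      also have "\<dots> = act (cof N') s r f (cofm N N' \<eta> r (tpure K (space N r) C n c))"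
        by (subst cofm_pure[OF r n c], subst cof_act_pure[OF N']) (rule ml h refl | assumption)+
      finally show "cofm N N' \<eta> s (act (cof N) s r f (tpure K (space N r) C n c))
        = act (cof N') s r f (cofm N N' \<eta> r (tpure K (space N r) C n c))" .
    qed (rule ml N r)+
  qed
  moreover have "colinear K C (space (cof N) r) (coact (cof N) r) (space (cof N') r) (coact (cof N') r) (cofm N N' \<eta> r)"
    if r: "r \<in> Ob E" for r
    unfolding colinear_def sp
  proof
    fix z assume z: "z \<in> carrier (tens K (space N r) C)"
    let ?T = "tens K (tens K (space N' r) C) C"
    note h = N N' r lin_comp[OF hom_lin[OF \<eta> N N']] linD(3)[OF hom_lin[OF \<eta> N N']]
      lin_comp[OF l[OF r]] linD(3)[OF l[OF r]] lin_comp[OF lin_cof_coact[OF N r]]  lin_comp[OF lin_cof_coact[OF N' r]]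
    show "tsum ?T (coact (cof N) r z) (\<lambda>a c. tpure K (tens K (space N' r) C) C (cofm N N' \<eta> r a) c)
      = coact (cof N') r (cofm N N' \<eta> r z)"
    proof (rule pure_ext[OF z, where U = ?T])
      fix n c assume n: "n \<in> carrier (space N r)" and c: "c \<in> carrier C"
      note h = h n c
      have "tsum ?T (coact (cof N) r (tpure K (space N r) C n c)) (\<lambda>a c. tpure K (tens K (space N' r) C) C (cofm N N' \<eta> r a) c)
        = tsum ?T (comul C c) (\<lambda>c1 c2. tpure K (tens K (space N' r) C) C (cofm N N' \<eta> r (tpure K (space N r) C n c1)) c2)"
        by (rule cof_coact_sum[OF N]) (rule ml h | assumption)+
      also have "\<dots> = tsum ?T (comul C c) (\<lambda>c1 c2. tpure K (tens K (space N' r) C) C (tpure K (space N' r) C (\<eta> r n) c1) c2)"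
        by (rule sum_cong, (rule ml h | assumption)+, subst cofm_pure) (rule ml h refl | assumption)+
      also have "\<dots> = coact (cof N') r (cofm N N' \<eta> r (tpure K (space N r) C n c))"
        by (subst cofm_pure[OF r n c], subst cof_coact_pure[OF N']) (rule ml h refl | assumption)+
      finally show "tsum ?T (coact (cof N) r (tpure K (space N r) C n c)) (\<lambda>a c. tpure K (tens K (space N' r) C) C (cofm N N' \<eta> r a) c)
        = coact (cof N') r (cofm N N' \<eta> r (tpure K (space N r) C n c))" .
    qed (rule ml h | assumption)+
  qed
  ultimately show ?thesis by (simp add: EMod_simps)
qed

end

section \<open>From families of maps to natural transformations\<close>

lemma theta_lin: "\<lbrakk>\<theta> \<in> V_at K C E; r \<in> Ob E\<rbrakk> \<Longrightarrow> lin K (tens K C C) (homs E r r) (\<theta> r)"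
  by (intro Lin_lin) (auto simp: V_at_def intro: ml)

context
  fixes \<theta> :: "'o \<Rightarrow> 'u \<Rightarrow> 'u" and M :: "('k, 'o, 'u) emod"
  assumes \<theta>: "\<theta> \<in> V_at K C E" and M: "entwined_module K C E M"
begin

lemmas theta_ml = lin_comp[OF theta_lin[OF \<theta>]] linD(3)[OF theta_lin[OF \<theta>]]

lemma lin_nat_of: "r \<in> Ob E \<Longrightarrow> lin K (tens K (space M r) C) (space M r) (nat_of K C E \<theta> M r)"
proof -
  assume r: "r \<in> Ob E"
  note h = M r theta_ml
  show ?thesis
    unfolding nat_of_def using r
    by simp (rule lin_restrict, (rule ml h | assumption)+)
qed

lemma nat_of_pure: "\<lbrakk>r \<in> Ob E; m \<in> carrier (space M r); c \<in> carrier C\<rbrakk>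
  \<Longrightarrow> nat_of K C E \<theta> M r (tpure K (space M r) C m c)
    = tsum (space M r) (coact M r m) (\<lambda>a d. act M r r (\<theta> r (tpure K C C d c)) a)"
proof -
  assume r: "r \<in> Ob E" and m: "m \<in> carrier (space M r)" and c: "c \<in> carrier C"
  note h = M r m c theta_ml
  have "tpure K (space M r) C m c \<in> carrier (tens K (space M r) C)" by (rule ml h)+
  then show ?thesis unfolding nat_of_def using r
    by (simp, subst sum_tpure) (rule ml h refl | assumption)+
qed

text \<open>
Moving \<open>f\<close> past the formula produces \<open>f\<^sub>\<psi>\<^sub>\<psi>\<close> composed with \<open>\<theta>\<^sub>s\<close>, twisted first by \<open>c\<close> and then by the
coaction of \<open>m\<close>; condition (ii) turns this into \<open>\<theta>\<^sub>r\<close> composed with \<open>f\<close>.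
\<close>

lemma nat_of_act:
  assumes r: "s \<in> Ob E" "r \<in> Ob E" and f: "f \<in> carrier (homs E s r)" and z: "z \<in> carrier (tens K (space M r) C)"
  shows "nat_of K C E \<theta> M s (act (cof (rmod.truncate M)) s r f z) = act M s r f (nat_of K C E \<theta> M r z)"
proof -
  have N: "right_module K E (rmod.truncate M)" using em_rm[OF M] by simp
  note cp = cof_act_pure[OF N r f, simplified] and cl = lin_cof_act[OF N r f, simplified]
  note h = M r f theta_ml
  show ?thesis
  proof (rule pure_ext[OF z lin_comp[OF lin_nat_of[OF r(1)] cl] lin_act[OF lin_nat_of[OF r(2)] em_rm[OF M] r f]])
    fix m c assume m: "m \<in> carrier (space M r)" and c: "c \<in> carrier C"
    note h = h m c
    let ?S = "space M s"
    have "nat_of K C E \<theta> M s (act (cof (rmod.truncate M)) s r f (tpure K (space M r) C m c))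
      = nat_of K C E \<theta> M s (tsum (tens K ?S C) (entw_app K C E s r c f) (\<lambda>f' c'. tpure K ?S C (act M s r f' m) c'))"
      by (subst cp) (rule h refl)+
    also have "\<dots> = tsum ?S (entw_app K C E s r c f) (\<lambda>f' c'. nat_of K C E \<theta> M s (tpure K ?S C (act M s r f' m) c'))"
      by (rule lin_sum[OF _ _ _ lin_nat_of[OF r(1)]]) (rule ml h | assumption)+
    also have "\<dots> = tsum ?S (entw_app K C E s r c f) (\<lambda>f' c'. tsum ?S (coact M s (act M s r f' m)) (\<lambda>a d.
        act M s s (\<theta> s (tpure K C C d c')) a))"
      by (rule sum_cong, (rule ml h | assumption)+, rule nat_of_pure) (rule ml h | assumption)+
    also have "\<dots> = tsum ?S (entw_app K C E s r c f) (\<lambda>f' c'. tsum ?S (coact M r m) (\<lambda>m0 m1.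
        tsum ?S (entw_app K C E s r m1 f') (\<lambda>f'' d. act M s s (\<theta> s (tpure K C C d c')) (act M s r f'' m0))))"
      by (rule sum_cong, (rule ml h | assumption)+, rule coact_act_sum) (rule ml h | assumption)+
    also have "\<dots> = tsum ?S (coact M r m) (\<lambda>m0 m1. tsum ?S (entw_app K C E s r c f) (\<lambda>f' c'.
        tsum ?S (entw_app K C E s r m1 f') (\<lambda>f'' d. act M s s (\<theta> s (tpure K C C d c')) (act M s r f'' m0))))"
      by (rule sum_swap) (rule ml h | assumption)+
    also have "\<dots> = tsum ?S (coact M r m) (\<lambda>m0 m1. tsum ?S (entw_app K C E s r c f) (\<lambda>f' c'.
        tsum ?S (entw_app K C E s r m1 f') (\<lambda>f'' d. act M s r (Cmp E s s r f'' (\<theta> s (tpure K C C d c'))) m0)))"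
      apply (rule sum_cong, (rule ml h | assumption)+, rule sum_cong, (rule ml h | assumption)+,
          rule sum_cong, (rule ml h | assumption)+)
      by (rule right_module.act_Cmp[OF em_rm[OF M], symmetric]; (subst homs_carrier[symmetric])?)
        (rule ml h refl | assumption)+
    also have "\<dots> = tsum ?S (coact M r m) (\<lambda>m0 m1. act M s r (tsum (homs E s r) (entw_app K C E s r c f) (\<lambda>f' c'.
        tsum (homs E s r) (entw_app K C E s r m1 f') (\<lambda>f'' d. Cmp E s s r f'' (\<theta> s (tpure K C C d c'))))) m0)"
    proof (rule sum_cong, (rule ml h | assumption)+)
      fix m0 m1 assume m0: "m0 \<in> carrier (space M r)" and m1: "m1 \<in> carrier C"
      have L: "lin K (homs E s r) ?S (\<lambda>g. act M s r g m0)" by (rule ml h m0)+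
      show "tsum ?S (entw_app K C E s r c f) (\<lambda>f' c'. tsum ?S (entw_app K C E s r m1 f') (\<lambda>f'' d.
          act M s r (Cmp E s s r f'' (\<theta> s (tpure K C C d c'))) m0))
        = act M s r (tsum (homs E s r) (entw_app K C E s r c f) (\<lambda>f' c'.
          tsum (homs E s r) (entw_app K C E s r m1 f') (\<lambda>f'' d. Cmp E s s r f'' (\<theta> s (tpure K C C d c'))))) m0"
        apply (subst lin_sum[OF _ _ _ L], (rule ml h m1 | assumption)+)
        apply (rule sum_cong, (rule ml h m1 | assumption)+)
        by (subst lin_sum[OF _ _ _ L]) (rule ml h m1 refl | assumption)+
    qed
    also have "\<dots> = tsum ?S (coact M r m) (\<lambda>m0 m1. act M s r (Cmp E s r r (\<theta> r (tpure K C C m1 c)) f) m0)"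
      by (rule sum_cong, (rule ml h | assumption)+) (use \<theta> r f c in \<open>simp add: V_at_def homs_carrier\<close>)
    also have "\<dots> = tsum ?S (coact M r m) (\<lambda>m0 m1. act M s r f (act M r r (\<theta> r (tpure K C C m1 c)) m0))"
      apply (rule sum_cong, (rule ml h | assumption)+)
      by (rule right_module.act_Cmp[OF em_rm[OF M]]; (subst homs_carrier[symmetric])?)
        (rule ml h refl | assumption)+
    also have "\<dots> = act M s r f (tsum (space M r) (coact M r m) (\<lambda>m0 m1. act M r r (\<theta> r (tpure K C C m1 c)) m0))"
      by (rule lin_sum[symmetric, where f = "act M s r f"]) (rule ml h | assumption)+
    also have "\<dots> = act M s r f (nat_of K C E \<theta> M r (tpure K (space M r) C m c))"
      by (subst nat_of_pure) (rule h refl)+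
    finally show "nat_of K C E \<theta> M s (act (cof (rmod.truncate M)) s r f (tpure K (space M r) C m c))
      = act M s r f (nat_of K C E \<theta> M r (tpure K (space M r) C m c))" .
  qed (rule ml h)+
qed

text \<open>
The coaction of \<open>m\<^sub>0 \<theta>\<^sub>r(m\<^sub>1 \<otimes> c)\<close> is \<open>m\<^sub>0 \<theta>\<^sub>r(m\<^sub>2 \<otimes> c)\<^sub>\<psi> \<otimes> m\<^sub>1\<^sup>\<psi>\<close>, by the entwining law and
coassociativity; condition (i) identifies this with \<open>m\<^sub>0 \<theta>\<^sub>r(m\<^sub>1 \<otimes> c\<^sub>1) \<otimes> c\<^sub>2\<close>.
\<close>

lemma nat_of_colinear:
  assumes r: "r \<in> Ob E"
  shows "colinear K C (tens K (space M r) C) (coact (cof (rmod.truncate M)) r) (space M r) (coact M r)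
    (nat_of K C E \<theta> M r)"
  unfolding colinear_def
proof
  have N: "right_module K E (rmod.truncate M)" using em_rm[OF M] by simp
  note l = lin_nat_of[OF r]
  note cl = lin_cof_coact[OF N r, simplified]
  note h = M r theta_ml lin_comp[OF l] linD(3)[OF l] lin_comp[OF cl]
  fix z assume z: "z \<in> carrier (tens K (space M r) C)"
  let ?S = "space M r" let ?T = "tens K ?S C" let ?n = "nat_of K C E \<theta> M r"
  show "tsum ?T (coact (cof (rmod.truncate M)) r z) (\<lambda>a c. tpure K ?S C (?n a) c) = coact M r (?n z)"
  proof (rule pure_ext[OF z, where U = ?T])
    fix m c assume m: "m \<in> carrier (space M r)" and c: "c \<in> carrier C"
    note h = h m c
    have "tsum ?T (coact (cof (rmod.truncate M)) r (tpure K ?S C m c)) (\<lambda>a c. tpure K ?S C (?n a) c)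
      = tsum ?T (comul C c) (\<lambda>c1 c2. tpure K ?S C (?n (tpure K ?S C m c1)) c2)"
      by (rule cof_coact_sum[OF N, simplified]) (rule ml h | assumption)+
    also have "\<dots> = tsum ?T (comul C c) (\<lambda>c1 c2. tpure K ?S C
        (tsum ?S (coact M r m) (\<lambda>a d. act M r r (\<theta> r (tpure K C C d c1)) a)) c2)"
      by (rule sum_cong, (rule ml h | assumption)+, subst nat_of_pure) (rule ml h refl | assumption)+
    also have "\<dots> = tsum ?T (comul C c) (\<lambda>c1 c2. tsum ?T (coact M r m) (\<lambda>a d. tpure K ?S C
        (act M r r (\<theta> r (tpure K C C d c1)) a) c2))"
      by (rule sum_cong, (rule ml h | assumption)+, rule lin_sum[where f = "\<lambda>u. tpure K ?S C u _"])
        (rule ml h refl | assumption)+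
    also have "\<dots> = tsum ?T (coact M r m) (\<lambda>a d. tsum ?T (comul C c) (\<lambda>c1 c2. tpure K ?S C
        (act M r r (\<theta> r (tpure K C C d c1)) a) c2))"
      by (rule sum_swap) (rule ml h | assumption)+
    also have "\<dots> = tsum ?T (coact M r m) (\<lambda>a d. tsum ?T (comul C d) (\<lambda>d1 d2.
        tsum ?T (entw_app K C E r r d1 (\<theta> r (tpure K C C d2 c))) (\<lambda>f' c'. tpure K ?S C (act M r r f' a) c')))"
    proof (rule sum_cong, (rule ml h | assumption)+)
      fix a d assume a: "a \<in> carrier ?S" and d: "d \<in> carrier C"
      let ?b = "\<lambda>f' c'. tpure K ?S C (act M r r f' a) c'"
      let ?H = "tens K (homs E r r) C"
      note h = h a d
      have "tsum ?T (comul C c) (\<lambda>c1 c2. ?b (\<theta> r (tpure K C C d c1)) c2)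
        = tsum ?T (tsum ?H (comul C c) (\<lambda>c1 c2. tpure K (homs E r r) C (\<theta> r (tpure K C C d c1)) c2)) ?b"
        by (rule sum_sum_pure[symmetric]) (rule ml h | assumption)+
      also have "\<dots> = tsum ?T (tsum ?H (comul C d) (\<lambda>d1 d2. entw_app K C E r r d1 (\<theta> r (tpure K C C d2 c)))) ?b"
        using \<theta> r c d by (simp add: V_at_def)
      also have "\<dots> = tsum ?T (comul C d) (\<lambda>d1 d2. tsum ?T (entw_app K C E r r d1 (\<theta> r (tpure K C C d2 c))) ?b)"
        by (rule sum_sum) (rule ml h | assumption)+
      finally show "tsum ?T (comul C c) (\<lambda>c1 c2. ?b (\<theta> r (tpure K C C d c1)) c2)
        = tsum ?T (comul C d) (\<lambda>d1 d2. tsum ?T (entw_app K C E r r d1 (\<theta> r (tpure K C C d2 c))) ?b)" .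
    qed
    also have "\<dots> = tsum ?T (coact M r m) (\<lambda>a d. tsum ?T (coact M r a) (\<lambda>m0 m1.
        tsum ?T (entw_app K C E r r m1 (\<theta> r (tpure K C C d c))) (\<lambda>f' c'. tpure K ?S C (act M r r f' m0) c')))"
      by (rule comodule_coassoc[OF em_comodule[OF M r], symmetric]) (rule ml h | assumption)+
    also have "\<dots> = tsum ?T (coact M r m) (\<lambda>a d. coact M r (act M r r (\<theta> r (tpure K C C d c)) a))"
      by (rule sum_cong, (rule ml h | assumption)+,
          rule entwined_module.coact_act[OF M, symmetric]; (subst homs_carrier[symmetric])?) (rule ml h refl | assumption)+
    also have "\<dots> = coact M r (tsum ?S (coact M r m) (\<lambda>a d. act M r r (\<theta> r (tpure K C C d c)) a))"
      by (rule lin_sum[symmetric, where f = "coact M r"]) (rule ml h | assumption)+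
    also have "\<dots> = coact M r (?n (tpure K ?S C m c))"
      by (subst nat_of_pure) (rule h refl)+
    finally show "tsum ?T (coact (cof (rmod.truncate M)) r (tpure K ?S C m c)) (\<lambda>a c. tpure K ?S C (?n a) c)
      = coact M r (?n (tpure K ?S C m c))" .
  qed (rule ml h | assumption)+
qed

lemma nat_of_hom: "nat_of K C E \<theta> M \<in> Mor (EMod K C E) (cof (rmod.truncate M)) M"
proof -
  have N: "right_module K E (rmod.truncate M)" using em_rm[OF M] by simp
  have sp: "space (cof (rmod.truncate M)) r = tens K (space M r) C" for r
    using cof_space[OF N] by simp
  have "nat_of K C E \<theta> M r \<in> Lin K (tens K (space M r) C) (space M r)" if "r \<in> Ob E" for r
    by (rule LinI[OF lin_nat_of[OF that]]) (simp add: nat_of_def that)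
  then show ?thesis
    by (auto simp: EMod_simps rmod_hom_def sp nat_of_colinear nat_of_act homs_carrier
        intro!: PiE_I) (simp add: nat_of_def)
qed

text \<open>
Colinearity of \<open>\<eta>\<close> carries \<open>m\<^sub>0 \<otimes> m\<^sub>1\<close> to the coaction of \<open>\<eta>(m)\<close>, and \<open>\<eta>\<close> commutes with the action of
\<open>\<theta>\<^sub>r(m\<^sub>1 \<otimes> c)\<close>. The last two premises are the description of \<open>nat_of\<close> at \<open>M'\<close>.
\<close>

lemma nat_of_natural:
  assumes M': "entwined_module K C E M'" and \<eta>: "\<eta> \<in> Mor (EMod K C E) M M'"
    and r: "r \<in> Ob E" and z: "z \<in> carrier (tens K (space M r) C)"
    and lin': "lin K (tens K (space M' r) C) (space M' r) (nat_of K C E \<theta> M' r)"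
    and pure': "\<And>m c. \<lbrakk>m \<in> carrier (space M' r); c \<in> carrier C\<rbrakk> \<Longrightarrow>
      nat_of K C E \<theta> M' r (tpure K (space M' r) C m c)
    = tsum (space M' r) (coact M' r m) (\<lambda>a d. act M' r r (\<theta> r (tpure K C C d c)) a)"
  shows "\<eta> r (nat_of K C E \<theta> M r z)
    = nat_of K C E \<theta> M' r (cofm (rmod.truncate M) (rmod.truncate M') \<eta> r z)"
proof -
  have N: "right_module K E (rmod.truncate M)" "right_module K E (rmod.truncate M')"
    using em_rm[OF M] em_rm[OF M'] by simp_all
  have \<eta>': "\<eta> \<in> rmod_hom K E (rmod.truncate M) (rmod.truncate M')" using \<eta> by (simp add: EMod_simps)
  note el = emod_hom_lin[OF \<eta> M M' r]
  note h = M M' r theta_ml lin_comp[OF el] linD(3)[OF el]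
  show ?thesis
  proof (rule pure_ext[OF z lin_comp[OF el lin_nat_of[OF r]] lin_comp[OF lin' lin_cofm[OF N \<eta>' r, simplified]]])
    fix m c assume m: "m \<in> carrier (space M r)" and c: "c \<in> carrier C"
    note h = h m c
    let ?S = "space M' r"
    have "\<eta> r (nat_of K C E \<theta> M r (tpure K (space M r) C m c))
      = \<eta> r (tsum (space M r) (coact M r m) (\<lambda>a d. act M r r (\<theta> r (tpure K C C d c)) a))"
      by (subst nat_of_pure) (rule h refl)+
    also have "\<dots> = tsum ?S (coact M r m) (\<lambda>a d. \<eta> r (act M r r (\<theta> r (tpure K C C d c)) a))"
      by (rule lin_sum[OF _ _ _ el]) (rule ml h | assumption)+
    also have "\<dots> = tsum ?S (coact M r m) (\<lambda>a d. act M' r r (\<theta> r (tpure K C C d c)) (\<eta> r a))"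
      by (rule sum_cong, (rule ml h | assumption)+, rule emod_hom_act[OF \<eta>]) (rule ml h | assumption)+
    also have "\<dots> = tsum ?S (coact M' r (\<eta> r m)) (\<lambda>a d. act M' r r (\<theta> r (tpure K C C d c)) a)"
      by (rule emod_hom_sum[OF \<eta> M M' r, symmetric]) (rule ml h | assumption)+
    also have "\<dots> = nat_of K C E \<theta> M' r (cofm (rmod.truncate M) (rmod.truncate M') \<eta> r (tpure K (space M r) C m c))"
      by (subst cofm_pure[OF N \<eta>' r, simplified], (rule h)+, subst pure') (rule ml h refl)+
    finally show "\<eta> r (nat_of K C E \<theta> M r (tpure K (space M r) C m c))
      = nat_of K C E \<theta> M' r (cofm (rmod.truncate M) (rmod.truncate M') \<eta> r (tpure K (space M r) C m c))" .
  qed (rule ml h)+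
qed

end

end

section \<open>From natural transformations to families of maps\<close>

text \<open>
The formula \<open>c \<otimes> d \<mapsto> (id \<otimes> \<epsilon>) \<upsilon>(h\<^sub>r \<otimes> C)(id\<^sub>r \<otimes> c \<otimes> d)\<close>.
\<close>

definition V_of ::
  "('k, 'r) ring_scheme \<Rightarrow> ('k, 'u::infinite) coalgebra \<Rightarrow> ('k, 'o, 'u) entw
    \<Rightarrow> (('k, 'o, 'u) emod \<Rightarrow> 'o \<Rightarrow> 'u \<Rightarrow> 'u) \<Rightarrow> 'o \<Rightarrow> 'u \<Rightarrow> 'u"
where
  "V_of K C E \<upsilon> = (\<lambda>r\<in>Ob E. \<lambda>z\<in>carrier (tens K C C). tsum (homs E r r) z (\<lambda>c d.
     tsum (homs E r r) (\<upsilon> (fobj (cofree K C E) (hmod E r)) r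
        (tpure K (tens K (homs E r r) C) C (tpure K (homs E r r) C (Idt E r) c) d))
       (\<lambda>f e. counit C e \<odot>\<^bsub>homs E r r\<^esub> f)))"

context entw_struct begin

lemma lin_contract: "\<lbrakk>lin K U (tens K V C) f; module K V\<rbrakk>
  \<Longrightarrow> lin K U V (\<lambda>u. contract V (f u))"
  by (rule ml | assumption)+

lemma contract_pure: "\<lbrakk>module K V; n \<in> carrier V; c \<in> carrier C\<rbrakk>
  \<Longrightarrow> contract V (tpure K V C n c) = counit C c \<odot>\<^bsub>V\<^esub> n"
  by (rule sum_tpure) (rule ml | assumption)+

text \<open>
\<open>id \<otimes> \<epsilon> : N \<otimes> C \<rightarrow> N\<close> is the counit of the adjunction. Its linearity over \<open>E\<close> and its naturality
are this lemma and the next; its triangle identity is \<open>cofm_contract_coact\<close>.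
\<close>

lemma contract_act:
  assumes N: "right_module K E N" and r: "s \<in> Ob E" "r \<in> Ob E" and f: "f \<in> carrier (homs E s r)"
    and z: "z \<in> carrier (tens K (space N r) C)"
  shows "contract (space N s) (act (cof N) s r f z)
    = act N s r f (contract (space N r) z)"
proof (rule pure_ext[OF z])
  note h = N r f
  show "lin K (tens K (space N r) C) (space N s)
      (\<lambda>z. contract (space N s) (act (cof N) s r f z))"
    by (rule lin_contract[OF lin_cof_act]) (rule ml h)+
  show "lin K (tens K (space N r) C) (space N s)
      (\<lambda>z. act N s r f (contract (space N r) z))"
    by (rule lin_act[OF lin_contract[OF lin_id]]) (rule ml h)+
  fix n c assume n: "n \<in> carrier (space N r)" and c: "c \<in> carrier C"
  note h = h n c
  have "contract (space N s) (act (cof N) s r f (tpure K (space N r) C n c))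
    = tsum (space N s) (entw_app K C E s r c f) (\<lambda>f' c'. counit C c' \<odot>\<^bsub>space N s\<^esub> act N s r f' n)"
    by (rule cof_act_sum) (rule ml h | assumption)+
  also have "\<dots> = counit C c \<odot>\<^bsub>space N s\<^esub> act N s r f n"
    by (rule psi_counit_sum) (rule ml h)+
  also have "\<dots> = act N s r f (counit C c \<odot>\<^bsub>space N r\<^esub> n)"
    by (rule linD(5)[OF lin_act[OF lin_id], symmetric]) (rule ml h)+
  also have "\<dots> = act N s r f (contract (space N r) (tpure K (space N r) C n c))"
    by (subst contract_pure) (rule ml h refl)+
  finally show "contract (space N s) (act (cof N) s r f (tpure K (space N r) C n c))
    = act N s r f (contract (space N r) (tpure K (space N r) C n c))" .
qed (rule ml N r)+

lemma contract_cofm: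
  assumes N: "right_module K E N" and N': "right_module K E N'" and \<eta>: "\<eta> \<in> rmod_hom K E N N'"
    and r: "r \<in> Ob E" and z: "z \<in> carrier (tens K (space N r) C)"
  shows "contract (space N' r) (cofm N N' \<eta> r z)
    = \<eta> r (contract (space N r) z)"
proof (rule pure_ext[OF z])
  note l = hom_lin[OF \<eta> N N' r]
  note h = N N' r linD(3)[OF l]
  show "lin K (tens K (space N r) C) (space N' r)
      (\<lambda>z. contract (space N' r) (cofm N N' \<eta> r z))"
    by (rule lin_contract[OF lin_cofm[OF N N' \<eta> r]]) (rule ml h)+
  show "lin K (tens K (space N r) C) (space N' r)
      (\<lambda>z. \<eta> r (contract (space N r) z))"
    by (rule lin_comp[OF l lin_contract[OF lin_id]]) (rule ml h)+
  fix n c assume n: "n \<in> carrier (space N r)" and c: "c \<in> carrier C"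
  note h = h n c
  show "contract (space N' r) (cofm N N' \<eta> r (tpure K (space N r) C n c))
    = \<eta> r (contract (space N r) (tpure K (space N r) C n c))"
    by (subst cofm_pure[OF N N' \<eta> r n c], subst contract_pure, (rule ml h)+, subst contract_pure, (rule ml h)+)
      (rule linD(5)[OF l, symmetric], (rule ml h)+)
qed (rule ml N r)+

lemma cofm_contract_coact:
  assumes N: "right_module K E N" and r: "r \<in> Ob E" and z: "z \<in> carrier (tens K (space N r) C)"
  shows "tsum (tens K (space N r) C) (coact (cof N) r z) (\<lambda>y e.
      tpure K (space N r) C (contract (space N r) y) e) = z"
proof (rule pure_ext[OF z, where U = "tens K (space N r) C"])
  note h = N r lin_cof_coact[OF N r]
  fix n c assume n: "n \<in> carrier (space N r)" and c: "c \<in> carrier C"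
  note h = h n c
  let ?T = "tens K (space N r) C"
  have "tsum ?T (coact (cof N) r (tpure K (space N r) C n c)) (\<lambda>y e.
      tpure K (space N r) C (contract (space N r) y) e)
    = tsum ?T (comul C c) (\<lambda>c1 c2. tpure K (space N r) C (contract (space N r) (tpure K (space N r) C n c1)) c2)"
    by (rule cof_coact_sum) (rule ml h | assumption)+
  also have "\<dots> = tsum ?T (comul C c) (\<lambda>c1 c2. tpure K (space N r) C (counit C c1 \<odot>\<^bsub>space N r\<^esub> n) c2)"
    by (rule sum_cong, (rule ml h | assumption)+, subst contract_pure) (rule ml h refl | assumption)+
  also have "\<dots> = tsum ?T (comul C c) (\<lambda>c1 c2. counit C c1 \<odot>\<^bsub>?T\<^esub> tpure K (space N r) C n c2)"
    by (rule sum_cong, (rule ml h | assumption)+, rule linD(5)[OF lin_tpure1[OF lin_id]]) (rule ml h refl | assumption)+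
  also have "\<dots> = tpure K (space N r) C n c"
    by (rule comul_counit_left) (rule ml h)+
  finally show "tsum ?T (coact (cof N) r (tpure K (space N r) C n c)) (\<lambda>y e.
      tpure K (space N r) C (contract (space N r) y) e)
    = tpure K (space N r) C n c" .
qed (rule ml N r lin_cof_coact[OF N r] | assumption)+

lemma truncate_rm: "entwined_module K C E M \<Longrightarrow> right_module K E (rmod.truncate M)"
  by (simp add: em_rm)

text \<open>
The coaction of \<open>M\<close> is the unit of the adjunction: the entwining law says that it is linear over \<open>E\<close>,
and coassociativity says that it is colinear.
\<close>

lemma unit_hom:
  assumes M: "entwined_module K C E M"
  shows "(\<lambda>r\<in>Ob E. coact M r) \<in> Mor (EMod K C E) M (cof (rmod.truncate M))"
proof -
  note N = truncate_rm[OF M]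
  have sp: "space (cof (rmod.truncate M)) r = tens K (space M r) C" for r
    using cof_space[OF N] by simp
  have 1: "(\<lambda>r\<in>Ob E. coact M r) \<in> (\<Pi>\<^sub>E r\<in>Ob E. Lin K (space M r) (tens K (space M r) C))"
    using comodule.coact_Lin[OF em_comodule[OF M]] by auto
  have 2: "coact M s (act M s r f m) = act (cof (rmod.truncate M)) s r f (coact M r m)"
    if s: "s \<in> Ob E" and r: "r \<in> Ob E" and f: "f \<in> carrier (homs E s r)" and m: "m \<in> carrier (space M r)" for s r f m
  proof -
    have "coact M r m \<in> carrier (tens K (space M r) C)" by (rule ml M r m)+
    then show ?thesis
      using entwined_module.coact_act[OF M s r, of f m] s r f m cof_act[OF N] by (simp add: homs_carrier)
  qed
  have 3: "colinear K C (space M r) (coact M r) (tens K (space M r) C) (coact (cof (rmod.truncate M)) r) (coact M r)"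
    if r: "r \<in> Ob E" for r
    unfolding colinear_def
  proof
    fix v assume v: "v \<in> carrier (space M r)"
    let ?S = "space M r" let ?T = "tens K (tens K ?S C) C"
    note h = M r v
    have "coact (cof (rmod.truncate M)) r (coact M r v)
      = coact (cof (rmod.truncate M)) r (tsum (tens K ?S C) (coact M r v) (\<lambda>a c. tpure K ?S C a c))"
      by (subst lin_into_sum) (rule ml h refl)+
    also have "\<dots> = tsum ?T (coact M r v) (\<lambda>a c. coact (cof (rmod.truncate M)) r (tpure K ?S C a c))"
      by (rule lin_sum[OF _ _ _ lin_cof_coact[OF N r, simplified]]) (rule ml h | assumption)+
    also have "\<dots> = tsum ?T (coact M r v) (\<lambda>a c. tsum ?T (comul C c) (\<lambda>c1 c2. tpure K (tens K ?S C) C (tpure K ?S C a c1) c2))"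
      by (rule sum_cong, (rule ml h | assumption)+, rule cof_coact_pure[OF N, simplified]) (rule ml h | assumption)+
    also have "\<dots> = tsum ?T (coact M r v) (\<lambda>a c2. tsum ?T (coact M r a) (\<lambda>a c1. tpure K (tens K ?S C) C (tpure K ?S C a c1) c2))"
      by (rule comodule_coassoc[OF em_comodule[OF M r], symmetric]) (rule ml h | assumption)+
    also have "\<dots> = tsum ?T (coact M r v) (\<lambda>a c2. tpure K (tens K ?S C) C (tsum (tens K ?S C) (coact M r a) (\<lambda>a c1. tpure K ?S C a c1)) c2)"
      by (rule sum_cong, (rule ml h | assumption)+, rule lin_sum[symmetric, where f = "\<lambda>u. tpure K (tens K ?S C) C u _"])
        (rule ml h | assumption)+
    also have "\<dots> = tsum ?T (coact M r v) (\<lambda>a c. tpure K (tens K ?S C) C (coact M r a) c)"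
      by (rule sum_cong, (rule ml h | assumption)+, subst lin_into_sum) (rule ml h refl | assumption)+
    finally show "tsum ?T (coact M r v) (\<lambda>a c. tpure K (tens K ?S C) C (coact M r a) c)
      = coact (cof (rmod.truncate M)) r (coact M r v)" by simp
  qed
  show ?thesis
    using 1 2 3 by (simp add: EMod_simps rmod_hom_def sp homs_carrier)
qed

lemma Nat_GF_at_iff:
  "\<upsilon> \<in> Nat_GF_at K C E \<longleftrightarrow>
    \<upsilon> \<in> (\<Pi>\<^sub>E M\<in>{M. entwined_module K C E M}. Mor (EMod K C E) (cof (rmod.truncate M)) M) \<and>
    (\<forall>M N \<eta> r z. entwined_module K C E M \<longrightarrow> entwined_module K C E N \<longrightarrow> \<eta> \<in> Mor (EMod K C E) M N
      \<longrightarrow> r \<in> Ob E \<longrightarrow> z \<in> carrier (tens K (space M r) C)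
      \<longrightarrow> \<eta> r (\<upsilon> M r z) = \<upsilon> N r (cofm (rmod.truncate M) (rmod.truncate N) \<eta> r z))"
proof -
  have O: "fobj (cofree_forget K C E) M = cof (rmod.truncate M)" if "entwined_module K C E M" for M
    using that by (simp add: fun_comp_def forget_def EMod_simps(1))
  have A: "farr (cofree_forget K C E) M N \<eta> = cofm (rmod.truncate M) (rmod.truncate N) \<eta>"
    if "entwined_module K C E M" "entwined_module K C E N" "\<eta> \<in> Mor (EMod K C E) M N" for M N \<eta>
    using that by (simp add: fun_comp_def forget_def EMod_simps(1))
  have sp: "space (cof (rmod.truncate M)) r = tens K (space M r) C" if "entwined_module K C E M" for M r
    using cof_space[OF truncate_rm[OF that]] by simp
  have P: "(\<Pi>\<^sub>E M\<in>Ob (EMod K C E). Mor (EMod K C E) (fobj (cofree_forget K C E) M) (fobj (fun_id (EMod K C E)) M))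
    = (\<Pi>\<^sub>E M\<in>{M. entwined_module K C E M}. Mor (EMod K C E) (cof (rmod.truncate M)) M)"
    unfolding EMod_simps(1) by (rule PiE_cong) (simp add: O fun_id_def EMod_simps(1))
  show ?thesis
    unfolding Nat_GF_at_def NatTrans_def P
    by (rule iffI; intro CollectI conjI; (elim CollectE conjE)?)
      (simp_all add: EMod_simps(1,3) O A fun_id_def restrict_compose_eq_iff sp)
qed

lemma nat_at:
  assumes \<upsilon>: "\<upsilon> \<in> Nat_GF_at K C E" and M: "entwined_module K C E M"
  shows nat_at_hom: "\<upsilon> M \<in> Mor (EMod K C E) (cof (rmod.truncate M)) M"
    and nat_at_natural: "\<lbrakk>entwined_module K C E N; \<eta> \<in> Mor (EMod K C E) M N; r \<in> Ob E;
      z \<in> carrier (tens K (space M r) C)\<rbrakk>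
      \<Longrightarrow> \<eta> r (\<upsilon> M r z) = \<upsilon> N r (cofm (rmod.truncate M) (rmod.truncate N) \<eta> r z)"
    and nat_at_lin: "r \<in> Ob E \<Longrightarrow> lin K (tens K (space M r) C) (space M r) (\<upsilon> M r)"
    and nat_at_Lin: "r \<in> Ob E \<Longrightarrow> \<upsilon> M r \<in> Lin K (tens K (space M r) C) (space M r)"
proof -
  have sp: "space (cof (rmod.truncate M)) r = tens K (space M r) C" for r
    using cof_space[OF truncate_rm[OF M]] by simp
  show *: "\<upsilon> M \<in> Mor (EMod K C E) (cof (rmod.truncate M)) M"
    using \<upsilon> M by (auto simp: Nat_GF_at_iff)
  show "\<lbrakk>entwined_module K C E N; \<eta> \<in> Mor (EMod K C E) M N; r \<in> Ob E;
      z \<in> carrier (tens K (space M r) C)\<rbrakk>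
      \<Longrightarrow> \<eta> r (\<upsilon> M r z) = \<upsilon> N r (cofm (rmod.truncate M) (rmod.truncate N) \<eta> r z)"
    using \<upsilon> M by (simp add: Nat_GF_at_iff)
  show L: "\<upsilon> M r \<in> Lin K (tens K (space M r) C) (space M r)" if r: "r \<in> Ob E"
    using * r by (auto simp: EMod_simps rmod_hom_def sp)
  show "lin K (tens K (space M r) C) (space M r) (\<upsilon> M r)" if r: "r \<in> Ob E"
    by (rule Lin_lin[OF L[OF r]]) (rule ml M r)+
qed

lemma nat_of_nat:
  assumes \<theta>: "\<theta> \<in> V_at K C E"
  shows "(\<lambda>M\<in>Ob (EMod K C E). nat_of K C E \<theta> M) \<in> Nat_GF_at K C E"
  unfolding Nat_GF_at_iff EMod_simps(1)
proof (intro conjI allI impI)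
  show "(\<lambda>M\<in>{M. entwined_module K C E M}. nat_of K C E \<theta> M)
    \<in> (\<Pi>\<^sub>E M\<in>{M. entwined_module K C E M}. Mor (EMod K C E) (cof (rmod.truncate M)) M)"
    using nat_of_hom[OF \<theta>] by auto
qed (simp add: nat_of_natural[OF \<theta>] lin_nat_of[OF \<theta>] nat_of_pure[OF \<theta>])

text \<open>
The value of the formula \<open>m\<^sub>0 t(m\<^sub>1 \<otimes> d)\<close> at the element \<open>m = id\<^sub>r \<otimes> c\<close> of \<open>h\<^sub>r \<otimes> C\<close>. It is the right hand
side of condition (i).
\<close>

lemma act_universal:
  assumes r: "r \<in> Ob E" and d: "d \<in> carrier C" and c: "c \<in> carrier C"
    and t: "lin K (tens K C C) (homs E r r) t"
  shows "tsum (space (cof (hmod E r)) r) (coact (cof (hmod E r)) r (tpure K (homs E r r) C (Idt E r) c))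
      (\<lambda>a e. act (cof (hmod E r)) r r (t (tpure K C C e d)) a)
    = tsum (tens K (homs E r r) C) (comul C c) (\<lambda>c1 c2. entw_app K C E r r c1 (t (tpure K C C c2 d)))"
proof -
  note N = hmod_rm[OF r] and G = cof_em[OF hmod_rm[OF r]]
  let ?H = "homs E r r" let ?T = "tens K ?H C"
  note sp = cof_space[OF N, of r, simplified]
  have ca: "act (cof (hmod E r)) r r f x \<in> carrier ?T" if "f \<in> carrier ?H" "x \<in> carrier ?T" for f x
    using linD(3)[OF lin_cof_act[OF N r r that(1)], of x] that(2) by simp
  note h = N r d c lin_comp[OF t] linD(3)[OF t] ca lin_act[OF _ cof_rm[OF N] r r, unfolded sp]
    lin_act2[OF _ cof_rm[OF N] r r, unfolded sp]
  have "tsum ?T (coact (cof (hmod E r)) r (tpure K ?H C (Idt E r) c))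
      (\<lambda>a e. act (cof (hmod E r)) r r (t (tpure K C C e d)) a)
    = tsum ?T (comul C c) (\<lambda>c1 c2. act (cof (hmod E r)) r r (t (tpure K C C c2 d)) (tpure K ?H C (Idt E r) c1))"
    by (rule cof_coact_sum[OF N, simplified]) (rule ml h | assumption)+
  also have "\<dots> = tsum ?T (comul C c) (\<lambda>c1 c2. entw_app K C E r r c1 (t (tpure K C C c2 d)))"
  proof (rule sum_cong, (rule ml h | assumption)+)
    fix c1 c2 assume c1: "c1 \<in> carrier C" and c2: "c2 \<in> carrier C"
    note h = h c1 c2
    have "act (cof (hmod E r)) r r (t (tpure K C C c2 d)) (tpure K ?H C (Idt E r) c1)
      = tsum ?T (entw_app K C E r r c1 (t (tpure K C C c2 d))) (\<lambda>f' c'. tpure K ?H C (act (hmod E r) r r f' (Idt E r)) c')"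
      by (rule cof_act_pure[OF N, simplified]) (rule ml h | assumption)+
    also have "\<dots> = tsum ?T (entw_app K C E r r c1 (t (tpure K C C c2 d))) (\<lambda>f' c'. tpure K ?H C f' c')"
      by (rule sum_cong, (rule ml h | assumption)+) (use r in \<open>simp add: Idt_cl homs_carrier Idt_closed Cmp_Idt_left\<close>)
    also have "\<dots> = entw_app K C E r r c1 (t (tpure K C C c2 d))"
      by (rule lin_into_sum) (rule ml h | assumption)+
    finally show "act (cof (hmod E r)) r r (t (tpure K C C c2 d)) (tpure K ?H C (Idt E r) c1)
      = entw_app K C E r r c1 (t (tpure K C C c2 d))" .
  qed
  finally show ?thesis by (simp add: sp)
qed

context
  fixes \<upsilon> :: "('k, 'o, 'u) emod \<Rightarrow> 'o \<Rightarrow> 'u \<Rightarrow> 'u"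
  assumes \<upsilon>: "\<upsilon> \<in> Nat_GF_at K C E"
begin

private abbreviation (input) "\<Theta> \<equiv> V_of K C E \<upsilon>"

lemma nat_cof_lin:
  assumes N: "right_module K E N" and r: "r \<in> Ob E"
  shows "lin K (tens K (tens K (space N r) C) C) (tens K (space N r) C) (\<upsilon> (cof N) r)"
  using nat_at_lin[OF \<upsilon> cof_em[OF N] r] by (simp add: cof_space[OF N])

lemma lin_V_of:
  assumes r: "r \<in> Ob E"
  shows "lin K (tens K C C) (homs E r r) (\<Theta> r)"
proof -
  note l = nat_cof_lin[OF hmod_rm[OF r] r, simplified]
  note h = r lin_comp[OF l]
  show ?thesis
    unfolding V_of_def using r
    by simp (rule lin_restrict, (rule ml h linD(3)[OF l] | assumption)+)
qed

lemma V_of_pure: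
  assumes r: "r \<in> Ob E" and c: "c \<in> carrier C" and d: "d \<in> carrier C"
  shows "\<Theta> r (tpure K C C c d) = contract (homs E r r) (\<upsilon> (cof (hmod E r)) r
        (tpure K (tens K (homs E r r) C) C (tpure K (homs E r r) C (Idt E r) c) d))"
proof -
  note l = nat_cof_lin[OF hmod_rm[OF r] r, simplified]
  note h = r c d lin_comp[OF l] linD(3)[OF l]
  have "tpure K C C c d \<in> carrier (tens K C C)" by (rule ml h)+
  then show ?thesis
    unfolding V_of_def using r
    by (simp, subst sum_tpure) (rule ml h refl | assumption)+
qed

text \<open>
Naturality at \<open>\<phi> \<otimes> id : h\<^sub>r \<otimes> C \<rightarrow> N \<otimes> C\<close> for the morphism \<open>\<phi>(f) = n f\<close>, which sends \<open>id\<^sub>r\<close> to \<open>n\<close>.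
\<close>

lemma contract_nat_cof:
  assumes N: "right_module K E N" and r: "r \<in> Ob E" and n: "n \<in> carrier (space N r)"
    and c: "c \<in> carrier C" and d: "d \<in> carrier C"
  shows "contract (space N r) (\<upsilon> (cof N) r (tpure K (tens K (space N r) C) C (tpure K (space N r) C n c) d))
    = act N r r (\<Theta> r (tpure K C C c d)) n"
proof -
  let ?H = "hmod E r" let ?S = "space N r"
  note H = hmod_rm[OF r]
  note l = nat_cof_lin[OF H r, simplified]
  note h = N r n c d
  define \<phi> where "\<phi> = (\<lambda>s\<in>Ob E. \<lambda>g\<in>carrier (homs E s r). act N s r g n)"
  have \<phi>: "\<phi> \<in> rmod_hom K E ?H N"
    unfolding rmod_hom_def
  proof (intro CollectI conjI ballI PiE_I)
    fix s assume s: "s \<in> Ob E"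
    have "lin K (homs E s r) (space N s) (\<lambda>g. act N s r g n)" by (rule ml h s)+
    then show "\<phi> s \<in> Lin K (space ?H s) (space N s)"
      unfolding \<phi>_def using s r N by (simp add: Lin_restrict_iff homs_module rm_mod)
  next
    fix s t f g assume s: "s \<in> Ob E" "t \<in> Ob E" and f: "f \<in> Mor E s t" and g: "g \<in> carrier (space ?H t)"
    then show "\<phi> s (act ?H s t f g) = act N s t f (\<phi> t g)"
      using right_module.act_Cmp[OF N s r f _ n, of g] r
      by (simp add: \<phi>_def homs_carrier Cmp_closed)
  qed (simp add: \<phi>_def)
  let ?G = "cof ?H" let ?G' = "cof N" let ?f = "cofm ?H N \<phi>"
  note G = cof_em[OF H] cof_em[OF N]
  note tG = truncate_rm[OF G(1)] truncate_rm[OF G(2)]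
  have f: "?f \<in> Mor (EMod K C E) ?G ?G'" by (rule cofm_hom[OF H N \<phi>])
  have f': "?f \<in> rmod_hom K E (rmod.truncate ?G) (rmod.truncate ?G')" using f by (simp add: EMod_simps)
  let ?p = "tpure K (homs E r r) C (Idt E r) c"
  let ?w = "tpure K (tens K (homs E r r) C) C ?p d"
  have p: "?p \<in> carrier (tens K (homs E r r) C)" by (rule ml h)+
  have w: "?w \<in> carrier (tens K (tens K (homs E r r) C) C)" by (rule ml p d r)+
  have fp: "?f r ?p = tpure K ?S C n c"
    using cofm_pure[OF H N \<phi> r, of "Idt E r" c] r c n
    by (simp add: Idt_cl \<phi>_def right_module.act_Idt[OF N])
  have "?f r (\<upsilon> ?G r ?w) = \<upsilon> ?G' r (cofm (rmod.truncate ?G) (rmod.truncate ?G') ?f r ?w)"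
    by (rule nat_at_natural[OF \<upsilon> G f r]) (use w in \<open>simp add: cof_space[OF H]\<close>)
  also have "cofm (rmod.truncate ?G) (rmod.truncate ?G') ?f r ?w = tpure K (tens K ?S C) C (tpure K ?S C n c) d"
    using cofm_pure[OF tG f' r, of ?p d] p d fp by (simp add: cof_space[OF H] cof_space[OF N])
  finally have e: "?f r (\<upsilon> ?G r ?w) = \<upsilon> ?G' r (tpure K (tens K ?S C) C (tpure K ?S C n c) d)" .
  have uw: "\<upsilon> ?G r ?w \<in> carrier (tens K (homs E r r) C)" by (rule linD(3)[OF l w])
  have "contract ?S (?f r (\<upsilon> ?G r ?w))
    = \<phi> r (contract (homs E r r) (\<upsilon> ?G r ?w))"
    using contract_cofm[OF H N \<phi> r, of "\<upsilon> ?G r ?w"] uw by simp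
  also have "\<dots> = act N r r (\<Theta> r (tpure K C C c d)) n"
  proof -
    have "contract (homs E r r) (\<upsilon> ?G r ?w) \<in> carrier (homs E r r)"
      by (rule sum_closed[OF uw]) (rule ml r | assumption)+
    then show ?thesis using r V_of_pure[OF r c d] by (simp add: \<phi>_def)
  qed
  finally show ?thesis by (simp add: e)
qed

text \<open>
Naturality at the coaction \<open>M \<rightarrow> M \<otimes> C\<close>, followed by \<open>id \<otimes> \<epsilon>\<close>: on the left the counit law removes
the coaction, and on the right the preceding lemma applies to each term \<open>m\<^sub>0 \<otimes> m\<^sub>1 \<otimes> c\<close>.
\<close>

lemma nat_eq_pure:
  assumes M: "entwined_module K C E M" and r: "r \<in> Ob E" and m: "m \<in> carrier (space M r)"
    and c: "c \<in> carrier C"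
  shows "\<upsilon> M r (tpure K (space M r) C m c)
    = tsum (space M r) (coact M r m) (\<lambda>a d. act M r r (\<Theta> r (tpure K C C d c)) a)"
proof -
  let ?S = "space M r" let ?N = "rmod.truncate M" let ?G = "cof ?N" let ?\<rho> = "\<lambda>r\<in>Ob E. coact M r"
  note N = truncate_rm[OF M]
  note G = cof_em[OF N] and tG = truncate_rm[OF cof_em[OF N]]
  note l = nat_cof_lin[OF N r, simplified] nat_at_lin[OF \<upsilon> M r]
  note h = M r m c lin_comp[OF l(1)] linD(3)[OF l(1)] linD(3)[OF l(2)]
  have \<rho>: "?\<rho> \<in> Mor (EMod K C E) M ?G" by (rule unit_hom[OF M])
  have \<rho>': "?\<rho> \<in> rmod_hom K E ?N (rmod.truncate ?G)" using \<rho> by (simp add: EMod_simps)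
  have p: "tpure K ?S C m c \<in> carrier (tens K ?S C)" by (rule ml h)+
  have e: "coact M r (\<upsilon> M r (tpure K ?S C m c)) = \<upsilon> ?G r (tpure K (tens K ?S C) C (coact M r m) c)"
    using nat_at_natural[OF \<upsilon> M G \<rho> r p] r cofm_pure[OF N tG \<rho>' r, of m c] m c
    by (simp add: cof_space[OF N])
  define L where "L = (\<lambda>y. contract ?S (\<upsilon> ?G r (tpure K (tens K ?S C) C y c)))"
  have L: "lin K (tens K ?S C) ?S L"
    unfolding L_def by (rule ml h | assumption)+
  have "\<upsilon> M r (tpure K ?S C m c) = contract ?S (coact M r (\<upsilon> M r (tpure K ?S C m c)))"
    by (rule comodule.coact_counit[OF em_comodule[OF M r], symmetric]) (rule ml h)+
  also have "\<dots> = L (coact M r m)" by (simp add: L_def e)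
  also have "\<dots> = L (tsum (tens K ?S C) (coact M r m) (\<lambda>a d. tpure K ?S C a d))"
    by (subst lin_into_sum) (rule ml h refl)+
  also have "\<dots> = tsum ?S (coact M r m) (\<lambda>a d. L (tpure K ?S C a d))"
    by (rule lin_sum[OF _ _ _ L]) (rule ml h | assumption)+
  also have "\<dots> = tsum ?S (coact M r m) (\<lambda>a d. act M r r (\<Theta> r (tpure K C C d c)) a)"
    unfolding L_def
    by (rule sum_cong, (rule ml h | assumption)+, rule contract_nat_cof[OF N r, simplified]) (rule ml h | assumption)+
  finally show ?thesis .
qed

text \<open>
For condition (i), \<open>\<upsilon>(h\<^sub>r \<otimes> C)(id\<^sub>r \<otimes> c \<otimes> d)\<close> is computed in two ways: by \<open>nat_eq_pure\<close>, which gives the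
right hand side, and from colinearity of \<open>\<upsilon>(h\<^sub>r \<otimes> C)\<close> followed by \<open>id \<otimes> \<epsilon> \<otimes> id\<close>, which gives the left
hand side. Condition (ii) is linearity of \<open>\<upsilon>(h\<^sub>r \<otimes> C)\<close> over \<open>E\<close> at the element
\<open>id\<^sub>r \<otimes> c \<otimes> d\<close>, followed by \<open>id \<otimes> \<epsilon>\<close>.
\<close>

lemma V_of_V_at: "\<Theta> \<in> V_at K C E"
proof -
  note t = lin_comp[OF lin_V_of] linD(3)[OF lin_V_of]
  have 1: "\<Theta> \<in> (\<Pi>\<^sub>E r\<in>Ob E. Lin K (tens K C C) (homs E r r))"
    by (rule PiE_I, rule LinI[OF lin_V_of]) (auto simp: V_of_def)
  have 2: "tsum (tens K (homs E r r) C) (comul C d) (\<lambda>d1 d2. tpure K (homs E r r) C (\<Theta> r (tpure K C C c d1)) d2)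
        = tsum (tens K (homs E r r) C) (comul C c) (\<lambda>c1 c2. entw_app K C E r r c1 (\<Theta> r (tpure K C C c2 d)))"
    if r: "r \<in> Ob E" and c: "c \<in> carrier C" and d: "d \<in> carrier C" for r c d
  proof -
    let ?H = "hmod E r" let ?h = "homs E r r" let ?G = "cof ?H" let ?T = "tens K ?h C"
    note H = hmod_rm[OF r]
    note G = cof_em[OF H]
    note tG = truncate_rm[OF G]
    note l = nat_cof_lin[OF H r, simplified]
    note spH = cof_space[OF H, of r, simplified]
    note cc = cof_coact_sum[OF tG r, unfolded truncate_simps spH]
    note lcc = lin_cof_coact[OF H r, simplified] lin_cof_coact[OF tG r, unfolded truncate_simps spH]
    note h = r c d t lin_comp[OF l] linD(3)[OF l]
    let ?p = "tpure K ?h C (Idt E r) c" let ?w = "tpure K ?T C ?p d"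
    have p: "?p \<in> carrier ?T" by (rule ml h)+
    have w: "?w \<in> carrier (tens K ?T C)" by (rule ml h)+
    have A: "\<upsilon> ?G r ?w = tsum ?T (comul C c) (\<lambda>c1 c2. entw_app K C E r r c1 (\<Theta> r (tpure K C C c2 d)))"
      using nat_eq_pure[OF G r, of ?p d] p d act_universal[OF r d c lin_V_of[OF r]] by (simp add: spH)
    \<comment> \<open>\<open>L\<close> is \<open>id \<otimes> \<epsilon> \<otimes> id\<close>\<close>
    define L where "L = (\<lambda>z. tsum ?T z (\<lambda>y e. tpure K ?h C (contract ?h y) e))"
    have L: "lin K (tens K ?T C) ?T L"
      unfolding L_def by (rule ml h | assumption)+
    have "colinear K C (space (cof (rmod.truncate ?G)) r) (coact (cof (rmod.truncate ?G)) r)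
        (space ?G r) (coact ?G r) (\<upsilon> ?G r)"
      using nat_at_hom[OF \<upsilon> G] r by (simp add: EMod_simps)
    then have "tsum (tens K ?T C) (coact (cof (rmod.truncate ?G)) r ?w) (\<lambda>a e. tpure K ?T C (\<upsilon> ?G r a) e)
      = coact ?G r (\<upsilon> ?G r ?w)"
      using w unfolding colinear_def by (simp add: spH cof_space[OF tG])
    then have "L (coact ?G r (\<upsilon> ?G r ?w))
      = L (tsum (tens K ?T C) (coact (cof (rmod.truncate ?G)) r ?w) (\<lambda>a e. tpure K ?T C (\<upsilon> ?G r a) e))"
      by simp
    also have "\<dots> = L (tsum (tens K ?T C) (comul C d) (\<lambda>d1 d2. tpure K ?T C (\<upsilon> ?G r (tpure K ?T C ?p d1)) d2))"
      by (subst cc) (rule ml h refl | assumption)+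
    also have "\<dots> = tsum ?T (comul C d) (\<lambda>d1 d2. L (tpure K ?T C (\<upsilon> ?G r (tpure K ?T C ?p d1)) d2))"
      by (rule lin_sum[OF _ _ _ L]) (rule ml h | assumption)+
    also have "\<dots> = tsum ?T (comul C d) (\<lambda>d1 d2. tpure K ?h C (\<Theta> r (tpure K C C c d1)) d2)"
    proof (rule sum_cong, (rule ml h | assumption)+)
      fix d1 d2 assume d12: "d1 \<in> carrier C" "d2 \<in> carrier C"
      show "L (tpure K ?T C (\<upsilon> ?G r (tpure K ?T C ?p d1)) d2) = tpure K ?h C (\<Theta> r (tpure K C C c d1)) d2"
        unfolding L_def by (subst sum_tpure) (rule ml h d12 V_of_pure[symmetric] arg_cong[where f = "\<lambda>x. tpure K ?h C x d2"] | assumption)+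
    qed
    finally have "L (coact ?G r (\<upsilon> ?G r ?w))
      = tsum ?T (comul C d) (\<lambda>d1 d2. tpure K ?h C (\<Theta> r (tpure K C C c d1)) d2)" .
    moreover have "L (coact ?G r (\<upsilon> ?G r ?w)) = \<upsilon> ?G r ?w"
      unfolding L_def using cofm_contract_coact[OF H r, of "\<upsilon> ?G r ?w"] linD(3)[OF l w] by simp
    ultimately show ?thesis using A by simp
  qed
  have 3: "Cmp E s r r (\<Theta> r (tpure K C C c d)) f
        = tsum (homs E s r) (entw_app K C E s r d f) (\<lambda>f' d'.
            tsum (homs E s r) (entw_app K C E s r c f') (\<lambda>f'' c'.
              Cmp E s s r f'' (\<Theta> s (tpure K C C c' d'))))"
    if s: "s \<in> Ob E" and r: "r \<in> Ob E" and f: "f \<in> carrier (homs E s r)"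
      and c: "c \<in> carrier C" and d: "d \<in> carrier C" for s r f c d
  proof -
    let ?H = "hmod E r" let ?h = "homs E r r" let ?hs = "homs E s r" let ?G = "cof ?H"
    let ?T = "tens K ?h C" let ?Ts = "tens K ?hs C"
    note H = hmod_rm[OF r]
    note G = cof_em[OF H]
    note tG = truncate_rm[OF G]
    note l = nat_cof_lin[OF H r, simplified] and ls = nat_cof_lin[OF H s, simplified]
    note sp = cof_space[OF H, simplified]
    note gc = act_cl[OF cof_rm[OF H], unfolded sp] and gl = lin_act2[OF _ cof_rm[OF H], unfolded sp]
    note h = s r f c d t lin_comp[OF ls] linD(3)[OF l] linD(3)[OF ls] gc gl
    let ?p = "tpure K ?h C (Idt E r) c" let ?w = "tpure K ?T C ?p d"
    have w: "?w \<in> carrier (tens K ?T C)" by (rule ml h)+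
    \<comment> \<open>\<open>L\<close> is \<open>(id \<otimes> \<epsilon>) \<upsilon>(h\<^sub>r \<otimes> C)\<close> at \<open>s\<close>\<close>
    define L where "L = (\<lambda>y. contract ?hs (\<upsilon> ?G s y))"
    have L: "lin K (tens K ?Ts C) ?hs L"
      unfolding L_def by (rule ml h | assumption)+
    \<comment> \<open>naturality at \<open>h\<^sub>s \<otimes> C \<rightarrow> h\<^sub>r \<otimes> C\<close>, given by composition with \<open>g\<close>, sends \<open>id\<^sub>s\<close> to \<open>g\<close>\<close>
    have Lp: "L (tpure K ?Ts C (tpure K ?hs C g c') d') = Cmp E s s r g (\<Theta> s (tpure K C C c' d'))"
      if g: "g \<in> carrier ?hs" and cd: "c' \<in> carrier C" "d' \<in> carrier C" for g c' d'
      using contract_nat_cof[OF H s _ cd, of g] g unfolding L_def by simp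
    have "Cmp E s r r (\<Theta> r (tpure K C C c d)) f
      = act ?H s r f (contract ?h (\<upsilon> ?G r ?w))"
      by (subst V_of_pure[OF r c d, symmetric], subst hmod_simps(2)) (rule ml h refl)+
    also have "\<dots> = contract ?hs (act ?G s r f (\<upsilon> ?G r ?w))"
      using contract_act[OF H s r f, of "\<upsilon> ?G r ?w"] linD(3)[OF l w] by simp
    also have "act ?G s r f (\<upsilon> ?G r ?w) = \<upsilon> ?G s (act (cof (rmod.truncate ?G)) s r f ?w)"
      by (rule emod_hom_act[OF nat_at_hom[OF \<upsilon> G] s r f, symmetric]) (use w in \<open>simp add: cof_space[OF tG] sp\<close>)
    also have "contract ?hs \<dots> = L (act (cof (rmod.truncate ?G)) s r f ?w)"
      by (simp add: L_def)
    also have "\<dots> = L (tsum (tens K ?Ts C) (entw_app K C E s r d f) (\<lambda>f' d'. tpure K ?Ts C (act ?G s r f' ?p) d'))"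
      by (subst cof_act_pure[OF tG s r f, unfolded truncate_simps sp]) (rule ml h refl)+
    also have "\<dots> = tsum ?hs (entw_app K C E s r d f) (\<lambda>f' d'. L (tpure K ?Ts C (act ?G s r f' ?p) d'))"
      by (rule lin_sum[OF _ _ _ L]) (rule ml h | assumption)+
    also have "\<dots> = tsum ?hs (entw_app K C E s r d f) (\<lambda>f' d'.
            tsum ?hs (entw_app K C E s r c f') (\<lambda>f'' c'. Cmp E s s r f'' (\<Theta> s (tpure K C C c' d'))))"
    proof (rule sum_cong, (rule ml h | assumption)+)
      fix f' d' assume f': "f' \<in> carrier ?hs" and d': "d' \<in> carrier C"
      note h = h f' d'
      have L': "lin K ?Ts ?hs (\<lambda>x. L (tpure K ?Ts C x d'))"
        by (rule lin_comp[OF L]) (rule ml h)+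
      have "act ?G s r f' ?p = tsum ?Ts (entw_app K C E s r c f') (\<lambda>f'' c'. tpure K ?hs C (act ?H s r f'' (Idt E r)) c')"
        by (rule cof_act_pure[OF H s r f', simplified]) (rule ml h)+
      also have "\<dots> = tsum ?Ts (entw_app K C E s r c f') (\<lambda>f'' c'. tpure K ?hs C f'' c')"
        by (rule sum_cong, (rule ml h | assumption)+)
          (use r s in \<open>simp add: Idt_cl homs_carrier Idt_closed Cmp_Idt_left\<close>)
      finally have "L (tpure K ?Ts C (act ?G s r f' ?p) d')
        = L (tpure K ?Ts C (tsum ?Ts (entw_app K C E s r c f') (\<lambda>f'' c'. tpure K ?hs C f'' c')) d')" by simp
      also have "\<dots> = tsum ?hs (entw_app K C E s r c f') (\<lambda>f'' c'. L (tpure K ?Ts C (tpure K ?hs C f'' c') d'))"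
        by (rule lin_sum[OF _ _ _ L']) (rule ml h | assumption)+
      also have "\<dots> = tsum ?hs (entw_app K C E s r c f') (\<lambda>f'' c'. Cmp E s s r f'' (\<Theta> s (tpure K C C c' d')))"
        by (rule sum_cong, (rule ml h | assumption)+, rule Lp[OF _ _ d'])
      finally show "L (tpure K ?Ts C (act ?G s r f' ?p) d')
        = tsum ?hs (entw_app K C E s r c f') (\<lambda>f'' c'. Cmp E s s r f'' (\<Theta> s (tpure K C C c' d')))" .
    qed
    finally show ?thesis .
  qed
  show ?thesis using 1 2 3 by (auto simp: V_at_def homs_carrier)
qed

lemma nat_of_V_of: "(\<lambda>M\<in>Ob (EMod K C E). nat_of K C E \<Theta> M) = \<upsilon>"
proof (rule extensionalityI[of _ "Ob (EMod K C E)"])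
  show "\<upsilon> \<in> extensional (Ob (EMod K C E))"
    using \<upsilon> by (auto simp: Nat_GF_at_iff EMod_simps(1) PiE_def)
  fix M assume "M \<in> Ob (EMod K C E)"
  then have M: "entwined_module K C E M" by (simp add: EMod_simps)
  have e: "nat_of K C E \<Theta> M r z = \<upsilon> M r z" if r: "r \<in> Ob E" and z: "z \<in> carrier (tens K (space M r) C)" for r z
    by (rule pure_ext[OF z lin_nat_of[OF V_of_V_at M r] nat_at_lin[OF \<upsilon> M r]])
      (simp add: nat_of_pure[OF V_of_V_at M r] nat_eq_pure[OF M r] | rule ml M r)+
  have "nat_of K C E \<Theta> M = \<upsilon> M"
  proof (rule extensionalityI[of _ "Ob E"])
    show "\<upsilon> M \<in> extensional (Ob E)"
      using nat_at_hom[OF \<upsilon> M] by (auto simp: EMod_simps rmod_hom_def PiE_def)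
    fix r assume r: "r \<in> Ob E"
    show "nat_of K C E \<Theta> M r = \<upsilon> M r"
      by (rule extensionalityI[of _ "carrier (tens K (space M r) C)"])
        (use r e Lin_extensional[OF nat_at_Lin[OF \<upsilon> M r]] in \<open>auto simp: nat_of_def\<close>)
  qed (simp add: nat_of_def)
  then show "(\<lambda>M\<in>Ob (EMod K C E). nat_of K C E \<Theta> M) M = \<upsilon> M" using M by (simp add: EMod_simps)
qed simp

end

text \<open>
Condition (i) rewrites the value at \<open>id\<^sub>r \<otimes> c \<otimes> d\<close> as \<open>\<theta>\<^sub>r(c \<otimes> d\<^sub>1) \<otimes> d\<^sub>2\<close>, from which \<open>id \<otimes> \<epsilon>\<close> recovers
\<open>\<theta>\<^sub>r(c \<otimes> d)\<close>.
\<close>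

lemma V_of_nat_of:
  assumes \<theta>: "\<theta> \<in> V_at K C E"
  shows "V_of K C E (\<lambda>M\<in>Ob (EMod K C E). nat_of K C E \<theta> M) = \<theta>"
proof (rule extensionalityI[of _ "Ob E"])
  show "\<theta> \<in> extensional (Ob E)" using \<theta> by (auto simp: V_at_def PiE_def)
  let ?\<upsilon> = "\<lambda>M\<in>Ob (EMod K C E). nat_of K C E \<theta> M"
  note n = nat_of_nat[OF \<theta>]
  fix r assume r: "r \<in> Ob E"
  note tl = theta_lin[OF \<theta> r]
  have e: "V_of K C E ?\<upsilon> r z = \<theta> r z" if z: "z \<in> carrier (tens K C C)" for z
  proof (rule pure_ext[OF z lin_V_of[OF n r] tl])
    fix c d assume c: "c \<in> carrier C" and d: "d \<in> carrier C"
    let ?H = "hmod E r" let ?h = "homs E r r" let ?G = "cof ?H" let ?T = "tens K ?h C"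
    note H = hmod_rm[OF r]
    note G = cof_em[OF H]
    note sp = cof_space[OF H, of r, simplified]
    note h = r c d lin_comp[OF tl] linD(3)[OF tl]
    let ?p = "tpure K ?h C (Idt E r) c" let ?w = "tpure K ?T C ?p d"
    have p: "?p \<in> carrier ?T" by (rule ml h)+
    have "?\<upsilon> ?G r ?w = tsum ?T (comul C c) (\<lambda>c1 c2. entw_app K C E r r c1 (\<theta> r (tpure K C C c2 d)))"
      using nat_of_pure[OF \<theta> G r, of ?p d] p d act_universal[OF r d c tl] G by (simp add: sp EMod_simps(1))
    also have "\<dots> = tsum ?T (comul C d) (\<lambda>d1 d2. tpure K ?h C (\<theta> r (tpure K C C c d1)) d2)"
      using \<theta> r c d by (simp add: V_at_def)
    finally have "V_of K C E ?\<upsilon> r (tpure K C C c d)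
      = contract ?h (tsum ?T (comul C d) (\<lambda>d1 d2. tpure K ?h C (\<theta> r (tpure K C C c d1)) d2))"
      using V_of_pure[OF n r c d] by simp
    also have "\<dots> = tsum ?h (comul C d) (\<lambda>d1 d2. counit C d2 \<odot>\<^bsub>?h\<^esub> \<theta> r (tpure K C C c d1))"
      by (rule sum_sum_pure) (rule ml h | assumption)+
    also have "\<dots> = \<theta> r (tpure K C C c d)"
      by (rule comul_counit_right[where L = "\<lambda>d1. \<theta> r (tpure K C C c d1)"]) (rule ml h)+
    finally show "V_of K C E ?\<upsilon> r (tpure K C C c d) = \<theta> r (tpure K C C c d)" .
  qed (rule ml)+
  show "V_of K C E ?\<upsilon> r = \<theta> r"
    by (rule extensionalityI[of _ "carrier (tens K C C)"])
      (use \<theta> r e in \<open>auto simp: V_of_def V_at_def Lin_def PiE_def\<close>)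
qed (simp add: V_of_def)

end

section \<open>Modules over a diagram of concrete categories\<close>

text \<open>
In both module categories a morphism is a family of functions indexed by objects, composition
depends on the source only, and restriction reindexes along a map \<open>a\<close> of objects. For such a family
of categories, objects and morphisms of \<open>RepMod\<close> are described by equations between elements
(\<open>Ob_iff\<close>, \<open>Mor_iff\<close>). The set \<open>sp M r\<close> is the carrier of \<open>M\<close> at \<open>r\<close>.
\<close>

locale repmod_family =
  fixes X :: "'x set" and leq :: "'x rel" and cat :: "'x \<Rightarrow> ('m, 'o \<Rightarrow> 'u \<Rightarrow> 'u) cat"
    and res :: "'x \<Rightarrow> 'x \<Rightarrow> ('m, 'o \<Rightarrow> 'u \<Rightarrow> 'u, 'm, 'o \<Rightarrow> 'u \<Rightarrow> 'u) fctr"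
    and I :: "'x \<Rightarrow> 'o set" and a :: "'x \<Rightarrow> 'x \<Rightarrow> 'o \<Rightarrow> 'o" and sp :: "'m \<Rightarrow> 'o \<Rightarrow> 'u set"
  assumes po: "preorder_on X leq"
    and a_closed: "\<lbrakk>(x, y) \<in> leq; r \<in> I x\<rbrakk> \<Longrightarrow> a x y r \<in> I y"
    and Cmp_eq: "x \<in> X \<Longrightarrow> Cmp (cat x) A B D \<theta> \<eta> = (\<lambda>r\<in>I x. compose (sp A r) (\<theta> r) (\<eta> r))"
    and Idt_eq: "x \<in> X \<Longrightarrow> Idt (cat x) A = (\<lambda>r\<in>I x. \<lambda>m\<in>sp A r. m)"
    and Mor_ext: "\<lbrakk>x \<in> X; \<eta> \<in> Mor (cat x) A B\<rbrakk> \<Longrightarrow> \<eta> \<in> (\<Pi>\<^sub>E r\<in>I x. sp A r \<rightarrow>\<^sub>E sp B r)"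
    and Idt_cl: "\<lbrakk>x \<in> X; A \<in> Ob (cat x)\<rbrakk> \<Longrightarrow> Idt (cat x) A \<in> Mor (cat x) A A"
    and Cmp_cl: "\<lbrakk>x \<in> X; A \<in> Ob (cat x); B \<in> Ob (cat x); D \<in> Ob (cat x); f \<in> Mor (cat x) A B;
      g \<in> Mor (cat x) B D\<rbrakk> \<Longrightarrow> Cmp (cat x) A B D g f \<in> Mor (cat x) A D"
    and res_ob: "\<lbrakk>(x, y) \<in> leq; N \<in> Ob (cat y)\<rbrakk> \<Longrightarrow> fobj (res x y) N \<in> Ob (cat x)"
    and res_sp: "\<lbrakk>(x, y) \<in> leq; N \<in> Ob (cat y)\<rbrakk> \<Longrightarrow> sp (fobj (res x y) N) r = sp N (a x y r)"
    and res_arr: "\<lbrakk>(x, y) \<in> leq; N \<in> Ob (cat y); N' \<in> Ob (cat y); \<eta> \<in> Mor (cat y) N N'\<rbrakk>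
      \<Longrightarrow> farr (res x y) N N' \<eta> = (\<lambda>r\<in>I x. \<eta> (a x y r))"
    and res_arr_cl: "\<lbrakk>(x, y) \<in> leq; N \<in> Ob (cat y); N' \<in> Ob (cat y); \<eta> \<in> Mor (cat y) N N'\<rbrakk>
      \<Longrightarrow> farr (res x y) N N' \<eta> \<in> Mor (cat x) (fobj (res x y) N) (fobj (res x y) N')"
begin

abbreviation "\<M> \<equiv> RepMod X leq cat res"

lemma leqD: "(x, y) \<in> leq \<Longrightarrow> x \<in> X" "(x, y) \<in> leq \<Longrightarrow> y \<in> X"
  and leq_refl: "x \<in> X \<Longrightarrow> (x, x) \<in> leq"
  and leq_trans: "\<lbrakk>(x, y) \<in> leq; (y, z) \<in> leq\<rbrakk> \<Longrightarrow> (x, z) \<in> leq"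
  using po by (auto simp: preorder_on_def refl_on_def dest: transD)

lemma Mor_eqI:
  assumes "x \<in> X" "f \<in> Mor (cat x) A B" "g \<in> Mor (cat x) A B'"
    "\<And>r m. \<lbrakk>r \<in> I x; m \<in> sp A r\<rbrakk> \<Longrightarrow> f r m = g r m"
  shows "f = g"
proof -
  note e = Mor_ext[OF assms(1,2)] Mor_ext[OF assms(1,3)]
  show ?thesis
  proof (rule extensionalityI[of _ "I x"])
    fix r assume r: "r \<in> I x"
    show "f r = g r"
      by (rule extensionalityI[of _ "sp A r"]) (use e r assms(4) in \<open>auto simp: PiE_iff\<close>)
  qed (use e in \<open>auto simp: PiE_iff\<close>)
qed

lemma Mor_closed: "\<lbrakk>x \<in> X; \<eta> \<in> Mor (cat x) A B; r \<in> I x; m \<in> sp A r\<rbrakk> \<Longrightarrow> \<eta> r m \<in> sp B r"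
  using Mor_ext[of x \<eta> A B] by (auto simp: PiE_iff)

lemma Cmp_app: "\<lbrakk>x \<in> X; r \<in> I x; m \<in> sp A r\<rbrakk> \<Longrightarrow> Cmp (cat x) A B D \<theta> \<eta> r m = \<theta> r (\<eta> r m)"
  by (simp add: Cmp_eq compose_def)

lemma Ob_iff:
  "M \<in> Ob \<M> \<longleftrightarrow> (\<forall>x\<in>X. mobj M x \<in> Ob (cat x)) \<and>
    (\<forall>(x, y)\<in>leq. mtr M x y \<in> Mor (cat x) (mobj M x) (fobj (res x y) (mobj M y))) \<and>
    (\<forall>x\<in>X. \<forall>r\<in>I x. \<forall>m\<in>sp (mobj M x) r. mtr M x x r m = m) \<and>
    (\<forall>x y z. (x, y) \<in> leq \<and> (y, z) \<in> leq \<longrightarrow> (\<forall>r\<in>I x. \<forall>m\<in>sp (mobj M x) r.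
      mtr M x z r m = mtr M y z (a x y r) (mtr M x y r m)))"
proof -
  {
    assume o: "\<forall>x\<in>X. mobj M x \<in> Ob (cat x)"
      and t: "\<forall>(x, y)\<in>leq. mtr M x y \<in> Mor (cat x) (mobj M x) (fobj (res x y) (mobj M y))"
    have 1: "mtr M x x = Idt (cat x) (mobj M x) \<longleftrightarrow> (\<forall>r\<in>I x. \<forall>m\<in>sp (mobj M x) r. mtr M x x r m = m)"
      if x: "x \<in> X" for x
    proof
      assume "\<forall>r\<in>I x. \<forall>m\<in>sp (mobj M x) r. mtr M x x r m = m"
      then show "mtr M x x = Idt (cat x) (mobj M x)"
        using t leq_refl[OF x] o x by (intro Mor_eqI[OF x _ Idt_cl]) (auto simp: Idt_eq)
    qed (use x in \<open>simp add: Idt_eq\<close>)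
    have 2: "mtr M x z = Cmp (cat x) (mobj M x) (fobj (res x y) (mobj M y))
             (fobj (res x y) (fobj (res y z) (mobj M z)))
             (farr (res x y) (mobj M y) (fobj (res y z) (mobj M z)) (mtr M y z)) (mtr M x y)
      \<longleftrightarrow> (\<forall>r\<in>I x. \<forall>m\<in>sp (mobj M x) r. mtr M x z r m = mtr M y z (a x y r) (mtr M x y r m))"
      (is "_ = ?c \<longleftrightarrow> _") if l: "(x, y) \<in> leq" "(y, z) \<in> leq" for x y z
    proof -
      have x: "x \<in> X" "y \<in> X" "z \<in> X" using l leqD by blast+
      have m: "mtr M y z \<in> Mor (cat y) (mobj M y) (fobj (res y z) (mobj M z))"
        "mtr M x y \<in> Mor (cat x) (mobj M x) (fobj (res x y) (mobj M y))" using t l by auto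
      have ob: "fobj (res y z) (mobj M z) \<in> Ob (cat y)" using o x l by (auto intro: res_ob)
      have app: "?c r m = mtr M y z (a x y r) (mtr M x y r m)"
        if "r \<in> I x" "m \<in> sp (mobj M x) r" for r m
        using that m l ob o x by (simp add: Cmp_app res_arr)
      show ?thesis
      proof
        assume "\<forall>r\<in>I x. \<forall>m\<in>sp (mobj M x) r. mtr M x z r m = mtr M y z (a x y r) (mtr M x y r m)"
        then show "mtr M x z = ?c"
          using t leq_trans[OF l] o x m l ob app
          by (intro Mor_eqI[OF x(1) _ Cmp_cl]) (auto intro: res_ob res_arr_cl)
      qed (use app in simp)
    qed
    note 1 2
  }
  then show ?thesis
    unfolding RepMod_def by (simp cong: conj_cong)
qed

lemma Mor_iff:
  assumes M: "M \<in> Ob \<M>" and N: "N \<in> Ob \<M>"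
  shows "\<eta> \<in> Mor \<M> M N \<longleftrightarrow> \<eta> \<in> (\<Pi>\<^sub>E x\<in>X. Mor (cat x) (mobj M x) (mobj N x)) \<and>
    (\<forall>(x, y)\<in>leq. \<forall>r\<in>I x. \<forall>m\<in>sp (mobj M x) r.
      mtr N x y r (\<eta> x r m) = \<eta> y (a x y r) (mtr M x y r m))"
proof -
  {
    fix x y assume \<eta>: "\<eta> \<in> (\<Pi>\<^sub>E x\<in>X. Mor (cat x) (mobj M x) (mobj N x))" and l: "(x, y) \<in> leq"
    have x: "x \<in> X" "y \<in> X" using l leqD by blast+
    have e: "\<eta> x \<in> Mor (cat x) (mobj M x) (mobj N x)" "\<eta> y \<in> Mor (cat y) (mobj M y) (mobj N y)"
      using \<eta> x by auto
    have o: "mobj M x \<in> Ob (cat x)" "mobj N x \<in> Ob (cat x)" "mobj M y \<in> Ob (cat y)" "mobj N y \<in> Ob (cat y)"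
      using M N x by (auto simp: Ob_iff)
    have t: "mtr M x y \<in> Mor (cat x) (mobj M x) (fobj (res x y) (mobj M y))"
      "mtr N x y \<in> Mor (cat x) (mobj N x) (fobj (res x y) (mobj N y))"
      using M N l by (auto simp: Ob_iff)
    let ?l = "Cmp (cat x) (mobj M x) (mobj N x) (fobj (res x y) (mobj N y)) (mtr N x y) (\<eta> x)"
    let ?r = "Cmp (cat x) (mobj M x) (fobj (res x y) (mobj M y)) (fobj (res x y) (mobj N y))
             (farr (res x y) (mobj M y) (mobj N y) (\<eta> y)) (mtr M x y)"
    have m: "?l \<in> Mor (cat x) (mobj M x) (fobj (res x y) (mobj N y))"
      "?r \<in> Mor (cat x) (mobj M x) (fobj (res x y) (mobj N y))"
      using e o t x l by (auto intro!: Cmp_cl res_ob res_arr_cl)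
    have app: "?l r m = mtr N x y r (\<eta> x r m)" "?r r m = \<eta> y (a x y r) (mtr M x y r m)"
      if "r \<in> I x" "m \<in> sp (mobj M x) r" for r m
      using that e o t x l by (simp_all add: Cmp_app res_arr)
    have "?l = ?r \<longleftrightarrow> (\<forall>r\<in>I x. \<forall>m\<in>sp (mobj M x) r.
      mtr N x y r (\<eta> x r m) = \<eta> y (a x y r) (mtr M x y r m))"
      using app Mor_eqI[OF x(1) m] by metis
  }
  then show ?thesis unfolding RepMod_def by (simp cong: conj_cong) blast
qed

lemma ObD:
  assumes "M \<in> Ob \<M>"
  shows "x \<in> X \<Longrightarrow> mobj M x \<in> Ob (cat x)"
    "(x, y) \<in> leq \<Longrightarrow> mtr M x y \<in> Mor (cat x) (mobj M x) (fobj (res x y) (mobj M y))"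
    "\<lbrakk>x \<in> X; r \<in> I x; m \<in> sp (mobj M x) r\<rbrakk> \<Longrightarrow> mtr M x x r m = m"
    "\<lbrakk>(x, y) \<in> leq; (y, z) \<in> leq; r \<in> I x; m \<in> sp (mobj M x) r\<rbrakk>
      \<Longrightarrow> mtr M x z r m = mtr M y z (a x y r) (mtr M x y r m)"
    "\<lbrakk>(x, y) \<in> leq; r \<in> I x; m \<in> sp (mobj M x) r\<rbrakk> \<Longrightarrow> mtr M x y r m \<in> sp (mobj M y) (a x y r)"
proof -
  show "x \<in> X \<Longrightarrow> mobj M x \<in> Ob (cat x)"
    "(x, y) \<in> leq \<Longrightarrow> mtr M x y \<in> Mor (cat x) (mobj M x) (fobj (res x y) (mobj M y))"
    "\<lbrakk>x \<in> X; r \<in> I x; m \<in> sp (mobj M x) r\<rbrakk> \<Longrightarrow> mtr M x x r m = m"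
    "\<lbrakk>(x, y) \<in> leq; (y, z) \<in> leq; r \<in> I x; m \<in> sp (mobj M x) r\<rbrakk>
      \<Longrightarrow> mtr M x z r m = mtr M y z (a x y r) (mtr M x y r m)"
    using assms by (auto simp: Ob_iff)
  assume l: "(x, y) \<in> leq" "r \<in> I x" "m \<in> sp (mobj M x) r"
  then have "mtr M x y \<in> Mor (cat x) (mobj M x) (fobj (res x y) (mobj M y))" "mobj M y \<in> Ob (cat y)"
    using assms leqD by (auto simp: Ob_iff)
  then show "mtr M x y r m \<in> sp (mobj M y) (a x y r)"
    using Mor_closed[OF leqD(1)[OF l(1)] _ l(2,3)] res_sp[OF l(1)] by blast
qed

lemma MorD:
  assumes "M \<in> Ob \<M>" "N \<in> Ob \<M>" "\<eta> \<in> Mor \<M> M N"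
  shows "x \<in> X \<Longrightarrow> \<eta> x \<in> Mor (cat x) (mobj M x) (mobj N x)"
    "\<lbrakk>(x, y) \<in> leq; r \<in> I x; m \<in> sp (mobj M x) r\<rbrakk>
      \<Longrightarrow> mtr N x y r (\<eta> x r m) = \<eta> y (a x y r) (mtr M x y r m)"
    "\<eta> \<in> extensional X"
    "\<lbrakk>x \<in> X; r \<in> I x; m \<in> sp (mobj M x) r\<rbrakk> \<Longrightarrow> \<eta> x r m \<in> sp (mobj N x) r"
proof -
  have 1: "x \<in> X \<Longrightarrow> \<eta> x \<in> Mor (cat x) (mobj M x) (mobj N x)" for x
    using assms Mor_iff[OF assms(1,2)] by (auto simp: PiE_iff)
  then show "x \<in> X \<Longrightarrow> \<eta> x \<in> Mor (cat x) (mobj M x) (mobj N x)" .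
  show "\<lbrakk>(x, y) \<in> leq; r \<in> I x; m \<in> sp (mobj M x) r\<rbrakk>
      \<Longrightarrow> mtr N x y r (\<eta> x r m) = \<eta> y (a x y r) (mtr M x y r m)" "\<eta> \<in> extensional X"
    using assms Mor_iff[OF assms(1,2)] by (auto simp: PiE_iff)
  show "\<lbrakk>x \<in> X; r \<in> I x; m \<in> sp (mobj M x) r\<rbrakk> \<Longrightarrow> \<eta> x r m \<in> sp (mobj N x) r"
    using Mor_closed[OF _ 1] by blast
qed

lemma RepMod_Mor_eqI:
  assumes "M \<in> Ob \<M>" "N \<in> Ob \<M>" "f \<in> Mor \<M> M N" "g \<in> Mor \<M> M N"
    "\<And>x r m. \<lbrakk>x \<in> X; r \<in> I x; m \<in> sp (mobj M x) r\<rbrakk> \<Longrightarrow> f x r m = g x r m"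
  shows "f = g"
proof (rule extensionalityI[of _ X])
  fix x assume x: "x \<in> X"
  show "f x = g x"
    by (rule Mor_eqI[OF x MorD(1)[OF assms(1,2,3) x] MorD(1)[OF assms(1,2,4) x]]) (rule assms(5)[OF x])
qed (use assms MorD(3) in blast)+

lemma RepMod_Cmp: "Cmp \<M> M N P \<theta> \<eta> = (\<lambda>x\<in>X. Cmp (cat x) (mobj M x) (mobj N x) (mobj P x) (\<theta> x) (\<eta> x))"
  and RepMod_Idt: "Idt \<M> M = (\<lambda>x\<in>X. Idt (cat x) (mobj M x))"
  by (simp_all add: RepMod_def)

lemma RepMod_Cmp_app: "\<lbrakk>x \<in> X; r \<in> I x; m \<in> sp (mobj M x) r\<rbrakk> \<Longrightarrow> Cmp \<M> M N P \<theta> \<eta> x r m = \<theta> x r (\<eta> x r m)"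
  by (simp add: RepMod_Cmp Cmp_app)

lemma RepMod_Idt_app: "\<lbrakk>x \<in> X; r \<in> I x; m \<in> sp (mobj M x) r\<rbrakk> \<Longrightarrow> Idt \<M> M x r m = m"
  by (simp add: RepMod_Idt Idt_eq)

lemma RepMod_Idt_closed: assumes M: "M \<in> Ob \<M>" shows "Idt \<M> M \<in> Mor \<M> M M"
  unfolding Mor_iff[OF M M]
  using ObD[OF M] a_closed leqD Idt_cl[OF _ ObD(1)[OF M]] by (auto simp: RepMod_Idt Idt_eq)

lemma RepMod_Cmp_closed:
  assumes M: "M \<in> Ob \<M>" and N: "N \<in> Ob \<M>" and P: "P \<in> Ob \<M>"
    and f: "f \<in> Mor \<M> M N" and g: "g \<in> Mor \<M> N P"
  shows "Cmp \<M> M N P g f \<in> Mor \<M> M P"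
  unfolding Mor_iff[OF M P]
proof (intro conjI ballI)
  show "Cmp \<M> M N P g f \<in> (\<Pi>\<^sub>E x\<in>X. Mor (cat x) (mobj M x) (mobj P x))"
    using ObD(1)[OF M] ObD(1)[OF N] ObD(1)[OF P] MorD(1)[OF M N f] MorD(1)[OF N P g]
    by (auto simp: RepMod_Cmp intro!: Cmp_cl)
  fix xy assume xy: "xy \<in> leq"
  obtain x y where [simp]: "xy = (x, y)" by (cases xy)
  have l: "(x, y) \<in> leq" using xy by simp
  have "mtr P x y r (Cmp \<M> M N P g f x r m) = Cmp \<M> M N P g f y (a x y r) (mtr M x y r m)"
    if r: "r \<in> I x" and m: "m \<in> sp (mobj M x) r" for r m
    using leqD[OF l] r m a_closed[OF l r] ObD(5)[OF M l r m] MorD(2)[OF M N f l r m]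
      MorD(2)[OF N P g l r] MorD(4)[OF M N f _ r m] by (simp add: RepMod_Cmp_app)
  then show "case xy of (x, y) \<Rightarrow> \<forall>r\<in>I x. \<forall>m\<in>sp (mobj M x) r.
      mtr P x y r (Cmp \<M> M N P g f x r m) = Cmp \<M> M N P g f y (a x y r) (mtr M x y r m)" by simp
qed

lemma RepMod_category: "category \<M>"
proof
  fix A B D E f g h
  assume A: "A \<in> Ob \<M>" and B: "B \<in> Ob \<M>" and f: "f \<in> Mor \<M> A B"
  show "Cmp \<M> A B B (Idt \<M> B) f = f"
    by (rule RepMod_Mor_eqI[OF A B RepMod_Cmp_closed[OF A B B f RepMod_Idt_closed[OF B]] f])
      (simp add: RepMod_Cmp_app RepMod_Idt_app MorD(4)[OF A B f])
  show "Cmp \<M> A A B f (Idt \<M> A) = f"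
    by (rule RepMod_Mor_eqI[OF A B RepMod_Cmp_closed[OF A A B RepMod_Idt_closed[OF A] f] f])
      (simp add: RepMod_Cmp_app RepMod_Idt_app)
  assume D: "D \<in> Ob \<M>" and E: "E \<in> Ob \<M>" and g: "g \<in> Mor \<M> B D" and h: "h \<in> Mor \<M> D E"
  note c = RepMod_Cmp_closed
  show "Cmp \<M> A D E h (Cmp \<M> A B D g f) = Cmp \<M> A B E (Cmp \<M> B D E h g) f"
    by (rule RepMod_Mor_eqI[OF A E c[OF A D E c[OF A B D f g] h] c[OF A B E f c[OF B D E g h]]])
      (simp add: RepMod_Cmp_app MorD(4)[OF A B f])
qed (rule RepMod_Idt_closed RepMod_Cmp_closed; assumption)+

end

section \<open>Restriction along a morphism of entwining structures\<close>

text \<open>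
Restriction of an entwined module is again entwined because \<open>\<alpha>\<close> commutes with the maps \<open>\<psi>\<close>; the
corresponding identity of Sweedler sums is \<open>arr_psi_sum\<close>.
\<close>

locale entw_morphism = S: entw_struct K C E + T: entw_struct K C E'
  for K :: "('k, 'r) ring_scheme" and C :: "('k, 'u::infinite) coalgebra"
    and E :: "('k, 'o, 'u) entw" and E' :: "('k, 'o, 'u) entw" +
  fixes \<alpha> :: "('o, 'u, 'o, 'u) fctr"
  assumes mor: "\<alpha> \<in> entw_mor K C E E'"
begin

lemma linear_functor_alpha: "linear_functor K E E' \<alpha>" using mor by (simp add: entw_mor_def)

sublocale F: linear_functor K E E' \<alpha> by (rule linear_functor_alpha)

lemma ob_cl [ml]: "r \<in> Ob E \<Longrightarrow> fobj \<alpha> r \<in> Ob E'"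
  using F.fobj_closed by auto

lemma arr_lin: "\<lbrakk>s \<in> Ob E; r \<in> Ob E\<rbrakk>
    \<Longrightarrow> lin K (homs E s r) (homs E' (fobj \<alpha> s) (fobj \<alpha> r)) (farr \<alpha> s r)"
  by (rule Lin_lin[OF F.farr_Lin]) (rule ml | assumption)+

lemma arr_lin' [ml]: "\<lbrakk>lin K U (homs E s r) f; s \<in> Ob E; r \<in> Ob E\<rbrakk>
    \<Longrightarrow> lin K U (homs E' (fobj \<alpha> s) (fobj \<alpha> r)) (\<lambda>u. farr \<alpha> s r (f u))"
  by (rule lin_comp[OF arr_lin])

lemma arr_cl [ml]: "\<lbrakk>f \<in> carrier (homs E s r); s \<in> Ob E; r \<in> Ob E\<rbrakk>
    \<Longrightarrow> farr \<alpha> s r f \<in> carrier (homs E' (fobj \<alpha> s) (fobj \<alpha> r))"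
  by (rule linD(3)[OF arr_lin])

lemma arr_psi_sum:
  assumes r: "r \<in> Ob E" "s \<in> Ob E" and f: "f \<in> carrier (homs E r s)" and c: "c \<in> carrier C"
    and b: "bilin K (homs E' (fobj \<alpha> r) (fobj \<alpha> s)) C U b"
  shows "tsum U (entw_app K C E' (fobj \<alpha> r) (fobj \<alpha> s) c (farr \<alpha> r s f)) b
    = tsum U (entw_app K C E r s c f) (\<lambda>f' c'. b (farr \<alpha> r s f') c')"
proof -
  have "entw_app K C E' (fobj \<alpha> r) (fobj \<alpha> s) c (farr \<alpha> r s f)
    = tsum (tens K (homs E' (fobj \<alpha> r) (fobj \<alpha> s)) C) (entw_app K C E r s c f) (\<lambda>f' c'.
        tpure K (homs E' (fobj \<alpha> r) (fobj \<alpha> s)) C (farr \<alpha> r s f') c')"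
    using mor r f c by (simp add: entw_mor_def S.homs_carrier)
  then show ?thesis
    by simp (rule sum_sum_pure; (rule ml r f c b | assumption)+)
qed

lemma rres_simps:
  assumes "right_module K E' N"
  shows "space (fobj (rres K E E' \<alpha>) N) r = space N (fobj \<alpha> r)"
    "act (fobj (rres K E E' \<alpha>) N) s r f = act N (fobj \<alpha> s) (fobj \<alpha> r) (farr \<alpha> s r f)"
  using assms by (simp_all add: rres_def RMod_simps)

lemma eres_simps:
  assumes "entwined_module K C E' N"
  shows "space (fobj (eres K C E E' \<alpha>) N) r = space N (fobj \<alpha> r)"
    "act (fobj (eres K C E E' \<alpha>) N) s r f = act N (fobj \<alpha> s) (fobj \<alpha> r) (farr \<alpha> s r f)"
    "coact (fobj (eres K C E E' \<alpha>) N) r = coact N (fobj \<alpha> r)"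
  using assms by (simp_all add: eres_def EMod_simps)

lemma truncate_eres:
  assumes "entwined_module K C E' N"
  shows "rmod.truncate (fobj (eres K C E E' \<alpha>) N) = fobj (rres K E E' \<alpha>) (rmod.truncate N)"
  using assms T.truncate_rm[OF assms, unfolded rmod.truncate_def]
  by (simp add: eres_def rres_def EMod_simps RMod_simps rmod.truncate_def)

lemma rres_rm:
  assumes N: "right_module K E' N"
  shows "right_module K E (fobj (rres K E E' \<alpha>) N)"
proof (rule right_module.intro, unfold rres_simps[OF N])
  note M = F.farr_closed[THEN PiE_mem, THEN PiE_mem, THEN PiE_mem]
  fix r assume r: "r \<in> Ob E"
  note r' = ob_cl[OF r]
  show "module K (space N (fobj \<alpha> r))" by (rule ml N r)+
  {
    fix m assume "m \<in> carrier (space N (fobj \<alpha> r))"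
    then show "act N (fobj \<alpha> r) (fobj \<alpha> r) (farr \<alpha> r r (Idt E r)) m = m"
      using right_module.act_Idt[OF N r'] r by (simp add: F.farr_Idt)
  }
  fix s assume s: "s \<in> Ob E"
  note s' = ob_cl[OF s]
  {
    fix f assume f: "f \<in> Mor E s r"
    show "act N (fobj \<alpha> s) (fobj \<alpha> r) (farr \<alpha> s r f) \<in> Lin K (space N (fobj \<alpha> r)) (space N (fobj \<alpha> s))"
      by (rule right_module.act_Lin[OF N s' r' M[OF s r f]])
    fix m assume m: "m \<in> carrier (space N (fobj \<alpha> r))"
    note al = S.homs_carrier[OF s r] linD[OF arr_lin[OF s r]]
    show "act N (fobj \<alpha> s) (fobj \<alpha> r) (farr \<alpha> s r (f \<oplus>\<^bsub>homs E s r\<^esub> g)) m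
      = act N (fobj \<alpha> s) (fobj \<alpha> r) (farr \<alpha> s r f) m \<oplus>\<^bsub>space N (fobj \<alpha> s)\<^esub> act N (fobj \<alpha> s) (fobj \<alpha> r) (farr \<alpha> s r g) m"
      if g: "g \<in> Mor E s r" for g
      using al f g right_module.act_add[OF N s' r' M[OF s r f] M[OF s r g] m] by simp
    show "act N (fobj \<alpha> s) (fobj \<alpha> r) (farr \<alpha> s r (k \<odot>\<^bsub>homs E s r\<^esub> f)) m
      = k \<odot>\<^bsub>space N (fobj \<alpha> s)\<^esub> act N (fobj \<alpha> s) (fobj \<alpha> r) (farr \<alpha> s r f) m"
      if k: "k \<in> carrier K" for k
      using al f k right_module.act_smult[OF N s' r' M[OF s r f] k m] by simp
  }
  fix t f g m assume t: "t \<in> Ob E" and f: "f \<in> Mor E t s" and g: "g \<in> Mor E s r"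
    and m: "m \<in> carrier (space N (fobj \<alpha> r))"
  show "act N (fobj \<alpha> t) (fobj \<alpha> r) (farr \<alpha> t r (Cmp E t s r g f)) m
    = act N (fobj \<alpha> t) (fobj \<alpha> s) (farr \<alpha> t s f) (act N (fobj \<alpha> s) (fobj \<alpha> r) (farr \<alpha> s r g) m)"
    using right_module.act_Cmp[OF N ob_cl[OF t] s' r' M[OF t s f] M[OF s r g] m] F.farr_Cmp[OF t s r f g] by simp
qed

lemma eres_em:
  assumes N: "entwined_module K C E' N"
  shows "entwined_module K C E (fobj (eres K C E E' \<alpha>) N)"
proof (intro entwined_module.intro entwined_module_axioms.intro, unfold eres_simps[OF N])
  show "right_module K E (fobj (eres K C E E' \<alpha>) N)"
    using rres_rm[of "rmod.truncate N"] T.em_rm[OF N] by (simp flip: truncate_eres[OF N])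
  fix r assume r: "r \<in> Ob E"
  show "comodule K C (space N (fobj \<alpha> r)) (coact N (fobj \<alpha> r))"
    by (rule T.em_comodule[OF N ob_cl[OF r]])
  fix s f m assume s: "s \<in> Ob E" and "f \<in> Mor E s r" and m: "m \<in> carrier (space N (fobj \<alpha> r))"
  then have f: "f \<in> carrier (homs E s r)" using r by (simp add: S.homs_carrier)
  note h = N r s f m
  let ?S = "space N (fobj \<alpha> s)" let ?T = "tens K ?S C"
  have "coact N (fobj \<alpha> s) (act N (fobj \<alpha> s) (fobj \<alpha> r) (farr \<alpha> s r f) m)
    = tsum ?T (coact N (fobj \<alpha> r) m) (\<lambda>m0 m1.
        tsum ?T (entw_app K C E' (fobj \<alpha> s) (fobj \<alpha> r) m1 (farr \<alpha> s r f)) (\<lambda>f' c.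
          tpure K ?S C (act N (fobj \<alpha> s) (fobj \<alpha> r) f' m0) c))"
    using entwined_module.coact_act[OF N ob_cl[OF s] ob_cl[OF r], of "farr \<alpha> s r f" m] m
      arr_cl[OF f s r] r s by (simp add: T.homs_carrier ob_cl)
  also have "\<dots> = tsum ?T (coact N (fobj \<alpha> r) m) (\<lambda>m0 m1.
        tsum ?T (entw_app K C E s r m1 f) (\<lambda>f' c.
          tpure K ?S C (act N (fobj \<alpha> s) (fobj \<alpha> r) (farr \<alpha> s r f') m0) c))"
    by (rule sum_cong, (rule ml h | assumption)+, rule arr_psi_sum) (rule ml h | assumption)+
  finally show "coact N (fobj \<alpha> s) (act N (fobj \<alpha> s) (fobj \<alpha> r) (farr \<alpha> s r f) m) = \<dots>" .
qed

lemma rres_arr: "\<lbrakk>right_module K E' N; right_module K E' N'; \<eta> \<in> rmod_hom K E' N N'\<rbrakk>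
  \<Longrightarrow> farr (rres K E E' \<alpha>) N N' \<eta> = (\<lambda>r\<in>Ob E. \<eta> (fobj \<alpha> r))"
  by (simp add: rres_def RMod_simps)

lemma eres_arr: "\<lbrakk>entwined_module K C E' N; entwined_module K C E' N'; \<eta> \<in> Mor (EMod K C E') N N'\<rbrakk>
  \<Longrightarrow> farr (eres K C E E' \<alpha>) N N' \<eta> = (\<lambda>r\<in>Ob E. \<eta> (fobj \<alpha> r))"
  by (simp add: eres_def EMod_simps(1))

lemma rres_hom:
  assumes N: "right_module K E' N" "right_module K E' N'" and \<eta>: "\<eta> \<in> rmod_hom K E' N N'"
  shows "(\<lambda>r\<in>Ob E. \<eta> (fobj \<alpha> r)) \<in> rmod_hom K E (fobj (rres K E E' \<alpha>) N) (fobj (rres K E E' \<alpha>) N')"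
proof -
  note M = F.farr_closed[THEN PiE_mem, THEN PiE_mem, THEN PiE_mem]
  show ?thesis using \<eta> ob_cl M unfolding rmod_hom_def rres_simps[OF N(1)] rres_simps[OF N(2)] by auto
qed

lemma eres_hom:
  assumes N: "entwined_module K C E' N" "entwined_module K C E' N'" and \<eta>: "\<eta> \<in> Mor (EMod K C E') N N'"
  shows "(\<lambda>r\<in>Ob E. \<eta> (fobj \<alpha> r)) \<in> Mor (EMod K C E) (fobj (eres K C E E' \<alpha>) N) (fobj (eres K C E E' \<alpha>) N')"
proof -
  note M = F.farr_closed[THEN PiE_mem, THEN PiE_mem, THEN PiE_mem]
  show ?thesis using \<eta> ob_cl M unfolding EMod_simps rmod_hom_def eres_simps[OF N(1)] eres_simps[OF N(2)] by auto
qed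

end

section \<open>Identities and composites of module morphisms\<close>

context entw_struct begin

lemma rmod_Idt_cl: "right_module K E M \<Longrightarrow> Idt (RMod K E) M \<in> Mor (RMod K E) M M"
  by (auto simp: RMod_simps rmod_hom_def Lin_restrict_iff rm_mod lin_id act_cl homs_carrier)

lemma rmod_Cmp_cl:
  assumes M: "right_module K E M" "right_module K E N" "right_module K E P"
    and f: "f \<in> Mor (RMod K E) M N" and g: "g \<in> Mor (RMod K E) N P"
  shows "Cmp (RMod K E) M N P g f \<in> Mor (RMod K E) M P"
proof -
  note f' = f[unfolded RMod_simps] and g' = g[unfolded RMod_simps]
  have "compose (carrier (space M r)) (g r) (f r) \<in> Lin K (space M r) (space P r)" if r: "r \<in> Ob E" for r
    unfolding compose_def Lin_restrict_iff[OF rm_mod[OF M(1) r] rm_mod[OF M(3) r]]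
    by (rule lin_comp[OF hom_lin[OF g' M(2,3) r] hom_lin[OF f' M(1,2) r]])
  moreover have "g s (f s (act M s r h m)) = act P s r h (g r (f r m))"
    if "s \<in> Ob E" "r \<in> Ob E" "h \<in> carrier (homs E s r)" "m \<in> carrier (space M r)" for s r h m
    using that by (simp add: hom_act[OF f'] hom_act[OF g'] linD(3)[OF hom_lin[OF f' M(1,2)]])
  ultimately show ?thesis
    by (auto simp: RMod_simps rmod_hom_def homs_carrier compose_def act_cl M)
qed

lemma emod_Idt_cl:
  assumes M: "entwined_module K C E M"
  shows "Idt (EMod K C E) M \<in> Mor (EMod K C E) M M"
proof -
  have "colinear K C (space M r) (coact M r) (space M r) (coact M r) (\<lambda>m\<in>carrier (space M r). m)" if r: "r \<in> Ob E" for r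
    unfolding colinear_def
  proof
    fix v assume v: "v \<in> carrier (space M r)"
    have "tsum (tens K (space M r) C) (coact M r v) (\<lambda>a c. tpure K (space M r) C ((\<lambda>m\<in>carrier (space M r). m) a) c)
      = tsum (tens K (space M r) C) (coact M r v) (\<lambda>a c. tpure K (space M r) C a c)"
      by (rule sum_cong, (rule ml M r v | assumption)+) simp
    also have "\<dots> = coact M r v" by (rule lin_into_sum) (rule ml M r v)+
    finally show "tsum (tens K (space M r) C) (coact M r v) (\<lambda>a c. tpure K (space M r) C ((\<lambda>m\<in>carrier (space M r). m) a) c)
      = coact M r ((\<lambda>m\<in>carrier (space M r). m) v)" using v by simp
  qed
  then show ?thesis
    using M by (auto simp: EMod_simps rmod_hom_def Lin_restrict_iff rm_mod em_rm lin_id act_cl homs_carrier)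
qed

lemma emod_Cmp_cl:
  assumes M: "entwined_module K C E M" "entwined_module K C E N" "entwined_module K C E P"
    and f: "f \<in> Mor (EMod K C E) M N" and g: "g \<in> Mor (EMod K C E) N P"
  shows "Cmp (EMod K C E) M N P g f \<in> Mor (EMod K C E) M P"
proof -
  note lf = emod_hom_lin[OF f M(1,2)] and lg = emod_hom_lin[OF g M(2,3)]
  have "compose (carrier (space M r)) (g r) (f r) \<in> Lin K (space M r) (space P r)" if r: "r \<in> Ob E" for r
    unfolding compose_def Lin_restrict_iff[OF rm_mod[OF em_rm[OF M(1)] r] rm_mod[OF em_rm[OF M(3)] r]]
    by (rule lin_comp[OF lg[OF r] lf[OF r]])
  moreover have "g s (f s (act M s r h m)) = act P s r h (g r (f r m))"
    if "s \<in> Ob E" "r \<in> Ob E" "h \<in> carrier (homs E s r)" "m \<in> carrier (space M r)" for s r h m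
    using that by (simp add: emod_hom_act[OF f] emod_hom_act[OF g] linD(3)[OF lf])
  moreover have "colinear K C (space M r) (coact M r) (space P r) (coact P r) (compose (carrier (space M r)) (g r) (f r))"
    if r: "r \<in> Ob E" for r
    unfolding colinear_def
  proof
    fix v assume v: "v \<in> carrier (space M r)"
    let ?T = "tens K (space P r) C"
    note h = M r v lin_comp[OF lg[OF r]] linD(3)[OF lg[OF r]] linD(3)[OF lf[OF r]]
    have "tsum ?T (coact M r v) (\<lambda>a c. tpure K (space P r) C (compose (carrier (space M r)) (g r) (f r) a) c)
      = tsum ?T (coact M r v) (\<lambda>a c. tpure K (space P r) C (g r (f r a)) c)"
      by (rule sum_cong, (rule ml h | assumption)+) (simp add: compose_def)
    also have "\<dots> = tsum ?T (coact N r (f r v)) (\<lambda>a c. tpure K (space P r) C (g r a) c)"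
      by (rule emod_hom_sum[OF f M(1,2) r, symmetric]) (rule ml h | assumption)+
    also have "\<dots> = coact P r (g r (f r v))"
      using g r linD(3)[OF lf[OF r] v] by (simp add: EMod_simps colinear_def)
    finally show "tsum ?T (coact M r v) (\<lambda>a c. tpure K (space P r) C (compose (carrier (space M r)) (g r) (f r) a) c)
      = coact P r (compose (carrier (space M r)) (g r) (f r) v)" using v by (simp add: compose_def)
  qed
  ultimately show ?thesis
    by (auto simp: EMod_simps rmod_hom_def homs_carrier compose_def act_cl em_rm M)
qed

section \<open>The adjunction over one entwining structure\<close>

text \<open>
\<open>adj\<close> and \<open>coadj\<close> are the two directions of the adjunction, \<open>m \<mapsto> f(m\<^sub>0) \<otimes> m\<^sub>1\<close> and
\<open>m \<mapsto> (id \<otimes> \<epsilon>)(g(m))\<close>.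
\<close>

definition adj :: "('k, 'o, 'u) emod \<Rightarrow> ('k, 'o, 'u) rmod \<Rightarrow> ('o \<Rightarrow> 'u \<Rightarrow> 'u) \<Rightarrow> 'o \<Rightarrow> 'u \<Rightarrow> 'u" where
  "adj M N f = (\<lambda>r\<in>Ob E. \<lambda>m\<in>carrier (space M r).
     tsum (tens K (space N r) C) (coact M r m) (\<lambda>a c. tpure K (space N r) C (f r a) c))"

definition coadj :: "('k, 'o, 'u) emod \<Rightarrow> ('k, 'o, 'u) rmod \<Rightarrow> ('o \<Rightarrow> 'u \<Rightarrow> 'u) \<Rightarrow> 'o \<Rightarrow> 'u \<Rightarrow> 'u" where
  "coadj M N g = (\<lambda>r\<in>Ob E. \<lambda>m\<in>carrier (space M r).
     contract (space N r) (g r m))"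

context
  fixes M :: "('k, 'o, 'u) emod" and N :: "('k, 'o, 'u) rmod"
  assumes M: "entwined_module K C E M" and N: "right_module K E N"
begin

lemma adj_cofm:
  assumes "f \<in> rmod_hom K E (rmod.truncate M) N" "r \<in> Ob E" "m \<in> carrier (space M r)"
  shows "adj M N f r m = cofm (rmod.truncate M) N f r (coact M r m)"
  using assms coact_cl[OF M assms(2,3)] by (simp add: adj_def cofm_eq[OF truncate_rm[OF M] N])

lemma adj_hom:
  assumes f: "f \<in> rmod_hom K E (rmod.truncate M) N"
  shows "adj M N f \<in> Mor (EMod K C E) M (cof N)"
proof -
  note tM = truncate_rm[OF M]
  have "adj M N f = Cmp (EMod K C E) M (cof (rmod.truncate M)) (cof N) (cofm (rmod.truncate M) N f) (\<lambda>r\<in>Ob E. coact M r)"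
    using adj_cofm[OF f] by (auto simp: EMod_simps compose_def adj_def restrict_def fun_eq_iff)
  then show ?thesis
    using emod_Cmp_cl[OF M cof_em[OF tM] cof_em[OF N] unit_hom[OF M] cofm_hom[OF tM N f]] by simp
qed

lemma coadj_hom:
  assumes g: "g \<in> Mor (EMod K C E) M (cof N)"
  shows "coadj M N g \<in> rmod_hom K E (rmod.truncate M) N"
  unfolding rmod_hom_def truncate_simps
proof (intro CollectI conjI ballI PiE_I)
  note l = emod_hom_lin[OF g M cof_em[OF N], unfolded cof_space[OF N]]
  note h = M N em_rm[OF M]
  fix r assume r: "r \<in> Ob E"
  have "lin K (space M r) (space N r) (\<lambda>m. contract (space N r) (g r m))"
    by (rule lin_contract[OF l[OF r]]) (rule ml h r)+
  then show "coadj M N g r \<in> Lin K (space M r) (space N r)"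
    unfolding coadj_def using r by (simp add: Lin_restrict_iff rm_mod M N em_rm)
  fix s f m assume s: "s \<in> Ob E" and "f \<in> Mor E s r" and m: "m \<in> carrier (space M r)"
  then have f: "f \<in> carrier (homs E s r)" using r by (simp add: homs_carrier)
  have am: "act M s r f m \<in> carrier (space M s)" by (rule ml h r s f m)+
  show "coadj M N g s (act M s r f m) = act N s r f (coadj M N g r m)"
    using contract_act[OF N s r f linD(3)[OF l[OF r] m]] emod_hom_act[OF g s r f m] am r s m
    by (simp add: coadj_def)
qed (simp add: coadj_def)

lemma coadj_adj:
  assumes f: "f \<in> rmod_hom K E (rmod.truncate M) N" and r: "r \<in> Ob E" and m: "m \<in> carrier (space M r)"
  shows "coadj M N (adj M N f) r m = f r m"
proof -
  note tM = truncate_rm[OF M]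
  have "coadj M N (adj M N f) r m = f r (contract (space M r) (coact M r m))"
    using contract_cofm[OF tM N f r, of "coact M r m"] coact_cl[OF M r m] r m by (simp add: coadj_def adj_cofm[OF f])
  then show ?thesis using comodule.coact_counit[OF em_comodule[OF M r] m] by simp
qed

text \<open>
Colinearity of \<open>g\<close> moves the coaction from \<open>m\<close> to \<open>g(m)\<close>, where the triangle identity applies.
\<close>

lemma adj_coadj:
  assumes g: "g \<in> Mor (EMod K C E) M (cof N)" and r: "r \<in> Ob E" and m: "m \<in> carrier (space M r)"
  shows "adj M N (coadj M N g) r m = g r m"
proof -
  note l = emod_hom_lin[OF g M cof_em[OF N] r, unfolded cof_space[OF N]]
  note h = M N r m em_rm[OF M] linD(3)[OF l]
  let ?T = "tens K (space N r) C"
  let ?e = "\<lambda>y. contract (space N r) y"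
  have "adj M N (coadj M N g) r m = tsum ?T (coact M r m) (\<lambda>a c. tpure K (space N r) C (?e (g r a)) c)"
    unfolding adj_def using r m
    by (simp, intro sum_cong[of _ K "space M r" C]) (simp_all add: coadj_def coact_cl M rm_mod em_rm mod_C)
  also have "\<dots> = tsum ?T (coact (cof N) r (g r m)) (\<lambda>y c. tpure K (space N r) C (?e y) c)"
    by (rule emod_hom_sum[OF g M cof_em[OF N] r, unfolded cof_space[OF N], symmetric]) (rule ml h | assumption)+
  also have "\<dots> = g r m"
    by (rule cofm_contract_coact[OF N r]) (rule ml h)+
  finally show ?thesis .
qed

end

end

section \<open>Entwined modules that agree on the objects\<close>

text \<open>
Two entwined modules that agree on the objects and arrows of \<open>E\<close> have the same morphisms, although
they may differ as records at other arguments. Restricting along a composite and restricting twice,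
or taking the cofree module before and after restriction, gives modules that are related in this
way.
\<close>

definition em_agree :: "('k, 'o, 'u) entw \<Rightarrow> ('k, 'o, 'u) emod \<Rightarrow> ('k, 'o, 'u) emod \<Rightarrow> bool" where
  "em_agree E A B \<longleftrightarrow> (\<forall>r\<in>Ob E. space A r = space B r \<and> coact A r = coact B r \<and>
    (\<forall>s\<in>Ob E. \<forall>f\<in>Mor E s r. act A s r f = act B s r f))"

lemma Mor_agree: "\<lbrakk>em_agree E A A'; em_agree E B B'\<rbrakk> \<Longrightarrow> Mor (EMod K C E) A B = Mor (EMod K C E) A' B'"
  unfolding EMod_simps rmod_hom_def em_agree_def by (auto simp: PiE_iff)

lemma em_agree_refl: "em_agree E A A" by (simp add: em_agree_def)

lemma em_agree_sym: "em_agree E A B \<Longrightarrow> em_agree E B A"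
  and em_agree_trans: "\<lbrakk>em_agree E A B; em_agree E B D\<rbrakk> \<Longrightarrow> em_agree E A D"
  by (simp_all add: em_agree_def)

context entw_morphism begin

lemma eres_agree:
  assumes A: "entwined_module K C E' A" and B: "entwined_module K C E' B" and ab: "em_agree E' A B"
  shows "em_agree E (fobj (eres K C E E' \<alpha>) A) (fobj (eres K C E E' \<alpha>) B)"
  unfolding em_agree_def eres_simps[OF A] eres_simps[OF B]
  using ab ob_cl F.farr_closed[THEN PiE_mem, THEN PiE_mem, THEN PiE_mem] unfolding em_agree_def by blast

lemma cof_rres_agree:
  assumes N: "right_module K E' N"
  shows "em_agree E (fobj (cofree K C E) (fobj (rres K E E' \<alpha>) N)) (fobj (eres K C E E' \<alpha>) (fobj (cofree K C E') N))"
  unfolding em_agree_def eres_simps[OF T.cof_em[OF N]] S.cof_space[OF rres_rm[OF N]] T.cof_space[OF N]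
    S.cof_coact[OF rres_rm[OF N]] T.cof_coact[OF N] S.cof_act[OF rres_rm[OF N]] T.cof_act[OF N] rres_simps[OF N]
proof (intro ballI conjI refl restrict_ext)
  fix r s f z assume r: "r \<in> Ob E" and s: "s \<in> Ob E" and "f \<in> Mor E s r"
    and z: "z \<in> carrier (tens K (space N (fobj \<alpha> r)) C)"
  then have f: "f \<in> carrier (homs E s r)" by (simp add: S.homs_carrier)
  note h = N r s f z
  show "tsum (tens K (space N (fobj \<alpha> s)) C) z (\<lambda>n c.
            tsum (tens K (space N (fobj \<alpha> s)) C) (entw_app K C E s r c f) (\<lambda>f' c'.
              tpure K (space N (fobj \<alpha> s)) C (act N (fobj \<alpha> s) (fobj \<alpha> r) (farr \<alpha> s r f') n) c'))
    = tsum (tens K (space N (fobj \<alpha> s)) C) z (\<lambda>n c.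
            tsum (tens K (space N (fobj \<alpha> s)) C) (entw_app K C E' (fobj \<alpha> s) (fobj \<alpha> r) c (farr \<alpha> s r f)) (\<lambda>f' c'.
              tpure K (space N (fobj \<alpha> s)) C (act N (fobj \<alpha> s) (fobj \<alpha> r) f' n) c'))"
    by (rule sum_cong, (rule ml h | assumption)+, rule arr_psi_sum[symmetric]) (rule ml h | assumption)+
qed

end

section \<open>Modules over a representation\<close>

locale entw_representation = coalgebra K C
  for K :: "('k, 'r) ring_scheme" and C :: "('k, 'u::infinite) coalgebra" +
  fixes X :: "'x set" and leq :: "'x rel" and \<R> :: "('k, 'o, 'u, 'x) entw_rep"
  assumes po: "partial_order_on X leq"
    and rep: "cat_functor (poset_cat X leq) (Ent K C) \<R>"
begin

abbreviation "E \<equiv> fobj \<R>"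
abbreviation "\<alpha> x y \<equiv> farr \<R> x y ()"

lemma leqD: "(x, y) \<in> leq \<Longrightarrow> x \<in> X" "(x, y) \<in> leq \<Longrightarrow> y \<in> X"
  and leq_refl: "x \<in> X \<Longrightarrow> (x, x) \<in> leq"
  and leq_trans: "\<lbrakk>(x, y) \<in> leq; (y, z) \<in> leq\<rbrakk> \<Longrightarrow> (x, z) \<in> leq"
  and leq_antisym: "\<lbrakk>(x, y) \<in> leq; (y, x) \<in> leq\<rbrakk> \<Longrightarrow> x = y"
  using po by (auto simp: partial_order_on_def preorder_on_def refl_on_def dest: transD antisymD)

lemma E_ent: "x \<in> X \<Longrightarrow> entw_struct K C (E x)"
  using cat_functor.fobj_closed[OF rep]
  by (auto simp: poset_cat_def Ent_def intro: entw_struct.intro coalgebra_axioms)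

lemma E_mor: "(x, y) \<in> leq \<Longrightarrow> entw_morphism K C (E x) (E y) (\<alpha> x y)"
proof -
  assume l: "(x, y) \<in> leq"
  have "\<alpha> x y \<in> Mor (Ent K C) (E x) (E y)"
    using cat_functor.farr_closed[OF rep] leqD[OF l] l by (fastforce simp: poset_cat_def PiE_iff)
  then show ?thesis
    using E_ent leqD[OF l] by (simp add: Ent_def entw_morphism_def entw_morphism_axioms_def)
qed

lemma alpha_id: "x \<in> X \<Longrightarrow> \<alpha> x x = fun_id (E x)"
  using cat_functor.farr_Idt[OF rep, of x] by (simp add: poset_cat_def Ent_def)

lemma alpha_comp: "\<lbrakk>(x, y) \<in> leq; (y, z) \<in> leq\<rbrakk> \<Longrightarrow> \<alpha> x z = fun_comp (E x) (\<alpha> y z) (\<alpha> x y)"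
  using cat_functor.farr_Cmp[OF rep, of x y z "()" "()"] leqD by (simp add: poset_cat_def Ent_def)

abbreviation "ao x y r \<equiv> fobj (\<alpha> x y) r"

lemma ao_closed: "\<lbrakk>(x, y) \<in> leq; r \<in> Ob (E x)\<rbrakk> \<Longrightarrow> ao x y r \<in> Ob (E y)"
  by (rule entw_morphism.ob_cl[OF E_mor])

lemma ao_id: "\<lbrakk>x \<in> X; r \<in> Ob (E x)\<rbrakk> \<Longrightarrow> ao x x r = r"
  by (simp add: alpha_id fun_id_def)

lemma ao_comp: "\<lbrakk>(x, y) \<in> leq; (y, z) \<in> leq; r \<in> Ob (E x)\<rbrakk> \<Longrightarrow> ao x z r = ao y z (ao x y r)"
  by (simp add: alpha_comp fun_comp_def)

sublocale MR: repmod_family X leq "\<lambda>x. RMod K (E x)" "RRes K \<R>" "\<lambda>x. Ob (E x)" ao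
    "\<lambda>M r. carrier (space M r)"
proof
  show "preorder_on X leq" using po by (simp add: partial_order_on_def)
  fix x y :: 'x and N N' :: "('k, 'o, 'u) rmod" and \<eta> assume l: "(x, y) \<in> leq"
  interpret entw_morphism K C "E x" "E y" "\<alpha> x y" by (rule E_mor[OF l])
  show "r \<in> Ob (E x) \<Longrightarrow> ao x y r \<in> Ob (E y)" for r by (rule ob_cl)
  assume N: "N \<in> Ob (RMod K (E y))"
  show "fobj (RRes K \<R> x y) N \<in> Ob (RMod K (E x))"
    "carrier (space (fobj (RRes K \<R> x y) N) r) = carrier (space N (ao x y r))" for r
    using N rres_rm rres_simps by (auto simp: RMod_simps)
  assume "N' \<in> Ob (RMod K (E y))" and "\<eta> \<in> Mor (RMod K (E y)) N N'"
  then show "farr (RRes K \<R> x y) N N' \<eta> = (\<lambda>r\<in>Ob (E x). \<eta> (ao x y r))"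
    "farr (RRes K \<R> x y) N N' \<eta> \<in> Mor (RMod K (E x)) (fobj (RRes K \<R> x y) N) (fobj (RRes K \<R> x y) N')"
    using N rres_hom rres_arr by (simp_all add: RMod_simps)
next
  fix x :: 'x and A B D :: "('k, 'o, 'u) rmod" and f g assume x: "x \<in> X"
  interpret entw_struct K C "E x" by (rule E_ent[OF x])
  show "A \<in> Ob (RMod K (E x)) \<Longrightarrow> Idt (RMod K (E x)) A \<in> Mor (RMod K (E x)) A A"
    by (rule rmod_Idt_cl) (simp add: RMod_simps)
  show "\<lbrakk>A \<in> Ob (RMod K (E x)); B \<in> Ob (RMod K (E x)); D \<in> Ob (RMod K (E x)); f \<in> Mor (RMod K (E x)) A B;
    g \<in> Mor (RMod K (E x)) B D\<rbrakk> \<Longrightarrow> Cmp (RMod K (E x)) A B D g f \<in> Mor (RMod K (E x)) A D"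
    by (rule rmod_Cmp_cl) (simp_all add: RMod_simps)
qed (auto simp: RMod_simps rmod_hom_def PiE_iff Lin_def)

sublocale CR: repmod_family X leq "\<lambda>x. EMod K C (E x)" "ERes K C \<R>" "\<lambda>x. Ob (E x)" ao
    "\<lambda>M r. carrier (space M r)"
proof
  show "preorder_on X leq" using po by (simp add: partial_order_on_def)
  fix x y :: 'x and N N' :: "('k, 'o, 'u) emod" and \<eta> assume l: "(x, y) \<in> leq"
  interpret entw_morphism K C "E x" "E y" "\<alpha> x y" by (rule E_mor[OF l])
  show "r \<in> Ob (E x) \<Longrightarrow> ao x y r \<in> Ob (E y)" for r by (rule ob_cl)
  assume N: "N \<in> Ob (EMod K C (E y))"
  show "fobj (ERes K C \<R> x y) N \<in> Ob (EMod K C (E x))"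
    "carrier (space (fobj (ERes K C \<R> x y) N) r) = carrier (space N (ao x y r))" for r
    using N eres_em eres_simps by (auto simp: EMod_simps(1))
  assume "N' \<in> Ob (EMod K C (E y))" and "\<eta> \<in> Mor (EMod K C (E y)) N N'"
  then show "farr (ERes K C \<R> x y) N N' \<eta> = (\<lambda>r\<in>Ob (E x). \<eta> (ao x y r))"
    "farr (ERes K C \<R> x y) N N' \<eta> \<in> Mor (EMod K C (E x)) (fobj (ERes K C \<R> x y) N) (fobj (ERes K C \<R> x y) N')"
    using N eres_hom eres_arr by (simp_all add: EMod_simps(1))
next
  fix x :: 'x and A B D :: "('k, 'o, 'u) emod" and f g assume x: "x \<in> X"
  interpret entw_struct K C "E x" by (rule E_ent[OF x])
  show "A \<in> Ob (EMod K C (E x)) \<Longrightarrow> Idt (EMod K C (E x)) A \<in> Mor (EMod K C (E x)) A A"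
    by (rule emod_Idt_cl) (simp add: EMod_simps(1))
  show "\<lbrakk>A \<in> Ob (EMod K C (E x)); B \<in> Ob (EMod K C (E x)); D \<in> Ob (EMod K C (E x)); f \<in> Mor (EMod K C (E x)) A B;
    g \<in> Mor (EMod K C (E x)) B D\<rbrakk> \<Longrightarrow> Cmp (EMod K C (E x)) A B D g f \<in> Mor (EMod K C (E x)) A D"
    by (rule emod_Cmp_cl) (simp_all add: EMod_simps(1))
qed (auto simp: EMod_simps rmod_hom_def PiE_iff Lin_def)

end

context entw_representation begin

text \<open>
The general facts about \<open>RepMod\<close> for the two categories \<open>Mod\<^sup>C-\<R>\<close> (prefix \<open>C\<close>) and \<open>Mod-\<R>\<close>
(prefix \<open>D\<close>).
\<close>

abbreviation "\<C> \<equiv> ModCR K C X leq \<R>"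
abbreviation "\<D> \<equiv> ModR K X leq \<R>"
abbreviation "\<F> \<equiv> Forget K C X leq \<R>"
abbreviation "\<G> \<equiv> Cofree K C X leq \<R>"

lemmas C_ObD = CR.ObD[folded ModCR_def] and C_MorD = CR.MorD[folded ModCR_def]
  and C_Ob_iff = CR.Ob_iff[folded ModCR_def] and C_Mor_iff = CR.Mor_iff[folded ModCR_def]
  and C_Mor_eqI = CR.RepMod_Mor_eqI[folded ModCR_def] and C_Cmp_app = CR.RepMod_Cmp_app[folded ModCR_def]
  and C_Idt_app = CR.RepMod_Idt_app[folded ModCR_def] and C_cat = CR.RepMod_category[folded ModCR_def]
  and C_Cmp_closed = CR.RepMod_Cmp_closed[folded ModCR_def] and C_Idt_closed = CR.RepMod_Idt_closed[folded ModCR_def]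

lemmas D_ObD = MR.ObD[folded ModR_def] and D_MorD = MR.MorD[folded ModR_def]
  and D_Ob_iff = MR.Ob_iff[folded ModR_def] and D_Mor_iff = MR.Mor_iff[folded ModR_def]
  and D_Mor_eqI = MR.RepMod_Mor_eqI[folded ModR_def] and D_Cmp_app = MR.RepMod_Cmp_app[folded ModR_def]
  and D_Idt_app = MR.RepMod_Idt_app[folded ModR_def] and D_cat = MR.RepMod_category[folded ModR_def]
  and D_Cmp_closed = MR.RepMod_Cmp_closed[folded ModR_def] and D_Idt_closed = MR.RepMod_Idt_closed[folded ModR_def]

lemma C_em: "\<lbrakk>M \<in> Ob \<C>; x \<in> X\<rbrakk> \<Longrightarrow> entwined_module K C (E x) (mobj M x)"
  using C_ObD(1) by (simp add: EMod_simps(1))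

lemma D_rm: "\<lbrakk>N \<in> Ob \<D>; x \<in> X\<rbrakk> \<Longrightarrow> right_module K (E x) (mobj N x)"
  using D_ObD(1) by (simp add: RMod_simps(1))

lemma D_hom: "\<lbrakk>N \<in> Ob \<D>; N' \<in> Ob \<D>; \<eta> \<in> Mor \<D> N N'; x \<in> X\<rbrakk> \<Longrightarrow> \<eta> x \<in> rmod_hom K (E x) (mobj N x) (mobj N' x)"
  using D_MorD(1) by (simp add: RMod_simps(2))

lemma D_mtr: "\<lbrakk>N \<in> Ob \<D>; (x, y) \<in> leq\<rbrakk> \<Longrightarrow> mtr N x y \<in> rmod_hom K (E x) (mobj N x) (fobj (RRes K \<R> x y) (mobj N y))"
  using D_ObD(2) by (simp add: RMod_simps(2))

subsection \<open>The forgetful functor\<close>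

lemma F_simps:
  assumes M: "M \<in> Ob \<C>"
  shows "x \<in> X \<Longrightarrow> mobj (fobj \<F> M) x = rmod.truncate (mobj M x)"
    "(x, y) \<in> leq \<Longrightarrow> mtr (fobj \<F> M) x y = mtr M x y"
    "\<lbrakk>N \<in> Ob \<C>; \<eta> \<in> Mor \<C> M N\<rbrakk> \<Longrightarrow> farr \<F> M N \<eta> = \<eta>"
proof -
  show "x \<in> X \<Longrightarrow> mobj (fobj \<F> M) x = rmod.truncate (mobj M x)"
    using M C_ObD(1)[OF M] by (simp add: Forget_def pointwise_def forget_def)
  show "(x, y) \<in> leq \<Longrightarrow> mtr (fobj \<F> M) x y = mtr M x y"
    using M C_ObD[OF M] leqD[of x y] CR.res_ob[of x y]  by (simp add: Forget_def pointwise_def forget_def)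
  assume N: "N \<in> Ob \<C>" and \<eta>: "\<eta> \<in> Mor \<C> M N"
  show "farr \<F> M N \<eta> = \<eta>"
    by (rule extensionalityI[of _ X])
      (use M N \<eta> C_ObD(1) C_MorD(1,3)[OF M N \<eta>] in \<open>auto simp: Forget_def pointwise_def forget_def\<close>)
qed

lemma F_ob: assumes M: "M \<in> Ob \<C>" shows "fobj \<F> M \<in> Ob \<D>"
  unfolding D_Ob_iff
proof (intro conjI ballI)
  fix x assume x: "x \<in> X"
  show "mobj (fobj \<F> M) x \<in> Ob (RMod K (E x))"
    using entw_struct.truncate_rm[OF E_ent[OF x] C_em[OF M x]] by (simp add: F_simps[OF M] x RMod_simps)
next
  fix xy assume "xy \<in> leq"
  moreover obtain x y where [simp]: "xy = (x, y)" by (cases xy)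
  ultimately have l: "(x, y) \<in> leq" by simp
  have "mtr M x y \<in> rmod_hom K (E x) (mobj M x) (fobj (ERes K C \<R> x y) (mobj M y))"
    using C_ObD(2)[OF M l] by (simp add: EMod_simps)
  then have "mtr M x y \<in> rmod_hom K (E x) (rmod.truncate (mobj M x)) (fobj (RRes K \<R> x y) (rmod.truncate (mobj M y)))"
    by (simp flip: entw_morphism.truncate_eres[OF E_mor[OF l] C_em[OF M leqD(2)[OF l]]])
  then show "case xy of (x, y) \<Rightarrow> mtr (fobj \<F> M) x y \<in> Mor (RMod K (E x)) (mobj (fobj \<F> M) x) (fobj (RRes K \<R> x y) (mobj (fobj \<F> M) y))"
    using l leqD[OF l] by (simp add: F_simps[OF M] RMod_simps)
next
  fix x r m assume "x \<in> X" "r \<in> Ob (E x)" "m \<in> carrier (space (mobj (fobj \<F> M) x) r)"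
  then show "mtr (fobj \<F> M) x x r m = m"
    by (simp add: F_simps[OF M] leq_refl C_ObD(3)[OF M])
next
  show "\<forall>x y z. (x, y) \<in> leq \<and> (y, z) \<in> leq \<longrightarrow> (\<forall>r\<in>Ob (E x). \<forall>m\<in>carrier (space (mobj (fobj \<F> M) x) r).
      mtr (fobj \<F> M) x z r m = mtr (fobj \<F> M) y z (ao x y r) (mtr (fobj \<F> M) x y r m))"
  proof (intro allI impI ballI)
    fix x y z r m assume l: "(x, y) \<in> leq \<and> (y, z) \<in> leq" and "r \<in> Ob (E x)"
      "m \<in> carrier (space (mobj (fobj \<F> M) x) r)"
    then show "mtr (fobj \<F> M) x z r m = mtr (fobj \<F> M) y z (ao x y r) (mtr (fobj \<F> M) x y r m)"
      using C_ObD(4)[OF M, of x y z r m] leq_trans[of x y z] leqD[of x y] by (simp add: F_simps[OF M])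
  qed
qed

lemma F_mor:
  assumes M: "M \<in> Ob \<C>" and N: "N \<in> Ob \<C>" and \<eta>: "\<eta> \<in> Mor \<C> M N"
  shows "\<eta> \<in> Mor \<D> (fobj \<F> M) (fobj \<F> N)"
proof -
  have *: "\<eta> x \<in> rmod_hom K (E x) (mobj M x) (mobj N x)" if "x \<in> X" for x
    using C_MorD(1)[OF M N \<eta> that] by (simp add: EMod_simps)
  show ?thesis
    unfolding D_Mor_iff[OF F_ob[OF M] F_ob[OF N]]
  proof (intro conjI ballI)
    show "\<eta> \<in> (\<Pi>\<^sub>E x\<in>X. Mor (RMod K (E x)) (mobj (fobj \<F> M) x) (mobj (fobj \<F> N) x))"
      using * C_MorD(3)[OF M N \<eta>] by (auto simp: F_simps[OF M] F_simps[OF N] RMod_simps PiE_iff)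
    fix xy assume "xy \<in> leq"
    moreover obtain x y where [simp]: "xy = (x, y)" by (cases xy)
    ultimately have l: "(x, y) \<in> leq" by simp
    show "case xy of (x, y) \<Rightarrow> \<forall>r\<in>Ob (E x). \<forall>m\<in>carrier (space (mobj (fobj \<F> M) x) r).
      mtr (fobj \<F> N) x y r (\<eta> x r m) = \<eta> y (ao x y r) (mtr (fobj \<F> M) x y r m)"
      using C_MorD(2)[OF M N \<eta> l] l leqD[OF l] by (simp add: F_simps[OF M] F_simps[OF N])
  qed
qed

lemma F_functor: "cat_functor \<C> \<D> \<F>"
proof (intro cat_functor.intro C_cat D_cat cat_functor_axioms.intro)
  show "fobj \<F> \<in> Ob \<C> \<rightarrow>\<^sub>E Ob \<D>"
    using F_ob by (auto simp: Forget_def pointwise_def)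
  show "farr \<F> \<in> (\<Pi>\<^sub>E A\<in>Ob \<C>. \<Pi>\<^sub>E B\<in>Ob \<C>. Mor \<C> A B \<rightarrow>\<^sub>E Mor \<D> (fobj \<F> A) (fobj \<F> B))"
    using F_mor by (intro PiE_I) (auto simp: F_simps, auto simp: Forget_def pointwise_def)
  fix A assume A: "A \<in> Ob \<C>"
  show "farr \<F> A A (Idt \<C> A) = Idt \<D> (fobj \<F> A)"
    unfolding F_simps(3)[OF A A C_Idt_closed[OF A]]
    by (rule D_Mor_eqI[OF F_ob[OF A] F_ob[OF A] F_mor[OF A A C_Idt_closed[OF A]] D_Idt_closed[OF F_ob[OF A]]])
      (simp add: F_simps[OF A] C_Idt_app D_Idt_app)
  fix B D f g assume B: "B \<in> Ob \<C>" and D: "D \<in> Ob \<C>" and f: "f \<in> Mor \<C> A B" and g: "g \<in> Mor \<C> B D"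
  note gf = C_Cmp_closed[OF A B D f g]
  show "farr \<F> A D (Cmp \<C> A B D g f) = Cmp \<D> (fobj \<F> A) (fobj \<F> B) (fobj \<F> D) (farr \<F> B D g) (farr \<F> A B f)"
    unfolding F_simps(3)[OF A D gf] F_simps(3)[OF A B f] F_simps(3)[OF B D g]
    by (rule D_Mor_eqI[OF F_ob[OF A] F_ob[OF D] F_mor[OF A D gf] D_Cmp_closed[OF F_ob[OF A] F_ob[OF B] F_ob[OF D] F_mor[OF A B f] F_mor[OF B D g]]])
      (simp add: F_simps[OF A] C_Cmp_app D_Cmp_app)
qed

subsection \<open>The cofree functor\<close>

lemma G_simps:
  assumes N: "N \<in> Ob \<D>"
  shows "mobj (fobj \<G> N) x = fobj (cofree K C (E x)) (mobj N x)"
    "mtr (fobj \<G> N) x y = farr (cofree K C (E x)) (mobj N x) (fobj (RRes K \<R> x y) (mobj N y)) (mtr N x y)"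
    "\<lbrakk>N' \<in> Ob \<D>; \<eta> \<in> Mor \<D> N N'; x \<in> X\<rbrakk> \<Longrightarrow> farr \<G> N N' \<eta> x = farr (cofree K C (E x)) (mobj N x) (mobj N' x) (\<eta> x)"
  using N by (simp_all add: Cofree_def pointwise_def)

lemma G_space: "\<lbrakk>N \<in> Ob \<D>; x \<in> X\<rbrakk> \<Longrightarrow> space (mobj (fobj \<G> N) x) r = tens K (space (mobj N x) r) C"
  using entw_struct.cof_space[OF E_ent D_rm] by (simp add: G_simps)

text \<open>
The structure maps of \<open>\<G>(N)\<close> are determined by their values \<open>n \<otimes> c \<mapsto> N\<^sub>\<alpha>(n) \<otimes> c\<close> on pure tensors, so the
functor laws below need to be checked on pure tensors only.
\<close>

lemma G_mtr_facts:
  assumes N: "N \<in> Ob \<D>" and l: "(x, y) \<in> leq" and r: "r \<in> Ob (E x)"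
  shows "lin K (tens K (space (mobj N x) r) C) (tens K (space (mobj N y) (ao x y r)) C) (mtr (fobj \<G> N) x y r)"
    and "\<lbrakk>n \<in> carrier (space (mobj N x) r); c \<in> carrier C\<rbrakk> \<Longrightarrow>
      mtr (fobj \<G> N) x y r (tpure K (space (mobj N x) r) C n c)
        = tpure K (space (mobj N y) (ao x y r)) C (mtr N x y r n) c"
proof -
  note x = leqD[OF l]
  interpret entw_morphism K C "E x" "E y" "\<alpha> x y" by (rule E_mor[OF l])
  note rm = D_rm[OF N x(1)] D_rm[OF N x(2)]
  note rr = rres_rm[OF rm(2)]
  note sp = rres_simps(1)[OF rm(2)]
  show "lin K (tens K (space (mobj N x) r) C) (tens K (space (mobj N y) (ao x y r)) C) (mtr (fobj \<G> N) x y r)"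
    using S.lin_cofm[OF rm(1) rr D_mtr[OF N l] r] by (simp add: G_simps[OF N] sp)
  show "\<lbrakk>n \<in> carrier (space (mobj N x) r); c \<in> carrier C\<rbrakk> \<Longrightarrow>
      mtr (fobj \<G> N) x y r (tpure K (space (mobj N x) r) C n c)
        = tpure K (space (mobj N y) (ao x y r)) C (mtr N x y r n) c"
    using S.cofm_pure[OF rm(1) rr D_mtr[OF N l] r] by (simp add: G_simps[OF N] sp)
qed

lemma G_mtr_mor:
  assumes N: "N \<in> Ob \<D>" and l: "(x, y) \<in> leq"
  shows "mtr (fobj \<G> N) x y \<in> Mor (EMod K C (E x)) (mobj (fobj \<G> N) x) (fobj (ERes K C \<R> x y) (mobj (fobj \<G> N) y))"
proof -
  note x = leqD[OF l]
  interpret entw_morphism K C "E x" "E y" "\<alpha> x y" by (rule E_mor[OF l])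
  note rm = D_rm[OF N x(1)] D_rm[OF N x(2)]
  show ?thesis
    using S.cofm_hom[OF rm(1) rres_rm[OF rm(2)] D_mtr[OF N l]] Mor_agree[where K = K and C = C, OF em_agree_refl cof_rres_agree[OF rm(2)]]
    by (simp add: G_simps[OF N])
qed

lemma G_ob: assumes N: "N \<in> Ob \<D>" shows "fobj \<G> N \<in> Ob \<C>"
  unfolding C_Ob_iff
proof (intro conjI ballI allI impI)
  fix x assume x: "x \<in> X"
  show "mobj (fobj \<G> N) x \<in> Ob (EMod K C (E x))"
    using entw_struct.cof_em[OF E_ent[OF x] D_rm[OF N x]] by (simp add: G_simps[OF N] EMod_simps(1))
  interpret entw_struct K C "E x" by (rule E_ent[OF x])
  fix r z assume r: "r \<in> Ob (E x)" and "z \<in> carrier (space (mobj (fobj \<G> N) x) r)"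
  then have z: "z \<in> carrier (tens K (space (mobj N x) r) C)" by (simp add: G_space[OF N x])
  note mt = G_mtr_facts[OF N leq_refl[OF x] r]
  note h = D_rm[OF N x] r
  show "mtr (fobj \<G> N) x x r z = z"
  proof (rule pure_ext[OF z mt(1)])
    show "lin K (tens K (space (mobj N x) r) C) (tens K (space (mobj N x) (ao x x r)) C) (\<lambda>z. z)"
      unfolding ao_id[OF x r] by (rule ml h)+
  qed (simp add: mt D_ObD[OF N] x r ao_id | rule ml h)+
next
  fix x y z assume l: "(x, y) \<in> leq \<and> (y, z) \<in> leq"
  then have l: "(x, y) \<in> leq" "(y, z) \<in> leq" by simp_all
  note x = leqD(1)[OF l(1)]
  interpret entw_struct K C "E x" by (rule E_ent[OF x])
  fix r w assume r: "r \<in> Ob (E x)" and "w \<in> carrier (space (mobj (fobj \<G> N) x) r)"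
  then have w: "w \<in> carrier (tens K (space (mobj N x) r) C)" by (simp add: G_space[OF N x])
  note ar = ao_closed[OF l(1) r]
  note mt = G_mtr_facts[OF N l(1) r] G_mtr_facts[OF N l(2) ar] G_mtr_facts[OF N leq_trans[OF l] r, unfolded ao_comp[OF l r]]
  show "mtr (fobj \<G> N) x z r w = mtr (fobj \<G> N) y z (ao x y r) (mtr (fobj \<G> N) x y r w)"
    by (rule pure_ext[OF w mt(5) lin_comp[OF mt(3) mt(1)]])
      (simp add: mt D_ObD(4)[OF N l r] D_ObD(5)[OF N l(1) r] | rule ml D_rm[OF N x] r)+
qed (use G_mtr_mor[OF N] in auto)

lemma G_arr_facts:
  assumes N: "N \<in> Ob \<D>" and N': "N' \<in> Ob \<D>" and \<eta>: "\<eta> \<in> Mor \<D> N N'" and x: "x \<in> X"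
  shows "r \<in> Ob (E x) \<Longrightarrow> lin K (tens K (space (mobj N x) r) C) (tens K (space (mobj N' x) r) C) (farr \<G> N N' \<eta> x r)"
    and "\<lbrakk>r \<in> Ob (E x); n \<in> carrier (space (mobj N x) r); c \<in> carrier C\<rbrakk> \<Longrightarrow>
      farr \<G> N N' \<eta> x r (tpure K (space (mobj N x) r) C n c) = tpure K (space (mobj N' x) r) C (\<eta> x r n) c"
    and "farr \<G> N N' \<eta> x \<in> Mor (EMod K C (E x)) (mobj (fobj \<G> N) x) (mobj (fobj \<G> N') x)"
  using entw_struct.lin_cofm[OF E_ent[OF x] D_rm[OF N x] D_rm[OF N' x] D_hom[OF N N' \<eta> x]]
    entw_struct.cofm_pure[OF E_ent[OF x] D_rm[OF N x] D_rm[OF N' x] D_hom[OF N N' \<eta> x]]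
    entw_struct.cofm_hom[OF E_ent[OF x] D_rm[OF N x] D_rm[OF N' x] D_hom[OF N N' \<eta> x]]
  by (simp_all add: G_simps[OF N] G_simps[OF N'] N' \<eta> x)

lemma G_pure_ext:
  assumes x: "x \<in> X" and N: "N \<in> Ob \<D>" and r: "r \<in> Ob (E x)"
    and z: "z \<in> carrier (space (mobj (fobj \<G> N) x) r)"
    and f: "lin K (tens K (space (mobj N x) r) C) U f" and g: "lin K (tens K (space (mobj N x) r) C) U g"
    and p: "\<And>n c. \<lbrakk>n \<in> carrier (space (mobj N x) r); c \<in> carrier C\<rbrakk>
      \<Longrightarrow> f (tpure K (space (mobj N x) r) C n c) = g (tpure K (space (mobj N x) r) C n c)"
  shows "f z = g z"
proof -
  interpret entw_struct K C "E x" by (rule E_ent[OF x])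
  show ?thesis
    by (rule pure_ext[OF _ f g]) (use z p in \<open>auto simp: G_space[OF N x] intro: ml r D_rm[OF N x]\<close>)
qed

lemma G_mor:
  assumes N: "N \<in> Ob \<D>" and N': "N' \<in> Ob \<D>" and \<eta>: "\<eta> \<in> Mor \<D> N N'"
  shows "farr \<G> N N' \<eta> \<in> Mor \<C> (fobj \<G> N) (fobj \<G> N')"
proof -
  have 1: "farr \<G> N N' \<eta> \<in> (\<Pi>\<^sub>E x\<in>X. Mor (EMod K C (E x)) (mobj (fobj \<G> N) x) (mobj (fobj \<G> N') x))"
    using G_arr_facts(3)[OF N N' \<eta>] by (auto simp: PiE_iff) (use N N' \<eta> in \<open>simp add: Cofree_def pointwise_def\<close>)
  have 2: "mtr (fobj \<G> N') x y r (farr \<G> N N' \<eta> x r z) = farr \<G> N N' \<eta> y (ao x y r) (mtr (fobj \<G> N) x y r z)"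
    if l: "(x, y) \<in> leq" and r: "r \<in> Ob (E x)" and z: "z \<in> carrier (space (mobj (fobj \<G> N) x) r)" for x y r z
  proof -
    note x = leqD[OF l] and ar = ao_closed[OF l r]
    note g = G_arr_facts[OF N N' \<eta> x(1)] G_arr_facts[OF N N' \<eta> x(2)]
    note m = G_mtr_facts[OF N l r] G_mtr_facts[OF N' l r]
    show ?thesis
      by (rule G_pure_ext[OF x(1) N r z lin_comp[OF m(3) g(1)[OF r]] lin_comp[OF g(4)[OF ar] m(1)]])
        (simp add: g m r ar D_MorD[OF N N' \<eta>] D_ObD(5)[OF N l r] l x)
  qed
  show ?thesis unfolding C_Mor_iff[OF G_ob[OF N] G_ob[OF N']] using 1 2 by auto
qed

lemma G_functor: "cat_functor \<D> \<C> \<G>"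
proof (intro cat_functor.intro C_cat D_cat cat_functor_axioms.intro)
  show "fobj \<G> \<in> Ob \<D> \<rightarrow>\<^sub>E Ob \<C>"
    using G_ob by (auto simp: Cofree_def pointwise_def)
  show "farr \<G> \<in> (\<Pi>\<^sub>E A\<in>Ob \<D>. \<Pi>\<^sub>E B\<in>Ob \<D>. Mor \<D> A B \<rightarrow>\<^sub>E Mor \<C> (fobj \<G> A) (fobj \<G> B))"
    using G_mor by (intro PiE_I) (auto, auto simp: Cofree_def pointwise_def)
  fix A assume A: "A \<in> Ob \<D>"
  note i = D_Idt_closed[OF A]
  show "farr \<G> A A (Idt \<D> A) = Idt \<C> (fobj \<G> A)"
  proof (rule C_Mor_eqI[OF G_ob[OF A] G_ob[OF A] G_mor[OF A A i] C_Idt_closed[OF G_ob[OF A]]])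
    fix x r z assume x: "x \<in> X" and r: "r \<in> Ob (E x)" and z: "z \<in> carrier (space (mobj (fobj \<G> A) x) r)"
    interpret entw_struct K C "E x" by (rule E_ent[OF x])
    note g = G_arr_facts[OF A A i x]
    have "farr \<G> A A (Idt \<D> A) x r z = z"
      by (rule G_pure_ext[OF x A r z g(1)[OF r] lin_id])
        (simp add: g r D_Idt_app x | rule ml D_rm[OF A x] r)+
    then show "farr \<G> A A (Idt \<D> A) x r z = Idt \<C> (fobj \<G> A) x r z"
      using z by (simp add: C_Idt_app x r)
  qed
  fix B D f g assume B: "B \<in> Ob \<D>" and D: "D \<in> Ob \<D>" and f: "f \<in> Mor \<D> A B" and g: "g \<in> Mor \<D> B D"
  note gf = D_Cmp_closed[OF A B D f g]
  show "farr \<G> A D (Cmp \<D> A B D g f) = Cmp \<C> (fobj \<G> A) (fobj \<G> B) (fobj \<G> D) (farr \<G> B D g) (farr \<G> A B f)"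
  proof (rule C_Mor_eqI[OF G_ob[OF A] G_ob[OF D] G_mor[OF A D gf]
        C_Cmp_closed[OF G_ob[OF A] G_ob[OF B] G_ob[OF D] G_mor[OF A B f] G_mor[OF B D g]]])
    fix x r z assume x: "x \<in> X" and r: "r \<in> Ob (E x)" and z: "z \<in> carrier (space (mobj (fobj \<G> A) x) r)"
    note a = G_arr_facts[OF A D gf x] G_arr_facts[OF A B f x] G_arr_facts[OF B D g x]
    have "farr \<G> A D (Cmp \<D> A B D g f) x r z = farr \<G> B D g x r (farr \<G> A B f x r z)"
      by (rule G_pure_ext[OF x A r z a(1)[OF r] lin_comp[OF a(7)[OF r] a(4)[OF r]]])
        (simp add: a r D_Cmp_app D_MorD(4)[OF A B f] x)
    then show "farr \<G> A D (Cmp \<D> A B D g f) x r z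
      = Cmp \<C> (fobj \<G> A) (fobj \<G> B) (fobj \<G> D) (farr \<G> B D g) (farr \<G> A B f) x r z"
      using z by (simp add: C_Cmp_app x r)
  qed
qed

subsection \<open>The adjunction\<close>

definition adjunct where
  "adjunct M N f = (\<lambda>x\<in>X. entw_struct.adj K C (E x) (mobj M x) (mobj N x) (f x))"

definition coadjunct where
  "coadjunct M N g = (\<lambda>x\<in>X. entw_struct.coadj C (E x) (mobj M x) (mobj N x) (g x))"

context
  fixes M N
  assumes M: "M \<in> Ob \<C>" and N: "N \<in> Ob \<D>"
begin

lemma FM_hom: "\<lbrakk>f \<in> Mor \<D> (fobj \<F> M) N; x \<in> X\<rbrakk> \<Longrightarrow> f x \<in> rmod_hom K (E x) (rmod.truncate (mobj M x)) (mobj N x)"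
  using D_hom[OF F_ob[OF M] N] by (simp add: F_simps[OF M])

lemma GN_hom: "\<lbrakk>g \<in> Mor \<C> M (fobj \<G> N); x \<in> X\<rbrakk>
    \<Longrightarrow> g x \<in> Mor (EMod K C (E x)) (mobj M x) (fobj (cofree K C (E x)) (mobj N x))"
  using C_MorD(1)[OF M G_ob[OF N]] by (simp add: G_simps[OF N])

lemma adjunct_app: "\<lbrakk>x \<in> X; r \<in> Ob (E x); m \<in> carrier (space (mobj M x) r)\<rbrakk> \<Longrightarrow>
  adjunct M N f x r m = tsum (tens K (space (mobj N x) r) C) (coact (mobj M x) r m)
    (\<lambda>a c. tpure K (space (mobj N x) r) C (f x r a) c)"
  by (simp add: adjunct_def entw_struct.adj_def[OF E_ent])

lemma coadjunct_app: "\<lbrakk>x \<in> X; r \<in> Ob (E x); m \<in> carrier (space (mobj M x) r)\<rbrakk> \<Longrightarrow>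
  coadjunct M N g x r m = contract (space (mobj N x) r) (g x r m)"
  by (simp add: coadjunct_def entw_struct.coadj_def[OF E_ent])

text \<open>
Both composites of the square send \<open>m\<close> to \<open>f\<^sub>y(M\<^sub>\<alpha>(m\<^sub>0)) \<otimes> m\<^sub>1\<close>: on one side because \<open>f\<close> commutes with
the structure maps, on the other because \<open>M\<^sub>\<alpha>\<close> is colinear.
\<close>

lemma adjunct_mor:
  assumes f: "f \<in> Mor \<D> (fobj \<F> M) N"
  shows "adjunct M N f \<in> Mor \<C> M (fobj \<G> N)"
proof -
  have 1: "adjunct M N f \<in> (\<Pi>\<^sub>E x\<in>X. Mor (EMod K C (E x)) (mobj M x) (mobj (fobj \<G> N) x))"
    using entw_struct.adj_hom[OF E_ent C_em[OF M] D_rm[OF N] FM_hom[OF f]]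
    by (auto simp: adjunct_def G_simps[OF N])
  have 2: "mtr (fobj \<G> N) x y r (adjunct M N f x r m) = adjunct M N f y (ao x y r) (mtr M x y r m)"
    if l: "(x, y) \<in> leq" and r: "r \<in> Ob (E x)" and m: "m \<in> carrier (space (mobj M x) r)" for x y r m
  proof -
    note x = leqD[OF l] and ar = ao_closed[OF l r]
    interpret entw_morphism K C "E x" "E y" "\<alpha> x y" by (rule E_mor[OF l])
    note Mx = C_em[OF M x(1)] and My = C_em[OF M x(2)]
    note Nx = D_rm[OF N x(1)] and Ny = D_rm[OF N x(2)]
    note lf = S.hom_lin[OF FM_hom[OF f x(1)] S.truncate_rm[OF Mx] Nx r, unfolded truncate_simps]
      T.hom_lin[OF FM_hom[OF f x(2)] T.truncate_rm[OF My] Ny ar, unfolded truncate_simps]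
    note g = G_mtr_facts[OF N l r]
    note mt = D_ObD(5)[OF N l r]
    let ?T = "tens K (space (mobj N y) (ao x y r)) C"
    let ?p = "\<lambda>n c. tpure K (space (mobj N y) (ao x y r)) C n c"
    note h = Mx My Nx Ny r ar m linD(3)[OF lf(1)] lin_comp[OF lf(2)]
    have "mtr (fobj \<G> N) x y r (adjunct M N f x r m)
      = mtr (fobj \<G> N) x y r (tsum (tens K (space (mobj N x) r) C) (coact (mobj M x) r m)
          (\<lambda>a c. tpure K (space (mobj N x) r) C (f x r a) c))"
      by (simp add: adjunct_app x r m)
    also have "\<dots> = tsum ?T (coact (mobj M x) r m) (\<lambda>a c. mtr (fobj \<G> N) x y r (tpure K (space (mobj N x) r) C (f x r a) c))"
      by (rule lin_sum[OF _ _ _ g(1)]) (rule ml h | assumption)+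
    also have "\<dots> = tsum ?T (coact (mobj M x) r m) (\<lambda>a c. ?p (f y (ao x y r) (mtr M x y r a)) c)"
    proof (rule sum_cong, (rule ml h | assumption)+)
      fix a c assume a: "a \<in> carrier (space (mobj M x) r)" and c: "c \<in> carrier C"
      then have "mtr N x y r (f x r a) = f y (ao x y r) (mtr M x y r a)"
        using D_MorD(2)[OF F_ob[OF M] N f l r, of a] by (simp add: F_simps[OF M] x l)
      then show "mtr (fobj \<G> N) x y r (tpure K (space (mobj N x) r) C (f x r a) c) = ?p (f y (ao x y r) (mtr M x y r a)) c"
        using g(2)[OF linD(3)[OF lf(1) a] c] by simp
    qed
    also have "\<dots> = tsum ?T (coact (mobj M y) (ao x y r) (mtr M x y r m)) (\<lambda>a c. ?p (f y (ao x y r) a) c)"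
      by (rule S.emod_hom_sum[OF C_ObD(2)[OF M l] Mx eres_em[OF My] r _ m, unfolded eres_simps[OF My], symmetric])
        (rule T.rm_mod[OF T.em_rm[OF My] ar] T.rm_mod[OF Ny ar] | rule ml h linD(3)[OF lf(2)] | assumption)+
    also have "\<dots> = adjunct M N f y (ao x y r) (mtr M x y r m)"
      using C_ObD(5)[OF M l r m] by (simp add: adjunct_app x ar eres_simps[OF My])
    finally show ?thesis .
  qed
  show ?thesis unfolding C_Mor_iff[OF M G_ob[OF N]] using 1 2 by auto
qed

lemma coadjunct_mor:
  assumes g: "g \<in> Mor \<C> M (fobj \<G> N)"
  shows "coadjunct M N g \<in> Mor \<D> (fobj \<F> M) N"
proof -
  have 1: "coadjunct M N g \<in> (\<Pi>\<^sub>E x\<in>X. Mor (RMod K (E x)) (mobj (fobj \<F> M) x) (mobj N x))"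
    using entw_struct.coadj_hom[OF E_ent C_em[OF M] D_rm[OF N] GN_hom[OF g]]
    by (auto simp: coadjunct_def F_simps[OF M] RMod_simps)
  have 2: "mtr N x y r (coadjunct M N g x r m) = coadjunct M N g y (ao x y r) (mtr M x y r m)"
    if l: "(x, y) \<in> leq" and r: "r \<in> Ob (E x)" and m: "m \<in> carrier (space (mobj M x) r)" for x y r m
  proof -
    note x = leqD[OF l] and ar = ao_closed[OF l r]
    interpret entw_morphism K C "E x" "E y" "\<alpha> x y" by (rule E_mor[OF l])
    note Nx = D_rm[OF N x(1)] and Ny = D_rm[OF N x(2)]
    have gm: "g x r m \<in> carrier (tens K (space (mobj N x) r) C)"
      using C_MorD(4)[OF M G_ob[OF N] g x(1) r m] by (simp add: G_space[OF N x(1)])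
    have "mtr N x y r (coadjunct M N g x r m)
      = contract (space (mobj N y) (ao x y r)) (mtr (fobj \<G> N) x y r (g x r m))"
      using S.contract_cofm[OF Nx rres_rm[OF Ny] D_mtr[OF N l] r gm]
      by (simp add: coadjunct_app x r m rres_simps[OF Ny] G_simps[OF N])
    also have "\<dots> = coadjunct M N g y (ao x y r) (mtr M x y r m)"
      using C_MorD(2)[OF M G_ob[OF N] g l r m] C_ObD(5)[OF M l r m] by (simp add: coadjunct_app x ar)
    finally show ?thesis .
  qed
  show ?thesis unfolding D_Mor_iff[OF F_ob[OF M] N] using 1 2 leqD by (auto simp: F_simps[OF M])
qed

lemma adjunct_bij: "bij_betw (adjunct M N) (Mor \<D> (fobj \<F> M) N) (Mor \<C> M (fobj \<G> N))"
proof (rule bij_betwI[where g = "coadjunct M N"])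
  fix f assume f: "f \<in> Mor \<D> (fobj \<F> M) N"
  show "coadjunct M N (adjunct M N f) = f"
    by (rule D_Mor_eqI[OF F_ob[OF M] N coadjunct_mor[OF adjunct_mor[OF f]] f])
      (simp add: F_simps[OF M] coadjunct_def adjunct_def entw_struct.coadj_adj[OF E_ent C_em[OF M] D_rm[OF N] FM_hom[OF f]])
next
  fix g assume g: "g \<in> Mor \<C> M (fobj \<G> N)"
  show "adjunct M N (coadjunct M N g) = g"
    by (rule C_Mor_eqI[OF M G_ob[OF N] adjunct_mor[OF coadjunct_mor[OF g]] g])
      (simp add: coadjunct_def adjunct_def entw_struct.adj_coadj[OF E_ent C_em[OF M] D_rm[OF N] GN_hom[OF g]])
qed (use adjunct_mor coadjunct_mor in auto)

end

lemma adjunct_natural: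
  assumes A: "A \<in> Ob \<C>" and A': "A' \<in> Ob \<C>" and B: "B \<in> Ob \<D>" and B': "B' \<in> Ob \<D>"
    and h: "h \<in> Mor \<C> A' A" and k: "k \<in> Mor \<D> B B'" and f: "f \<in> Mor \<D> (fobj \<F> A) B"
  shows "adjunct A' B' (Cmp \<D> (fobj \<F> A') B B' k (Cmp \<D> (fobj \<F> A') (fobj \<F> A) B f (farr \<F> A' A h)))
    = Cmp \<C> A' (fobj \<G> B) (fobj \<G> B') (farr \<G> B B' k) (Cmp \<C> A' A (fobj \<G> B) (adjunct A B f) h)"
    (is "adjunct A' B' ?kfh = ?r")
proof -
  note FA = F_ob[OF A] and FA' = F_ob[OF A'] and GB = G_ob[OF B] and GB' = G_ob[OF B']
  note h' = F_mor[OF A' A h]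
  note fh = D_Cmp_closed[OF FA' FA B h' f]
  have kfh: "?kfh \<in> Mor \<D> (fobj \<F> A') B'"
    unfolding F_simps(3)[OF A' A h] by (rule D_Cmp_closed[OF FA' B B' fh k])
  note af = adjunct_mor[OF A B f]
  note afh = C_Cmp_closed[OF A' A GB h af]
  show ?thesis
  proof (rule C_Mor_eqI[OF A' GB' adjunct_mor[OF A' B' kfh] C_Cmp_closed[OF A' GB GB' afh G_mor[OF B B' k]]])
    fix x r m assume x: "x \<in> X" and r: "r \<in> Ob (E x)" and m: "m \<in> carrier (space (mobj A' x) r)"
    interpret entw_struct K C "E x" by (rule E_ent[OF x])
    note a = C_em[OF A x] C_em[OF A' x] and b = D_rm[OF B x] D_rm[OF B' x]
    note lh = emod_hom_lin[OF C_MorD(1)[OF A' A h x] a(2,1) r]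
    note lf = hom_lin[OF FM_hom[OF A B f x] truncate_rm[OF a(1)] b(1) r, unfolded truncate_simps]
    note g = G_arr_facts[OF B B' k x]
    note hh = a b r m linD(3)[OF lh] linD(3)[OF lf] lin_comp[OF lf]
    have hm: "h x r m \<in> carrier (space (mobj A x) r)" by (rule hh)+
    let ?T = "tens K (space (mobj B' x) r) C"
    have "?r x r m = farr \<G> B B' k x r (tsum (tens K (space (mobj B x) r) C) (coact (mobj A x) r (h x r m))
        (\<lambda>a c. tpure K (space (mobj B x) r) C (f x r a) c))"
      by (simp add: C_Cmp_app x r m adjunct_app[OF A B] hm)
    also have "\<dots> = farr \<G> B B' k x r (tsum (tens K (space (mobj B x) r) C) (coact (mobj A' x) r m)
        (\<lambda>a c. tpure K (space (mobj B x) r) C (f x r (h x r a)) c))"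
      by (subst emod_hom_sum[OF C_MorD(1)[OF A' A h x] a(2,1) r _ m]) (rule ml hh refl | assumption)+
    also have "\<dots> = tsum ?T (coact (mobj A' x) r m) (\<lambda>a c. farr \<G> B B' k x r (tpure K (space (mobj B x) r) C (f x r (h x r a)) c))"
      by (rule lin_sum[OF _ _ _ g(1)[OF r]]) (rule ml hh | assumption)+
    also have "\<dots> = tsum ?T (coact (mobj A' x) r m) (\<lambda>a c. tpure K (space (mobj B' x) r) C (?kfh x r a) c)"
    proof (rule sum_cong, (rule ml hh | assumption)+)
      fix m c assume m: "m \<in> carrier (space (mobj A' x) r)" and c: "c \<in> carrier C"
      have "f x r (h x r m) \<in> carrier (space (mobj B x) r)" by (rule hh m)+
      then show "farr \<G> B B' k x r (tpure K (space (mobj B x) r) C (f x r (h x r m)) c)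
        = tpure K (space (mobj B' x) r) C (?kfh x r m) c"
        using g(2)[OF r _ c] m x r by (simp add: D_Cmp_app F_simps[OF A'] F_simps(3)[OF A' A h])
    qed
    also have "\<dots> = adjunct A' B' ?kfh x r m"
      by (simp add: adjunct_app[OF A' B'] x r m)
    finally show "adjunct A' B' ?kfh x r m = ?r x r m" by simp
  qed
qed

theorem Cofree_right_adjoint: "right_adjoint \<C> \<D> \<F> \<G>"
  unfolding right_adjoint_def
  using F_functor G_functor adjunct_bij adjunct_natural by blast

end

section \<open>The zero entwined module\<close>

text \<open>
The underlying set must be a subset of the type of elements, and \<open>undefined\<close> is an available element
of it. With this choice the constant zero function, the zero morphism and the identity of the zero
module are the same extensional function.
\<close>

definition zmod :: "('k, 'u) module" where
  "zmod = \<lparr>carrier = {undefined}, mult = undefined, one = undefined, zero = undefined,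
    add = (\<lambda>_ _. undefined), smult = (\<lambda>_ _. undefined)\<rparr>"

definition zem :: "('k, 'r) ring_scheme \<Rightarrow> ('k, 'u::infinite) coalgebra \<Rightarrow> ('k, 'o, 'u) emod" where
  "zem K C = \<lparr>space = (\<lambda>r. zmod), act = (\<lambda>s r f. \<lambda>m\<in>{undefined}. undefined),
    coact = (\<lambda>r. \<lambda>m\<in>{undefined}. \<zero>\<^bsub>tens K (zmod :: ('k, 'u) module) C\<^esub>)\<rparr>"

lemma zem_simps [simp]: "space (zem K C) r = zmod" "act (zem K C) s r f = (\<lambda>m\<in>{undefined}. undefined)"
  "coact (zem K C) r = (\<lambda>m\<in>{undefined}. \<zero>\<^bsub>tens K zmod C\<^esub>)"
  by (simp_all add: zem_def)

lemma zmod_simps [simp]: "carrier zmod = {undefined}" "\<zero>\<^bsub>zmod\<^esub> = undefined"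
  "a \<oplus>\<^bsub>zmod\<^esub> b = undefined" "k \<odot>\<^bsub>zmod\<^esub> b = undefined"
  by (simp_all add: zmod_def)

lemma zmod_module: "cring K \<Longrightarrow> module K zmod"
  by (rule moduleI) (auto intro!: abelian_groupI)

text \<open>
Every equation between tensors over the zero module is therefore trivial, which proves the comodule
and entwining laws of \<open>zem\<close> below.
\<close>

lemma tens_zmod:
  fixes W :: "('k, 'u::infinite, 'm) module_scheme"
  assumes K: "cring K" and W: "module K W" and z: "z \<in> carrier (tens K zmod W)"
  shows "z = \<zero>\<^bsub>tens K zmod W\<^esub>"
proof -
  note Z = zmod_module[OF K]
  interpret T: module K "tens K zmod W" by (rule module_tens[OF Z W])
  show ?thesis
  proof (rule tens_induct[OF Z W z])
    fix v w :: 'u assume v: "v \<in> carrier zmod" and w: "w \<in> carrier W"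
    show "tpure K zmod W v w = \<zero>\<^bsub>tens K zmod W\<^esub>"
      using lin_zero[OF lin_tpure1[OF lin_id[OF Z] W w]] v by simp
  qed simp
qed

context entw_struct begin

lemma cring_K: "cring K"
  using mod_C by (simp add: module_def)

lemma zem_em: "entwined_module K C E (zem K C)"
proof -
  have Z: "module K zmod" by (rule zmod_module[OF cring_K])
  note tz = tens_zmod[OF cring_K]
  have cz: "(\<lambda>m\<in>{undefined}. \<zero>\<^bsub>tens K zmod C\<^esub>) \<in> Lin K zmod (tens K zmod C)"
    using Lin_restrict_iff[OF Z module_tens[OF Z mod_C]] lin_const_zero[OF Z module_tens[OF Z mod_C]] by auto
  have zc: "\<zero>\<^bsub>tens K zmod C\<^esub> \<in> carrier (tens K zmod C)"
    using linD(3)[OF Lin_lin[OF cz Z module_tens[OF Z mod_C]], of undefined] by simp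
  have az: "(\<lambda>m\<in>{undefined}. undefined) \<in> Lin K zmod zmod"
    by (auto simp: Lin_def)
  have rm: "right_module K E (zem K C)"
    by (rule right_module.intro) (use Z az in auto)
  have co: "comodule K C zmod (\<lambda>m\<in>{undefined}. \<zero>\<^bsub>tens K zmod C\<^esub>)"
  proof (intro comodule.intro comodule_axioms.intro Z cz)
    fix v :: 'u assume v: "v \<in> carrier zmod"
    let ?\<rho> = "\<lambda>m\<in>{undefined}. \<zero>\<^bsub>tens K zmod C\<^esub>" let ?C2 = "tens K C C" let ?T = "tens K zmod ?C2"
    have \<rho>: "?\<rho> a \<in> carrier (tens K zmod C)" if "a \<in> carrier zmod" for a using zc that by auto
    note h = Z v \<rho>
    have "tsum ?T (?\<rho> v) (\<lambda>a d. tsum ?T (?\<rho> a) (\<lambda>a' b. tpure K zmod ?C2 a' (tpure K C C b d))) = \<zero>\<^bsub>?T\<^esub>"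
      by (rule tz) (rule ml h | assumption)+
    moreover have "tsum ?T (?\<rho> v) (\<lambda>a d. tpure K zmod ?C2 a (comul C d)) = \<zero>\<^bsub>?T\<^esub>"
      by (rule tz) (rule ml h | assumption)+
    ultimately show "tsum ?T (?\<rho> v) (\<lambda>a d. tsum ?T (?\<rho> a) (\<lambda>a' b. tpure K zmod ?C2 a' (tpure K C C b d)))
      = tsum ?T (?\<rho> v) (\<lambda>a d. tpure K zmod ?C2 a (comul C d))" by simp
    let ?Z = "zmod :: ('k, 'u) module"
    have "contract ?Z (?\<rho> v) \<in> carrier ?Z"
      by (rule ml h | assumption)+
    then show "contract ?Z (?\<rho> v) = v" using v by simp
  qed
  show ?thesis
  proof (intro entwined_module.intro entwined_module_axioms.intro rm, unfold zem_simps)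
    show "comodule K C zmod (\<lambda>m\<in>{undefined}. \<zero>\<^bsub>tens K zmod C\<^esub>)" by (rule co)
    fix s r f and m :: 'u assume s: "s \<in> Ob E" and r: "r \<in> Ob E" and f: "f \<in> Mor E s r" and m: "m \<in> carrier zmod"
    have f: "f \<in> carrier (homs E s r)" using f s r by (simp add: homs_carrier)
    let ?\<rho> = "\<lambda>m\<in>{undefined}. \<zero>\<^bsub>tens K zmod C\<^esub>"
    have \<rho>: "?\<rho> a \<in> carrier (tens K zmod C)" if "a \<in> carrier zmod" for a using zc that by auto
    have a: "(\<lambda>m\<in>{undefined}. undefined) a \<in> carrier zmod" if "a \<in> carrier zmod" for a :: 'u using that by simp
    note h = Z s r f m \<rho> a
    have "tsum (tens K zmod C) (?\<rho> m) (\<lambda>m0 m1. tsum (tens K zmod C) (entw_app K C E s r m1 f)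
      (\<lambda>f' c. tpure K zmod C ((\<lambda>m\<in>{undefined}. undefined) m0) c)) = \<zero>\<^bsub>tens K zmod C\<^esub>"
      by (rule tz) (rule ml h | assumption)+
    moreover have "?\<rho> ((\<lambda>m\<in>{undefined}. undefined) m) = \<zero>\<^bsub>tens K zmod C\<^esub>"
      by (rule tz) (rule ml h | assumption)+
    ultimately show "?\<rho> ((\<lambda>m\<in>{undefined}. undefined) m)
      = tsum (tens K zmod C) (?\<rho> m) (\<lambda>m0 m1. tsum (tens K zmod C) (entw_app K C E s r m1 f)
      (\<lambda>f' c. tpure K zmod C ((\<lambda>m\<in>{undefined}. undefined) m0) c))" by simp
  qed
qed

lemma zero_hom:
  assumes A: "entwined_module K C E A" and B: "entwined_module K C E B"
    and z: "\<And>r. r \<in> Ob E \<Longrightarrow> space B r = zmod"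
  shows "(\<lambda>r\<in>Ob E. \<lambda>m\<in>carrier (space A r). undefined) \<in> Mor (EMod K C E) A B"
proof -
  let ?z = "\<lambda>r\<in>Ob E. \<lambda>m\<in>carrier (space A r). undefined"
  have Z: "module K zmod" by (rule zmod_module[OF cring_K])
  have L: "?z r \<in> Lin K (space A r) (space B r)" if r: "r \<in> Ob E" for r
    using r z[OF r] rm_mod[OF em_rm[OF A] r] lin_const_zero[OF rm_mod[OF em_rm[OF A] r] Z]
    by (simp add: Lin_restrict_iff Z)
  have a: "?z s (act A s r f m) = act B s r f (?z r m)"
    if s: "s \<in> Ob E" and r: "r \<in> Ob E" and f: "f \<in> carrier (homs E s r)" and m: "m \<in> carrier (space A r)" for s r f m
  proof -
    have "act A s r f m \<in> carrier (space A s)" by (rule ml A s r f m)+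
    moreover have "act B s r f undefined \<in> carrier (space B s)"
      by (rule act_cl[OF em_rm[OF B] f _ s r]) (simp add: z r)
    ultimately show ?thesis using s r m by (simp add: z)
  qed
  have c: "colinear K C (space A r) (coact A r) (space B r) (coact B r) (?z r)" if r: "r \<in> Ob E" for r
    unfolding colinear_def z[OF r]
  proof
    fix v assume v: "v \<in> carrier (space A r)"
    have zz: "?z r a \<in> carrier zmod" if "a \<in> carrier (space A r)" for a using that r by simp
    note h = A r v Z zz
    have "tsum (tens K zmod C) (coact A r v) (\<lambda>a c. tpure K zmod C (?z r a) c) = \<zero>\<^bsub>tens K zmod C\<^esub>"
      by (rule tens_zmod[OF cring_K mod_C]) (rule ml h | assumption)+
    moreover have "coact B r (?z r v) = \<zero>\<^bsub>tens K zmod C\<^esub>"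
      by (rule tens_zmod[OF cring_K mod_C]) (use coact_cl[OF B r, of undefined] z[OF r] r v in simp)
    ultimately show "tsum (tens K zmod C) (coact A r v) (\<lambda>a c. tpure K zmod C (?z r a) c) = coact B r (?z r v)" by simp
  qed
  show ?thesis using L a c by (auto simp: EMod_simps rmod_hom_def homs_carrier)
qed

lemma cofm_Idt:
  assumes N: "right_module K E N" and r: "r \<in> Ob E" and z: "z \<in> carrier (tens K (space N r) C)"
  shows "cofm N N (\<lambda>r\<in>Ob E. \<lambda>m\<in>carrier (space N r). m) r z = z"
proof -
  let ?i = "\<lambda>r\<in>Ob E. \<lambda>m\<in>carrier (space N r). m"
  have i: "?i \<in> rmod_hom K E N N" using rmod_Idt_cl[OF N] by (simp add: RMod_simps)
  show ?thesis
    by (rule pure_ext[OF z lin_cofm[OF N N i r] lin_id]) (simp add: cofm_pure[OF N N i r] r | rule ml N r)+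
qed

end

context entw_representation begin

section \<open>Coextension of an entwined module along the poset\<close>

text \<open>
The coextension of \<open>M\<close> from \<open>x\<close>: at \<open>y \<le> x\<close> the restriction of \<open>M\<close>, with identities as structure maps,
and zero at all other \<open>y\<close>. At \<open>y = x\<close> the record \<open>M\<close> itself is used instead of its restriction along
the identity, which could differ from \<open>M\<close> outside the objects; this makes the component at \<open>x\<close>
literally \<open>M\<close>.
\<close>

definition coe :: "'x \<Rightarrow> ('k, 'o, 'u) emod \<Rightarrow> ('x, ('k, 'o, 'u) emod, 'o \<Rightarrow> 'u \<Rightarrow> 'u) repmod" where
  "coe x M = (let m = (\<lambda>y. if y = x then M else if (y, x) \<in> leq then fobj (ERes K C \<R> y x) M else zem K C)
    in \<lparr>mobj = m, mtr = (\<lambda>y z. \<lambda>r\<in>Ob (E y). \<lambda>n\<in>carrier (space (m y) r). if (z, x) \<in> leq then n else undefined)\<rparr>)"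

lemma coe_mobj: "mobj (coe x M) x = M" "(y, x) \<notin> leq \<Longrightarrow> x \<in> X \<Longrightarrow> mobj (coe x M) y = zem K C"
  using leq_refl by (auto simp: coe_def)

lemma coe_mtr: "mtr (coe x M) y z = (\<lambda>r\<in>Ob (E y). \<lambda>n\<in>carrier (space (mobj (coe x M) y) r). if (z, x) \<in> leq then n else undefined)"
  by (simp add: coe_def Let_def)

context
  fixes x :: 'x and M :: "('k, 'o, 'u) emod"
  assumes x: "x \<in> X" and M: "entwined_module K C (E x) M"
begin

lemma coe_em: "y \<in> X \<Longrightarrow> entwined_module K C (E y) (mobj (coe x M) y)"
  using M entw_morphism.eres_em[OF E_mor M] entw_struct.zem_em[OF E_ent]
  by (auto simp: coe_def Let_def)

lemma coe_agree: "(y, x) \<in> leq \<Longrightarrow> em_agree (E y) (mobj (coe x M) y) (fobj (ERes K C \<R> y x) M)"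
proof -
  assume l: "(y, x) \<in> leq"
  note s = entw_morphism.eres_simps[OF E_mor[OF leq_refl[OF x]] M]
  show ?thesis
  proof (cases "y = x")
    case True
    have "em_agree (E x) M (fobj (ERes K C \<R> x x) M)"
      unfolding em_agree_def s by (simp add: alpha_id[OF x] fun_id_def)
    then show ?thesis using True by (simp add: coe_mobj)
  qed (use l in \<open>simp add: coe_def Let_def em_agree_refl\<close>)
qed

lemma coe_agree_trans:
  assumes l: "(y, z) \<in> leq" "(z, x) \<in> leq"
  shows "em_agree (E y) (mobj (coe x M) y) (fobj (ERes K C \<R> y z) (mobj (coe x M) z))"
proof -
  interpret Y: entw_morphism K C "E y" "E z" "\<alpha> y z" by (rule E_mor[OF l(1)])
  interpret Z: entw_morphism K C "E z" "E x" "\<alpha> z x" by (rule E_mor[OF l(2)])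
  interpret YX: entw_morphism K C "E y" "E x" "\<alpha> y x" by (rule E_mor[OF leq_trans[OF l]])
  have "em_agree (E y) (fobj (ERes K C \<R> y x) M) (fobj (ERes K C \<R> y z) (fobj (ERes K C \<R> z x) M))"
    unfolding em_agree_def YX.eres_simps[OF M] Y.eres_simps[OF Z.eres_em[OF M]] Z.eres_simps[OF M]
    by (simp add: alpha_comp[OF l] fun_comp_def)
  moreover have "em_agree (E y) (fobj (ERes K C \<R> y z) (fobj (ERes K C \<R> z x) M)) (fobj (ERes K C \<R> y z) (mobj (coe x M) z))"
    using Y.eres_agree[OF Z.eres_em[OF M] coe_em[OF leqD(2)[OF l(1)]] em_agree_sym[OF coe_agree[OF l(2)]]] .
  ultimately show ?thesis using coe_agree[OF leq_trans[OF l]] em_agree_trans by blast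
qed

lemma coe_mtr_mor:
  assumes l: "(y, z) \<in> leq"
  shows "mtr (coe x M) y z \<in> Mor (EMod K C (E y)) (mobj (coe x M) y) (fobj (ERes K C \<R> y z) (mobj (coe x M) z))"
proof -
  note y = leqD[OF l]
  interpret Y: entw_morphism K C "E y" "E z" "\<alpha> y z" by (rule E_mor[OF l])
  show ?thesis
  proof (cases "(z, x) \<in> leq")
    case True
    have "Idt (EMod K C (E y)) (mobj (coe x M) y) \<in> Mor (EMod K C (E y)) (mobj (coe x M) y) (mobj (coe x M) y)"
      by (rule Y.S.emod_Idt_cl[OF coe_em[OF y(1)]])
    then show ?thesis
      using True Mor_agree[where K = K and C = C, OF em_agree_refl coe_agree_trans[OF l True]]
      by (simp add: coe_mtr EMod_simps(4))
  next
    case False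
    have "space (fobj (ERes K C \<R> y z) (mobj (coe x M) z)) r = zmod" for r
      unfolding Y.eres_simps(1)[OF coe_em[OF y(2)]] using False x by (simp add: coe_mobj)
    then show ?thesis
      using Y.S.zero_hom[OF coe_em[OF y(1)] Y.eres_em[OF coe_em[OF y(2)]]] False by (simp add: coe_mtr)
  qed
qed

text \<open>
For \<open>w \<le> y \<le> z\<close> the structure maps compose because \<open>z \<le> x\<close> implies \<open>y \<le> x\<close>: a structure map out of a
zero component into a nonzero one never occurs.
\<close>

lemma coe_ob: "coe x M \<in> Ob \<C>"
  unfolding C_Ob_iff
proof (intro conjI ballI allI impI)
  fix y assume y: "y \<in> X"
  show "mobj (coe x M) y \<in> Ob (EMod K C (E y))" using coe_em[OF y] by (simp add: EMod_simps(1))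
  fix r m assume "r \<in> Ob (E y)" "m \<in> carrier (space (mobj (coe x M) y) r)"
  then show "mtr (coe x M) y y r m = m"
    by (cases "(y, x) \<in> leq") (auto simp: coe_mtr coe_mobj x)
next
  fix w y z r m assume l: "(w, y) \<in> leq \<and> (y, z) \<in> leq" and r: "r \<in> Ob (E w)"
    and m: "m \<in> carrier (space (mobj (coe x M) w) r)"
  then have l: "(w, y) \<in> leq" "(y, z) \<in> leq" by simp_all
  have "mtr (coe x M) w y r m \<in> carrier (space (mobj (coe x M) y) (ao w y r))"
    using CR.Mor_closed[OF leqD(1)[OF l(1)] coe_mtr_mor[OF l(1)] r m] 
      entw_morphism.eres_simps(1)[OF E_mor[OF l(1)] coe_em[OF leqD(2)[OF l(1)]]] by simp
  then show "mtr (coe x M) w z r m = mtr (coe x M) y z (ao w y r) (mtr (coe x M) w y r m)"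
    using r m ao_closed[OF l(1) r] leq_trans[OF l(2)] by (auto simp: coe_mtr)
qed (use coe_mtr_mor in auto)

end

text \<open>
The transpose \<open>M \<rightarrow> coe x N\<close> of a morphism \<open>f : M\<^sub>x \<rightarrow> N\<close>, under the adjunction between evaluation at \<open>x\<close>
and coextension. Its component at \<open>y \<le> x\<close> is \<open>M\<^sub>y \<rightarrow> \<alpha>\<^sub>* M\<^sub>x \<rightarrow> \<alpha>\<^sub>* N\<close>.
\<close>

definition lift where
  "lift x M f = (\<lambda>y\<in>X. \<lambda>r\<in>Ob (E y). \<lambda>m\<in>carrier (space (mobj M y) r).
     if (y, x) \<in> leq then f (ao y x r) (mtr M y x r m) else undefined)"

context
  fixes x M N f
  assumes x: "x \<in> X" and M: "M \<in> Ob \<C>" and N: "entwined_module K C (E x) N"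
    and f: "f \<in> Mor (EMod K C (E x)) (mobj M x) N"
begin

lemma lift_at: "lift x M f x = f"
proof (rule CR.Mor_eqI[OF x _ f])
  have "f r m = lift x M f x r m" if "r \<in> Ob (E x)" "m \<in> carrier (space (mobj M x) r)" for r m
    using that x by (simp add: lift_def leq_refl ao_id C_ObD(3)[OF M])
  note * = this
  have "lift x M f x = f"
  proof (rule extensionalityI[of _ "Ob (E x)"])
    show "f \<in> extensional (Ob (E x))" using CR.Mor_ext[OF x f] by (auto simp: PiE_iff)
    fix r assume r: "r \<in> Ob (E x)"
    show "lift x M f x r = f r"
      by (rule extensionalityI[of _ "carrier (space (mobj M x) r)"])
        (use CR.Mor_ext[OF x f] r x * in \<open>auto simp: PiE_iff lift_def\<close>)
  qed (simp add: lift_def x)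
  then show "lift x M f x \<in> Mor (EMod K C (E x)) (mobj M x) N" using f by simp
  show "\<And>r m. \<lbrakk>r \<in> Ob (E x); m \<in> carrier (space (mobj M x) r)\<rbrakk> \<Longrightarrow> lift x M f x r m = f r m"
    using * by simp
qed

lemma lift_comp:
  assumes y: "y \<in> X"
  shows "lift x M f y \<in> Mor (EMod K C (E y)) (mobj M y) (mobj (coe x N) y)"
proof (cases "(y, x) \<in> leq")
  case True
  note Mo = C_ObD(1)[OF M]
  have No: "N \<in> Ob (EMod K C (E x))" using N by (simp add: EMod_simps(1))
  \<comment> \<open>the component as a composite \<open>M\<^sub>y \<rightarrow> \<alpha>\<^sub>* M\<^sub>x \<rightarrow> \<alpha>\<^sub>* N\<close> of morphisms\<close>
  let ?c = "Cmp (EMod K C (E y)) (mobj M y) (fobj (ERes K C \<R> y x) (mobj M x)) (fobj (ERes K C \<R> y x) N)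
      (farr (ERes K C \<R> y x) (mobj M x) N f) (mtr M y x)"
  have c: "?c \<in> Mor (EMod K C (E y)) (mobj M y) (fobj (ERes K C \<R> y x) N)"
    by (rule CR.Cmp_cl[OF y Mo[OF y] CR.res_ob[OF True Mo[OF x]] CR.res_ob[OF True No] C_ObD(2)[OF M True]
      CR.res_arr_cl[OF True Mo[OF x] No f]])
  have "lift x M f y = ?c"
    unfolding CR.Cmp_eq[OF y] CR.res_arr[OF True Mo[OF x] No f]
    using True y by (auto simp: lift_def compose_def fun_eq_iff restrict_def)
  then show ?thesis
    using c Mor_agree[where K = K and C = C, OF em_agree_refl coe_agree[OF x N True]] by simp
next
  case False
  have "lift x M f y = (\<lambda>r\<in>Ob (E y). \<lambda>m\<in>carrier (space (mobj M y) r). undefined)"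
    using False y by (simp add: lift_def)
  then show ?thesis
    using entw_struct.zero_hom[OF E_ent[OF y] C_em[OF M y] coe_em[OF x N y]] False x by (simp add: coe_mobj)
qed

lemma lift_mor: "lift x M f \<in> Mor \<C> M (coe x N)"
proof -
  have "mtr (coe x N) y z r (lift x M f y r m) = lift x M f z (ao y z r) (mtr M y z r m)"
    if l: "(y, z) \<in> leq" and r: "r \<in> Ob (E y)" and m: "m \<in> carrier (space (mobj M y) r)" for y z r m
  proof -
    note y = leqD[OF l] and ar = ao_closed[OF l r]
    have c: "lift x M f y r m \<in> carrier (space (mobj (coe x N) y) r)"
      by (rule CR.Mor_closed[OF y(1) lift_comp[OF y(1)] r m])
    show ?thesis
    proof (cases "(z, x) \<in> leq")
      case True
      then show ?thesis
        using c r m y ar C_ObD(4)[OF M l True r m] C_ObD(5)[OF M l r m] leq_trans[OF l True] ao_comp[OF l True r]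
        by (simp add: coe_mtr) (simp add: lift_def)
    next
      case False
      then show ?thesis
        using c r m y ar C_ObD(5)[OF M l r m] by (simp add: coe_mtr) (simp add: lift_def)
    qed
  qed
  then show ?thesis
    unfolding C_Mor_iff[OF M coe_ob[OF x N]] using lift_comp by (auto simp: PiE_iff) (simp add: lift_def)
qed

end

section \<open>Natural transformations are compatible families\<close>

lemma GF_space: "\<lbrakk>M \<in> Ob \<C>; x \<in> X\<rbrakk> \<Longrightarrow> space (mobj (fobj \<G> (fobj \<F> M)) x) r = tens K (space (mobj M x) r) C"
  by (simp add: G_space[OF F_ob] F_simps)

lemma GF_mobj: "\<lbrakk>M \<in> Ob \<C>; x \<in> X\<rbrakk> \<Longrightarrow> mobj (fobj \<G> (fobj \<F> M)) x = fobj (cofree K C (E x)) (rmod.truncate (mobj M x))"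
  by (simp add: G_simps[OF F_ob] F_simps)

text \<open>
Naturality and compatibility, here and in the next lemma, as equations between elements.
\<close>

lemma Nat_GF_iff:
  "\<upsilon> \<in> Nat_GF K C X leq \<R> \<longleftrightarrow> \<upsilon> \<in> (\<Pi>\<^sub>E M\<in>Ob \<C>. Mor \<C> (fobj \<G> (fobj \<F> M)) M) \<and>
    (\<forall>M N \<eta> x r z. M \<in> Ob \<C> \<longrightarrow> N \<in> Ob \<C> \<longrightarrow> \<eta> \<in> Mor \<C> M N \<longrightarrow> x \<in> X \<longrightarrow> r \<in> Ob (E x) \<longrightarrow>
      z \<in> carrier (tens K (space (mobj M x) r) C) \<longrightarrow>
      \<eta> x r (\<upsilon> M x r z) = \<upsilon> N x r (farr (cofree K C (E x)) (rmod.truncate (mobj M x)) (rmod.truncate (mobj N x)) (\<eta> x) r z))"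
proof -
  let ?GF = "fun_comp \<C> \<G> \<F>"
  have P: "(\<Pi>\<^sub>E M\<in>Ob \<C>. Mor \<C> (fobj ?GF M) (fobj (fun_id \<C>) M)) = (\<Pi>\<^sub>E M\<in>Ob \<C>. Mor \<C> (fobj \<G> (fobj \<F> M)) M)"
    by (rule PiE_cong) (simp add: fun_comp_def fun_id_def)
  have e: "Cmp \<C> (fobj ?GF M) (fobj (fun_id \<C>) M) (fobj (fun_id \<C>) N) (farr (fun_id \<C>) M N \<eta>) (\<upsilon> M)
      = Cmp \<C> (fobj ?GF M) (fobj ?GF N) (fobj (fun_id \<C>) N) (\<upsilon> N) (farr ?GF M N \<eta>)
    \<longleftrightarrow> (\<forall>x r z. x \<in> X \<longrightarrow> r \<in> Ob (E x) \<longrightarrow> z \<in> carrier (tens K (space (mobj M x) r) C) \<longrightarrow>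
      \<eta> x r (\<upsilon> M x r z) = \<upsilon> N x r (farr (cofree K C (E x)) (rmod.truncate (mobj M x)) (rmod.truncate (mobj N x)) (\<eta> x) r z))"
    (is "?l = ?r \<longleftrightarrow> ?e")
    if \<upsilon>: "\<upsilon> \<in> (\<Pi>\<^sub>E M\<in>Ob \<C>. Mor \<C> (fobj \<G> (fobj \<F> M)) M)" and M: "M \<in> Ob \<C>" and N: "N \<in> Ob \<C>" and \<eta>: "\<eta> \<in> Mor \<C> M N" for M N \<eta>
  proof -
    note fM = F_ob[OF M] and fN = F_ob[OF N]
    note gM = G_ob[OF fM] and gN = G_ob[OF fN]
    have u: "\<upsilon> M \<in> Mor \<C> (fobj \<G> (fobj \<F> M)) M" "\<upsilon> N \<in> Mor \<C> (fobj \<G> (fobj \<F> N)) N" using \<upsilon> M N by auto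
    have g: "farr \<G> (fobj \<F> M) (fobj \<F> N) \<eta> \<in> Mor \<C> (fobj \<G> (fobj \<F> M)) (fobj \<G> (fobj \<F> N))"
      by (rule G_mor[OF fM fN F_mor[OF M N \<eta>]])
    have l: "?l = Cmp \<C> (fobj \<G> (fobj \<F> M)) M N \<eta> (\<upsilon> M)"
      and r: "?r = Cmp \<C> (fobj \<G> (fobj \<F> M)) (fobj \<G> (fobj \<F> N)) N (\<upsilon> N) (farr \<G> (fobj \<F> M) (fobj \<F> N) \<eta>)"
      using M N \<eta> by (simp_all add: fun_comp_def fun_id_def F_simps)
    have lm: "?l \<in> Mor \<C> (fobj \<G> (fobj \<F> M)) N" unfolding l by (rule C_Cmp_closed[OF gM M N u(1) \<eta>])
    have rm: "?r \<in> Mor \<C> (fobj \<G> (fobj \<F> M)) N" unfolding r by (rule C_Cmp_closed[OF gM gN N g u(2)])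
    have la: "?l x r z = \<eta> x r (\<upsilon> M x r z)" and
      ra: "?r x r z = \<upsilon> N x r (farr (cofree K C (E x)) (rmod.truncate (mobj M x)) (rmod.truncate (mobj N x)) (\<eta> x) r z)"
      if "x \<in> X" "r \<in> Ob (E x)" "z \<in> carrier (tens K (space (mobj M x) r) C)" for x r z
      unfolding l r using that M N \<eta> F_mor[OF M N \<eta>]
      by (simp_all add: C_Cmp_app GF_space G_simps(3)[OF fM fN] F_simps)
    show ?thesis
    proof
      assume "?l = ?r" then show ?e using la ra by metis
    next
      assume ?e then show "?l = ?r"
        by (intro C_Mor_eqI[OF gM N lm rm]) (simp add: la ra GF_space M)
    qed
  qed
  show ?thesis
    unfolding Nat_GF_def NatTrans_def P
    by (rule iffI; intro CollectI conjI; (elim CollectE conjE)?) (simp_all add: e)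
qed

lemma compatible_iff:
  "\<upsilon> \<in> compatible_families K C X leq \<R> \<longleftrightarrow> \<upsilon> \<in> (\<Pi>\<^sub>E x\<in>X. Nat_GF_at K C (E x)) \<and>
    (\<forall>x y M r z. (x, y) \<in> leq \<longrightarrow> M \<in> Ob \<C> \<longrightarrow> r \<in> Ob (E x) \<longrightarrow> z \<in> carrier (tens K (space (mobj M x) r) C) \<longrightarrow>
      mtr M x y r (\<upsilon> x (mobj M x) r z) = \<upsilon> y (mobj M y) (ao x y r) (mtr (fobj \<G> (fobj \<F> M)) x y r z))"
proof -
  let ?GF = "\<lambda>z. cofree_forget K C (E z)"
  have e: "Cmp (EMod K C (E x)) (fobj (?GF x) (mobj M x)) (mobj M x) (fobj (ERes K C \<R> x y) (mobj M y))
              (mtr M x y) (\<upsilon> x (mobj M x))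
            = Cmp (EMod K C (E x)) (fobj (?GF x) (mobj M x)) (fobj (?GF x) (fobj (ERes K C \<R> x y) (mobj M y))) (fobj (ERes K C \<R> x y) (mobj M y))
                (farr (ERes K C \<R> x y) (fobj (?GF y) (mobj M y)) (mobj M y) (\<upsilon> y (mobj M y)))
                (farr (?GF x) (mobj M x) (fobj (ERes K C \<R> x y) (mobj M y)) (mtr M x y))
    \<longleftrightarrow> (\<forall>r z. r \<in> Ob (E x) \<longrightarrow> z \<in> carrier (tens K (space (mobj M x) r) C) \<longrightarrow>
      mtr M x y r (\<upsilon> x (mobj M x) r z) = \<upsilon> y (mobj M y) (ao x y r) (mtr (fobj \<G> (fobj \<F> M)) x y r z))"
    if \<upsilon>: "\<upsilon> \<in> (\<Pi>\<^sub>E x\<in>X. Nat_GF_at K C (E x))" and l: "(x, y) \<in> leq" and M: "M \<in> Ob \<C>" for x y M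
  proof -
    note x = leqD[OF l]
    interpret entw_morphism K C "E x" "E y" "\<alpha> x y" by (rule E_mor[OF l])
    note Mx = C_em[OF M x(1)] and My = C_em[OF M x(2)]
    have O: "fobj (?GF z) N = fobj (cofree K C (E z)) (rmod.truncate N)" if "entwined_module K C (E z) N" for z N
      using that by (simp add: fun_comp_def forget_def EMod_simps(1))
    have A: "farr (?GF x) (mobj M x) (fobj (ERes K C \<R> x y) (mobj M y)) (mtr M x y) = mtr (fobj \<G> (fobj \<F> M)) x y"
      using Mx eres_em[OF My] C_ObD(2)[OF M l] l x M truncate_eres[OF My]
      by (simp add: fun_comp_def forget_def EMod_simps(1) G_simps[OF F_ob] F_simps)
    have uy: "\<upsilon> y \<in> Nat_GF_at K C (E y)" using \<upsilon> x by auto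
    have B: "farr (ERes K C \<R> x y) (fobj (?GF y) (mobj M y)) (mobj M y) (\<upsilon> y (mobj M y)) = (\<lambda>r\<in>Ob (E x). \<upsilon> y (mobj M y) (ao x y r))"
      unfolding O[OF My]
      by (rule eres_arr[OF T.cof_em[OF T.truncate_rm[OF My]] My T.nat_at_hom[OF uy My]])
    show ?thesis
      unfolding EMod_simps(3) restrict_compose_eq_iff A B O[OF Mx] S.cof_space[OF S.truncate_rm[OF Mx]] by auto
  qed
  show ?thesis
    unfolding compatible_families_def Let_def mem_Collect_eq
    by (rule conj_cong[OF refl]) (auto simp: e)
qed

text \<open>
The component at \<open>x\<close> of a natural transformation, evaluated on entwined modules over \<open>\<R>\<^sub>x\<close> through
their coextensions.
\<close>

definition hat where
  "hat \<upsilon> = (\<lambda>x\<in>X. \<lambda>M\<in>Ob (EMod K C (E x)). \<upsilon> (coe x M) x)"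

context
  fixes \<upsilon>
  assumes \<upsilon>: "\<upsilon> \<in> Nat_GF K C X leq \<R>"
begin

lemma nat_mor: "M \<in> Ob \<C> \<Longrightarrow> \<upsilon> M \<in> Mor \<C> (fobj \<G> (fobj \<F> M)) M"
  using \<upsilon> by (auto simp: Nat_GF_iff)

text \<open>
Naturality of \<open>\<upsilon>\<close> at the transpose of \<open>f\<close>, read off at \<open>x\<close>. Taking for \<open>M\<close> a coextension gives
naturality of \<open>hat \<upsilon> x\<close>, and taking for \<open>f\<close> the identity gives \<open>hat_component\<close>.
\<close>

lemma hat_key:
  assumes x: "x \<in> X" and M: "M \<in> Ob \<C>" and N: "entwined_module K C (E x) N"
    and f: "f \<in> Mor (EMod K C (E x)) (mobj M x) N" and r: "r \<in> Ob (E x)"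
    and z: "z \<in> carrier (tens K (space (mobj M x) r) C)"
  shows "f r (\<upsilon> M x r z) = hat \<upsilon> x N r (farr (cofree K C (E x)) (rmod.truncate (mobj M x)) (rmod.truncate N) f r z)"
proof -
  have "lift x M f x r (\<upsilon> M x r z) = \<upsilon> (coe x N) x r (farr (cofree K C (E x)) (rmod.truncate (mobj M x)) (rmod.truncate (mobj (coe x N) x)) (lift x M f x) r z)"
    using \<upsilon> M coe_ob[OF x N] lift_mor[OF x M N f] x r z unfolding Nat_GF_iff by blast
  then show ?thesis using x N by (simp add: lift_at[OF x M N f] coe_mobj hat_def EMod_simps(1))
qed

lemma hat_at: assumes x: "x \<in> X" shows "hat \<upsilon> x \<in> Nat_GF_at K C (E x)"
  unfolding entw_struct.Nat_GF_at_iff[OF E_ent[OF x]]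
proof (intro conjI allI impI)
  show "hat \<upsilon> x \<in> (\<Pi>\<^sub>E M\<in>{M. entwined_module K C (E x) M}. Mor (EMod K C (E x)) (fobj (cofree K C (E x)) (rmod.truncate M)) M)"
  proof (rule PiE_I)
    fix M :: "('k, 'o, 'u) emod" assume "M \<in> {M. entwined_module K C (E x) M}"
    then have M: "entwined_module K C (E x) M" by simp
    note c = coe_ob[OF x M]
    show "hat \<upsilon> x M \<in> Mor (EMod K C (E x)) (fobj (cofree K C (E x)) (rmod.truncate M)) M"
      using C_MorD(1)[OF G_ob[OF F_ob[OF c]] c nat_mor[OF c] x] x M
      by (simp add: GF_mobj[OF c x] coe_mobj hat_def EMod_simps(1))
  qed (simp add: hat_def x EMod_simps(1))
  fix M N \<eta> r z assume M: "entwined_module K C (E x) M" and N: "entwined_module K C (E x) N"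
    and \<eta>: "\<eta> \<in> Mor (EMod K C (E x)) M N" and r: "r \<in> Ob (E x)" and z: "z \<in> carrier (tens K (space M r) C)"
  show "\<eta> r (hat \<upsilon> x M r z) = hat \<upsilon> x N r (farr (cofree K C (E x)) (rmod.truncate M) (rmod.truncate N) \<eta> r z)"
    using hat_key[OF x coe_ob[OF x M] N _ r] \<eta> z x M by (simp add: coe_mobj hat_def EMod_simps(1))
qed

lemma hat_component:
  assumes x: "x \<in> X" and M: "M \<in> Ob \<C>"
  shows "\<upsilon> M x = hat \<upsilon> x (mobj M x)"
proof -
  note Mx = C_em[OF M x]
  interpret entw_struct K C "E x" by (rule E_ent[OF x])
  have u: "\<upsilon> M x \<in> Mor (EMod K C (E x)) (cof (rmod.truncate (mobj M x))) (mobj M x)"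
    using C_MorD(1)[OF G_ob[OF F_ob[OF M]] M nat_mor[OF M] x] by (simp add: GF_mobj[OF M x])
  note sp = cof_space[OF truncate_rm[OF Mx]]
  show ?thesis
  proof (rule CR.Mor_eqI[OF x u nat_at_hom[OF hat_at[OF x] Mx]])
    fix r z assume r: "r \<in> Ob (E x)" and "z \<in> carrier (space (cof (rmod.truncate (mobj M x))) r)"
    then have z: "z \<in> carrier (tens K (space (mobj M x) r) C)" by (simp add: sp)
    have uz: "\<upsilon> M x r z \<in> carrier (space (mobj M x) r)"
      by (rule CR.Mor_closed[OF x u r]) (use z in \<open>simp add: sp\<close>)
    show "\<upsilon> M x r z = hat \<upsilon> x (mobj M x) r z"
      using hat_key[OF x M Mx emod_Idt_cl[OF Mx, unfolded EMod_simps(4)] r z] uz r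
        cofm_Idt[OF truncate_rm[OF Mx] r, unfolded truncate_simps, OF z] by simp
  qed
qed

lemma hat_compatible: "hat \<upsilon> \<in> compatible_families K C X leq \<R>"
  unfolding compatible_iff
proof (intro conjI allI impI)
  show "hat \<upsilon> \<in> (\<Pi>\<^sub>E x\<in>X. Nat_GF_at K C (E x))"
    using hat_at by (auto simp: PiE_iff) (simp add: hat_def)
  fix x y M r z assume l: "(x, y) \<in> leq" and M: "M \<in> Ob \<C>" and r: "r \<in> Ob (E x)"
    and z: "z \<in> carrier (tens K (space (mobj M x) r) C)"
  show "mtr M x y r (hat \<upsilon> x (mobj M x) r z) = hat \<upsilon> y (mobj M y) (ao x y r) (mtr (fobj \<G> (fobj \<F> M)) x y r z)"
    using C_MorD(2)[OF G_ob[OF F_ob[OF M]] M nat_mor[OF M] l r, of z] z leqD[OF l]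
    by (simp add: GF_space[OF M] hat_component[OF _ M])
qed

end

definition assemble where
  "assemble \<upsilon> = (\<lambda>M\<in>Ob \<C>. \<lambda>x\<in>X. \<upsilon> x (mobj M x))"

lemma assemble_nat:
  assumes \<upsilon>: "\<upsilon> \<in> compatible_families K C X leq \<R>"
  shows "assemble \<upsilon> \<in> Nat_GF K C X leq \<R>"
  unfolding Nat_GF_iff
proof (intro conjI allI impI)
  have at: "\<upsilon> x \<in> Nat_GF_at K C (E x)" if "x \<in> X" for x using \<upsilon> that by (auto simp: compatible_iff)
  show "assemble \<upsilon> \<in> (\<Pi>\<^sub>E M\<in>Ob \<C>. Mor \<C> (fobj \<G> (fobj \<F> M)) M)"
  proof (rule PiE_I)
    fix M assume M: "M \<in> Ob \<C>"
    show "assemble \<upsilon> M \<in> Mor \<C> (fobj \<G> (fobj \<F> M)) M"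
      unfolding C_Mor_iff[OF G_ob[OF F_ob[OF M]] M]
    proof (intro conjI ballI)
      show "assemble \<upsilon> M \<in> (\<Pi>\<^sub>E x\<in>X. Mor (EMod K C (E x)) (mobj (fobj \<G> (fobj \<F> M)) x) (mobj M x))"
        using entw_struct.nat_at_hom[OF E_ent at C_em[OF M]] M by (auto simp: assemble_def GF_mobj[OF M])
      fix xy assume "xy \<in> leq"
      moreover obtain x y where [simp]: "xy = (x, y)" by (cases xy)
      ultimately have l: "(x, y) \<in> leq" by simp
      show "case xy of (x, y) \<Rightarrow> \<forall>r\<in>Ob (E x). \<forall>z\<in>carrier (space (mobj (fobj \<G> (fobj \<F> M)) x) r).
        mtr M x y r (assemble \<upsilon> M x r z) = assemble \<upsilon> M y (ao x y r) (mtr (fobj \<G> (fobj \<F> M)) x y r z)"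
        using \<upsilon> l M leqD[OF l] unfolding compatible_iff by (simp add: assemble_def GF_space[OF M])
    qed
  qed (simp add: assemble_def)
  fix M N \<eta> x r z assume M: "M \<in> Ob \<C>" and N: "N \<in> Ob \<C>" and \<eta>: "\<eta> \<in> Mor \<C> M N" and x: "x \<in> X"
    and r: "r \<in> Ob (E x)" and z: "z \<in> carrier (tens K (space (mobj M x) r) C)"
  show "\<eta> x r (assemble \<upsilon> M x r z) = assemble \<upsilon> N x r (farr (cofree K C (E x)) (rmod.truncate (mobj M x)) (rmod.truncate (mobj N x)) (\<eta> x) r z)"
    using entw_struct.nat_at_natural[OF E_ent[OF x] at[OF x] C_em[OF M x] C_em[OF N x] C_MorD(1)[OF M N \<eta> x] r z] M N x
    by (simp add: assemble_def)
qed

theorem assemble_bij: "bij_betw assemble (compatible_families K C X leq \<R>) (Nat_GF K C X leq \<R>)"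
proof (rule bij_betwI[where g = hat])
  show "assemble \<in> compatible_families K C X leq \<R> \<rightarrow> Nat_GF K C X leq \<R>" using assemble_nat by auto
  show "hat \<in> Nat_GF K C X leq \<R> \<rightarrow> compatible_families K C X leq \<R>" using hat_compatible by auto
next
  fix \<upsilon> assume \<upsilon>: "\<upsilon> \<in> Nat_GF K C X leq \<R>"
  have "\<upsilon> M \<in> extensional X" if M: "M \<in> Ob \<C>" for M
    by (rule C_MorD(3)[OF G_ob[OF F_ob[OF M]] M nat_mor[OF \<upsilon> M]])
  then show "assemble (hat \<upsilon>) = \<upsilon>"
    using \<upsilon> hat_component[OF \<upsilon>]
    by (intro extensionalityI[of _ "Ob \<C>"]) (auto simp: assemble_def Nat_GF_iff PiE_iff intro: extensionalityI[of _ X])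
next
  fix \<upsilon> assume \<upsilon>: "\<upsilon> \<in> compatible_families K C X leq \<R>"
  then have at: "\<upsilon> \<in> (\<Pi>\<^sub>E x\<in>X. Nat_GF_at K C (E x))" by (simp add: compatible_iff)
  have "hat (assemble \<upsilon>) x = \<upsilon> x" if x: "x \<in> X" for x
  proof (rule extensionalityI[of _ "Ob (EMod K C (E x))"])
    show "\<upsilon> x \<in> extensional (Ob (EMod K C (E x)))"
      using at x by (auto simp: Nat_GF_at_def NatTrans_def PiE_iff)
    fix M assume "M \<in> Ob (EMod K C (E x))"
    then show "hat (assemble \<upsilon>) x M = \<upsilon> x M"
      using x coe_ob[OF x] by (simp add: hat_def assemble_def coe_mobj EMod_simps(1))
  qed (simp add: hat_def x)
  then show "hat (assemble \<upsilon>) = \<upsilon>"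
    using at by (intro extensionalityI[of _ X]) (auto simp: hat_def PiE_iff)
qed

end

section \<open>Linear conditions cut out submodules\<close>

text \<open>
The conditions that define \<open>V\<^sub>1\<close> are equations between linear functions of the family \<open>\<theta>\<close>. Such
conditions are closed under the module operations, and so are conjunctions and bounded universal
quantifications of them.
\<close>

definition linear_condition :: "('k, 'r) ring_scheme \<Rightarrow> ('k, 'a, 'm) module_scheme \<Rightarrow> ('a \<Rightarrow> bool) \<Rightarrow> bool" where
  "linear_condition K V P \<longleftrightarrow> P \<zero>\<^bsub>V\<^esub> \<and>
    (\<forall>u\<in>carrier V. \<forall>v\<in>carrier V. P u \<longrightarrow> P v \<longrightarrow> P (u \<oplus>\<^bsub>V\<^esub> v)) \<and>
    (\<forall>k\<in>carrier K. \<forall>u\<in>carrier V. P u \<longrightarrow> P (k \<odot>\<^bsub>V\<^esub> u))"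

lemma linear_condition_eq:
  assumes f: "lin K V U f" and g: "lin K V U g"
  shows "linear_condition K V (\<lambda>v. f v = g v)"
  using lin_zero[OF f] lin_zero[OF g] linD(4,5)[OF f] linD(4,5)[OF g] by (simp add: linear_condition_def)

lemma linear_condition_ball: "(\<And>i. i \<in> I \<Longrightarrow> linear_condition K V (P i)) \<Longrightarrow> linear_condition K V (\<lambda>v. \<forall>i\<in>I. P i v)"
  by (simp add: linear_condition_def)

lemma linear_condition_conj: "\<lbrakk>linear_condition K V P; linear_condition K V Q\<rbrakk> \<Longrightarrow> linear_condition K V (\<lambda>v. P v \<and> Q v)"
  by (simp add: linear_condition_def)

lemma module_linear_condition:
  assumes V: "module K V" and P: "linear_condition K V P"
  shows "module K (V\<lparr>carrier := {v \<in> carrier V. P v}\<rparr>)"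
proof -
  interpret V: module K V by (rule V)
  have "submodule {v \<in> carrier V. P v} K V"
  proof (rule V.submoduleI)
    fix v assume "v \<in> {v \<in> carrier V. P v}"
    moreover then have "\<ominus>\<^bsub>V\<^esub> v = (\<ominus>\<^bsub>K\<^esub> \<one>\<^bsub>K\<^esub>) \<odot>\<^bsub>V\<^esub> v" by (simp add: V.smult_l_minus)
    ultimately show "\<ominus>\<^bsub>V\<^esub> v \<in> {v \<in> carrier V. P v}" using P by (simp add: linear_condition_def)
  qed (use P in \<open>auto simp: linear_condition_def\<close>)
  then show ?thesis by (rule submodule.submodule_is_module[OF _ V])
qed

text \<open>
A bijection that respects the operations carries the module laws to \<open>W\<close>. Applied to \<open>nat_trans_of\<close>, this
shows that sums and multiples of natural transformations are natural without a separate argument.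
\<close>

lemma mod_iso_transport:
  assumes V: "module K V" and g: "bij_betw g (carrier V) (carrier W)"
    and z: "g \<zero>\<^bsub>V\<^esub> = \<zero>\<^bsub>W\<^esub>"
    and a: "\<And>u v. \<lbrakk>u \<in> carrier V; v \<in> carrier V\<rbrakk> \<Longrightarrow> g (u \<oplus>\<^bsub>V\<^esub> v) = g u \<oplus>\<^bsub>W\<^esub> g v"
    and m: "\<And>k v. \<lbrakk>k \<in> carrier K; v \<in> carrier V\<rbrakk> \<Longrightarrow> g (k \<odot>\<^bsub>V\<^esub> v) = k \<odot>\<^bsub>W\<^esub> g v"
  shows "mod_iso K W V"
proof -
  interpret V: module K V by (rule V)
  note a' = a[symmetric] and m' = m[symmetric] and z' = z[symmetric]
  have img: "\<exists>v\<in>carrier V. w = g v" if "w \<in> carrier W" for w using g that by (auto simp: bij_betw_def)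
  have cl: "g v \<in> carrier W" if "v \<in> carrier V" for v using g that by (auto simp: bij_betw_def)
  have "abelian_group W"
  proof (rule abelian_groupI)
    show "\<zero>\<^bsub>W\<^esub> \<in> carrier W" using cl[OF V.zero_closed] z by simp
  next
    fix x y assume "x \<in> carrier W" "y \<in> carrier W"
    then show "x \<oplus>\<^bsub>W\<^esub> y \<in> carrier W" "x \<oplus>\<^bsub>W\<^esub> y = y \<oplus>\<^bsub>W\<^esub> x"
      by (auto dest!: img simp: a' cl V.a_comm)
  next
    fix x y w assume "x \<in> carrier W" "y \<in> carrier W" "w \<in> carrier W"
    then show "x \<oplus>\<^bsub>W\<^esub> y \<oplus>\<^bsub>W\<^esub> w = x \<oplus>\<^bsub>W\<^esub> (y \<oplus>\<^bsub>W\<^esub> w)"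
      by (auto dest!: img simp: a' V.a_assoc)
  next
    fix x assume x: "x \<in> carrier W"
    then show "\<zero>\<^bsub>W\<^esub> \<oplus>\<^bsub>W\<^esub> x = x" by (auto dest!: img simp: a' z')
    obtain v where v: "v \<in> carrier V" "x = g v" using img[OF x] by blast
    then have "g (\<ominus>\<^bsub>V\<^esub> v) \<oplus>\<^bsub>W\<^esub> x = \<zero>\<^bsub>W\<^esub>" by (simp add: a' z' V.l_neg)
    then show "\<exists>y\<in>carrier W. y \<oplus>\<^bsub>W\<^esub> x = \<zero>\<^bsub>W\<^esub>" using cl[of "\<ominus>\<^bsub>V\<^esub> v"] v by auto
  qed
  moreover have "cring K" by (rule V.R.is_cring)
  ultimately have W: "module K W"
    by (intro moduleI) (auto dest!: img simp: a' m' cl V.smult_l_distr V.smult_r_distr V.smult_assoc1)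
  let ?f = "restrict (inv_into (carrier V) g) (carrier W)"
  have f: "?f (g v) = v" if "v \<in> carrier V" for v
    using g that cl[OF that] by (simp add: bij_betw_def)
  have "?f \<in> Lin K W V"
    unfolding Lin_def
  proof (intro CollectI conjI ballI)
    interpret W: module K W by (rule W)
    show "?f \<in> carrier W \<rightarrow>\<^sub>E carrier V" using g bij_betw_inv_into[OF g] by (auto simp: bij_betw_def)
    fix v v' assume "v \<in> carrier W" "v' \<in> carrier W"
    then show "?f (v \<oplus>\<^bsub>W\<^esub> v') = ?f v \<oplus>\<^bsub>V\<^esub> ?f v'"
      by (auto dest!: img simp: a' f simp del: restrict_apply)
  next
    fix k v assume "k \<in> carrier K" "v \<in> carrier W"
    then show "?f (k \<odot>\<^bsub>W\<^esub> v) = k \<odot>\<^bsub>V\<^esub> ?f v"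
      by (auto dest!: img simp: m' f simp del: restrict_apply)
  qed
  moreover have "bij_betw ?f (carrier W) (carrier V)"
    using bij_betw_inv_into[OF g] by (simp cong: bij_betw_cong)
  ultimately show ?thesis unfolding mod_iso_def using V W by blast
qed

section \<open>The space V1\<close>

context entw_representation begin

text \<open>
All families of functions, without any condition, with the operations of \<open>V\<^sub>1\<close>. In this module the
evaluation at a fixed argument is linear (\<open>lin_eval\<close>), so the rules \<open>ml\<close> prove linearity in \<open>\<theta>\<close> of
each expression in which \<open>\<theta>\<close> occurs once.
\<close>

definition function_space where
  "function_space = (V1_space K C X leq \<R>)\<lparr>carrier :=
     \<Pi>\<^sub>E x\<in>X. \<Pi>\<^sub>E r\<in>Ob (E x). carrier (tens K C C) \<rightarrow>\<^sub>E carrier (homs (E x) r r)\<rparr>"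

abbreviation "FS \<equiv> function_space"

lemma FS_simps:
  "carrier FS = (\<Pi>\<^sub>E x\<in>X. \<Pi>\<^sub>E r\<in>Ob (E x). carrier (tens K C C) \<rightarrow>\<^sub>E carrier (homs (E x) r r))"
  "\<zero>\<^bsub>FS\<^esub> = (\<lambda>x\<in>X. \<lambda>r\<in>Ob (E x). \<lambda>z\<in>carrier (tens K C C). \<zero>\<^bsub>homs (E x) r r\<^esub>)"
  "\<theta> \<oplus>\<^bsub>FS\<^esub> \<theta>' = (\<lambda>x\<in>X. \<lambda>r\<in>Ob (E x). \<lambda>z\<in>carrier (tens K C C). \<theta> x r z \<oplus>\<^bsub>homs (E x) r r\<^esub> \<theta>' x r z)"
  "k \<odot>\<^bsub>FS\<^esub> \<theta> = (\<lambda>x\<in>X. \<lambda>r\<in>Ob (E x). \<lambda>z\<in>carrier (tens K C C). k \<odot>\<^bsub>homs (E x) r r\<^esub> \<theta> x r z)"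
  by (simp_all add: function_space_def V1_space_def Let_def)

lemma FS_eqI:
  assumes "\<theta> \<in> carrier FS" "\<theta>' \<in> carrier FS"
    "\<And>x r z. \<lbrakk>x \<in> X; r \<in> Ob (E x); z \<in> carrier (tens K C C)\<rbrakk> \<Longrightarrow> \<theta> x r z = \<theta>' x r z"
  shows "\<theta> = \<theta>'"
proof (rule extensionalityI[of _ X])
  fix x assume x: "x \<in> X"
  show "\<theta> x = \<theta>' x"
  proof (rule extensionalityI[of _ "Ob (E x)"])
    fix r assume r: "r \<in> Ob (E x)"
    show "\<theta> x r = \<theta>' x r"
      by (rule extensionalityI[of _ "carrier (tens K C C)"]) (use assms x r in \<open>auto simp: FS_simps(1) PiE_iff\<close>)
  qed (use assms x in \<open>auto simp: FS_simps(1) PiE_iff\<close>)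
qed (use assms in \<open>auto simp: FS_simps(1) PiE_iff\<close>)

lemma homs_mod: "\<lbrakk>x \<in> X; r \<in> Ob (E x); s \<in> Ob (E x)\<rbrakk> \<Longrightarrow> module K (homs (E x) r s)"
  by (rule entw_struct.mod_homs[OF E_ent])

lemma FS_val: "\<lbrakk>\<theta> \<in> carrier FS; x \<in> X; r \<in> Ob (E x); z \<in> carrier (tens K C C)\<rbrakk> \<Longrightarrow> \<theta> x r z \<in> carrier (homs (E x) r r)"
  by (auto simp: FS_simps(1) PiE_iff)

lemma FS_module: "module K FS"
proof -
  have m: "module K (homs (E x) r r)" if "x \<in> X" "r \<in> Ob (E x)" for x r using homs_mod that by blast
  note ab = module.axioms(2)[OF m]
  have g: "abelian_group (homs (E x) r r)" if "x \<in> X" "r \<in> Ob (E x)" for x r using ab that by blast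
  note gr = abelian_group.axioms(1)[OF g]
  note mn = abelian_monoid.a_closed[OF gr] abelian_monoid.zero_closed[OF gr] abelian_monoid.l_zero[OF gr]
  note gi = abelian_group.a_inv_closed[OF g] abelian_group.l_neg[OF g] module.smult_closed[OF m]
  have cl: "\<theta> \<oplus>\<^bsub>FS\<^esub> \<theta>' \<in> carrier FS" if "\<theta> \<in> carrier FS" "\<theta>' \<in> carrier FS" for \<theta> \<theta>'
    using that FS_val by (auto simp: FS_simps(1,3) intro!: mn(1))
  have zc: "\<zero>\<^bsub>FS\<^esub> \<in> carrier FS" by (auto simp: FS_simps(1,2) mn(2))
  have sc: "k \<odot>\<^bsub>FS\<^esub> \<theta> \<in> carrier FS" if "k \<in> carrier K" "\<theta> \<in> carrier FS" for k \<theta>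
    using that FS_val by (auto simp: FS_simps(1,4) intro!: gi(3))
  show ?thesis
  proof (rule moduleI)
    show "cring K" using mod_C by (simp add: module_def)
    show "abelian_group FS"
    proof (rule abelian_groupI)
      fix f g assume f: "f \<in> carrier FS" and g: "g \<in> carrier FS"
      show "f \<oplus>\<^bsub>FS\<^esub> g \<in> carrier FS" by (rule cl[OF f g])
      show "f \<oplus>\<^bsub>FS\<^esub> g = g \<oplus>\<^bsub>FS\<^esub> f"
        by (rule FS_eqI[OF cl[OF f g] cl[OF g f]])
          (simp add: FS_simps(3) abelian_monoid.a_comm[OF gr] FS_val f g)
      fix h assume h: "h \<in> carrier FS"
      show "f \<oplus>\<^bsub>FS\<^esub> g \<oplus>\<^bsub>FS\<^esub> h = f \<oplus>\<^bsub>FS\<^esub> (g \<oplus>\<^bsub>FS\<^esub> h)"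
        by (rule FS_eqI[OF cl[OF cl[OF f g] h] cl[OF f cl[OF g h]]])
          (simp add: FS_simps(3) abelian_monoid.a_assoc[OF gr] FS_val f g h)
    next
      show "\<zero>\<^bsub>FS\<^esub> \<in> carrier FS" by (rule zc)
      fix f assume f: "f \<in> carrier FS"
      show "\<zero>\<^bsub>FS\<^esub> \<oplus>\<^bsub>FS\<^esub> f = f"
        by (rule FS_eqI[OF cl[OF zc f] f]) (simp add: FS_simps(2,3) mn FS_val f)
      let ?n = "\<lambda>x\<in>X. \<lambda>r\<in>Ob (E x). \<lambda>z\<in>carrier (tens K C C). \<ominus>\<^bsub>homs (E x) r r\<^esub> f x r z"
      have n: "?n \<in> carrier FS" using f FS_val by (auto simp: FS_simps(1) intro!: gi(1))
      have "?n \<oplus>\<^bsub>FS\<^esub> f = \<zero>\<^bsub>FS\<^esub>"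
        by (rule FS_eqI[OF cl[OF n f] zc]) (simp add: FS_simps(2,3) gi FS_val f)
      then show "\<exists>g\<in>carrier FS. g \<oplus>\<^bsub>FS\<^esub> f = \<zero>\<^bsub>FS\<^esub>" using n by blast
    qed
    fix k f assume k: "k \<in> carrier K" and f: "f \<in> carrier FS"
    show "k \<odot>\<^bsub>FS\<^esub> f \<in> carrier FS" by (rule sc[OF k f])
    show "(k \<oplus>\<^bsub>K\<^esub> l) \<odot>\<^bsub>FS\<^esub> f = k \<odot>\<^bsub>FS\<^esub> f \<oplus>\<^bsub>FS\<^esub> l \<odot>\<^bsub>FS\<^esub> f" if l: "l \<in> carrier K" for l
      by (rule FS_eqI[OF sc cl[OF sc sc]])
        (simp_all add: FS_simps(3,4) k l f module.smult_l_distr[OF m] FS_val)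
    show "(k \<otimes>\<^bsub>K\<^esub> l) \<odot>\<^bsub>FS\<^esub> f = k \<odot>\<^bsub>FS\<^esub> (l \<odot>\<^bsub>FS\<^esub> f)" if l: "l \<in> carrier K" for l
      by (rule FS_eqI[OF sc sc[OF _ sc]])
        (simp_all add: FS_simps(4) k l f module.smult_assoc1[OF m] FS_val)
    show "k \<odot>\<^bsub>FS\<^esub> (f \<oplus>\<^bsub>FS\<^esub> g) = k \<odot>\<^bsub>FS\<^esub> f \<oplus>\<^bsub>FS\<^esub> k \<odot>\<^bsub>FS\<^esub> g" if g: "g \<in> carrier FS" for g
      by (rule FS_eqI[OF sc[OF _ cl] cl[OF sc sc]])
        (simp_all add: FS_simps(3,4) k g f module.smult_r_distr[OF m] FS_val)
  next
    fix f assume f: "f \<in> carrier FS"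
    have o: "\<one>\<^bsub>K\<^esub> \<in> carrier K" by simp
    show "\<one>\<^bsub>K\<^esub> \<odot>\<^bsub>FS\<^esub> f = f"
      by (rule FS_eqI[OF sc[OF o f] f]) (simp add: FS_simps(4) f module.smult_one[OF m] FS_val)
  qed
qed

lemma lin_eval [ml]:
  assumes "x \<in> X" "r \<in> Ob (E x)" "z \<in> carrier (tens K C C)"
  shows "lin K FS (homs (E x) r r) (\<lambda>\<theta>. \<theta> x r z)"
  by (rule linI) (use assms FS_module homs_mod FS_val in \<open>auto simp: FS_simps(3,4)\<close>)

lemma V1_iff:
  "\<theta> \<in> V1_set K C X leq \<R> \<longleftrightarrow> \<theta> \<in> (\<Pi>\<^sub>E x\<in>X. V_at K C (E x)) \<and>
    (\<forall>x y r c d. (x, y) \<in> leq \<longrightarrow> r \<in> Ob (E x) \<longrightarrow> c \<in> carrier C \<longrightarrow> d \<in> carrier C \<longrightarrow>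
      farr (\<alpha> x y) r r (\<theta> x r (tpure K C C c d)) = \<theta> y (ao x y r) (tpure K C C c d))"
  unfolding V1_set_def V_at_def Let_def PiE_iff by auto

definition linear_family where
  "linear_family \<theta> \<longleftrightarrow> (\<forall>x\<in>X. \<forall>r\<in>Ob (E x).
    (\<forall>z\<in>carrier (tens K C C). \<forall>z'\<in>carrier (tens K C C).
      \<theta> x r (z \<oplus>\<^bsub>tens K C C\<^esub> z') = \<theta> x r z \<oplus>\<^bsub>homs (E x) r r\<^esub> \<theta> x r z') \<and>
    (\<forall>k\<in>carrier K. \<forall>z\<in>carrier (tens K C C).
      \<theta> x r (k \<odot>\<^bsub>tens K C C\<^esub> z) = k \<odot>\<^bsub>homs (E x) r r\<^esub> \<theta> x r z))"

definition V1_equations where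
  "V1_equations \<theta> \<longleftrightarrow> 
      (\<forall>x\<in>X. \<forall>r\<in>Ob (E x). \<forall>c\<in>carrier C. \<forall>d\<in>carrier C.
          tsum (tens K (homs (E x) r r) C) (comul C d) (\<lambda>d1 d2. tpure K (homs (E x) r r) C (\<theta> x r (tpure K C C c d1)) d2)
          = tsum (tens K (homs (E x) r r) C) (comul C c) (\<lambda>c1 c2. entw_app K C (E x) r r c1 (\<theta> x r (tpure K C C c2 d)))) \<and>
      (\<forall>x\<in>X. \<forall>s\<in>Ob (E x). \<forall>r\<in>Ob (E x). \<forall>f\<in>Mor (E x) s r. \<forall>c\<in>carrier C. \<forall>d\<in>carrier C.
          Cmp (E x) s r r (\<theta> x r (tpure K C C c d)) f
          = tsum (homs (E x) s r) (entw_app K C (E x) s r d f) (\<lambda>f' d'.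
              tsum (homs (E x) s r) (entw_app K C (E x) s r c f') (\<lambda>f'' c'.
                Cmp (E x) s s r f'' (\<theta> x s (tpure K C C c' d'))))) \<and>
      (\<forall>p\<in>leq. \<forall>r\<in>Ob (E (fst p)). \<forall>c\<in>carrier C. \<forall>d\<in>carrier C.
        farr (\<alpha> (fst p) (snd p)) r r (\<theta> (fst p) r (tpure K C C c d))
        = \<theta> (snd p) (ao (fst p) (snd p) r) (tpure K C C c d))"

lemma V1_set_eq: "V1_set K C X leq \<R> = {\<theta> \<in> carrier FS. linear_family \<theta> \<and> V1_equations \<theta>}"
proof -
  have "\<theta> \<in> (\<Pi>\<^sub>E x\<in>X. \<Pi>\<^sub>E r\<in>Ob (E x). Lin K (tens K C C) (homs (E x) r r)) \<longleftrightarrow> \<theta> \<in> carrier FS \<and> linear_family \<theta>" for \<theta>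
    by (auto simp: FS_simps(1) linear_family_def Lin_def PiE_iff)
  then show ?thesis
    unfolding V1_set_def V1_equations_def Let_def by (auto simp: case_prod_beta)
qed

lemma V1_module: "module K (V1_space K C X leq \<R>)"
proof -
  have "linear_condition K FS (\<lambda>\<theta>. linear_family \<theta> \<and> V1_equations \<theta>)"
    unfolding linear_family_def V1_equations_def
  proof (intro linear_condition_conj linear_condition_ball)
    fix x r z z' assume x: "x \<in> X" and r: "r \<in> Ob (E x)"
      and z: "z \<in> carrier (tens K C C)" "z' \<in> carrier (tens K C C)"
    interpret module K "tens K C C" by (rule ml)+
    show "linear_condition K FS (\<lambda>\<theta>. \<theta> x r (z \<oplus>\<^bsub>tens K C C\<^esub> z') = \<theta> x r z \<oplus>\<^bsub>homs (E x) r r\<^esub> \<theta> x r z')"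
      by (rule linear_condition_eq[OF lin_eval[OF x r] lin_add[OF lin_eval[OF x r] lin_eval[OF x r]]]) (use z in auto)
  next
    fix x r k z assume x: "x \<in> X" and r: "r \<in> Ob (E x)" and k: "k \<in> carrier K" and z: "z \<in> carrier (tens K C C)"
    interpret module K "tens K C C" by (rule ml)+
    show "linear_condition K FS (\<lambda>\<theta>. \<theta> x r (k \<odot>\<^bsub>tens K C C\<^esub> z) = k \<odot>\<^bsub>homs (E x) r r\<^esub> \<theta> x r z)"
      by (rule linear_condition_eq[OF lin_eval[OF x r] lin_smult[OF lin_eval[OF x r]]]) (use z k in auto)
  next
    fix x r c d assume x: "x \<in> X" and r: "r \<in> Ob (E x)" and c: "c \<in> carrier C" and d: "d \<in> carrier C"
    interpret entw_struct K C "E x" by (rule E_ent[OF x])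
    note h = x r c d FS_module
    show "linear_condition K FS (\<lambda>\<theta>.
        tsum (tens K (homs (E x) r r) C) (comul C d) (\<lambda>d1 d2. tpure K (homs (E x) r r) C (\<theta> x r (tpure K C C c d1)) d2)
          = tsum (tens K (homs (E x) r r) C) (comul C c) (\<lambda>c1 c2. entw_app K C (E x) r r c1 (\<theta> x r (tpure K C C c2 d))))"
      by (rule linear_condition_eq) (rule ml h | assumption)+
  next
    fix x s r f c d assume x: "x \<in> X" and s: "s \<in> Ob (E x)" and r: "r \<in> Ob (E x)" and f': "f \<in> Mor (E x) s r"
      and c: "c \<in> carrier C" and d: "d \<in> carrier C"
    interpret entw_struct K C "E x" by (rule E_ent[OF x])
    have f: "f \<in> carrier (homs (E x) s r)" using f' r s by (simp add: homs_carrier)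
    note h = x r s f c d FS_module
    show "linear_condition K FS (\<lambda>\<theta>. Cmp (E x) s r r (\<theta> x r (tpure K C C c d)) f
          = tsum (homs (E x) s r) (entw_app K C (E x) s r d f) (\<lambda>f' d'.
              tsum (homs (E x) s r) (entw_app K C (E x) s r c f') (\<lambda>f'' c'.
                Cmp (E x) s s r f'' (\<theta> x s (tpure K C C c' d')))))"
      by (rule linear_condition_eq) (rule ml h | assumption)+
  next
    fix p r c d assume "p \<in> leq" and "r \<in> Ob (E (fst p))" and c: "c \<in> carrier C" and d: "d \<in> carrier C"
    moreover obtain x y where [simp]: "p = (x, y)" by (cases p)
    ultimately have l: "(x, y) \<in> leq" and r: "r \<in> Ob (E x)" by simp_all
    interpret entw_morphism K C "E x" "E y" "\<alpha> x y" by (rule E_mor[OF l])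
    note h = leqD[OF l] r ao_closed[OF l r] c d FS_module
    have "linear_condition K FS (\<lambda>\<theta>. farr (\<alpha> x y) r r (\<theta> x r (tpure K C C c d)) = \<theta> y (ao x y r) (tpure K C C c d))"
      by (rule linear_condition_eq) (rule ml h | assumption)+
    then show "linear_condition K FS (\<lambda>\<theta>. farr (\<alpha> (fst p) (snd p)) r r (\<theta> (fst p) r (tpure K C C c d))
        = \<theta> (snd p) (ao (fst p) (snd p) r) (tpure K C C c d))" by simp
  qed
  from module_linear_condition[OF FS_module this]
  have "module K (FS\<lparr>carrier := V1_set K C X leq \<R>\<rparr>)" unfolding V1_set_eq .
  then show ?thesis by (simp add: function_space_def V1_space_def Let_def)
qed

section \<open>The isomorphism of V1 with the natural transformations\<close>

text \<open>
The isomorphism is obtained over each \<open>x\<close> separately, by \<open>nat_of\<close> and \<open>V_of\<close>; only the equivalence of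
condition (iii) with compatibility involves different objects of the poset.
\<close>

definition family_of where
  "family_of \<theta> = (\<lambda>x\<in>X. \<lambda>M\<in>Ob (EMod K C (E x)). nat_of K C (E x) (\<theta> x) M)"

text \<open>
The structure map \<open>M\<^sub>\<alpha>\<close> is linear and colinear, so it sends \<open>m\<^sub>0 \<theta>\<^sub>x(m\<^sub>1 \<otimes> c)\<close> to the same expression for
\<open>M\<^sub>\<alpha>(m)\<close> with \<open>\<alpha>(\<theta>\<^sub>x(m\<^sub>1 \<otimes> c))\<close> in place of \<open>\<theta>\<^sub>y(m\<^sub>1 \<otimes> c)\<close>; condition (iii) says that these are equal.
\<close>

lemma family_of_compatible:
  assumes \<theta>: "\<theta> \<in> V1_set K C X leq \<R>"
  shows "family_of \<theta> \<in> compatible_families K C X leq \<R>"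
  unfolding compatible_iff
proof (intro conjI allI impI)
  have at: "\<theta> x \<in> V_at K C (E x)" if "x \<in> X" for x using \<theta> that by (auto simp: V1_iff)
  show "family_of \<theta> \<in> (\<Pi>\<^sub>E x\<in>X. Nat_GF_at K C (E x))"
    using entw_struct.nat_of_nat[OF E_ent at] by (auto simp: family_of_def)
  fix x y M r z assume l: "(x, y) \<in> leq" and M: "M \<in> Ob \<C>" and r: "r \<in> Ob (E x)"
    and z: "z \<in> carrier (tens K (space (mobj M x) r) C)"
  note x = leqD[OF l] and ar = ao_closed[OF l r]
  interpret entw_morphism K C "E x" "E y" "\<alpha> x y" by (rule E_mor[OF l])
  note Mx = C_em[OF M x(1)] and My = C_em[OF M x(2)]
  note N = F_ob[OF M]
  note g = G_mtr_facts[OF N l r, simplified F_simps[OF M] truncate_simps x l]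
  note mt = C_ObD(2)[OF M l]
  note lm = S.emod_hom_lin[OF mt Mx eres_em[OF My] r, unfolded eres_simps[OF My]]
  note nx = S.lin_nat_of[OF at[OF x(1)] Mx r] and ny = T.lin_nat_of[OF at[OF x(2)] My ar]
  note tx = S.theta_lin[OF at[OF x(1)] r] and ty = T.theta_lin[OF at[OF x(2)] ar]
  have "mtr M x y r (nat_of K C (E x) (\<theta> x) (mobj M x) r z)
    = nat_of K C (E y) (\<theta> y) (mobj M y) (ao x y r) (mtr (fobj \<G> (fobj \<F> M)) x y r z)"
  proof (rule pure_ext[OF z lin_comp[OF lm nx] lin_comp[OF ny g(1)]])
    fix m c assume m: "m \<in> carrier (space (mobj M x) r)" and c: "c \<in> carrier C"
    let ?S = "space (mobj M x) r" let ?U = "space (mobj M y) (ao x y r)"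
    note h = S.rm_mod[OF S.em_rm[OF Mx] r] T.rm_mod[OF T.em_rm[OF My] ar]
      Mx My r ar m c linD(3)[OF tx] linD(3)[OF ty] lin_comp[OF tx] lin_comp[OF ty] linD(3)[OF lm]
    have "mtr M x y r (nat_of K C (E x) (\<theta> x) (mobj M x) r (tpure K ?S C m c))
      = mtr M x y r (tsum ?S (coact (mobj M x) r m) (\<lambda>a d. act (mobj M x) r r (\<theta> x r (tpure K C C d c)) a))"
      by (subst S.nat_of_pure[OF at[OF x(1)] Mx r m c]) (rule refl)
    also have "\<dots> = tsum ?U (coact (mobj M x) r m) (\<lambda>a d. mtr M x y r (act (mobj M x) r r (\<theta> x r (tpure K C C d c)) a))"
      by (rule lin_sum[OF _ _ _ lm]) (rule h | rule ml h | assumption)+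
    also have "\<dots> = tsum ?U (coact (mobj M x) r m) (\<lambda>a d. act (mobj M y) (ao x y r) (ao x y r) (\<theta> y (ao x y r) (tpure K C C d c)) (mtr M x y r a))"
    proof (rule sum_cong, (rule h | rule ml h | assumption)+)
      fix a d assume a: "a \<in> carrier ?S" and d: "d \<in> carrier C"
      have t: "\<theta> x r (tpure K C C d c) \<in> carrier (homs (E x) r r)" by (rule h | rule ml h d)+
      show "mtr M x y r (act (mobj M x) r r (\<theta> x r (tpure K C C d c)) a)
        = act (mobj M y) (ao x y r) (ao x y r) (\<theta> y (ao x y r) (tpure K C C d c)) (mtr M x y r a)"
        using S.emod_hom_act[OF mt r r t a] \<theta> l r c d unfolding V1_iff eres_simps[OF My] by simp
    qed
    also have "\<dots> = tsum ?U (coact (mobj M y) (ao x y r) (mtr M x y r m)) (\<lambda>a d. act (mobj M y) (ao x y r) (ao x y r) (\<theta> y (ao x y r) (tpure K C C d c)) a)"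
      by (rule S.emod_hom_sum[OF mt Mx eres_em[OF My] r _ m, unfolded eres_simps[OF My], symmetric])
        (rule h | rule T.lin_act T.lin_act2 T.em_rm | rule ml h | assumption)+
    also have "\<dots> = nat_of K C (E y) (\<theta> y) (mobj M y) (ao x y r) (tpure K ?U C (mtr M x y r m) c)"
      by (rule T.nat_of_pure[OF at[OF x(2)] My ar _ c, symmetric]) (rule h)+
    also have "\<dots> = nat_of K C (E y) (\<theta> y) (mobj M y) (ao x y r) (mtr (fobj \<G> (fobj \<F> M)) x y r (tpure K ?S C m c))"
      using g(2)[OF m c] by simp
    finally show "mtr M x y r (nat_of K C (E x) (\<theta> x) (mobj M x) r (tpure K ?S C m c))
      = nat_of K C (E y) (\<theta> y) (mobj M y) (ao x y r) (mtr (fobj \<G> (fobj \<F> M)) x y r (tpure K ?S C m c))" .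
  qed (rule S.rm_mod[OF S.em_rm[OF Mx] r] mod_C)+
  then show "mtr M x y r (family_of \<theta> x (mobj M x) r z)
    = family_of \<theta> y (mobj M y) (ao x y r) (mtr (fobj \<G> (fobj \<F> M)) x y r z)"
    by (simp add: family_of_def x Mx My EMod_simps(1))
qed

text \<open>
Compatibility is tested on the coextension from \<open>y\<close> of \<open>h\<^sub>q \<otimes> C\<close>, where \<open>q = \<alpha>(r)\<close>. Its structure map from
\<open>x\<close> to \<open>y\<close> is an identity, so \<open>\<upsilon>\<^sub>y(h\<^sub>q \<otimes> C)\<close> and \<open>\<upsilon>\<^sub>x\<close> of the restricted module have the same value at
\<open>id\<^sub>q \<otimes> c \<otimes> d\<close>. The first yields \<open>\<theta>\<^sub>y(c \<otimes> d)\<close> after \<open>id \<otimes> \<epsilon>\<close>. The second is given by the formula for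
\<open>\<upsilon>\<^sub>x\<close>, in which \<open>\<theta>\<^sub>x\<close> acts through \<open>\<alpha>\<close>, and yields \<open>\<alpha>(\<theta>\<^sub>x(c \<otimes> d))\<close>.
\<close>

lemma V1_of_compatible:
  assumes \<upsilon>: "\<upsilon> \<in> compatible_families K C X leq \<R>"
  shows "(\<lambda>x\<in>X. V_of K C (E x) (\<upsilon> x)) \<in> V1_set K C X leq \<R>"
  unfolding V1_iff
proof (intro conjI allI impI)
  have at: "\<upsilon> x \<in> Nat_GF_at K C (E x)" if "x \<in> X" for x using \<upsilon> that by (auto simp: compatible_iff)
  show "(\<lambda>x\<in>X. V_of K C (E x) (\<upsilon> x)) \<in> (\<Pi>\<^sub>E x\<in>X. V_at K C (E x))"
    using entw_struct.V_of_V_at[OF E_ent at] by auto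
  fix x y r c d assume l: "(x, y) \<in> leq" and r: "r \<in> Ob (E x)" and c: "c \<in> carrier C" and d: "d \<in> carrier C"
  note x = leqD[OF l] and ar = ao_closed[OF l r]
  interpret entw_morphism K C "E x" "E y" "\<alpha> x y" by (rule E_mor[OF l])
  let ?q = "ao x y r"
  let ?h = "homs (E y) ?q ?q" let ?H = "hmod (E y) ?q" let ?N = "T.cof ?H" let ?T = "tens K ?h C"
  let ?M = "coe y ?N" let ?P = "mobj ?M x"
  note H = T.hmod_rm[OF ar]
  note N = T.cof_em[OF H]
  note M = coe_ob[OF x(2) N]
  note P = coe_em[OF x(2) N x(1)]
  note spN = T.cof_space[OF H, of ?q, simplified]
  have ag: "em_agree (E x) ?P (fobj (ERes K C \<R> x y) ?N)" by (rule coe_agree[OF x(2) N l])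
  have sp: "space ?P r = ?T" and cP: "coact ?P r = coact ?N ?q"
    and aP: "f \<in> Mor (E x) r r \<Longrightarrow> act ?P r r f = act ?N ?q ?q (farr (\<alpha> x y) r r f)" for f
    using ag r by (simp_all add: em_agree_def eres_simps[OF N] spN)
  let ?p = "tpure K ?h C (Idt (E y) ?q) c" let ?w = "tpure K ?T C ?p d"
  let ?\<theta> = "V_of K C (E x) (\<upsilon> x) r"
  let ?t = "\<lambda>u. farr (\<alpha> x y) r r (?\<theta> u)"
  note tl = S.lin_V_of[OF at[OF x(1)] r]
  have t: "lin K (tens K C C) ?h ?t" by (rule lin_comp[OF arr_lin[OF r r] tl])
  note h = T.mod_homs[OF ar ar] ar c d lin_comp[OF t] linD(3)[OF t]
  have p: "?p \<in> carrier ?T" by (rule h T.Idt_cl ml)+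
  have w: "?w \<in> carrier (tens K ?T C)" by (rule p h T.Idt_cl ml)+
  have mt: "mtr ?M x y r m = m" if "m \<in> carrier ?T" for m
    using that r leq_refl[OF x(2)] by (simp add: coe_mtr sp)
  have gw: "mtr (fobj \<G> (fobj \<F> ?M)) x y r ?w = ?w"
    using G_mtr_facts(2)[OF F_ob[OF M] l r, of ?p d] p d
    by (simp add: F_simps[OF M] x l sp mt coe_mobj spN)
  have ux: "\<upsilon> x ?P r ?w \<in> carrier ?T"
    using linD(3)[OF S.nat_at_lin[OF at[OF x(1)] P r], of ?w] w by (simp add: sp)
  have comp: "mtr ?M x y r (\<upsilon> x ?P r ?w) = \<upsilon> y (mobj ?M y) ?q (mtr (fobj \<G> (fobj \<F> ?M)) x y r ?w)"
    using \<upsilon> l M r w unfolding compatible_iff by (simp add: sp)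
  then have e: "\<upsilon> y ?N ?q ?w = \<upsilon> x ?P r ?w"
    by (simp add: gw mt[OF ux] coe_mobj)
  have "\<upsilon> x ?P r ?w = tsum ?T (coact ?N ?q ?p) (\<lambda>a e. act ?P r r (?\<theta> (tpure K C C e d)) a)"
    using S.nat_eq_pure[OF at[OF x(1)] P r, of ?p d] p d by (simp add: sp cP)
  also have "\<dots> = tsum ?T (coact ?N ?q ?p) (\<lambda>a e. act ?N ?q ?q (?t (tpure K C C e d)) a)"
  proof (rule sum_cong)
    show "coact ?N ?q ?p \<in> carrier (tens K ?T C)"
      using T.coact_cl[OF N ar, of ?p] p by (simp add: spN)
    show "module K ?T" "module K C" by (rule h ml)+
    fix a e assume "a \<in> carrier ?T" and e: "e \<in> carrier C"
    have "?\<theta> (tpure K C C e d) \<in> carrier (homs (E x) r r)"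
      by (rule linD(3)[OF tl]) (rule ml e d)+
    then show "act ?P r r (?\<theta> (tpure K C C e d)) a = act ?N ?q ?q (?t (tpure K C C e d)) a"
      using aP r by (simp add: S.homs_carrier)
  qed
  also have "\<dots> = tsum ?T (comul C c) (\<lambda>c1 c2. entw_app K C (E y) ?q ?q c1 (?t (tpure K C C c2 d)))"
    using T.act_universal[OF ar d c t] by (simp add: spN)
  finally have u: "\<upsilon> y ?N ?q ?w = tsum ?T (comul C c) (\<lambda>c1 c2. entw_app K C (E y) ?q ?q c1 (?t (tpure K C C c2 d)))"
    by (simp add: e)
  have "V_of K C (E y) (\<upsilon> y) ?q (tpure K C C c d)
    = contract ?h (tsum ?T (comul C c) (\<lambda>c1 c2. entw_app K C (E y) ?q ?q c1 (?t (tpure K C C c2 d))))"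
    by (simp add: T.V_of_pure[OF at[OF x(2)] ar c d] u)
  also have "\<dots> = tsum ?h (comul C c) (\<lambda>c1 c2. contract ?h (entw_app K C (E y) ?q ?q c1 (?t (tpure K C C c2 d))))"
    by (rule sum_sum) (rule h | rule T.psi_cl | rule ml h | assumption)+
  also have "\<dots> = tsum ?h (comul C c) (\<lambda>c1 c2. counit C c1 \<odot>\<^bsub>?h\<^esub> ?t (tpure K C C c2 d))"
    by (rule sum_cong, (rule ml h | assumption)+, rule T.psi_counit_sum[OF ar ar _ _ lin_id[OF h(1)]])
      (rule h | rule ml h | assumption)+
  also have "\<dots> = ?t (tpure K C C c d)"
    by (rule comul_counit_left[where L = "\<lambda>c2. ?t (tpure K C C c2 d)"]) (rule h | rule ml h | assumption)+
  finally show "farr (\<alpha> x y) r r ((\<lambda>x\<in>X. V_of K C (E x) (\<upsilon> x)) x r (tpure K C C c d))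
    = (\<lambda>x\<in>X. V_of K C (E x) (\<upsilon> x)) y ?q (tpure K C C c d)"
    by (simp add: x)
qed

lemma family_of_bij: "bij_betw family_of (V1_set K C X leq \<R>) (compatible_families K C X leq \<R>)"
proof (rule bij_betwI[where g = "\<lambda>\<upsilon>. \<lambda>x\<in>X. V_of K C (E x) (\<upsilon> x)"])
  fix \<theta> assume "\<theta> \<in> V1_set K C X leq \<R>"
  then have "\<theta> \<in> (\<Pi>\<^sub>E x\<in>X. V_at K C (E x))" by (simp add: V1_iff)
  then show "(\<lambda>x\<in>X. V_of K C (E x) (family_of \<theta> x)) = \<theta>"
    using entw_struct.V_of_nat_of[OF E_ent]
    by (intro extensionalityI[of _ X]) (auto simp: family_of_def PiE_iff)
next
  fix \<upsilon> assume "\<upsilon> \<in> compatible_families K C X leq \<R>"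
  then have "\<upsilon> \<in> (\<Pi>\<^sub>E x\<in>X. Nat_GF_at K C (E x))" by (simp add: compatible_iff)
  then show "family_of (\<lambda>x\<in>X. V_of K C (E x) (\<upsilon> x)) = \<upsilon>"
    using entw_struct.nat_of_V_of[OF E_ent]
    by (intro extensionalityI[of _ X]) (auto simp: family_of_def PiE_iff)
qed (use family_of_compatible V1_of_compatible in auto)

definition nat_trans_of where
  "nat_trans_of \<theta> = assemble (family_of \<theta>)"

lemma nat_trans_of_bij: "bij_betw nat_trans_of (V1_set K C X leq \<R>) (Nat_GF K C X leq \<R>)"
  unfolding nat_trans_of_def using bij_betw_trans[OF family_of_bij assemble_bij] by (simp add: comp_def)

lemma nat_trans_of_app:
  assumes "M \<in> Ob \<C>" "x \<in> X" "r \<in> Ob (E x)" "z \<in> carrier (tens K (space (mobj M x) r) C)"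
  shows "nat_trans_of \<theta> M x r z = tsum (space (mobj M x) r) z (\<lambda>m c. tsum (space (mobj M x) r) (coact (mobj M x) r m)
    (\<lambda>a d. act (mobj M x) r r (\<theta> x r (tpure K C C d c)) a))"
  using assms C_em[OF assms(1,2)] by (simp add: nat_trans_of_def assemble_def family_of_def nat_of_def EMod_simps(1))

lemma lin_nat_trans_of:
  assumes "M \<in> Ob \<C>" "x \<in> X" "r \<in> Ob (E x)" "z \<in> carrier (tens K (space (mobj M x) r) C)"
  shows "lin K FS (space (mobj M x) r) (\<lambda>\<theta>. nat_trans_of \<theta> M x r z)"
proof -
  interpret entw_struct K C "E x" by (rule E_ent[OF assms(2)])
  note h = assms(2-4) C_em[OF assms(1,2)] FS_module
  show ?thesis unfolding nat_trans_of_app[OF assms] by (rule ml h | assumption)+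
qed

definition nat_domain where
  "nat_domain h = (\<lambda>M\<in>Ob \<C>. \<lambda>x\<in>X. \<lambda>r\<in>Ob (E x). \<lambda>z\<in>carrier (tens K (space (mobj M x) r) C). h M x r z)"

lemma nat_trans_of_eq:
  assumes "\<And>M x r z. \<lbrakk>M \<in> Ob \<C>; x \<in> X; r \<in> Ob (E x); z \<in> carrier (tens K (space (mobj M x) r) C)\<rbrakk>
    \<Longrightarrow> nat_trans_of \<theta> M x r z = h M x r z"
  shows "nat_trans_of \<theta> = nat_domain h"
proof -
  have "nat_trans_of \<theta> = nat_domain (nat_trans_of \<theta>)"
    unfolding nat_domain_def
    by (rule ext)+ (auto simp: nat_trans_of_def assemble_def family_of_def nat_of_def EMod_simps(1) restrict_def C_em)
  also have "\<dots> = nat_domain h"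
    unfolding nat_domain_def by (intro restrict_ext) (use assms in auto)
  finally show ?thesis .
qed

theorem Nat_V1_iso: "mod_iso K (Nat_space K C X leq \<R>) (V1_space K C X leq \<R>)"
proof (rule mod_iso_transport[where g = nat_trans_of, OF V1_module])
  let ?N = "Nat_space K C X leq \<R>" and ?V = "V1_space K C X leq \<R>"
  have V: "carrier ?V = V1_set K C X leq \<R>" by (simp add: V1_space_def Let_def)
  have ops: "\<zero>\<^bsub>?V\<^esub> = \<zero>\<^bsub>FS\<^esub>" "u \<oplus>\<^bsub>?V\<^esub> v = u \<oplus>\<^bsub>FS\<^esub> v" "k \<odot>\<^bsub>?V\<^esub> u = k \<odot>\<^bsub>FS\<^esub> u" for u v k
    by (simp_all add: function_space_def)
  have N: "\<zero>\<^bsub>?N\<^esub> = nat_domain (\<lambda>M x r z. \<zero>\<^bsub>space (mobj M x) r\<^esub>)"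
    "u \<oplus>\<^bsub>?N\<^esub> v = nat_domain (\<lambda>M x r z. u M x r z \<oplus>\<^bsub>space (mobj M x) r\<^esub> v M x r z)"
    "k \<odot>\<^bsub>?N\<^esub> u = nat_domain (\<lambda>M x r z. k \<odot>\<^bsub>space (mobj M x) r\<^esub> u M x r z)" for u v k
    by (simp_all add: Nat_space_def Let_def nat_domain_def)
  have F: "u \<in> carrier FS" if "u \<in> carrier ?V" for u using that by (simp add: V V1_set_eq)
  show "bij_betw nat_trans_of (carrier ?V) (carrier ?N)"
    using nat_trans_of_bij by (simp add: V Nat_space_def Let_def)
  show "nat_trans_of \<zero>\<^bsub>?V\<^esub> = \<zero>\<^bsub>?N\<^esub>"
    unfolding ops N by (rule nat_trans_of_eq) (rule lin_zero[OF lin_nat_trans_of])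
  show "nat_trans_of (u \<oplus>\<^bsub>?V\<^esub> v) = nat_trans_of u \<oplus>\<^bsub>?N\<^esub> nat_trans_of v"
    if "u \<in> carrier ?V" "v \<in> carrier ?V" for u v
    unfolding ops N by (rule nat_trans_of_eq, rule linD(4)[OF lin_nat_trans_of]) (assumption | rule F that)+
  show "nat_trans_of (k \<odot>\<^bsub>?V\<^esub> v) = k \<odot>\<^bsub>?N\<^esub> nat_trans_of v"
    if "k \<in> carrier K" "v \<in> carrier ?V" for k v
    unfolding ops N by (rule nat_trans_of_eq, rule linD(5)[OF lin_nat_trans_of]) (assumption | rule F that)+
qed

end

section \<open>The theorem\<close>

theorem theorem6:
  fixes K :: "('k, 'r) ring_scheme"
    and C :: "('k, 'u::infinite) coalgebra"
    and X :: "'x set" and leq :: "'x rel"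
    and \<R> :: "('k, 'o, 'u, 'x) entw_rep"
  assumes "field K"
    and "partial_order_on X leq"
    and "coalgebra K C"
    and "right_semiperfect K C"
    and "cat_functor (poset_cat X leq) (Ent K C) \<R>"
  shows "right_adjoint (ModCR K C X leq \<R>) (ModR K X leq \<R>) (Forget K C X leq \<R>) (Cofree K C X leq \<R>) \<and>
    bij_betw (\<lambda>\<upsilon>. \<lambda>M\<in>Ob (ModCR K C X leq \<R>). \<lambda>x\<in>X. \<upsilon> x (mobj M x))
      (compatible_families K C X leq \<R>) (Nat_GF K C X leq \<R>) \<and>
    mod_iso K (Nat_space K C X leq \<R>) (V1_space K C X leq \<R>)"
proof -
  interpret entw_representation K C X leq \<R>
    using assms by (simp add: entw_representation_def entw_representation_axioms_def)
  show ?thesis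
    using Cofree_right_adjoint assemble_bij Nat_V1_iso unfolding assemble_def by blast
qed

end
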